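(* Let $n\ge 3$, $m\ge 1$, and let $\Omega\subseteq\mathbb{R}^n_x\times\mathbb{R}^m_y$ be an open set with Lipschitz boundary which is repulsive with respect to the $x$ variables. Let $V:\Omega\to\mathbb{R}$ be a locally bounded potential satisfying $$V\ge 0,\qquad -x\cdot\nabla_x(|x|V)\ge 0\quad\text{on }\Omega,$$ and such that $H=-\Delta+V(x,y)$ with Dirichlet boundary conditions is selfadjoint on $L^2(\Omega)$. Then $H$ has no eigenvalues.
   Context: Points of $\mathbb{R}^{n+m}$ are written $(x,y)$ with $x\in\mathbb{R}^n$, $y\in\mathbb{R}^m$; $\Delta=\Delta_x+\Delta_y$. An open set $\Omega\subseteq\mathbb{R}^n_x\times\mathbb{R}^m_y$ with Lipschitz boundary is called repulsive with respect to the $x$ variables if, denoting by $\nu$ the exterior unit normal to $\partial\Omega$, one has $\nu\cdot(x,0)\le 0$ at all points $(x,y)$ of $\partial\Omega$ (where the normal exists). The domain of the Dirichlet operator $H$ is contained in $H^1_0(\Omega)$. *)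

theory Defs
  imports "HOL-Analysis.Analysis"
begin

section \<open>Test functions and distributions\<close>

abbreviation partial :: "'a \<Rightarrow> ('a::real_normed_vector \<Rightarrow> 'b::real_normed_vector) \<Rightarrow> 'a \<Rightarrow> 'b" where
  "partial b f \<equiv> (\<lambda>z. frechet_derivative f (at z) b)"

primrec Ck :: "nat \<Rightarrow> ('a::real_normed_vector \<Rightarrow> 'b::real_normed_vector) \<Rightarrow> bool" where
  "Ck 0 f \<longleftrightarrow> continuous_on UNIV f"
| "Ck (Suc k) f \<longleftrightarrow> (\<forall>z. f differentiable (at z)) \<and> (\<forall>b. Ck k (partial b f))"

definition test_function :: "'a::real_normed_vector set \<Rightarrow> ('a \<Rightarrow> 'b::real_normed_vector) \<Rightarrow> bool" where
  "test_function \<Omega> \<phi> \<longleftrightarrow>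
     (\<forall>k. Ck k \<phi>) \<and> compact (closure {z. \<phi> z \<noteq> 0}) \<and> closure {z. \<phi> z \<noteq> 0} \<subseteq> \<Omega>"

text \<open>Distributions on \<open>\<Omega>\<close> are functionals, only ever applied to test functions on \<open>\<Omega>\<close>.
  The pairing is bilinear (no complex conjugation).\<close>

definition distr_of ::
  "'a::euclidean_space set \<Rightarrow> ('a \<Rightarrow> 'b) \<Rightarrow> ('a \<Rightarrow> 'b) \<Rightarrow> 'b::{real_normed_algebra,banach,second_countable_topology}" where
  "distr_of \<Omega> f \<phi> = (LINT z|lebesgue_on \<Omega>. f z * \<phi> z)"

definition distr_deriv ::
  "'a::real_normed_vector \<Rightarrow> (('a \<Rightarrow> 'b::real_normed_vector) \<Rightarrow> 'b) \<Rightarrow> ('a \<Rightarrow> 'b) \<Rightarrow> 'b" where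
  "distr_deriv b T \<phi> = - T (partial b \<phi>)"

definition distr_laplacian ::
  "(('a::euclidean_space \<Rightarrow> 'b::real_normed_vector) \<Rightarrow> 'b) \<Rightarrow> ('a \<Rightarrow> 'b) \<Rightarrow> 'b" where
  "distr_laplacian T \<phi> = (\<Sum>b\<in>Basis. distr_deriv b (distr_deriv b T) \<phi>)"


section \<open>Square integrable functions and unbounded operators\<close>

text \<open>Elements of \<open>L\<^sup>2(M)\<close> are represented by functions; equality is almost-everywhere equality.\<close>

definition L2 :: "'a measure \<Rightarrow> ('a \<Rightarrow> complex) set" where
  "L2 M = {u \<in> borel_measurable M. integrable M (\<lambda>z. (cmod (u z))\<^sup>2)}"

definition L2_inner :: "'a measure \<Rightarrow> ('a \<Rightarrow> complex) \<Rightarrow> ('a \<Rightarrow> complex) \<Rightarrow> complex" where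
  "L2_inner M u v = (LINT z|M. u z * cnj (v z))"

definition L2_norm :: "'a measure \<Rightarrow> ('a \<Rightarrow> complex) \<Rightarrow> real" where
  "L2_norm M u = sqrt (LINT z|M. (cmod (u z))\<^sup>2)"

text \<open>An unbounded operator \<open>H\<close> is given by its graph: \<open>(u, f) \<in> H\<close> means that \<open>u\<close> lies in the
  domain of \<open>H\<close> and \<open>H u = f\<close>.\<close>

type_synonym 'a L2_graph = "(('a \<Rightarrow> complex) \<times> ('a \<Rightarrow> complex)) set"

definition densely_defined :: "'a measure \<Rightarrow> 'a L2_graph \<Rightarrow> bool" where
  "densely_defined M H \<longleftrightarrow>
     (\<forall>v\<in>L2 M. \<forall>\<epsilon>>0. \<exists>u\<in>Domain H. L2_norm M (\<lambda>z. u z - v z) < \<epsilon>)"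

definition adjoint_graph :: "'a measure \<Rightarrow> 'a L2_graph \<Rightarrow> 'a L2_graph" where
  "adjoint_graph M H =
     {(v, g). v \<in> L2 M \<and> g \<in> L2 M \<and> (\<forall>(u, f)\<in>H. L2_inner M f v = L2_inner M u g)}"

text \<open>An adjoint graph is always linear and closed under almost-everywhere equality, and the
  adjoint of a densely defined graph is single-valued up to null sets; hence the equality
  below already makes \<open>H\<close> the graph of a linear operator.\<close>

definition selfadjoint :: "'a measure \<Rightarrow> 'a L2_graph \<Rightarrow> bool" where
  "selfadjoint M H \<longleftrightarrow> H \<subseteq> L2 M \<times> L2 M \<and> densely_defined M H \<and> adjoint_graph M H = H"

definition eigenvalue :: "'a measure \<Rightarrow> 'a L2_graph \<Rightarrow> complex \<Rightarrow> bool" where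
  "eigenvalue M H \<mu> \<longleftrightarrow> (\<exists>u. (u, \<lambda>z. \<mu> * u z) \<in> H \<and> \<not> (AE z in M. u z = 0))"


section \<open>The Dirichlet Schroedinger operator\<close>

definition weak_deriv ::
  "'a::euclidean_space set \<Rightarrow> 'a \<Rightarrow> ('a \<Rightarrow> complex) \<Rightarrow> ('a \<Rightarrow> complex) \<Rightarrow> bool" where
  "weak_deriv \<Omega> b u g \<longleftrightarrow>
     (\<forall>\<phi>. test_function \<Omega> \<phi> \<longrightarrow> distr_deriv b (distr_of \<Omega> u) \<phi> = distr_of \<Omega> g \<phi>)"

text \<open>\<open>H\<^sup>1\<^sub>0(\<Omega>)\<close> is the closure of the test functions in the \<open>H\<^sup>1\<close> norm.\<close>

definition H10 :: "'a::euclidean_space set \<Rightarrow> ('a \<Rightarrow> complex) set" where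
  "H10 \<Omega> = {u \<in> L2 (lebesgue_on \<Omega>). \<exists>Du.
     (\<forall>b\<in>Basis. Du b \<in> L2 (lebesgue_on \<Omega>) \<and> weak_deriv \<Omega> b u (Du b)) \<and>
     (\<exists>\<phi> :: nat \<Rightarrow> 'a \<Rightarrow> complex. (\<forall>k. test_function \<Omega> (\<phi> k)) \<and>
        (\<lambda>k. L2_norm (lebesgue_on \<Omega>) (\<lambda>z. \<phi> k z - u z)) \<longlonglongrightarrow> 0 \<and>
        (\<forall>b\<in>Basis. (\<lambda>k. L2_norm (lebesgue_on \<Omega>) (\<lambda>z. partial b (\<phi> k) z - Du b z)) \<longlonglongrightarrow> 0))}"

definition dirichlet_schroedinger ::
  "'a::euclidean_space set \<Rightarrow> ('a \<Rightarrow> real) \<Rightarrow> 'a L2_graph \<Rightarrow> bool" where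
  "dirichlet_schroedinger \<Omega> V H \<longleftrightarrow>
     (\<forall>(u, f)\<in>H. u \<in> H10 \<Omega> \<and> f \<in> L2 (lebesgue_on \<Omega>) \<and>
        (\<forall>\<phi>. test_function \<Omega> \<phi> \<longrightarrow>
           - distr_laplacian (distr_of \<Omega> u) \<phi> + distr_of \<Omega> (\<lambda>z. of_real (V z) * u z) \<phi>
             = distr_of \<Omega> f \<phi>))"


section \<open>Lipschitz boundaries and repulsive sets\<close>

text \<open>Near \<open>p\<close>, the set \<open>\<Omega>\<close> lies strictly below the graph, in the direction of the unit
  vector \<open>e\<close>, of a Lipschitz function \<open>f\<close> on the hyperplane orthogonal to \<open>e\<close>.\<close>

definition lipschitz_chart ::
  "'a::euclidean_space set \<Rightarrow> 'a \<Rightarrow> 'a \<Rightarrow> ('a \<Rightarrow> real) \<Rightarrow> bool" where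
  "lipschitz_chart \<Omega> p e f \<longleftrightarrow> norm e = 1 \<and> (\<exists>L. L-lipschitz_on {w. w \<bullet> e = 0} f) \<and>
     (\<exists>r>0. \<Omega> \<inter> ball p r = {z \<in> ball p r. z \<bullet> e < f (z - (z \<bullet> e) *\<^sub>R e)})"

definition lipschitz_boundary :: "'a::euclidean_space set \<Rightarrow> bool" where
  "lipschitz_boundary \<Omega> \<longleftrightarrow> (\<forall>p\<in>frontier \<Omega>. \<exists>e f. lipschitz_chart \<Omega> p e f)"

text \<open>The normal exists where the chart function \<open>f\<close> is differentiable; with \<open>g\<close> the gradient
  of \<open>f\<close>, it is the normalised gradient \<open>e - g\<close> of the defining function
  \<open>z \<mapsto> z \<bullet> e - f (z - (z \<bullet> e) e)\<close>, which is negative in \<open>\<Omega>\<close>.\<close>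

definition exterior_unit_normal :: "'a::euclidean_space set \<Rightarrow> 'a \<Rightarrow> 'a \<Rightarrow> bool" where
  "exterior_unit_normal \<Omega> p \<nu> \<longleftrightarrow> p \<in> frontier \<Omega> \<and>
     (\<exists>e f g. lipschitz_chart \<Omega> p e f \<and> g \<bullet> e = 0 \<and>
        (f has_derivative (\<lambda>h. g \<bullet> h)) (at (p - (p \<bullet> e) *\<^sub>R e) within {w. w \<bullet> e = 0}) \<and>
        \<nu> = (e - g) /\<^sub>R norm (e - g))"

definition repulsive :: "('x::euclidean_space \<times> 'y::euclidean_space) set \<Rightarrow> bool" where
  "repulsive \<Omega> \<longleftrightarrow> (\<forall>x y \<nu>. exterior_unit_normal \<Omega> (x, y) \<nu> \<longrightarrow> \<nu> \<bullet> (x, 0) \<le> 0)"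


section \<open>Conditions on the potential\<close>

definition locally_bounded_on :: "'a::topological_space set \<Rightarrow> ('a \<Rightarrow> real) \<Rightarrow> bool" where
  "locally_bounded_on \<Omega> V \<longleftrightarrow> (\<forall>K. compact K \<and> K \<subseteq> \<Omega> \<longrightarrow> bounded (V ` K))"

text \<open>The distribution \<open>x \<cdot> \<nabla>\<^sub>x W\<close>: the factor \<open>x \<bullet> b\<close> is moved onto the test function.\<close>

definition distr_x_grad ::
  "('x::euclidean_space \<times> 'y::euclidean_space) set \<Rightarrow> ('x \<times> 'y \<Rightarrow> real) \<Rightarrow> ('x \<times> 'y \<Rightarrow> real) \<Rightarrow> real" where
  "distr_x_grad \<Omega> W \<phi> =
     (\<Sum>b\<in>Basis. distr_deriv (b, 0) (distr_of \<Omega> W) (\<lambda>z. (fst z \<bullet> b) * \<phi> z))"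

definition distr_nonneg :: "'a::real_normed_vector set \<Rightarrow> (('a \<Rightarrow> real) \<Rightarrow> real) \<Rightarrow> bool" where
  "distr_nonneg \<Omega> T \<longleftrightarrow> (\<forall>\<phi>. test_function \<Omega> \<phi> \<and> (\<forall>z. \<phi> z \<ge> 0) \<longrightarrow> T \<phi> \<ge> 0)"

end

(* A virial argument that needs no regularity of the eigenfunction u. By star-shapedness, for
   small t > 0 the map pull t, which shrinks x to (1 - t / <x>) x with <x> = sqrt (1 + |x|^2), has
   the complement of Omega as an invariant set, so v = damp * (u o pull t), with a damping factor
   close to the square root of the Jacobian, is an admissible competitor in H^1_0. Expanding in t,
   the quadratic form of H - lam at v is at most - c t times a weighted norm of u plus O(t^2):
   the kinetic term contributes the bilaplacian of <x>, which is negative for n >= 3, and V only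
   decreases along the flow. Testing the eigenvalue equation with v - u shows on the other hand
   that the form is at least - C t^2. Hence u = 0.

   Star-shapedness in x follows from repulsiveness, which by Rademacher's theorem is an almost
   everywhere differential inequality for a Lipschitz defining function of Omega; integrated
   against test functions it gives pointwise monotonicity along the radial flow. *)
theory Submission
  imports Defs
begin

section \<open>Closure properties of \<open>Ck\<close>, \<open>smooth\<close> and
  \<open>test_function\<close>\<close>

section \<open>Smooth functions and test functions\<close>

text \<open>The classical route multiplies the eigenvalue equation by a radial derivative of
  \<open>u\<close> and integrates by parts. Here \<open>u\<close> has no second derivatives up to
  the Lipschitz boundary, and even the integral of V u^2 is not known to be finite, because the
  equation holds only against test functions. Deforming the independent variable needs first
  derivatives only. The damping makes the L2 norm stationary to first order, so the eigenvalue,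
  whatever its sign, enters at order t^2. The velocity x / <x> is bounded, hence v - u is O(t) in L2
  by the gradient of \<open>u\<close> alone. Two approximating sequences are used: test functions
  converging to \<open>u\<close> in H^1 carry the kinetic energy, truncated ones, merely bounded in
  H^1, carry the potential. Convexity of squares turns the linear expression obtained by testing
  into a difference of energies. On the geometric side a radial line is a null set, so an almost
  everywhere inequality says nothing on it directly; transporting small bumps along the flow bridges
  this gap.\<close>

lemma Ck_imp_continuous: "Ck k f \<Longrightarrow> continuous_on UNIV f"
  by (cases k) (auto intro!: continuous_at_imp_continuous_on differentiable_imp_continuous_within)

lemma Ck_SucD: "Ck (Suc k) f \<Longrightarrow> Ck k f"
proof (induction k arbitrary: f)
  case 0
  then show ?case using Ck_imp_continuous by fastforce
next
  case (Suc k)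
  then show ?case by (metis Ck.simps(2))
qed

text \<open>\<open>partial\<close> is built on a choice term; this rule lets later proofs supply an
  explicit derivative instead.\<close>

lemma Ck_SucI:
  assumes "\<And>z. (f has_derivative f' z) (at z)" and "\<And>b. Ck k (\<lambda>z. f' z b)"
  shows "Ck (Suc k) f"
proof -
  have "partial b f = (\<lambda>z. f' z b)" for b
    using frechet_derivative_at[OF assms(1)] by metis
  then show ?thesis using assms by (auto simp: differentiable_def)
qed

lemma Ck_const [simp]: "Ck k (\<lambda>z. c)"
proof (induction k arbitrary: c)
  case (Suc k)
  show ?case by (rule Ck_SucI[where f'="\<lambda>z h. 0"]) (use Suc in auto)
qed simp

lemma Ck_has_derivative:
  "Ck (Suc k) f \<Longrightarrow> (f has_derivative (\<lambda>h. partial h f z)) (at z)"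
  by (simp add: frechet_derivative_works eta_contract_eq)

lemma Ck_add: "Ck k f \<Longrightarrow> Ck k g \<Longrightarrow> Ck k (\<lambda>z. f z + g z)"
proof (induction k arbitrary: f g)
  case 0
  then show ?case by (auto intro: continuous_intros)
next
  case (Suc k)
  have d: "Ck k (partial b f)" "Ck k (partial b g)" for b using Suc.prems by auto
  show ?case
    by (rule Ck_SucI[where f'="\<lambda>z h. partial h f z + partial h g z"],
        rule has_derivative_add[OF Ck_has_derivative[OF Suc.prems(1)] Ck_has_derivative[OF Suc.prems(2)]],
        rule Suc.IH[OF d])
qed

text \<open>One induction covers multiplication, scaling and inner products. Both functions stay
  arbitrary because the product rule pairs each with a partial derivative of the other.\<close>

lemma Ck_bilinear:
  assumes "bounded_bilinear bop"
  shows "Ck k f \<Longrightarrow> Ck k g \<Longrightarrow> Ck k (\<lambda>z. bop (f z) (g z))"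
proof (induction k arbitrary: f g)
  case 0
  then show ?case by (auto intro: bounded_bilinear.continuous_on[OF assms])
next
  case (Suc k)
  have d: "Ck k (partial b f)" "Ck k (partial b g)" for b using Suc.prems by auto
  show ?case
    by (rule Ck_SucI[where f'="\<lambda>z h. bop (f z) (partial h g z) + bop (partial h f z) (g z)"])
       (rule bounded_bilinear.FDERIV[OF assms Ck_has_derivative[OF Suc.prems(1)] Ck_has_derivative[OF Suc.prems(2)]],
        rule Ck_add[OF Suc.IH[OF Ck_SucD[OF Suc.prems(1)] d(2)] Suc.IH[OF d(1) Ck_SucD[OF Suc.prems(2)]]])
qed

lemmas Ck_mult = Ck_bilinear[OF bounded_bilinear_mult]
lemmas Ck_scaleR = Ck_bilinear[OF bounded_bilinear_scaleR]
lemmas Ck_inner = Ck_bilinear[OF bounded_bilinear_inner]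

lemma Ck_linear:
  assumes "bounded_linear L"
  shows "Ck k f \<Longrightarrow> Ck k (\<lambda>z. L (f z))"
proof (induction k arbitrary: f)
  case 0
  then show ?case using bounded_linear.continuous_on[OF assms] by auto
next
  case (Suc k)
  have d: "Ck k (partial b f)" for b using Suc.prems by auto
  show ?case
    by (rule Ck_SucI[where f'="\<lambda>z h. L (partial h f z)"])
       (rule bounded_linear.has_derivative[OF assms Ck_has_derivative[OF Suc.prems]], rule Suc.IH[OF d])
qed

lemma Ck_ident [simp]: "Ck k (\<lambda>z. z)"
proof (cases k)
  case (Suc j)
  show ?thesis unfolding Suc by (rule Ck_SucI[where f'="\<lambda>z h. h"]) auto
qed simp

lemma Ck_inverse:
  fixes f :: "'a::real_normed_vector \<Rightarrow> real"
  assumes nz: "\<And>z. f z \<noteq> 0"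
  shows "Ck k f \<Longrightarrow> Ck k (\<lambda>z. inverse (f z))"
proof (induction k)
  case 0
  then show ?case using nz by (auto intro!: continuous_intros)
next
  case (Suc k)
  have d: "Ck k (partial b f)" for b using Suc.prems by auto
  have i: "Ck k (\<lambda>z. inverse (f z))" using Suc Ck_SucD by blast
  show ?case
  proof (rule Ck_SucI[where f'="\<lambda>z h. (-1) * (inverse (f z) * partial h f z * inverse (f z))"])
    show "((\<lambda>z. inverse (f z)) has_derivative (\<lambda>h. (-1) * (inverse (f z) * partial h f z * inverse (f z)))) (at z)" for z
      using Deriv.has_derivative_inverse[OF nz Ck_has_derivative[OF Suc.prems]] by simp
    show "Ck k (\<lambda>z. (-1) * (inverse (f z) * partial b f z * inverse (f z)))" for b
      by (intro Ck_mult i d Ck_const)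
  qed
qed

lemma Ck_sum: "(\<And>i. i \<in> I \<Longrightarrow> Ck k (f i)) \<Longrightarrow> Ck k (\<lambda>z. \<Sum>i\<in>I. f i z)"
  by (induction I rule: infinite_finite_induct) (auto intro: Ck_add simp del: Ck.simps)

lemma Ck_prod:
  fixes f :: "'i \<Rightarrow> 'a::real_normed_vector \<Rightarrow> 'b::real_normed_field"
  shows "(\<And>i. i \<in> I \<Longrightarrow> Ck k (f i)) \<Longrightarrow> Ck k (\<lambda>z. \<Prod>i\<in>I. f i z)"
  by (induction I rule: infinite_finite_induct) (auto intro: Ck_mult simp del: Ck.simps)

lemma Ck_power:
  fixes f :: "'a::real_normed_vector \<Rightarrow> 'b::real_normed_field"
  shows "Ck k f \<Longrightarrow> Ck k (\<lambda>z. f z ^ n)"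
  by (induction n) (auto intro: Ck_mult simp del: Ck.simps)

lemma Ck_diff: "Ck k f \<Longrightarrow> Ck k g \<Longrightarrow> Ck k (\<lambda>z. f z - g z)"
  using Ck_add[of k f "\<lambda>z. - g z"] Ck_linear[OF bounded_linear_minus[OF bounded_linear_ident], of k g] by simp

lemma linear_sum_Basis:
  fixes D :: "'a::euclidean_space \<Rightarrow> 'b::real_vector"
  assumes "linear D" shows "D h = (\<Sum>b\<in>Basis. (h \<bullet> b) *\<^sub>R D b)"
proof -
  have "D h = D (\<Sum>b\<in>Basis. (h \<bullet> b) *\<^sub>R b)" by (simp add: euclidean_representation)
  also have "\<dots> = (\<Sum>b\<in>Basis. (h \<bullet> b) *\<^sub>R D b)" by (simp add: linear_sum[OF assms] linear_scale[OF assms])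
  finally show ?thesis .
qed

lemma partial_sum_Basis:
  fixes f :: "'a::euclidean_space \<Rightarrow> 'b::real_normed_vector"
  assumes "f differentiable (at z)"
  shows "partial h f z = (\<Sum>b\<in>Basis. (h \<bullet> b) *\<^sub>R partial b f z)"
  by (rule linear_sum_Basis) (use assms linear_frechet_derivative in blast)

text \<open>\<open>Ck\<close> only speaks of partial derivatives in fixed directions, whereas the
  chain rule differentiates \<open>f\<close> in the moving direction \<open>partial h g z\<close>.
  Expanding that direction in \<open>Basis\<close> leaves fixed directions with coefficients of
  class k, and the induction closes with \<open>g\<close> fixed.\<close>

lemma Ck_compose:
  fixes g :: "'a::real_normed_vector \<Rightarrow> 'b::euclidean_space" and f :: "'b \<Rightarrow> 'c::real_normed_vector"
  shows "Ck k f \<Longrightarrow> Ck k g \<Longrightarrow> Ck k (\<lambda>z. f (g z))"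
proof (induction k arbitrary: f)
  case 0
  then show ?case by (auto intro: continuous_on_compose2)
next
  case (Suc k)
  have d: "Ck k (partial c f)" "Ck k (partial b g)" for b c using Suc.prems by auto
  have c: "Ck k (\<lambda>z. (partial h g z \<bullet> b) *\<^sub>R partial b f (g z))" for h b
    by (intro Ck_scaleR Ck_inner Suc.IH d Ck_const Ck_SucD[OF Suc.prems(2)])
  show ?case
  proof (rule Ck_SucI[where f'="\<lambda>z h. \<Sum>b\<in>Basis. (partial h g z \<bullet> b) *\<^sub>R partial b f (g z)"])
    fix z
    have "((\<lambda>z. f (g z)) has_derivative (\<lambda>h. partial (partial h g z) f (g z))) (at z)"
      by (rule has_derivative_compose[OF Ck_has_derivative[OF Suc.prems(2)] Ck_has_derivative[OF Suc.prems(1)]])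
    moreover have "(\<lambda>h. partial (partial h g z) f (g z)) = (\<lambda>h. \<Sum>b\<in>Basis. (partial h g z \<bullet> b) *\<^sub>R partial b f (g z))"
      by (rule ext, rule partial_sum_Basis) (use Suc.prems in auto)
    ultimately show "((\<lambda>z. f (g z)) has_derivative (\<lambda>h. \<Sum>b\<in>Basis. (partial h g z \<bullet> b) *\<^sub>R partial b f (g z))) (at z)"
      by (rule has_derivative_eq_rhs)
  next
    show "Ck k (\<lambda>z. \<Sum>b\<in>Basis. (partial h g z \<bullet> b) *\<^sub>R partial b f (g z))" for h
      by (rule Ck_sum, rule c)
  qed
qed

definition smooth :: "('a::real_normed_vector \<Rightarrow> 'b::real_normed_vector) \<Rightarrow> bool" where
  "smooth f \<longleftrightarrow> (\<forall>k. Ck k f)"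

named_theorems smooth_intros

lemma smooth_const [smooth_intros]: "smooth (\<lambda>z. c)" by (simp add: smooth_def)
lemma smooth_ident [smooth_intros]: "smooth (\<lambda>z. z)" by (simp add: smooth_def)
lemma smooth_add [smooth_intros]: "smooth f \<Longrightarrow> smooth g \<Longrightarrow> smooth (\<lambda>z. f z + g z)" by (simp add: smooth_def Ck_add)
lemma smooth_diff [smooth_intros]: "smooth f \<Longrightarrow> smooth g \<Longrightarrow> smooth (\<lambda>z. f z - g z)" by (simp add: smooth_def Ck_diff)
lemma smooth_mult [smooth_intros]:
  fixes f :: "'a::real_normed_vector \<Rightarrow> 'b::real_normed_algebra"
  shows "smooth f \<Longrightarrow> smooth g \<Longrightarrow> smooth (\<lambda>z. f z * g z)" by (simp add: smooth_def Ck_mult)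
lemma smooth_scaleR [smooth_intros]: "smooth f \<Longrightarrow> smooth g \<Longrightarrow> smooth (\<lambda>z. f z *\<^sub>R g z)" by (simp add: smooth_def Ck_scaleR)
lemma smooth_inner [smooth_intros]: "smooth f \<Longrightarrow> smooth g \<Longrightarrow> smooth (\<lambda>z. f z \<bullet> g z)" by (simp add: smooth_def Ck_inner)
lemma smooth_linear: "bounded_linear L \<Longrightarrow> smooth f \<Longrightarrow> smooth (\<lambda>z. L (f z))" by (simp add: smooth_def Ck_linear)
lemma smooth_minus [smooth_intros]: "smooth f \<Longrightarrow> smooth (\<lambda>z. - f z)"
  using smooth_linear[OF bounded_linear_minus[OF bounded_linear_ident]] .
lemma smooth_inverse [smooth_intros]:
  fixes f :: "'a::real_normed_vector \<Rightarrow> real"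
  shows "(\<And>z. f z \<noteq> 0) \<Longrightarrow> smooth f \<Longrightarrow> smooth (\<lambda>z. inverse (f z))" by (simp add: smooth_def Ck_inverse)
lemma smooth_divide [smooth_intros]:
  fixes f :: "'a::real_normed_vector \<Rightarrow> real"
  shows "(\<And>z. g z \<noteq> 0) \<Longrightarrow> smooth f \<Longrightarrow> smooth g \<Longrightarrow> smooth (\<lambda>z. f z / g z)"
  unfolding divide_inverse by (intro smooth_intros)
lemma smooth_sum [smooth_intros]: "(\<And>i. i \<in> I \<Longrightarrow> smooth (f i)) \<Longrightarrow> smooth (\<lambda>z. \<Sum>i\<in>I. f i z)" by (simp add: smooth_def Ck_sum)
lemma smooth_prod [smooth_intros]:
  fixes f :: "'i \<Rightarrow> 'a::real_normed_vector \<Rightarrow> 'b::real_normed_field"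
  shows "(\<And>i. i \<in> I \<Longrightarrow> smooth (f i)) \<Longrightarrow> smooth (\<lambda>z. \<Prod>i\<in>I. f i z)" by (simp add: smooth_def Ck_prod)
lemma smooth_power [smooth_intros]:
  fixes f :: "'a::real_normed_vector \<Rightarrow> 'b::real_normed_field"
  shows "smooth f \<Longrightarrow> smooth (\<lambda>z. f z ^ n)" by (simp add: smooth_def Ck_power)
lemma smooth_compose:
  fixes g :: "'a::real_normed_vector \<Rightarrow> 'b::euclidean_space"
  shows "smooth f \<Longrightarrow> smooth g \<Longrightarrow> smooth (\<lambda>z. f (g z))" by (simp add: smooth_def Ck_compose)
lemma smooth_fst [smooth_intros]: "smooth f \<Longrightarrow> smooth (\<lambda>z. fst (f z))" by (rule smooth_linear[OF bounded_linear_fst])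
lemma smooth_snd [smooth_intros]: "smooth f \<Longrightarrow> smooth (\<lambda>z. snd (f z))" by (rule smooth_linear[OF bounded_linear_snd])
lemma smooth_Pair [smooth_intros]:
  assumes "smooth f" "smooth g" shows "smooth (\<lambda>z. (f z, g z))"
proof -
  have "bounded_linear (\<lambda>x::'b. (x, 0::'c))" "bounded_linear (\<lambda>y::'c. (0::'b, y))"
    by (auto intro!: bounded_linear_Pair bounded_linear_ident bounded_linear_zero)
  then have "smooth (\<lambda>z. (f z, 0) + (0, g z))"
    by (intro smooth_add) (use assms smooth_linear in blast)+
  then show ?thesis by simp
qed

lemma smooth_partial [smooth_intros]: "smooth f \<Longrightarrow> smooth (partial b f)"
  unfolding smooth_def by (metis Ck.simps(2))

lemma smooth_continuous: "smooth f \<Longrightarrow> continuous_on A f"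
  unfolding smooth_def using Ck_imp_continuous continuous_on_subset by blast

lemma smooth_has_derivative: "smooth f \<Longrightarrow> (f has_derivative (\<lambda>h. partial h f z)) (at z)"
  unfolding smooth_def using Ck_has_derivative by blast

lemma smooth_differentiable: "smooth f \<Longrightarrow> f differentiable (at z)"
  using smooth_has_derivative differentiable_def by blast

lemma partial_eqI: "(f has_derivative f') (at z) \<Longrightarrow> partial b f z = f' b"
  using frechet_derivative_at by metis

text \<open>A function whose derivative is a polynomial in itself and smooth functions is smooth by
  bootstrapping; this treats \<open>(1 + \<bar>x\<bar>\<^sup>2) powr (- 1 / 2)\<close>.\<close>

lemma smooth_bootstrap:
  assumes "\<And>z. (f has_derivative f' z) (at z)"
    and "\<And>k b. Ck k f \<Longrightarrow> Ck k (\<lambda>z. f' z b)"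
  shows "smooth f"
proof -
  have c: "continuous_on UNIV f"
    using assms(1) by (meson continuous_at_imp_continuous_on has_derivative_continuous)
  have "Ck k f" for k
  proof (induction k)
    case (Suc k)
    show ?case by (rule Ck_SucI[OF assms(1) assms(2)[OF Suc]])
  qed (use c in simp)
  then show ?thesis by (simp add: smooth_def)
qed

lemma test_functionI:
  assumes "smooth \<phi>" "compact K" "K \<subseteq> \<Omega>" "\<And>z. z \<notin> K \<Longrightarrow> \<phi> z = 0"
  shows "test_function \<Omega> \<phi>"
proof -
  have "closure {z. \<phi> z \<noteq> 0} \<subseteq> K"
    by (rule closure_minimal) (use assms compact_imp_closed in auto)
  then show ?thesis unfolding test_function_def
    using assms compact_Int_closed[of K "closure {z. \<phi> z \<noteq> 0}"] by (simp add: smooth_def Int_absorb1)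
qed

lemma test_functionE:
  assumes "test_function \<Omega> \<phi>"
  obtains K where "smooth \<phi>" "compact K" "K \<subseteq> \<Omega>" "\<And>z. z \<notin> K \<Longrightarrow> \<phi> z = 0"
proof (rule that)
  show "smooth \<phi>" "compact (closure {z. \<phi> z \<noteq> 0})" "closure {z. \<phi> z \<noteq> 0} \<subseteq> \<Omega>"
    using assms unfolding test_function_def smooth_def by blast+
  show "\<phi> z = 0" if "z \<notin> closure {z. \<phi> z \<noteq> 0}" for z
    using that closure_subset[of "{z. \<phi> z \<noteq> 0}"] by blast
qed

lemma test_function_smooth: "test_function \<Omega> \<phi> \<Longrightarrow> smooth \<phi>"
  unfolding test_function_def smooth_def by blast

lemma test_function_mono: "test_function \<Omega> \<phi> \<Longrightarrow> \<Omega> \<subseteq> \<Omega>' \<Longrightarrow> test_function \<Omega>' \<phi>"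
  unfolding test_function_def by blast

lemma partial_zero_outside:
  assumes "compact K" "\<And>z. z \<notin> K \<Longrightarrow> \<phi> z = 0" "z \<notin> K"
  shows "partial b \<phi> z = 0"
proof -
  have "open (- K)" using assms compact_imp_closed by blast
  then have "(\<phi> has_derivative (\<lambda>h. 0)) (at z)"
    by (rule has_derivative_transform_within_open[OF has_derivative_const[of 0]])
       (simp_all add: assms(2,3))
  then show ?thesis by (rule partial_eqI)
qed

lemma test_function_partial: 
  assumes "test_function \<Omega> \<phi>" shows "test_function \<Omega> (partial b \<phi>)"
proof -
  obtain K where "smooth \<phi>" "compact K" "K \<subseteq> \<Omega>" "\<And>z. z \<notin> K \<Longrightarrow> \<phi> z = 0"
    using test_functionE[OF assms] by metis
  then show ?thesis
    by (intro test_functionI[of _ K]) (auto intro: smooth_partial partial_zero_outside)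
qed

lemma test_function_mult:
  fixes \<phi> :: "'a::real_normed_vector \<Rightarrow> 'b::real_normed_algebra"
  assumes "test_function \<Omega> \<phi>" "smooth f"
  shows "test_function \<Omega> (\<lambda>z. f z * \<phi> z)" "test_function \<Omega> (\<lambda>z. \<phi> z * f z)"
proof -
  obtain K where "smooth \<phi>" "compact K" "K \<subseteq> \<Omega>" "\<And>z. z \<notin> K \<Longrightarrow> \<phi> z = 0"
    using test_functionE[OF assms(1)] by metis
  then show "test_function \<Omega> (\<lambda>z. f z * \<phi> z)" "test_function \<Omega> (\<lambda>z. \<phi> z * f z)"
    using assms(2) by (intro test_functionI[of _ K] smooth_mult; simp)+
qed

lemma test_function_add:
  assumes "test_function \<Omega> \<phi>" "test_function \<Omega> \<psi>"
  shows "test_function \<Omega> (\<lambda>z. \<phi> z + \<psi> z)"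
proof -
  obtain K where "smooth \<phi>" "compact K" "K \<subseteq> \<Omega>" "\<And>z. z \<notin> K \<Longrightarrow> \<phi> z = 0"
    using test_functionE[OF assms(1)] by metis
  moreover obtain L where "smooth \<psi>" "compact L" "L \<subseteq> \<Omega>" "\<And>z. z \<notin> L \<Longrightarrow> \<psi> z = 0"
    using test_functionE[OF assms(2)] by metis
  ultimately show ?thesis
    by (intro test_functionI[of _ "K \<union> L"]) (auto intro: smooth_add)
qed

lemma test_function_linear:
  assumes "bounded_linear L" "test_function \<Omega> \<phi>"
  shows "test_function \<Omega> (\<lambda>z. L (\<phi> z))"
proof -
  obtain K where "smooth \<phi>" "compact K" "K \<subseteq> \<Omega>" "\<And>z. z \<notin> K \<Longrightarrow> \<phi> z = 0"
    using test_functionE[OF assms(2)] by metis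
  then show ?thesis using linear_0[OF bounded_linear.linear[OF assms(1)]]
    by (intro test_functionI[of _ K]) (auto intro: smooth_linear assms)
qed

lemma test_function_zero [simp]: "test_function \<Omega> (\<lambda>z. 0)"
  by (rule test_functionI[of _ "{}"]) (auto intro: smooth_intros)

lemma test_function_diff:
  "test_function \<Omega> \<phi> \<Longrightarrow> test_function \<Omega> \<psi> \<Longrightarrow> test_function \<Omega> (\<lambda>z. \<phi> z - \<psi> z)"
  using test_function_add[of \<Omega> \<phi> "\<lambda>z. - \<psi> z"] 
    test_function_linear[OF bounded_linear_minus[OF bounded_linear_ident], of \<Omega> \<psi>] by simp

lemma test_function_sum:
  "(\<And>i. i \<in> I \<Longrightarrow> test_function \<Omega> (f i)) \<Longrightarrow> test_function \<Omega> (\<lambda>z. \<Sum>i\<in>I. f i z)"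
  by (induction I rule: infinite_finite_induct) (auto intro: test_function_add)

lemma test_function_bounded:
  assumes "test_function \<Omega> \<phi>"
  obtains B where "B > 0" "\<And>z. norm (\<phi> z) \<le> B"
proof -
  obtain K where K: "smooth \<phi>" "compact K" "K \<subseteq> \<Omega>" "\<And>z. z \<notin> K \<Longrightarrow> \<phi> z = 0"
    using test_functionE[OF assms] by metis
  have "bounded (\<phi> ` K)"
    using K compact_continuous_image compact_imp_bounded smooth_continuous by blast
  then obtain B where "B > 0" "\<forall>x\<in>\<phi> ` K. norm x \<le> B" using bounded_pos by metis
  then show ?thesis using K that[of B] by (metis imageI less_imp_le norm_zero)
qed

section \<open>Differentiation under the integral sign and integration by parts\<close>

section \<open>Integrals of test functions\<close>

lemma integrable_lebesgue_lborel:
  fixes f :: "'a::euclidean_space \<Rightarrow> 'b::{banach, second_countable_topology}"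
  shows "integrable lborel f \<Longrightarrow> integrable lebesgue f"
  using integrable_completion[of f lborel] borel_measurable_integrable[of lborel f] by simp

lemma continuous_borel_measurable_lebesgue:
  fixes f :: "'a::euclidean_space \<Rightarrow> 'b::real_normed_vector"
  shows "continuous_on UNIV f \<Longrightarrow> f \<in> borel_measurable lebesgue"
  by (intro measurable_completion) (simp add: borel_measurable_continuous_onI)

lemma smooth_measurable [measurable_dest]:
  fixes f :: "'a::euclidean_space \<Rightarrow> 'b::real_normed_vector"
  shows "smooth f \<Longrightarrow> f \<in> borel_measurable lebesgue"
  using continuous_borel_measurable_lebesgue smooth_continuous by blast

lemma integrable_bounded_compact:
  fixes f :: "'a::euclidean_space \<Rightarrow> real"
  assumes f: "f \<in> borel_measurable lebesgue" and K: "compact K"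
    and B: "\<And>z. z \<in> K \<Longrightarrow> \<bar>f z\<bar> \<le> B" and Z: "\<And>z. z \<notin> K \<Longrightarrow> f z = 0"
  shows "integrable lebesgue f"
proof (rule Bochner_Integration.integrable_bound[OF _ f])
  have "integrable lborel (\<lambda>x. indicator K x *\<^sub>R B)"
    by (rule borel_integrable_compact[OF K continuous_on_const])
  from integrable_lebesgue_lborel[OF this] show "integrable lebesgue (\<lambda>x. indicator K x * B)"
    by simp
  show "AE x in lebesgue. norm (f x) \<le> norm (indicator K x * B)"
  proof (rule AE_I2)
    fix x show "norm (f x) \<le> norm (indicator K x * B)"
      using B[of x] Z[of x] by (cases "x \<in> K") auto
  qed
qed

text \<open>Boundedness of \<open>W\<close> is asked on \<open>K\<close> alone, so that the
  criterion applies to a potential that may blow up at the boundary of the domain.\<close>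

lemma integrable_mult_test_function:
  fixes W \<phi> :: "'a::euclidean_space \<Rightarrow> real"
  assumes W: "W \<in> borel_measurable lebesgue" and K: "compact K" "bounded (W ` K)"
    and \<phi>: "continuous_on UNIV \<phi>" "\<And>z. z \<notin> K \<Longrightarrow> \<phi> z = 0"
  shows "integrable lebesgue (\<lambda>z. W z * \<phi> z)"
proof -
  obtain B where B: "\<forall>z\<in>K. \<bar>W z\<bar> \<le> B" using K(2) by (auto simp: bounded_iff)
  have "bounded (\<phi> ` K)"
    by (intro compact_imp_bounded compact_continuous_image K continuous_on_subset[OF \<phi>(1)]) simp
  then obtain C where C: "\<forall>z\<in>K. \<bar>\<phi> z\<bar> \<le> C" by (auto simp: bounded_iff)
  show ?thesis
  proof (rule integrable_bounded_compact[OF _ K(1)])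
    show "(\<lambda>z. W z * \<phi> z) \<in> borel_measurable lebesgue"
      using W continuous_borel_measurable_lebesgue[OF \<phi>(1)] by measurable
    show "\<bar>W z * \<phi> z\<bar> \<le> B * C" if "z \<in> K" for z
    proof -
      have "0 \<le> B" using B that by force
      then show ?thesis using B C that by (auto simp: abs_mult intro!: mult_mono)
    qed
  qed (use \<phi> in simp)
qed

lemma test_function_integrable:
  fixes \<phi> :: "'a::euclidean_space \<Rightarrow> real"
  assumes "test_function \<Omega> \<phi>" shows "integrable lebesgue \<phi>"
proof -
  obtain K where "smooth \<phi>" "compact K" "\<And>z. z \<notin> K \<Longrightarrow> \<phi> z = 0"
    using test_functionE[OF assms] by metis
  then show ?thesis
    using integrable_mult_test_function[of "\<lambda>z. 1" K \<phi>] smooth_continuous[of \<phi>]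
    by (auto simp: image_constant_conv)
qed

lemma partial_mult:
  fixes f g :: "'a::real_normed_vector \<Rightarrow> real"
  assumes "smooth f" "smooth g"
  shows "partial b (\<lambda>z. f z * g z) z = f z * partial b g z + partial b f z * g z"
  by (rule partial_eqI[OF has_derivative_mult[OF smooth_has_derivative smooth_has_derivative], OF assms])

lemma partial_diff:
  assumes "smooth f" "smooth g"
  shows "partial b (\<lambda>z. f z - g z) z = partial b f z - partial b g z"
  by (rule partial_eqI[OF has_derivative_diff[OF smooth_has_derivative smooth_has_derivative], OF assms])

lemma partial_scaleR: "smooth f \<Longrightarrow> partial (c *\<^sub>R h) f z = c *\<^sub>R partial h f z"
  using linear_scale[OF linear_frechet_derivative[OF smooth_differentiable]] by metis

lemma partial_uminus: "smooth f \<Longrightarrow> partial (- h) f z = - partial h f z"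
  using partial_scaleR[of f z "-1 :: real" h] by simp

lemma test_function_partial_bound:
  fixes \<phi> :: "'a::euclidean_space \<Rightarrow> real"
  assumes "test_function \<Omega> \<phi>"
  obtains B where "B > 0" "\<And>z h. \<bar>partial h \<phi> z\<bar> \<le> B * norm h"
proof -
  have "\<exists>B>0. \<forall>z. norm (partial b \<phi> z) \<le> B" for b
    using test_function_bounded[OF test_function_partial[OF assms]] by metis
  then obtain B where B: "\<And>b. B b > 0" "\<And>b z. norm (partial b \<phi> z) \<le> B b" by metis
  show ?thesis
  proof (rule that[of "(\<Sum>b\<in>Basis. B b)"])
    show "(\<Sum>b\<in>Basis. B b) > 0" using B by (intro sum_pos) auto
    fix z h
    have "partial h \<phi> z = (\<Sum>b\<in>Basis. (h \<bullet> b) *\<^sub>R partial b \<phi> z)"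
      by (rule partial_sum_Basis) (use assms test_function_smooth smooth_differentiable in blast)
    also have "\<bar>\<dots>\<bar> \<le> (\<Sum>b\<in>Basis. norm h * B b)"
      by (rule order_trans[OF sum_abs], rule sum_mono)
         (use B in \<open>auto simp: abs_mult intro!: mult_mono Basis_le_norm\<close>)
    finally show "\<bar>partial h \<phi> z\<bar> \<le> (\<Sum>b\<in>Basis. B b) * norm h"
      by (simp add: sum_distrib_left mult.commute)
  qed
qed

text \<open>Dominated convergence for difference quotients: the mean value inequality on the convex
  set \<open>S\<close> bounds them by the same \<open>w\<close> that bounds \<open>f'\<close>.
  Derivatives are taken within \<open>S\<close> because the deformation parameter runs over a closed
  interval.\<close>

lemma has_real_derivative_integral:
  fixes f :: "real \<Rightarrow> 'a \<Rightarrow> real"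
  assumes S: "convex S" "t \<in> S"
    and d: "\<And>s z. s \<in> S \<Longrightarrow> ((\<lambda>s. f s z) has_real_derivative f' s z) (at s within S)"
    and f: "\<And>s. s \<in> S \<Longrightarrow> integrable M (f s)" and f': "f' t \<in> borel_measurable M"
    and w: "\<And>s z. s \<in> S \<Longrightarrow> \<bar>f' s z\<bar> \<le> w z" "integrable M w"
  shows "((\<lambda>s. LINT z|M. f s z) has_real_derivative (LINT z|M. f' t z)) (at t within S)"
  unfolding has_field_derivative_iff tendsto_at_iff_sequentially
proof (intro allI impI)
  fix X assume X: "\<forall>i. X i \<in> S - {t}" "X \<longlonglongrightarrow> t"
  let ?q = "\<lambda>i z. (f (X i) z - f t z) / (X i - t)"
  have "(\<lambda>i. LINT z|M. ?q i z) \<longlonglongrightarrow> (LINT z|M. f' t z)"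
  proof (rule integral_dominated_convergence[OF f' _ w(2)])
    show "(\<lambda>z. ?q i z) \<in> borel_measurable M" for i
      using f[of "X i"] f[of t] X S by (auto intro!: borel_measurable_diff borel_measurable_divide borel_measurable_integrable)
    show "AE z in M. (\<lambda>i. ?q i z) \<longlonglongrightarrow> f' t z"
    proof (rule AE_I2)
      fix z
      show "(\<lambda>i. ?q i z) \<longlonglongrightarrow> f' t z"
        using d[OF S(2), of z] X unfolding has_field_derivative_iff tendsto_at_iff_sequentially
        by (auto simp: comp_def)
    qed
    show "AE z in M. norm (?q i z) \<le> w z" for i
    proof (rule AE_I2)
      fix z
      have "norm (f (X i) z - f t z) \<le> w z * norm (X i - t)"
        by (rule field_differentiable_bound[OF S(1), of "\<lambda>s. f s z" "\<lambda>s. f' s z"]) (use d w S X in auto)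
      then show "norm (?q i z) \<le> w z"
        using X(1) by (auto simp: field_simps)
    qed
  qed
  moreover have "(\<lambda>i. LINT z|M. ?q i z) = ((\<lambda>y. ((LINT z|M. f y z) - (LINT z|M. f t z)) / (y - t)) \<circ> X)"
  proof
    fix i
    have "(LINT z|M. f (X i) z - f t z) = (LINT z|M. f (X i) z) - (LINT z|M. f t z)"
      by (rule Bochner_Integration.integral_diff) (use f X S in auto)
    then show "(LINT z|M. ?q i z) = ((\<lambda>y. ((LINT z|M. f y z) - (LINT z|M. f t z)) / (y - t)) \<circ> X) i"
      by simp
  qed
  ultimately show "((\<lambda>y. ((LINT z|M. f y z) - (LINT z|M. f t z)) / (y - t)) \<circ> X) \<longlonglongrightarrow> (LINT z|M. f' t z)"
    by simp
qed

lemma integral_lebesgue_translate: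
  fixes f :: "'a::euclidean_space \<Rightarrow> real"
  assumes "f \<in> borel_measurable borel"
  shows "(LINT z|lebesgue. f (z + c)) = (LINT z|lebesgue. f z)"
proof -
  have "(LINT z|lborel. f z) = (LINT z|distr lborel borel ((+) c). f z)"
    by (metis lborel_distr_plus)
  also have "\<dots> = (LINT z|lborel. f (c + z))"
    by (subst integral_distr) (use assms in auto)
  finally show ?thesis
    using assms by (subst (1 2) integral_completion) (auto simp: add.commute)
qed

text \<open>The integral of the translates \<open>\<phi> (z + s *\<^sub>R b)\<close> does not depend
  on \<open>s\<close>, while differentiating it under the integral at s = 0 gives the integral of
  the partial derivative.\<close>

lemma integral_partial_zero:
  fixes \<phi> :: "'a::euclidean_space \<Rightarrow> real"
  assumes "test_function \<Omega> \<phi>"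
  shows "(LINT z|lebesgue. partial b \<phi> z) = 0"
proof -
  obtain K where K: "smooth \<phi>" "compact K" "\<And>z. z \<notin> K \<Longrightarrow> \<phi> z = 0"
    using test_functionE[OF assms] by metis
  obtain B where B: "B > 0" "\<And>z. \<bar>partial b \<phi> z\<bar> \<le> B"
    using test_function_bounded[OF test_function_partial[OF assms]] by (metis real_norm_def)
  \<comment> \<open>\<open>C\<close> contains the supports of all translates with s in the unit
    interval, so a multiple of its indicator dominates.\<close>
  define C where "C = (\<lambda>(s, z). z - s *\<^sub>R b) ` ({0..1::real} \<times> K)"
  have C: "compact C" unfolding C_def case_prod_unfold
    by (intro compact_continuous_image continuous_intros compact_Times K) auto
  have outC: "z + s *\<^sub>R b \<notin> K" if "z \<notin> C" "s \<in> {0..1}" for s z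
  proof
    assume "z + s *\<^sub>R b \<in> K"
    then have "z \<in> C" unfolding C_def using that(2)
      by (auto intro!: image_eqI[where x="(s, z + s *\<^sub>R b)"])
    with that show False by simp
  qed
  have sh: "smooth (\<lambda>z. \<phi> (z + s *\<^sub>R b))" for s
    by (intro smooth_compose[OF K(1)] smooth_intros)
  have "((\<lambda>s. LINT z|lebesgue. \<phi> (z + s *\<^sub>R b)) has_real_derivative (LINT z|lebesgue. partial b \<phi> (z + 0 *\<^sub>R b)))
      (at 0 within {0..1})"
  proof (rule has_real_derivative_integral[where w="\<lambda>z. B * indicator C z"])
    fix s :: real and z assume s: "s \<in> {0..1}"
    have "((\<lambda>s. \<phi> (z + s *\<^sub>R b)) has_derivative (\<lambda>u. partial (u *\<^sub>R b) \<phi> (z + s *\<^sub>R b))) (at s)"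
      by (rule has_derivative_compose[OF _ smooth_has_derivative[OF K(1)]]) (auto intro!: derivative_eq_intros)
    then show "((\<lambda>s. \<phi> (z + s *\<^sub>R b)) has_real_derivative partial b \<phi> (z + s *\<^sub>R b)) (at s within {0..1})"
      unfolding has_field_derivative_def
      by (rule has_derivative_at_withinI[OF has_derivative_eq_rhs])
         (simp add: partial_scaleR[OF K(1)] fun_eq_iff)
    show "\<bar>partial b \<phi> (z + s *\<^sub>R b)\<bar> \<le> B * indicator C z"
    proof (cases "z \<in> C")
      case False
      then show ?thesis using partial_zero_outside[OF K(2,3) outC[OF False s]] by simp
    qed (use B in auto)
  next
    fix s :: real assume s: "s \<in> {0..1}"
    have "integrable lebesgue (\<lambda>z. 1 * \<phi> (z + s *\<^sub>R b))"
      by (rule integrable_mult_test_function[OF _ C _ smooth_continuous[OF sh]])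
         (use outC s K(3) in \<open>auto simp: image_constant_conv\<close>)
    then show "integrable lebesgue (\<lambda>z. \<phi> (z + s *\<^sub>R b))" by simp
  next
    have "integrable lborel (\<lambda>x. indicator C x *\<^sub>R B)"
      by (rule borel_integrable_compact[OF C continuous_on_const])
    from integrable_lebesgue_lborel[OF this] show "integrable lebesgue (\<lambda>z. B * indicator C z)"
      by (simp add: mult.commute)
    show "(\<lambda>z. partial b \<phi> (z + 0 *\<^sub>R b)) \<in> borel_measurable lebesgue"
      using smooth_measurable[OF smooth_partial[OF K(1)]] by simp
  qed auto
  moreover have "(\<lambda>s. LINT z|lebesgue. \<phi> (z + s *\<^sub>R b)) = (\<lambda>s. LINT z|lebesgue. \<phi> z)"
    by (intro ext integral_lebesgue_translate)
       (simp add: borel_measurable_continuous_onI smooth_continuous[OF K(1)])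
  ultimately have "((\<lambda>s. LINT z|lebesgue. \<phi> z) has_real_derivative (LINT z|lebesgue. partial b \<phi> z)) (at 0 within {0..1::real})"
    by simp
  moreover have "((\<lambda>s. LINT z|lebesgue. \<phi> z) has_real_derivative 0) (at 0 within {0..1::real})"
    by (rule derivative_intros)
  ultimately have "((\<lambda>s. LINT z|lebesgue. \<phi> z) has_vector_derivative (LINT z|lebesgue. partial b \<phi> z)) (at 0 within {0..1::real})"
    "((\<lambda>s. LINT z|lebesgue. \<phi> z) has_vector_derivative 0) (at 0 within {0..1::real})"
    by (simp_all add: has_real_derivative_iff_has_vector_derivative)
  then show ?thesis
    using vector_derivative_unique_within_closed_interval[of 0 1 "0::real" "\<lambda>s. LINT z|lebesgue. \<phi> z"] by simp
qed

lemma integral_by_parts: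
  fixes \<phi> \<psi> :: "'a::euclidean_space \<Rightarrow> real"
  assumes "test_function \<Omega> \<phi>" "smooth \<psi>"
  shows "(LINT z|lebesgue. \<psi> z * partial b \<phi> z) = - (LINT z|lebesgue. partial b \<psi> z * \<phi> z)"
proof -
  have i: "integrable lebesgue (\<lambda>z. \<psi> z * partial b \<phi> z)" "integrable lebesgue (\<lambda>z. partial b \<psi> z * \<phi> z)"
    using test_function_integrable test_function_mult(1) test_function_partial smooth_partial assms by blast+
  have "0 = (LINT z|lebesgue. partial b (\<lambda>z. \<psi> z * \<phi> z) z)"
    using integral_partial_zero[OF test_function_mult(1)[OF assms]] by simp
  also have "\<dots> = (LINT z|lebesgue. \<psi> z * partial b \<phi> z + partial b \<psi> z * \<phi> z)"
    using partial_mult[OF assms(2) test_function_smooth[OF assms(1)]] by simp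
  finally show ?thesis using i by simp
qed

section \<open>An explicit radial deformation in x and its continuity equation\<close>

section \<open>The radial flow\<close>

text \<open>The reciprocal 1 / <x> of the Japanese bracket of the x component. The weights below are
  polynomials in it, since \<open>jap_sq\<close> eliminates the squared norm of x.\<close>

definition jap :: "'x::euclidean_space \<times> 'y::euclidean_space \<Rightarrow> real" where
  "jap z = 1 / sqrt (1 + fst z \<bullet> fst z)"

text \<open>One explicit Euler step of length \<open>t\<close> along the field -x / <x>, not the
  flow of that field: the dependence on \<open>t\<close> is affine and the Jacobian is explicit. For
  nonnegative \<open>t\<close> the displacement has length at most \<open>t\<close>.\<close>

definition pull :: "real \<Rightarrow> 'x::euclidean_space \<times> 'y::euclidean_space \<Rightarrow> 'x \<times> 'y" where
  "pull t z = ((1 - t * jap z) *\<^sub>R fst z, snd z)"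

text \<open>The determinant of the derivative of \<open>pull t\<close>. Its x block is a multiple of
  the identity plus a multiple of x x^T, with eigenvalue \<open>1 - t * jap z\<close> on the n - 1
  directions orthogonal to x and \<open>1 - t * jap z ^ 3\<close> along x.\<close>

definition jac :: "real \<Rightarrow> 'x::euclidean_space \<times> 'y::euclidean_space \<Rightarrow> real" where
  "jac t z = (1 - t * jap z) ^ (DIM('x) - 1) * (1 - t * jap z ^ 3)"

text \<open>The x-divergence of the field \<open>\<phi>\<close> x. Its integral against a function W
  is the distribution -x . grad_x W applied to \<open>\<phi>\<close>.\<close>

definition xdiv :: "('x::euclidean_space \<times> 'y::euclidean_space \<Rightarrow> real) \<Rightarrow> 'x \<times> 'y \<Rightarrow> real" where
  "xdiv \<phi> z = (\<Sum>b\<in>Basis. partial (b, 0) (\<lambda>z. (fst z \<bullet> b) * \<phi> z) z)"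

lemma jap_pos: "0 < jap z" and jap_le_1: "jap z \<le> 1"
  by (auto simp: jap_def add_pos_nonneg divide_le_eq)

lemma jap_sq: "(fst z \<bullet> fst z) * (jap z)\<^sup>2 = 1 - (jap z)\<^sup>2"
proof -
  have "1 + fst z \<bullet> fst z > 0" by (simp add: add_pos_nonneg)
  then show ?thesis unfolding jap_def power_divide by (simp add: field_simps)
qed

lemma norm_jap_le_1: "norm (fst z) * jap z \<le> 1"
proof -
  have "(norm (fst z) * jap z)\<^sup>2 \<le> 1\<^sup>2"
    using jap_sq[of z] by (simp add: power_mult_distrib power2_norm_eq_inner)
  then show ?thesis using power2_le_imp_le zero_le_one by blast
qed

lemma jap_has_derivative:
  "(jap has_derivative (\<lambda>h. - ((fst z \<bullet> fst h) * jap z ^ 3))) (at z)"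
proof -
  let ?s = "sqrt (1 + fst z \<bullet> fst z)"
  have p: "1 + fst z \<bullet> fst z > 0" by (simp add: add_pos_nonneg)
  then have s: "?s > 0" by simp
  have 1: "((\<lambda>z::'a \<times> 'b. fst z \<bullet> fst z) has_derivative (\<lambda>h. fst z \<bullet> fst h + fst h \<bullet> fst z)) (at z)"
    by (intro has_derivative_inner bounded_linear.has_derivative[OF bounded_linear_fst] has_derivative_ident)
  have "((\<lambda>s. 1 / sqrt (1 + s)) has_real_derivative - (jap z ^ 3 / 2)) (at (fst z \<bullet> fst z))"
    using p s by (auto intro!: derivative_eq_intros simp: jap_def power3_eq_cube field_simps)
  then have 2: "((\<lambda>s. 1 / sqrt (1 + s)) has_derivative (\<lambda>h. - (jap z ^ 3 / 2) * h)) (at (fst z \<bullet> fst z))"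
    by (rule has_field_derivative_imp_has_derivative)
  have "(\<lambda>h::'a \<times> 'b. - (jap z ^ 3 / 2) * (fst z \<bullet> fst h + fst h \<bullet> fst z)) = (\<lambda>h. - ((fst z \<bullet> fst h) * jap z ^ 3))"
    by (auto simp: fun_eq_iff inner_commute)
  then show ?thesis
    using has_derivative_compose[OF 1 2] unfolding jap_def[abs_def] by (simp only:)
qed

lemma smooth_jap [smooth_intros]: "smooth jap"
proof (rule smooth_bootstrap[OF jap_has_derivative])
  fix k b assume "Ck k (jap :: 'a \<times> 'b \<Rightarrow> real)"
  then show "Ck k (\<lambda>z::'a \<times> 'b. - ((fst z \<bullet> fst b) * jap z ^ 3))"
    using Ck_linear[OF bounded_linear_minus[OF bounded_linear_ident]]
      Ck_mult[OF Ck_inner[OF Ck_linear[OF bounded_linear_fst Ck_ident] Ck_const] Ck_power] by blast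
qed

lemma smooth_pull [smooth_intros]: "smooth (pull t)"
  unfolding pull_def[abs_def] by (intro smooth_intros)

lemma smooth_jac [smooth_intros]: "smooth (jac t)"
  unfolding jac_def[abs_def] by (intro smooth_intros)

lemma pull_has_derivative:
  "(pull t has_derivative (\<lambda>h. ((1 - t * jap z) *\<^sub>R fst h + (t * (fst z \<bullet> fst h) * jap z ^ 3) *\<^sub>R fst z, snd h))) (at z)"
proof -
  have 1: "((\<lambda>z. 1 - t * jap z) has_derivative (\<lambda>h. 0 - t * - ((fst z \<bullet> fst h) * jap z ^ 3))) (at z)"
    by (intro has_derivative_diff has_derivative_const has_derivative_mult_right jap_has_derivative)
  show ?thesis
    unfolding pull_def[abs_def]
    by (rule has_derivative_eq_rhs[OF has_derivative_Pair[OF has_derivative_scaleR[OF 1 has_derivative_fst[OF has_derivative_ident]] 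
         has_derivative_snd[OF has_derivative_ident]]]) (simp add: fun_eq_iff algebra_simps)
qed

lemma linear_sum_fst_Basis:
  fixes D :: "'x::euclidean_space \<times> 'y::euclidean_space \<Rightarrow> real"
  assumes "linear D" shows "(\<Sum>b\<in>Basis. (x \<bullet> b) * D (b, 0)) = D (x, 0)"
proof -
  have "D (x, 0) = D (\<Sum>b\<in>Basis. (x \<bullet> b) *\<^sub>R (b, 0))"
    by (simp add: euclidean_representation sum_prod scaleR_Pair flip: )
  also have "\<dots> = (\<Sum>b\<in>Basis. (x \<bullet> b) * D (b, 0))" by (simp only: linear_sum[OF assms] linear_scale[OF assms] real_scaleR_def)
  finally show ?thesis by simp
qed

lemma xdiv_eq:
  fixes \<phi> :: "'x::euclidean_space \<times> 'y::euclidean_space \<Rightarrow> real"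
  assumes "smooth \<phi>"
  shows "xdiv \<phi> z = DIM('x) * \<phi> z + partial (fst z, 0) \<phi> z"
proof -
  have "partial (b, 0) (\<lambda>z. (fst z \<bullet> b) * \<phi> z) z = (fst z \<bullet> b) * partial (b, 0) \<phi> z + \<phi> z" if "b \<in> Basis" for b
  proof -
    have "((\<lambda>z. (fst z \<bullet> b) * \<phi> z) has_derivative (\<lambda>h. (fst z \<bullet> b) * partial h \<phi> z + (fst h \<bullet> b) * \<phi> z)) (at z)"
      by (rule has_derivative_mult[OF _ smooth_has_derivative[OF assms]]) (auto intro!: derivative_eq_intros)
    from partial_eqI[OF this, of "(b, 0)"] show ?thesis using that by simp
  qed
  then have "xdiv \<phi> z = (\<Sum>b\<in>Basis. (fst z \<bullet> b) * partial (b, 0) \<phi> z) + DIM('x) * \<phi> z"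
    by (simp add: xdiv_def sum.distrib)
  then show ?thesis
    using linear_sum_fst_Basis[OF linear_frechet_derivative[OF smooth_differentiable[OF assms]], where x="fst z"] by simp
qed

lemma jap_bounds:
  assumes "0 \<le> t" "t \<le> 1"
  shows "0 \<le> 1 - t * jap z" "1 - t * jap z \<le> 1" "0 \<le> 1 - t * jap z ^ 3" "1 - t * jap z ^ 3 \<le> 1"
proof -
  have "jap z ^ 3 \<le> 1" using jap_pos[of z] jap_le_1[of z] by (simp add: power_le_one)
  then show "0 \<le> 1 - t * jap z" "1 - t * jap z \<le> 1" "0 \<le> 1 - t * jap z ^ 3" "1 - t * jap z ^ 3 \<le> 1"
    using assms jap_pos[of z] jap_le_1[of z] by (auto simp: mult_le_one)
qed

lemma jac_bounds:
  assumes "0 \<le> t" "t \<le> 1" shows "0 \<le> jac t z" "jac t z \<le> 1"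
  unfolding jac_def using jap_bounds[OF assms, of z] by (auto intro!: mult_nonneg_nonneg mult_le_one power_le_one)

text \<open>The transported amount per unit time, as a multiple of x. The velocity of the moving
  density is x times \<open>jap z / (1 - t * jap z ^ 3)\<close>; the denominator cancels the radial
  eigenvalue in \<open>jac\<close>, so no division is left.\<close>

definition flux :: "real \<Rightarrow> ('x::euclidean_space \<times> 'y::euclidean_space \<Rightarrow> real) \<Rightarrow> 'x \<times> 'y \<Rightarrow> real" where
  "flux t \<eta> z = \<eta> (pull t z) * (jap z * (1 - t * jap z) ^ (DIM('x) - 1))"

lemma smooth_flux: "smooth \<eta> \<Longrightarrow> smooth (flux t \<eta>)"
  unfolding flux_def[abs_def]
  by (rule smooth_mult[OF smooth_compose[OF _ smooth_pull]]) (auto intro!: smooth_intros)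

text \<open>The continuity equation for the transported density.\<close>

lemma transport_has_derivative:
  fixes \<eta> :: "'x::euclidean_space \<times> 'y::euclidean_space \<Rightarrow> real"
  assumes \<eta>: "smooth \<eta>"
  defines "J' \<equiv> \<lambda>t z::'x \<times> 'y. - (real (DIM('x) - 1) * jap z * (1 - t * jap z) ^ (DIM('x) - 2) * (1 - t * jap z ^ 3))
        - jap z ^ 3 * (1 - t * jap z) ^ (DIM('x) - 1)"
  shows "((\<lambda>t. \<eta> (pull t z) * jac t z) has_real_derivative
      (- jap z * partial (fst z, 0) \<eta> (pull t z) * jac t z + \<eta> (pull t z) * J' t z)) (at t)"
    and "- jap z * partial (fst z, 0) \<eta> (pull t z) * jac t z + \<eta> (pull t z) * J' t z = - xdiv (flux t \<eta>) z"
proof -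
  let ?a = "jap z" and ?n = "DIM('x)" and ?X = "(fst z, 0::'y)"
  let ?D = "partial ?X \<eta> (pull t z)"
  have "((\<lambda>t. pull t z) has_derivative (\<lambda>u. (u * - ?a) *\<^sub>R ?X)) (at t)"
    unfolding pull_def by (auto intro!: derivative_eq_intros simp: fun_eq_iff algebra_simps)
  from has_derivative_compose[OF this smooth_has_derivative[OF \<eta>]]
  have d1: "((\<lambda>t. \<eta> (pull t z)) has_real_derivative (- ?a * ?D)) (at t)"
    unfolding has_field_derivative_def
    by (rule has_derivative_eq_rhs) (simp only: partial_scaleR[OF \<eta>], simp add: fun_eq_iff)
  have d2: "((\<lambda>t. jac t z) has_real_derivative J' t z) (at t)"
  proof -
    have l: "((\<lambda>t. 1 - t * c) has_real_derivative - c) (at t)" for c :: real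
      by (auto intro!: derivative_eq_intros)
    show ?thesis
      unfolding jac_def J'_def
      by (rule DERIV_cong[OF DERIV_mult[OF DERIV_power[OF l[of ?a], of "?n - 1"] l[of "?a ^ 3"]]])
         (simp add: numeral_2_eq_2)
  qed
  show "((\<lambda>t. \<eta> (pull t z) * jac t z) has_real_derivative
      (- ?a * ?D * jac t z + \<eta> (pull t z) * J' t z)) (at t)"
    using DERIV_mult[OF d1 d2] by (simp add: algebra_simps)
  have a3: "(fst z \<bullet> fst z) * ?a ^ 3 = ?a - ?a ^ 3"
  proof -
    have "(fst z \<bullet> fst z) * ?a ^ 3 = ((fst z \<bullet> fst z) * ?a\<^sup>2) * ?a" by (simp add: power3_eq_cube power2_eq_square)
    then show ?thesis unfolding jap_sq by (simp add: power3_eq_cube power2_eq_square algebra_simps)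
  qed
  define A where "A = - (?a - ?a ^ 3)"
  have da: "(jap has_derivative (\<lambda>h. - ((fst z \<bullet> fst h) * ?a ^ 3))) (at z)" by (rule jap_has_derivative)
  have 0: "((\<lambda>z. 1 - t * jap z) has_derivative (\<lambda>h. 0 - t * - ((fst z \<bullet> fst h) * ?a ^ 3))) (at z)"
    by (intro has_derivative_diff has_derivative_const has_derivative_mult_right da)
  note 2 = has_derivative_mult[OF da has_derivative_power[OF 0, of "?n - 1"]]
  note 3 = has_derivative_mult[OF has_derivative_compose[OF pull_has_derivative smooth_has_derivative[OF \<eta>]] 2]
  have "(flux t \<eta> has_derivative (\<lambda>h. \<eta> (pull t z) * (?a * (real (?n - 1) * (- t * - ((fst z \<bullet> fst h) * ?a ^ 3)) * (1 - t * ?a) ^ (?n - 1 - 1)) 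
       + - ((fst z \<bullet> fst h) * ?a ^ 3) * (1 - t * ?a) ^ (?n - 1))
      + partial ((1 - t * ?a) *\<^sub>R fst h + (t * (fst z \<bullet> fst h) * ?a ^ 3) *\<^sub>R fst z, snd h) \<eta> (pull t z) * (?a * (1 - t * ?a) ^ (?n - 1)))) (at z)"
    unfolding flux_def[abs_def]
    by (rule has_derivative_eq_rhs[OF 3]) (simp add: fun_eq_iff algebra_simps)
  from partial_eqI[OF this, of ?X]
  have "partial ?X (flux t \<eta>) z = \<eta> (pull t z) * (?a * (real (?n - 1) * (- t * A) * (1 - t * ?a) ^ (?n - 2)) 
       + A * (1 - t * ?a) ^ (?n - 1))
      + partial ((1 - t * ?a) *\<^sub>R fst z + (t * (?a - ?a ^ 3)) *\<^sub>R fst z, 0) \<eta> (pull t z) * (?a * (1 - t * ?a) ^ (?n - 1))"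
    by (simp only: fst_conv snd_conv a3 A_def mult.assoc numeral_2_eq_2 diff_Suc_1 diff_diff_left add_Suc_right add_0_right One_nat_def)
  \<comment> \<open>x is an eigenvector of the derivative of \<open>pull t\<close>; this is the
    radial eigenvalue in \<open>jac\<close>.\<close>
  moreover have "((1 - t * ?a) *\<^sub>R fst z + (t * (?a - ?a ^ 3)) *\<^sub>R fst z, 0::'y) = (1 - t * ?a ^ 3) *\<^sub>R ?X"
    by (simp add: algebra_simps flip: scaleR_left_distrib)
  ultimately have px: "partial ?X (flux t \<eta>) z = \<eta> (pull t z) * (?a * (real (?n - 1) * (- t * A) * (1 - t * ?a) ^ (?n - 2)) 
       + A * (1 - t * ?a) ^ (?n - 1)) + (1 - t * ?a ^ 3) * ?D * (?a * (1 - t * ?a) ^ (?n - 1))"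
    by (simp only: partial_scaleR[OF \<eta>]) simp
  \<comment> \<open>The exponents \<open>?n - 1\<close> and \<open>?n - 2\<close> are truncated
    subtractions, so dimension one, where the factor \<open>?n - 1\<close> vanishes, is a separate
    case.\<close>
  obtain m where m: "?n = Suc m" by (metis DIM_positive gr0_implies_Suc)
  show "- ?a * ?D * jac t z + \<eta> (pull t z) * J' t z = - xdiv (flux t \<eta>) z"
    unfolding xdiv_eq[OF smooth_flux[OF \<eta>]] px
    unfolding flux_def jac_def J'_def A_def m
    by (cases m) (simp_all add: algebra_simps power3_eq_cube)
qed

lemma jac_zero [simp]: "jac 0 z = 1" and pull_zero [simp]: "pull 0 z = z"
  by (simp_all add: jac_def pull_def)

lemma xdiv_outside:
  assumes "compact K" "\<And>z. z \<notin> K \<Longrightarrow> \<phi> z = 0" "z \<notin> K"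
  shows "xdiv \<phi> z = 0"
  unfolding xdiv_def by (intro sum.neutral ballI partial_zero_outside[OF assms(1) _ assms(3)]) (simp add: assms(2))

lemma smooth_xdiv [smooth_intros]: "smooth \<phi> \<Longrightarrow> smooth (xdiv \<phi>)"
  unfolding xdiv_def[abs_def] by (intro smooth_intros)

lemma integrable_indicator_compact:
  fixes C :: "'a::euclidean_space set"
  assumes "compact C" shows "integrable lebesgue (\<lambda>z. B * indicator C z :: real)"
proof -
  have "integrable lborel (\<lambda>x. indicator C x *\<^sub>R B)"
    by (rule borel_integrable_compact[OF assms continuous_on_const])
  from integrable_lebesgue_lborel[OF this] show ?thesis by (simp add: mult.commute)
qed

lemma smooth_comp_pull [smooth_intros]: "smooth \<eta> \<Longrightarrow> smooth (\<lambda>z. \<eta> (pull t z))"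
  using smooth_compose smooth_pull by blast

text \<open>The weight \<open>W\<close> is merely bounded on a compact set, so the whole dependence
  on \<open>t\<close> is carried by the test function. \<open>C\<close> contains the supports of all
  transported functions at once, because a single dominating function is needed.\<close>

lemma flow_has_derivative:
  fixes W \<eta> :: "'x::euclidean_space \<times> 'y::euclidean_space \<Rightarrow> real"
  assumes W: "W \<in> borel_measurable lebesgue" and C: "compact C" "bounded (W ` C)"
    and \<eta>: "test_function UNIV \<eta>" and T: "T \<le> 1"
    and out: "\<And>t z. 0 \<le> t \<Longrightarrow> t \<le> T \<Longrightarrow> z \<notin> C \<Longrightarrow> \<eta> (pull t z) = 0"
    and t: "t \<in> {0..T}"
  shows "((\<lambda>t. LINT z|lebesgue. W z * (\<eta> (pull t z) * jac t z)) has_real_derivative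
      (LINT z|lebesgue. W z * - xdiv (flux t \<eta>) z)) (at t within {0..T})"
proof -
  have s\<eta>: "smooth \<eta>" using \<eta> by (rule test_function_smooth)
  obtain B where B: "\<forall>z\<in>C. \<bar>W z\<bar> \<le> B" using C(2) by (auto simp: bounded_iff)
  obtain B1 where B1: "B1 > 0" "\<And>z h. \<bar>partial h \<eta> z\<bar> \<le> B1 * norm h"
    by (rule test_function_partial_bound[OF \<eta>]) blast
  obtain B2 where B2: "B2 > 0" "\<And>z. \<bar>\<eta> z\<bar> \<le> B2" using test_function_bounded[OF \<eta>] by auto
  let ?n = "DIM('x)"
  \<comment> \<open>\<open>B1\<close> bounds the transport term, because the speed
    \<open>norm (fst z) * jap z\<close> is at most 1; the multiple of \<open>B2\<close> bounds the
    terms in which one of the two factors of \<open>jac\<close> is differentiated.\<close>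
  define Q where "Q = B1 + B2 * (real (?n - 1) + 1)"
  have fl: "flux s \<eta> z = 0" if "s \<in> {0..T}" "z \<notin> C" for s z
    using out that by (simp add: flux_def)
  show ?thesis
  proof (rule has_real_derivative_integral[where w="\<lambda>z. B * Q * indicator C z", OF _ t])
    fix s z assume s: "s \<in> {0..T}"
    have "((\<lambda>t. \<eta> (pull t z) * jac t z) has_real_derivative - xdiv (flux s \<eta>) z) (at s within {0..T})"
      using transport_has_derivative[OF s\<eta>, of z s] by (auto intro: has_field_derivative_at_within)
    then show "((\<lambda>t. W z * (\<eta> (pull t z) * jac t z)) has_real_derivative W z * - xdiv (flux s \<eta>) z) (at s within {0..T})"
      by (rule DERIV_cmult)
    show "\<bar>W z * - xdiv (flux s \<eta>) z\<bar> \<le> B * Q * indicator C z"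
    proof (cases "z \<in> C")
      case False
      then show ?thesis using xdiv_outside[OF C(1) fl False] s by simp
    next
      case True
      have s1: "0 \<le> s" "s \<le> 1" using s T by auto
      note jb = jap_bounds[OF s1, of z]
      define c where "c = 1 - s * jap z"
      define d where "d = 1 - s * jap z ^ 3"
      have cd: "0 \<le> c" "c \<le> 1" "0 \<le> d" "d \<le> 1" using jb by (auto simp: c_def d_def)
      have a: "0 \<le> jap z" "jap z \<le> 1" using jap_pos[of z] jap_le_1[of z] by auto
      define j where "j = real (?n - 1) * jap z * c ^ (?n - 2) * d"
      define l where "l = jap z ^ 3 * c ^ (?n - 1)"
      have "jap z * c ^ (?n - 2) * d \<le> 1"
        using a cd by (intro mult_le_one mult_nonneg_nonneg power_le_one) auto
      then have j: "0 \<le> j" "j \<le> real (?n - 1)"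
        unfolding j_def using a cd mult_left_mono[of "jap z * c ^ (?n - 2) * d" 1 "real (?n - 1)"] by (auto simp: mult.assoc)
      have l: "0 \<le> l" "l \<le> 1" unfolding l_def using a cd by (auto intro!: mult_le_one power_le_one)
      have "\<bar>partial (fst z, 0) \<eta> (pull s z)\<bar> \<le> B1 * norm (fst z)"
        using B1(2)[of "(fst z, 0)" "pull s z"] B1(2)[of "pull s z" "(fst z, 0)"] by (simp add: norm_Pair)
      then have "jap z * \<bar>partial (fst z, 0) \<eta> (pull s z)\<bar> \<le> jap z * (B1 * norm (fst z))"
        using a mult_left_mono by blast
      also have "\<dots> \<le> B1" using norm_jap_le_1[of z] B1(1) by (simp add: mult.commute mult.left_commute)
      finally have p: "jap z * \<bar>partial (fst z, 0) \<eta> (pull s z)\<bar> \<le> B1" .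
      have jj: "0 \<le> jac s z" "jac s z \<le> 1" using jac_bounds[OF s1, of z] by auto
      have "\<bar>- jap z * partial (fst z, 0) \<eta> (pull s z) * jac s z\<bar> \<le> B1 * 1"
        unfolding abs_mult using p jj a B1(1) by (intro mult_mono) auto
      moreover have "\<bar>\<eta> (pull s z) * (- j - l)\<bar> \<le> B2 * (real (?n - 1) + 1)"
        unfolding abs_mult using j l B2 by (intro mult_mono) auto
      ultimately have "\<bar>- jap z * partial (fst z, 0) \<eta> (pull s z) * jac s z + \<eta> (pull s z) * (- j - l)\<bar> \<le> Q"
        unfolding Q_def by linarith
      then have "\<bar>- xdiv (flux s \<eta>) z\<bar> \<le> Q"
        using transport_has_derivative(2)[OF s\<eta>, of z s] by (simp add: j_def l_def c_def d_def)
      then show ?thesis using B True unfolding abs_mult by (auto intro!: mult_mono)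
    qed
  next
    fix s assume s: "s \<in> {0..T}"
    show "integrable lebesgue (\<lambda>z. W z * (\<eta> (pull s z) * jac s z))"
      by (rule integrable_mult_test_function[OF W C]) 
         (use out s in \<open>auto intro!: smooth_continuous smooth_intros s\<eta>\<close>)
  next
    show "(\<lambda>z. W z * - xdiv (flux t \<eta>) z) \<in> borel_measurable lebesgue"
      by (intro borel_measurable_times W smooth_measurable smooth_intros smooth_flux s\<eta>)
    show "integrable lebesgue (\<lambda>z. B * Q * indicator C z)" by (rule integrable_indicator_compact[OF C(1)])
  qed auto
qed

text \<open>\<open>flux t \<eta>\<close> is itself a nonnegative test function on \<open>U\<close>,
  so a differential inequality for \<open>W\<close> that is assumed only against test functions
  makes the time derivative nonpositive. Both the potential and the defining function of the
  boundary are treated by this lemma.\<close>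

lemma flow_decreasing:
  fixes W \<eta> :: "'x::euclidean_space \<times> 'y::euclidean_space \<Rightarrow> real"
  assumes W: "W \<in> borel_measurable lebesgue" and C: "compact C" "bounded (W ` C)" "C \<subseteq> U"
    and \<eta>: "test_function UNIV \<eta>" "\<And>z. 0 \<le> \<eta> z" and T: "0 \<le> T" "T \<le> 1"
    and out: "\<And>t z. 0 \<le> t \<Longrightarrow> t \<le> T \<Longrightarrow> z \<notin> C \<Longrightarrow> \<eta> (pull t z) = 0"
    and hyp: "\<And>\<phi>. test_function U \<phi> \<Longrightarrow> (\<And>z. 0 \<le> \<phi> z) \<Longrightarrow> 0 \<le> (LINT z|lebesgue. W z * xdiv \<phi> z)"
  shows "(LINT z|lebesgue. W z * (\<eta> (pull T z) * jac T z)) \<le> (LINT z|lebesgue. W z * \<eta> z)"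
proof -
  define G where "G = (\<lambda>t. LINT z|lebesgue. W z * (\<eta> (pull t z) * jac t z))"
  have d: "(G has_real_derivative (LINT z|lebesgue. W z * - xdiv (flux t \<eta>) z)) (at t within {0..T})" if "t \<in> {0..T}" for t
    unfolding G_def by (rule flow_has_derivative[OF W C(1,2) \<eta>(1) T(2) out that])
  have "G T \<le> G 0"
  proof (rule DERIV_nonpos_imp_decreasing_open[OF T(1)])
    fix t assume t: "0 < t" "t < T"
    then have "(G has_real_derivative (LINT z|lebesgue. W z * - xdiv (flux t \<eta>) z)) (at t)"
      using d[of t] at_within_interior[of t "{0..T}"] by simp
    moreover have "0 \<le> (LINT z|lebesgue. W z * xdiv (flux t \<eta>) z)"
    proof (rule hyp)
      show "test_function U (flux t \<eta>)"
        by (rule test_functionI[OF smooth_flux[OF test_function_smooth[OF \<eta>(1)]] C(1,3)])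
           (use out t in \<open>simp add: flux_def\<close>)
      show "0 \<le> flux t \<eta> z" for z
        unfolding flux_def using \<eta>(2) jap_pos[of z] jap_bounds[of t z] t T by simp
    qed
    ultimately show "\<exists>y. (G has_real_derivative y) (at t) \<and> y \<le> 0" by fastforce
  next
    show "continuous_on {0..T} G"
      using d DERIV_continuous continuous_on_eq_continuous_within by blast
  qed
  then show ?thesis by (simp add: G_def)
qed

text \<open>For t between 0 and 1/2 the map \<open>pull t\<close> shrinks x by a factor between 1/2
  and 1; the preimages of \<open>K\<close> therefore lie in this hull.\<close>

definition xhull :: "('x::euclidean_space \<times> 'y::euclidean_space) set \<Rightarrow> ('x \<times> 'y) set" where
  "xhull K = (\<lambda>(s, z). (s *\<^sub>R fst z, snd z)) ` ({1..2::real} \<times> K)"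

text \<open>Equivalently the complement is closed under shrinking x by positive factors at most 1,
  so composing with \<open>pull t\<close> preserves vanishing outside the set.\<close>

definition xstar :: "('x::euclidean_space \<times> 'y::euclidean_space) set \<Rightarrow> bool" where
  "xstar \<Omega> \<longleftrightarrow> (\<forall>z\<in>\<Omega>. \<forall>s\<ge>1. (s *\<^sub>R fst z, snd z) \<in> \<Omega>)"

lemma xstar_UNIV [simp]: "xstar UNIV" by (simp add: xstar_def)

lemma compact_xhull: "compact K \<Longrightarrow> compact (xhull K)"
  unfolding xhull_def case_prod_unfold
  by (intro compact_continuous_image compact_Times) (auto intro!: continuous_intros)

lemma xhull_subset: "xstar \<Omega> \<Longrightarrow> K \<subseteq> \<Omega> \<Longrightarrow> xhull K \<subseteq> \<Omega>"
  unfolding xhull_def xstar_def by fastforce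

lemma pull_in_xhull:
  assumes "0 \<le> t" "t \<le> 1/2" "pull t z \<in> K" shows "z \<in> xhull K"
proof -
  have "t * jap z \<le> 1/2 * 1" using assms jap_pos[of z] jap_le_1[of z] by (intro mult_mono) auto
  then have c: "1/2 \<le> 1 - t * jap z" "1 - t * jap z \<le> 1" using assms jap_pos[of z] by auto
  then have "z = (inverse (1 - t * jap z) *\<^sub>R fst (pull t z), snd (pull t z))"
    by (auto simp: pull_def prod_eq_iff)
  moreover have "inverse (1 - t * jap z) \<in> {1..2}" using c by (auto simp: field_simps)
  ultimately show ?thesis unfolding xhull_def using assms(3)
    by (auto intro!: image_eqI[where x="(inverse (1 - t * jap z), pull t z)"])
qed

text \<open>Star-shapedness is what keeps the competitors supported inside the domain: the support
  is only moved outward in x.\<close>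

lemma test_function_comp_pull:
  assumes "test_function \<Omega> \<eta>" "xstar \<Omega>" "0 \<le> t" "t \<le> 1/2"
  shows "test_function \<Omega> (\<lambda>z. \<eta> (pull t z))"
proof -
  obtain K where K: "smooth \<eta>" "compact K" "K \<subseteq> \<Omega>" "\<And>z. z \<notin> K \<Longrightarrow> \<eta> z = 0"
    using test_functionE[OF assms(1)] by metis
  show ?thesis
    by (rule test_functionI[OF smooth_comp_pull[OF K(1)] compact_xhull[OF K(2)] xhull_subset[OF assms(2) K(3)]])
       (use pull_in_xhull[OF assms(3,4)] K in blast)
qed

lemma integral_xdiv_zero:
  assumes "test_function \<Omega> \<phi>" shows "(LINT z|lebesgue. xdiv \<phi> z) = 0"
proof -
  have tf: "test_function \<Omega> (\<lambda>z. (fst z \<bullet> b) * \<phi> z)" for b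
    by (rule test_function_mult(1)[OF assms]) (intro smooth_intros)
  have "(LINT z|lebesgue. xdiv \<phi> z) = (\<Sum>b\<in>Basis. LINT z|lebesgue. partial (b, 0) (\<lambda>z. (fst z \<bullet> b) * \<phi> z) z)"
    unfolding xdiv_def 
    by (rule Bochner_Integration.integral_sum) (rule test_function_integrable[OF test_function_partial[OF tf]])
  also have "\<dots> = 0" by (simp add: integral_partial_zero[OF tf])
  finally show ?thesis .
qed

text \<open>Integrating the continuity equation gives the change of variables formula for \<open>pull t\<close>.\<close>

lemma flow_invariant:
  fixes \<eta> :: "'x::euclidean_space \<times> 'y::euclidean_space \<Rightarrow> real"
  assumes \<eta>: "test_function \<Omega> \<eta>" and t: "0 \<le> t" "t \<le> 1/2"
  shows "(LINT z|lebesgue. \<eta> (pull t z) * jac t z) = (LINT z|lebesgue. \<eta> z)"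
proof -
  obtain K where K: "smooth \<eta>" "compact K" "\<And>z. z \<notin> K \<Longrightarrow> \<eta> z = 0"
    using test_functionE[OF \<eta>] by metis
  define G where "G = (\<lambda>t. LINT z|lebesgue. 1 * (\<eta> (pull t z) * jac t z))"
  have out: "\<eta> (pull s z) = 0" if "0 \<le> s" "s \<le> 1/2" "z \<notin> xhull K" for s z
    using pull_in_xhull[OF that(1,2)] that(3) K(3) by blast
  have "(G has_real_derivative 0) (at s within {0..1/2})" if s: "s \<in> {0..1/2}" for s
  proof -
    have "test_function UNIV (flux s \<eta>)"
      by (rule test_functionI[OF smooth_flux[OF K(1)] compact_xhull[OF K(2)]])
         (use out s in \<open>auto simp: flux_def\<close>)
    then have "(LINT z|lebesgue. 1 * - xdiv (flux s \<eta>) z) = 0" using integral_xdiv_zero by simp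
    moreover have "(G has_real_derivative (LINT z|lebesgue. 1 * - xdiv (flux s \<eta>) z)) (at s within {0..1/2})"
      unfolding G_def
      by (rule flow_has_derivative[OF _ compact_xhull[OF K(2)] _ test_function_mono[OF \<eta>] _ out s])
         (auto simp: image_constant_conv)
    ultimately show ?thesis by metis
  qed
  then obtain c where "\<And>s. s \<in> {0..1/2} \<Longrightarrow> G s = c"
    using has_field_derivative_zero_constant[of "{0..1/2}" G] by (metis convex_real_interval(5))
  then have "G t = G 0" using t by simp
  then show ?thesis by (simp add: G_def)
qed

section \<open>Energy and mass of the deformed functions up to order t^2\<close>

section \<open>The deformed test functions\<close>

definition gsq :: "('a::euclidean_space \<Rightarrow> real) \<Rightarrow> 'a \<Rightarrow> real" where
  "gsq \<phi> z = (\<Sum>b\<in>Basis. (partial b \<phi> z)\<^sup>2)"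

definition grad :: "('a::euclidean_space \<Rightarrow> real) \<Rightarrow> 'a \<Rightarrow> 'a" where
  "grad \<phi> z = (\<Sum>b\<in>Basis. partial b \<phi> z *\<^sub>R b)"

lemma grad_inner_Basis: "b \<in> Basis \<Longrightarrow> grad \<phi> z \<bullet> b = partial b \<phi> z"
  by (simp add: grad_def)

lemma partial_grad:
  assumes "smooth \<phi>" shows "partial h \<phi> z = grad \<phi> z \<bullet> h"
proof -
  have "partial h \<phi> z = (\<Sum>b\<in>Basis. (h \<bullet> b) *\<^sub>R partial b \<phi> z)"
    by (rule partial_sum_Basis[OF smooth_differentiable[OF assms]])
  also have "\<dots> = grad \<phi> z \<bullet> h"
    unfolding grad_def inner_sum_left by (simp add: inner_commute mult.commute)
  finally show ?thesis .
qed

lemma gsq_grad: "gsq \<phi> z = (norm (grad \<phi> z))\<^sup>2"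
  unfolding gsq_def power2_norm_eq_inner
  by (subst euclidean_inner) (simp add: grad_inner_Basis power2_eq_square)

lemma grad_eqI:
  assumes "smooth \<phi>" "\<And>h. partial h \<phi> z = v \<bullet> h" shows "grad \<phi> z = v"
  by (rule euclidean_eqI) (simp add: grad_inner_Basis assms(2))

lemma test_function_gsq: "test_function \<Omega> \<phi> \<Longrightarrow> test_function \<Omega> (gsq \<phi>)"
  unfolding gsq_def[abs_def] power2_eq_square
  by (intro test_function_sum test_function_mult test_function_partial smooth_partial test_function_smooth)

lemma gsq_nonneg [simp]: "0 \<le> gsq \<phi> z" by (simp add: gsq_def sum_nonneg)

text \<open>The x-Laplacian of <x>, equivalently the divergence of x / <x>. It is the first-order
  coefficient in the expansion of \<open>jac\<close>, namely 1 - t \<open>lapl\<close> +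
  O(t^2).\<close>

definition lapl :: "'x::euclidean_space \<times> 'y::euclidean_space \<Rightarrow> real" where
  "lapl z = real (DIM('x) - 1) * jap z + jap z ^ 3"

text \<open>The first-order expansion of the square root of \<open>jac\<close>. Being affine in
  \<open>t\<close> it has an explicit gradient, and its square differs from \<open>jac\<close> at
  order t^2 only.\<close>

definition damp :: "real \<Rightarrow> 'x::euclidean_space \<times> 'y::euclidean_space \<Rightarrow> real" where
  "damp t z = 1 - t / 2 * lapl z"

definition deform :: "real \<Rightarrow> ('x::euclidean_space \<times> 'y::euclidean_space \<Rightarrow> real) \<Rightarrow> 'x \<times> 'y \<Rightarrow> real" where
  "deform t \<phi> z = damp t z * \<phi> (pull t z)"

lemma smooth_lapl [smooth_intros]: "smooth lapl" unfolding lapl_def[abs_def] by (intro smooth_intros)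
lemma smooth_damp [smooth_intros]: "smooth (damp t)" unfolding damp_def[abs_def] by (intro smooth_intros)

lemma test_function_deform:
  "test_function \<Omega> \<phi> \<Longrightarrow> xstar \<Omega> \<Longrightarrow> 0 \<le> t \<Longrightarrow> t \<le> 1/2 \<Longrightarrow> test_function \<Omega> (deform t \<phi>)"
  unfolding deform_def[abs_def] by (intro test_function_mult test_function_comp_pull smooth_damp)

text \<open>Passing from k to k + 1 adds at most k x^2 to the remainder, and k^2 + k \<le> (k +
  1)^2.\<close>

lemma power_one_minus_approx:
  fixes x :: real
  assumes "0 \<le> x" "x \<le> 1"
  shows "\<bar>(1 - x) ^ k - (1 - real k * x)\<bar> \<le> (real k)\<^sup>2 * x\<^sup>2"
proof (induction k)
  case (Suc k)
  have "(1 - x) ^ Suc k - (1 - real (Suc k) * x) = (1 - x) * ((1 - x) ^ k - (1 - real k * x)) + real k * x\<^sup>2"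
    by (simp add: algebra_simps power2_eq_square)
  also have "\<bar>\<dots>\<bar> \<le> 1 * ((real k)\<^sup>2 * x\<^sup>2) + real k * x\<^sup>2"
  proof -
    have "\<bar>(1 - x) * ((1 - x) ^ k - (1 - real k * x))\<bar> \<le> 1 * ((real k)\<^sup>2 * x\<^sup>2)"
      unfolding abs_mult using assms Suc by (intro mult_mono) auto
    then show ?thesis by (intro order_trans[OF abs_triangle_ineq] add_mono) auto
  qed
  also have "\<dots> \<le> (real (Suc k))\<^sup>2 * x\<^sup>2"
    using assms by (simp add: algebra_simps power2_eq_square)
  finally show ?case .
qed simp

lemma lapl_bounds: "0 \<le> lapl (z :: 'x::euclidean_space \<times> 'y::euclidean_space)" "lapl z \<le> real DIM('x)"
proof -
  have a: "0 \<le> jap z" "jap z \<le> 1" using jap_pos[of z] jap_le_1[of z] by auto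
  have "real (DIM('x) - 1) * jap z \<le> real (DIM('x) - 1) * 1" using a by (intro mult_left_mono) auto
  moreover have "jap z ^ 3 \<le> 1" using a by (simp add: power_le_one)
  moreover have "real (DIM('x) - 1) + 1 = real DIM('x)" using DIM_positive[where 'a='x] by linarith
  ultimately show "lapl z \<le> real DIM('x)" unfolding lapl_def by linarith
  show "0 \<le> lapl z" unfolding lapl_def using a by simp
qed

lemma lapl_partial: 
  fixes z :: "'x::euclidean_space \<times> 'y::euclidean_space"
  shows "partial h lapl z = - ((real (DIM('x) - 1) * jap z ^ 3 + 3 * jap z ^ 5) * (fst z \<bullet> fst h))"
proof -
  have "(lapl has_derivative (\<lambda>h. real (DIM('x) - 1) * - ((fst z \<bullet> fst h) * jap z ^ 3) 
      + real 3 * - ((fst z \<bullet> fst h) * jap z ^ 3) * jap z ^ (3 - 1))) (at z)"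
    unfolding lapl_def[abs_def]
    by (intro has_derivative_add has_derivative_mult_right has_derivative_power jap_has_derivative)
  from partial_eqI[OF this, of h] show ?thesis
    by (simp add: algebra_simps eval_nat_numeral)
qed

section \<open>Bounds for \<open>damp\<close> and \<open>jac\<close>, and the mass of
  \<open>deform\<close>, for small t\<close>

context
  fixes t :: real
  assumes t: "0 \<le> t" "t \<le> 1 / (2 * real DIM('x::euclidean_space))"
begin

text \<open>The range of \<open>t\<close> is chosen so that both \<open>damp\<close> and
  \<open>jac\<close> stay at least 1/2: \<open>lapl\<close> is at most n, and Bernoulli's inequality
  handles \<open>jac\<close>.\<close>

lemma t_half: "t \<le> 1/2" "t * real DIM('x) \<le> 1/2"
proof -
  have n: "(1::real) \<le> real DIM('x)" using DIM_positive[where 'a='x] by linarith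
  then have h: "t * (2 * real DIM('x)) \<le> 1" using t by (simp add: pos_le_divide_eq)
  then show "t * real DIM('x) \<le> 1/2" by simp
  have "t * (2 * 1) \<le> t * (2 * real DIM('x))" using t n by (intro mult_left_mono) auto
  then show "t \<le> 1/2" using h by simp
qed

text \<open>Lowering the last factor of \<open>jac\<close> to \<open>1 - t * jap z\<close> leaves an
  n-th power, to which Bernoulli's inequality applies.\<close>

lemma jac_ge_half: "1/2 \<le> jac t (z :: 'x \<times> 'y::euclidean_space)"
proof -
  have a: "0 \<le> jap z" "jap z \<le> 1" using jap_pos[of z] jap_le_1[of z] by auto
  have b: "0 \<le> 1 - t * jap z" "1 - t * jap z \<le> 1" using jap_bounds[of t z] t t_half by auto
  have "t * jap z ^ 3 \<le> t * jap z" using a t power_decreasing[of 1 3 "jap z"] by (intro mult_left_mono) auto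
  then have "(1 - t * jap z) ^ (DIM('x) - 1) * (1 - t * jap z) \<le> jac t z"
    unfolding jac_def using b by (intro mult_left_mono) auto
  moreover have "(1 - t * jap z) ^ (DIM('x) - 1) * (1 - t * jap z) = (1 - t * jap z) ^ DIM('x)"
    by (metis DIM_positive One_nat_def Suc_pred power_Suc2)
  moreover have "1 + real DIM('x) * (- (t * jap z)) \<le> (1 + - (t * jap z)) ^ DIM('x)"
    by (rule Bernoulli_inequality) (use b in auto)
  moreover have "real DIM('x) * (t * jap z) \<le> 1/2"
  proof -
    have "real DIM('x) * (t * jap z) \<le> real DIM('x) * (t * 1)" using a t by (intro mult_left_mono) auto
    also have "\<dots> = t * real DIM('x)" by simp
    finally show ?thesis using t_half(2) by linarith
  qed
  ultimately show ?thesis by simp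
qed

lemma damp_bounds: "1/2 \<le> damp t (z :: 'x \<times> 'y::euclidean_space)" "damp t z \<le> 1" "\<bar>damp t z - 1\<bar> \<le> t * real DIM('x)"
proof -
  have "t * lapl z \<le> t * real DIM('x)" "0 \<le> t * lapl z" using t lapl_bounds[of z] by (auto intro: mult_left_mono)
  then show "1/2 \<le> damp t z" "damp t z \<le> 1" "\<bar>damp t z - 1\<bar> \<le> t * real DIM('x)" unfolding damp_def using t_half(2) by auto
qed

text \<open>Both functions equal 1 - t \<open>lapl\<close> up to order t^2. With k = n - 1 the error
  of \<open>jac\<close> has a part k^2 from the power and a part k from the cross term, together at
  most n^2; the square of \<open>damp\<close> adds at most n^2 / 4.\<close>

lemma damp_sq_jac: "\<bar>(damp t z)\<^sup>2 - jac t (z :: 'x \<times> 'y::euclidean_space)\<bar> \<le> 2 * (real DIM('x))\<^sup>2 * t\<^sup>2"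
proof -
  let ?a = "jap z"
  define k where "k = DIM('x) - 1"
  have a: "0 \<le> ?a" "?a \<le> 1" using jap_pos[of z] jap_le_1[of z] by auto
  have kn: "real k + 1 = real DIM('x)" using DIM_positive[where 'a='x] by (simp add: k_def)
  have b: "0 \<le> t * ?a" "t * ?a \<le> t" "t * ?a \<le> 1" "0 \<le> 1 - t * ?a ^ 3" "1 - t * ?a ^ 3 \<le> 1"
    using jap_bounds[of t z] t t_half a mult_left_mono[of ?a 1 t] by auto
  define E where "E = (1 - t * ?a) ^ k - (1 - real k * (t * ?a))"
  have "(t * ?a)\<^sup>2 \<le> t\<^sup>2" using b t by (intro power_mono) auto
  then have "(real k)\<^sup>2 * (t * ?a)\<^sup>2 \<le> (real k)\<^sup>2 * t\<^sup>2" by (intro mult_left_mono) auto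
  then have E: "\<bar>E\<bar> \<le> (real k)\<^sup>2 * t\<^sup>2"
    using power_one_minus_approx[of "t * ?a" k] b unfolding E_def by linarith
  have "jac t z = (E + (1 - real k * (t * ?a))) * (1 - t * ?a ^ 3)"
    unfolding jac_def E_def k_def by simp
  then have "jac t z - (1 - t * lapl z) = E * (1 - t * ?a ^ 3) + real k * t\<^sup>2 * ?a ^ 4"
    unfolding lapl_def k_def[symmetric] by (simp add: algebra_simps power2_eq_square eval_nat_numeral)
  moreover have "\<bar>E * (1 - t * ?a ^ 3)\<bar> \<le> ((real k)\<^sup>2 * t\<^sup>2) * 1"
    unfolding abs_mult using E b by (intro mult_mono) auto
  moreover have "\<bar>real k * t\<^sup>2 * ?a ^ 4\<bar> \<le> real k * t\<^sup>2 * 1"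
    unfolding abs_mult using a by (intro mult_mono) (auto simp: power_le_one)
  ultimately have "\<bar>jac t z - (1 - t * lapl z)\<bar> \<le> (real k)\<^sup>2 * t\<^sup>2 + real k * t\<^sup>2"
    by linarith
  then have 1: "\<bar>jac t z - (1 - t * lapl z)\<bar> \<le> ((real k)\<^sup>2 + real k) * t\<^sup>2"
    by (simp add: algebra_simps)
  have "(damp t z)\<^sup>2 = 1 - t * lapl z + t\<^sup>2 * (lapl z)\<^sup>2 / 4"
    unfolding damp_def by (simp add: power2_eq_square field_simps)
  moreover have "t\<^sup>2 * (lapl z)\<^sup>2 \<le> t\<^sup>2 * (real DIM('x))\<^sup>2"
    using lapl_bounds[of z] by (intro mult_left_mono power_mono) auto
  moreover have "((real k)\<^sup>2 + real k) * t\<^sup>2 \<le> (real DIM('x))\<^sup>2 * t\<^sup>2"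
    unfolding kn[symmetric] by (intro mult_right_mono) (auto simp: power2_eq_square algebra_simps)
  moreover have "0 \<le> t\<^sup>2 * (lapl z)\<^sup>2" "0 \<le> (real DIM('x))\<^sup>2 * t\<^sup>2" by auto
  moreover have "t\<^sup>2 * (real DIM('x))\<^sup>2 = (real DIM('x))\<^sup>2 * t\<^sup>2" by simp
  ultimately show ?thesis using 1 unfolding abs_le_iff by linarith
qed

text \<open>The additive error becomes a factor because \<open>jac\<close> is at least 1/2; a factor
  passes through integrals with nonnegative weights such as the potential.\<close>

lemma damp_sq_le_jac: "(damp t z)\<^sup>2 \<le> (1 + 4 * (real DIM('x))\<^sup>2 * t\<^sup>2) * jac t (z :: 'x \<times> 'y::euclidean_space)"
proof -
  have "2 * (real DIM('x))\<^sup>2 * t\<^sup>2 * 1 \<le> 2 * (real DIM('x))\<^sup>2 * t\<^sup>2 * (2 * jac t z)"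
    using jac_ge_half[of z] by (intro mult_left_mono) auto
  then show ?thesis using damp_sq_jac[of z] by (simp add: algebra_simps abs_le_iff)
qed

text \<open>The transported integral with \<open>jac\<close> is invariant, and omitting
  \<open>jac\<close> costs at most a factor 2.\<close>

lemma integral_pull_le:
  fixes \<eta> :: "'x \<times> 'y::euclidean_space \<Rightarrow> real"
  assumes "test_function \<Omega> \<eta>" "\<And>z. 0 \<le> \<eta> z"
  shows "(LINT z|lebesgue. \<eta> (pull t z)) \<le> 2 * (LINT z|lebesgue. \<eta> z)"
proof -
  have tf: "test_function UNIV \<eta>" by (rule test_function_mono[OF assms(1)]) simp
  have tp: "test_function UNIV (\<lambda>z. \<eta> (pull t z))" by (rule test_function_comp_pull[OF tf]) (use t t_half in auto)
  have "(LINT z|lebesgue. \<eta> (pull t z)) \<le> (LINT z|lebesgue. 2 * (\<eta> (pull t z) * jac t z))"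
  proof (rule integral_mono[OF test_function_integrable[OF tp]])
    show "integrable lebesgue (\<lambda>z. 2 * (\<eta> (pull t z) * jac t z))"
      by (intro integrable_mult_right test_function_integrable[OF test_function_mult(2)[OF tp smooth_jac]])
    show "\<eta> (pull t z) \<le> 2 * (\<eta> (pull t z) * jac t z)" for z
      using mult_left_mono[OF jac_ge_half[of z] assms(2)[of "pull t z"]] by simp
  qed
  also have "\<dots> = 2 * (LINT z|lebesgue. \<eta> z)"
    using flow_invariant[OF assms(1) t(1) t_half(1)] by simp
  finally show ?thesis .
qed

text \<open>Mass is conserved to second order, which removes the eigenvalue from the first-order
  balance.\<close>

lemma deform_L2_norm:
  fixes \<phi> :: "'x \<times> 'y::euclidean_space \<Rightarrow> real"
  assumes \<phi>: "test_function UNIV \<phi>"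
  shows "\<bar>(LINT z|lebesgue. (deform t \<phi> z)\<^sup>2) - (LINT z|lebesgue. (\<phi> z)\<^sup>2)\<bar>
    \<le> 4 * (real DIM('x))\<^sup>2 * t\<^sup>2 * (LINT z|lebesgue. (\<phi> z)\<^sup>2)"
proof -
  have t1: "t \<le> 1/2" by (rule t_half)
  have s2: "test_function UNIV (\<lambda>z. (\<phi> z)\<^sup>2)"
    unfolding power2_eq_square by (rule test_function_mult[OF \<phi> test_function_smooth[OF \<phi>]])
  have p2: "test_function UNIV (\<lambda>z. (\<phi> (pull t z))\<^sup>2)"
    by (rule test_function_comp_pull[OF s2]) (use t t1 in auto)
  have i: "integrable lebesgue (\<lambda>z. (\<phi> (pull t z))\<^sup>2 * f z)" if "smooth f" for f
    by (rule test_function_integrable[OF test_function_mult(2)[OF p2 that]])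
  have "(LINT z|lebesgue. (deform t \<phi> z)\<^sup>2) - (LINT z|lebesgue. (\<phi> z)\<^sup>2)
      = (LINT z|lebesgue. (\<phi> (pull t z))\<^sup>2 * (damp t z)\<^sup>2) - (LINT z|lebesgue. (\<phi> (pull t z))\<^sup>2 * jac t z)"
    unfolding flow_invariant[OF s2 t(1) t1] deform_def power_mult_distrib by (simp add: mult.commute)
  also have "\<dots> = (LINT z|lebesgue. (\<phi> (pull t z))\<^sup>2 * (damp t z)\<^sup>2 - (\<phi> (pull t z))\<^sup>2 * jac t z)"
    by (rule Bochner_Integration.integral_diff[symmetric]) (intro i smooth_intros)+
  also have "\<bar>\<dots>\<bar> \<le> (LINT z|lebesgue. \<bar>(\<phi> (pull t z))\<^sup>2 * (damp t z)\<^sup>2 - (\<phi> (pull t z))\<^sup>2 * jac t z\<bar>)"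
    by (rule integral_abs_bound)
  also have "\<dots> \<le> (LINT z|lebesgue. (\<phi> (pull t z))\<^sup>2 * (2 * (real DIM('x))\<^sup>2 * t\<^sup>2))"
  proof (rule integral_mono)
    show "integrable lebesgue (\<lambda>z. \<bar>(\<phi> (pull t z))\<^sup>2 * (damp t z)\<^sup>2 - (\<phi> (pull t z))\<^sup>2 * jac t z\<bar>)"
      by (intro integrable_abs Bochner_Integration.integrable_diff i smooth_intros)
    show "integrable lebesgue (\<lambda>z. (\<phi> (pull t z))\<^sup>2 * (2 * (real DIM('x))\<^sup>2 * t\<^sup>2))"
      by (intro i smooth_intros)
    show "\<bar>(\<phi> (pull t z))\<^sup>2 * (damp t z)\<^sup>2 - (\<phi> (pull t z))\<^sup>2 * jac t z\<bar> \<le> (\<phi> (pull t z))\<^sup>2 * (2 * (real DIM('x))\<^sup>2 * t\<^sup>2)" for z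
      unfolding right_diff_distrib[symmetric] abs_mult using damp_sq_jac[of z] by (intro mult_mono) auto
  qed
  also have "\<dots> = (2 * (real DIM('x))\<^sup>2 * t\<^sup>2) * (LINT z|lebesgue. (\<phi> (pull t z))\<^sup>2)" by simp
  also have "\<dots> \<le> (2 * (real DIM('x))\<^sup>2 * t\<^sup>2) * (2 * (LINT z|lebesgue. (\<phi> z)\<^sup>2))"
    by (intro mult_left_mono integral_pull_le[OF s2]) auto
  finally show ?thesis by simp
qed

end

text \<open>The radial coefficient with grad \<open>lapl\<close> = - \<open>lgrad\<close> x. The
  divergence of the field \<open>lgrad\<close> x is therefore minus the bilaplacian of <x>.\<close>

definition lgrad :: "'x::euclidean_space \<times> 'y::euclidean_space \<Rightarrow> real" where
  "lgrad z = real (DIM('x) - 1) * jap z ^ 3 + 3 * jap z ^ 5"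

lemma smooth_lgrad [smooth_intros]: "smooth lgrad" unfolding lgrad_def[abs_def] by (intro smooth_intros)

lemma damp_partial: 
  fixes z :: "'x::euclidean_space \<times> 'y::euclidean_space"
  shows "partial h (damp t) z = t / 2 * lgrad z * (fst z \<bullet> fst h)"
proof -
  have "((\<lambda>z. 1 - t / 2 * lapl z) has_derivative (\<lambda>h. 0 - t / 2 * partial h lapl z)) (at z)"
    by (intro has_derivative_diff has_derivative_const has_derivative_mult_right smooth_has_derivative smooth_lapl)
  then have "(damp t has_derivative (\<lambda>h. 0 - t / 2 * partial h lapl z)) (at z)"
    by (simp add: damp_def[abs_def])
  from partial_eqI[OF this, of h] show ?thesis by (simp add: lapl_partial lgrad_def)
qed

lemma jap_power_cubed: "(fst z \<bullet> fst z) * jap z ^ 3 = jap z - jap z ^ 3"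
proof -
  have "(fst z \<bullet> fst z) * jap z ^ 3 = ((fst z \<bullet> fst z) * (jap z)\<^sup>2) * jap z" by (simp add: power3_eq_cube power2_eq_square)
  then show ?thesis unfolding jap_sq by (simp add: power3_eq_cube power2_eq_square algebra_simps)
qed

text \<open>This is \<open>- \<Delta>\<close> of \<open>lapl\<close>, i.e. minus the bilaplacian of \<open>(1 + \<bar>x\<bar>\<^sup>2) powr (1 / 2)\<close>; its
  positivity is where dimension at least three enters.\<close>

lemma lgrad_divergence:
  fixes z :: "'x::euclidean_space \<times> 'y::euclidean_space"
  assumes n: "DIM('x) \<ge> 3"
  shows "15 * jap z ^ 7 \<le> real DIM('x) * lgrad z + partial (fst z, 0) lgrad z"
proof -
  let ?a = "jap z" and ?N = "real DIM('x)"
  have N: "real (DIM('x) - 1) = ?N - 1" using n by simp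
  have "(lgrad has_derivative (\<lambda>h. real (DIM('x) - 1) * (real 3 * - ((fst z \<bullet> fst h) * jap z ^ 3) * jap z ^ (3 - 1))
      + 3 * (real 5 * - ((fst z \<bullet> fst h) * jap z ^ 3) * jap z ^ (5 - 1)))) (at z)"
    unfolding lgrad_def[abs_def]
    by (intro has_derivative_add has_derivative_mult_right has_derivative_power jap_has_derivative)
  from partial_eqI[OF this, of "(fst z, 0)"]
  have "partial (fst z, 0) lgrad z = (?N - 1) * (3 * (?a ^ 3 - ?a) * ?a\<^sup>2) + 15 * (?a ^ 3 - ?a) * ?a ^ 4"
    by (simp add: jap_power_cubed N)
  \<comment> \<open>With n the dimension of x, the coefficients are (n - 1)(n - 3), 6 (n - 3) and
    15. For n = 3 only the last survives, which is the origin of the weight \<open>jap z ^ 7\<close>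
    and of all later multiples of 15.\<close>
  then have "?N * lgrad z + partial (fst z, 0) lgrad z = (?N - 1) * (?N - 3) * ?a ^ 3 + 6 * (?N - 3) * ?a ^ 5 + 15 * ?a ^ 7"
    unfolding lgrad_def N by (simp add: algebra_simps eval_nat_numeral)
  moreover have "0 \<le> (?N - 1) * (?N - 3) * ?a ^ 3" "0 \<le> 6 * (?N - 3) * ?a ^ 5"
    using n jap_pos[of z] by auto
  ultimately show ?thesis by linarith
qed

lemma lgrad_nonneg: "0 \<le> lgrad z" unfolding lgrad_def using jap_pos[of z] by simp

lemma norm_lgrad: 
  fixes z :: "'x::euclidean_space \<times> 'y::euclidean_space"
  shows "lgrad z * norm (fst z) \<le> real DIM('x) + 2"
proof -
  let ?a = "jap z"
  have a: "0 \<le> ?a" "?a \<le> 1" using jap_pos[of z] jap_le_1[of z] by auto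
  have "lgrad z * norm (fst z) = (real (DIM('x) - 1) * ?a ^ 2 + 3 * ?a ^ 4) * (norm (fst z) * ?a)"
    unfolding lgrad_def by (simp add: algebra_simps eval_nat_numeral)
  also have "\<dots> \<le> (real (DIM('x) - 1) * 1 + 3 * 1) * 1"
    using a norm_jap_le_1[of z] by (intro mult_mono add_mono power_le_one) auto
  also have "\<dots> = real DIM('x) + 2" using DIM_positive[where 'a='x] by simp
  finally show ?thesis .
qed

text \<open>The derivative of \<open>pull t\<close> at \<open>z\<close>, applied to
  \<open>h\<close>. It is a symmetric matrix, so the gradient of a composition with
  \<open>pull t\<close> arises by applying it to the gradient, without a transpose.\<close>

definition pullT :: "real \<Rightarrow> 'x::euclidean_space \<times> 'y::euclidean_space \<Rightarrow> 'x \<times> 'y \<Rightarrow> 'x \<times> 'y" where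
  "pullT t z h = ((1 - t * jap z) *\<^sub>R fst h + (t * (fst z \<bullet> fst h) * jap z ^ 3) *\<^sub>R fst z, snd h)"

lemma pullT_symmetric: "g \<bullet> pullT t z h = pullT t z g \<bullet> h"
  by (simp add: pullT_def inner_prod_def inner_add_left inner_add_right inner_commute)

text \<open>In the x block the matrix is the identity minus t times the Hessian of <x>, with
  eigenvalues \<open>1 - t * jap z\<close> and \<open>1 - t * jap z ^ 3\<close> in the unit
  interval. By convexity of <x> the Hessian term has a favourable sign, and it is discarded
  here.\<close>

lemma norm_pullT:
  fixes z v :: "'x::euclidean_space \<times> 'y::euclidean_space"
  assumes "0 \<le> t" "t \<le> 1" shows "norm (pullT t z v) \<le> norm v"
proof -
  let ?a = "jap z"
  note b = jap_bounds[OF assms, of z]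
  have "norm (fst (pullT t z v)) \<le> norm ((1 - t * ?a) *\<^sub>R fst v) + norm ((t * (fst z \<bullet> fst v) * ?a ^ 3) *\<^sub>R fst z)"
    unfolding pullT_def fst_conv by (rule norm_triangle_ineq)
  also have "norm ((t * (fst z \<bullet> fst v) * ?a ^ 3) *\<^sub>R fst z) \<le> t * (norm (fst z) * norm (fst v)) * ?a ^ 3 * norm (fst z)"
    using assms jap_pos[of z] Cauchy_Schwarz_ineq2[of "fst z" "fst v"]
    by (auto simp: abs_mult intro!: mult_right_mono mult_left_mono)
  also have "\<dots> = t * ((fst z \<bullet> fst z) * ?a ^ 3) * norm (fst v)"
    by (simp add: power2_norm_eq_inner[symmetric] power2_eq_square)
  also have "norm ((1 - t * ?a) *\<^sub>R fst v) = (1 - t * ?a) * norm (fst v)" using b by simp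
  also have "(1 - t * ?a) * norm (fst v) + t * ((fst z \<bullet> fst z) * ?a ^ 3) * norm (fst v) = (1 - t * ?a ^ 3) * norm (fst v)"
    unfolding jap_power_cubed by (simp add: algebra_simps)
  also have "\<dots> \<le> 1 * norm (fst v)" using b by (intro mult_right_mono) auto
  finally have "(norm (fst (pullT t z v)))\<^sup>2 \<le> (norm (fst v))\<^sup>2" by (intro power_mono) auto
  then show ?thesis
    by (cases v) (simp add: norm_prod_def pullT_def)
qed

lemma comp_pull_partial:
  assumes "smooth \<phi>"
  shows "partial h (\<lambda>z. \<phi> (pull t z)) z = grad \<phi> (pull t z) \<bullet> pullT t z h"
proof -
  have "((\<lambda>z. \<phi> (pull t z)) has_derivative (\<lambda>h. partial (pullT t z h) \<phi> (pull t z))) (at z)"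
    unfolding pullT_def by (rule has_derivative_compose[OF pull_has_derivative smooth_has_derivative[OF assms]])
  from partial_eqI[OF this, of h] show ?thesis by (simp only: partial_grad[OF assms])
qed

lemma smooth_deform: "smooth \<phi> \<Longrightarrow> smooth (deform t \<phi>)"
  unfolding deform_def[abs_def] by (intro smooth_intros)

text \<open>After integration by parts the weight sits at \<open>z\<close>, whereas the change of
  variables needs it at \<open>pull t z\<close>; the replacement costs a factor 2 per power of
  \<open>jap\<close>.\<close>

lemma jap_pull_le:
  assumes "0 \<le> t" "t \<le> 1/2" shows "jap (pull t z) \<le> 2 * jap z"
proof -
  have "t * jap z \<le> 1/2 * 1" using assms jap_pos[of z] jap_le_1[of z] by (intro mult_mono) auto
  then have "(1/2)\<^sup>2 * (fst z \<bullet> fst z) \<le> (1 - t * jap z)\<^sup>2 * (fst z \<bullet> fst z)"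
    by (intro mult_right_mono power_mono) auto
  then have "(1 + fst z \<bullet> fst z) / 4 \<le> 1 + fst (pull t z) \<bullet> fst (pull t z)"
    by (simp add: pull_def power2_eq_square)
  then have "sqrt ((1 + fst z \<bullet> fst z) / 4) \<le> sqrt (1 + fst (pull t z) \<bullet> fst (pull t z))" by (rule real_sqrt_le_mono)
  then have "sqrt (1 + fst z \<bullet> fst z) / 2 \<le> sqrt (1 + fst (pull t z) \<bullet> fst (pull t z))" by (simp add: real_sqrt_divide)
  moreover have "0 < sqrt (1 + fst z \<bullet> fst z)" "0 < sqrt (1 + fst (pull t z) \<bullet> fst (pull t z))"
    by (simp_all add: add_pos_nonneg)
  ultimately show ?thesis unfolding jap_def by (simp add: field_simps)
qed

text \<open>The gradient is p M + \<open>damp\<close> G, where M comes from differentiating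
  \<open>damp\<close>. The square of the first term is O(t^2), that of the second is controlled by
  the contraction \<open>pullT\<close> and by \<open>damp_sq_le_jac\<close>. The cross term is
  written as a derivative of the squared composition, so that it can be integrated by parts.\<close>

lemma deform_energy_pointwise:
  fixes \<phi> :: "'x::euclidean_space \<times> 'y::euclidean_space \<Rightarrow> real"
  assumes t: "0 \<le> t" "t \<le> 1 / (2 * real DIM('x))" and \<phi>: "smooth \<phi>"
  shows "gsq (deform t \<phi>) z \<le> (real DIM('x) + 2)\<^sup>2 / 4 * t\<^sup>2 * (\<phi> (pull t z))\<^sup>2
    + t / 2 * (damp t z * lgrad z * partial (fst z, 0) (\<lambda>z. (\<phi> (pull t z))\<^sup>2) z)
    + (1 + 4 * (real DIM('x))\<^sup>2 * t\<^sup>2) * (gsq \<phi> (pull t z) * jac t z)"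
proof -
  have t1: "t \<le> 1" using t_half(1)[OF t] by simp
  define M where "M = (t / 2 * lgrad z) *\<^sub>R (fst z, 0::'y)"
  define g where "g = grad \<phi> (pull t z)"
  define p where "p = \<phi> (pull t z)"
  define G where "G = pullT t z g"
  have sp: "smooth (\<lambda>z. \<phi> (pull t z))" by (rule smooth_comp_pull[OF \<phi>])
  have pd: "partial h (deform t \<phi>) z = (p *\<^sub>R M + damp t z *\<^sub>R G) \<bullet> h" for h
  proof -
    have "partial h (deform t \<phi>) z = damp t z * partial h (\<lambda>z. \<phi> (pull t z)) z + partial h (damp t) z * \<phi> (pull t z)"
      unfolding deform_def[abs_def] by (rule partial_mult[OF smooth_damp sp])
    then show ?thesis
      unfolding comp_pull_partial[OF \<phi>] damp_partial pullT_symmetric G_def M_def g_def p_def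
      by (cases h) (simp add: inner_add_left mult.commute mult.left_commute)
  qed
  have "grad (deform t \<phi>) z = p *\<^sub>R M + damp t z *\<^sub>R G"
    by (rule grad_eqI[OF smooth_deform[OF \<phi>] pd])
  then have "gsq (deform t \<phi>) z = p\<^sup>2 * (M \<bullet> M) + 2 * p * damp t z * (M \<bullet> G) + (damp t z)\<^sup>2 * (G \<bullet> G)"
    unfolding gsq_grad power2_norm_eq_inner
    by (simp add: inner_add_left inner_add_right inner_commute power2_eq_square algebra_simps)
  moreover have "p\<^sup>2 * (M \<bullet> M) \<le> (real DIM('x) + 2)\<^sup>2 / 4 * t\<^sup>2 * p\<^sup>2"
  proof -
    have "M \<bullet> M = t\<^sup>2 / 4 * (lgrad z * norm (fst z))\<^sup>2"
      unfolding M_def by (simp add: power2_norm_eq_inner power_mult_distrib) (simp add: power2_eq_square)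
    also have "\<dots> \<le> t\<^sup>2 / 4 * (real DIM('x) + 2)\<^sup>2"
      using norm_lgrad[of z] lgrad_nonneg[of z] by (intro mult_left_mono power_mono) auto
    finally have "p\<^sup>2 * (M \<bullet> M) \<le> p\<^sup>2 * (t\<^sup>2 / 4 * (real DIM('x) + 2)\<^sup>2)" by (rule mult_left_mono) simp
    then show ?thesis by (simp add: mult.commute mult.left_commute)
  qed
  moreover have "2 * p * damp t z * (M \<bullet> G) = t / 2 * (damp t z * lgrad z * partial (fst z, 0) (\<lambda>z. (\<phi> (pull t z))\<^sup>2) z)"
  proof -
    have "partial (fst z, 0) (\<lambda>z. (\<phi> (pull t z))\<^sup>2) z = 2 * p * ((fst z, 0) \<bullet> G)"
      unfolding power2_eq_square partial_mult[OF sp sp] comp_pull_partial[OF \<phi>] pullT_symmetric[of "grad \<phi> (pull t z)"] G_def g_def p_def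
      by (simp add: inner_commute)
    then show ?thesis by (simp add: M_def del: scaleR_Pair)
  qed
  moreover have "(damp t z)\<^sup>2 * (G \<bullet> G) \<le> (1 + 4 * (real DIM('x))\<^sup>2 * t\<^sup>2) * (gsq \<phi> (pull t z) * jac t z)"
  proof -
    have "G \<bullet> G \<le> gsq \<phi> (pull t z)"
      unfolding G_def gsq_grad g_def power2_norm_eq_inner[symmetric]
      by (intro power_mono norm_pullT[OF t(1) t1]) auto
    then have "(damp t z)\<^sup>2 * (G \<bullet> G) \<le> (1 + 4 * (real DIM('x))\<^sup>2 * t\<^sup>2) * jac t z * gsq \<phi> (pull t z)"
      using damp_sq_le_jac[OF t, of z] jac_bounds[OF t(1) t1, of z] by (intro mult_mono) auto
    then show ?thesis by (simp add: mult.commute mult.left_commute)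
  qed
  ultimately show ?thesis unfolding p_def by linarith
qed

text \<open>Integrated by parts, the cross term carries the x-divergence of
  \<open>damp * lgrad\<close> times x with a minus sign. This divergence is positive in dimension at
  least three, and it is the only first-order contribution that is kept.\<close>

lemma deform_energy:
  fixes \<phi> :: "'x::euclidean_space \<times> 'y::euclidean_space \<Rightarrow> real"
  assumes n: "DIM('x) \<ge> 3" and t: "0 \<le> t" "t \<le> 1 / (2 * real DIM('x))" and \<phi>: "test_function UNIV \<phi>"
  shows "(LINT z|lebesgue. gsq (deform t \<phi>) z) \<le> (1 + 4 * (real DIM('x))\<^sup>2 * t\<^sup>2) * (LINT z|lebesgue. gsq \<phi> z)
    + (real DIM('x) + 2)\<^sup>2 * t\<^sup>2 * (LINT z|lebesgue. (\<phi> z)\<^sup>2) 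
    - 15 / 512 * t * (LINT z|lebesgue. jap z ^ 7 * (\<phi> z)\<^sup>2)"
proof -
  have t1: "t \<le> 1/2" by (rule t_half[OF t])
  note tt = t(1) t1
  have sm: "smooth \<phi>" by (rule test_function_smooth[OF \<phi>])
  let ?Z = "\<lambda>z. (\<phi> (pull t z))\<^sup>2"
  have s2: "test_function UNIV (\<lambda>z. (\<phi> z)\<^sup>2)"
    unfolding power2_eq_square by (rule test_function_mult[OF \<phi> sm])
  have Z: "test_function UNIV ?Z" by (rule test_function_comp_pull[OF s2 xstar_UNIV tt])
  have sZ: "smooth ?Z" by (rule test_function_smooth[OF Z])
  let ?f = "\<lambda>z::'x \<times> 'y. damp t z * lgrad z"
  have sf: "smooth ?f" by (intro smooth_intros)
  let ?P = "\<lambda>z. partial (fst z, 0) ?Z z"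
  have fZ: "test_function UNIV (\<lambda>z. ?f z * ?Z z)" by (rule test_function_mult(1)[OF Z sf])
  have i1: "integrable lebesgue (\<lambda>z. f z * ?Z z)" if "smooth f" for f
    by (rule test_function_integrable[OF test_function_mult(1)[OF Z that]])
  have xd: "xdiv (\<lambda>z. ?f z * ?Z z) z = (real DIM('x) * ?f z + partial (fst z, 0) ?f z) * ?Z z + ?f z * ?P z" for z
    unfolding xdiv_eq[OF test_function_smooth[OF fZ]] partial_mult[OF sf sZ] by (simp add: algebra_simps)
  have P: "?P z = (\<Sum>b\<in>Basis. (fst z \<bullet> b) * partial (b, 0) ?Z z)" for z
    using linear_sum_fst_Basis[OF linear_frechet_derivative[OF smooth_differentiable[OF sZ]], where x="fst z"] by simp
  have "test_function UNIV (\<lambda>z. \<Sum>b\<in>Basis. (fst z \<bullet> b) * partial (b, 0) ?Z z)"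
    by (intro test_function_sum test_function_mult(1) test_function_partial Z smooth_intros)
  then have tP: "test_function UNIV ?P" unfolding P .
  have ifP: "integrable lebesgue (\<lambda>z. ?f z * ?P z)"
    by (rule test_function_integrable[OF test_function_mult(1)[OF tP sf]])
  have sx: "smooth (\<lambda>z. partial (fst z, 0) ?f z)"
  proof -
    have "partial (fst z, 0) ?f z = (\<Sum>b\<in>Basis. (fst z \<bullet> b) * partial (b, 0) ?f z)" for z
      using linear_sum_fst_Basis[OF linear_frechet_derivative[OF smooth_differentiable[OF sf]], where x="fst z"] by simp
    moreover have "smooth (\<lambda>z. \<Sum>b\<in>Basis. (fst z \<bullet> b) * partial (b, 0) ?f z)" by (intro smooth_intros sf)
    ultimately show ?thesis by simp
  qed
  have iq: "integrable lebesgue (\<lambda>z. (real DIM('x) * ?f z + partial (fst z, 0) ?f z) * ?Z z)"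
    by (rule i1) (intro smooth_intros sx sf)
  have "0 = (LINT z|lebesgue. xdiv (\<lambda>z. ?f z * ?Z z) z)" using integral_xdiv_zero[OF fZ] by simp
  also have "\<dots> = (LINT z|lebesgue. (real DIM('x) * ?f z + partial (fst z, 0) ?f z) * ?Z z) + (LINT z|lebesgue. ?f z * ?P z)"
    unfolding xd by (rule Bochner_Integration.integral_add[OF iq ifP])
  finally have byparts: "(LINT z|lebesgue. ?f z * ?P z) = - (LINT z|lebesgue. (real DIM('x) * ?f z + partial (fst z, 0) ?f z) * ?Z z)" by simp
  \<comment> \<open>15/256 is 15, times 1/2 from the lower bound of \<open>damp\<close>, times 2^-7
    from moving the weight to \<open>pull t z\<close>. Differentiating \<open>damp\<close> adds a
    nonnegative term, and inserting \<open>jac \<le> 1\<close> prepares the change of variables. The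
    factor t / 2 of the cross term later gives 15/512.\<close>
  have low: "15 / 256 * ((jap (pull t z) ^ 7 * ?Z z) * jac t z) \<le> (real DIM('x) * ?f z + partial (fst z, 0) ?f z) * ?Z z" for z
  proof -
    have d: "1/2 \<le> damp t z" by (rule damp_bounds[OF t])
    have "partial (fst z, 0) ?f z = damp t z * partial (fst z, 0) lgrad z + partial (fst z, 0) (damp t) z * lgrad z"
      by (rule partial_mult[OF smooth_damp smooth_lgrad])
    then have "real DIM('x) * ?f z + partial (fst z, 0) ?f z = damp t z * (real DIM('x) * lgrad z + partial (fst z, 0) lgrad z)
        + t / 2 * (lgrad z)\<^sup>2 * (fst z \<bullet> fst z)"
      by (simp add: damp_partial algebra_simps power2_eq_square)
    moreover have "0 \<le> t / 2 * (lgrad z)\<^sup>2 * (fst z \<bullet> fst z)" using t by simp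
    moreover have "1/2 * (15 * jap z ^ 7) \<le> damp t z * (real DIM('x) * lgrad z + partial (fst z, 0) lgrad z)"
      using d lgrad_divergence[OF n, of z] jap_pos[of z] by (intro mult_mono) auto
    moreover have "jap (pull t z) ^ 7 \<le> (2 * jap z) ^ 7"
      using jap_pull_le[OF tt, of z] jap_pos[of "pull t z"] by (intro power_mono) auto
    moreover have "(2 * jap z) ^ 7 = 128 * jap z ^ 7" by (simp add: power_mult_distrib)
    ultimately have "15 / 256 * jap (pull t z) ^ 7 \<le> real DIM('x) * ?f z + partial (fst z, 0) ?f z"
      by linarith
    then have "15 / 256 * jap (pull t z) ^ 7 * ?Z z \<le> (real DIM('x) * ?f z + partial (fst z, 0) ?f z) * ?Z z"
      by (rule mult_right_mono) simp
    moreover have "(15 / 256 * jap (pull t z) ^ 7 * ?Z z) * jac t z \<le> 15 / 256 * jap (pull t z) ^ 7 * ?Z z * 1"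
      using jac_bounds[of t z] t t1 jap_pos[of "pull t z"] by (intro mult_left_mono) auto
    moreover have "15 / 256 * ((jap (pull t z) ^ 7 * ?Z z) * jac t z) = (15 / 256 * jap (pull t z) ^ 7 * ?Z z) * jac t z" by simp
    ultimately show ?thesis by linarith
  qed
  have tJ: "test_function UNIV (\<lambda>z. jap z ^ 7 * (\<phi> z)\<^sup>2)" by (rule test_function_mult(1)[OF s2]) (intro smooth_intros)
  have iJ: "integrable lebesgue (\<lambda>z. (jap (pull t z) ^ 7 * ?Z z) * jac t z)"
    by (rule test_function_integrable[OF test_function_mult(2)[OF test_function_comp_pull[OF tJ xstar_UNIV tt] smooth_jac]])
  have "15 / 256 * (LINT z|lebesgue. jap z ^ 7 * (\<phi> z)\<^sup>2) = (LINT z|lebesgue. 15 / 256 * ((jap (pull t z) ^ 7 * ?Z z) * jac t z))"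
    using flow_invariant[OF tJ tt] by simp
  also have "\<dots> \<le> (LINT z|lebesgue. (real DIM('x) * ?f z + partial (fst z, 0) ?f z) * ?Z z)"
    by (rule integral_mono[OF integrable_mult_right[OF iJ] iq low])
  finally have cross: "(LINT z|lebesgue. ?f z * ?P z) \<le> - (15 / 256 * (LINT z|lebesgue. jap z ^ 7 * (\<phi> z)\<^sup>2))"
    using byparts by linarith
  have tg: "test_function UNIV (gsq \<phi>)" by (rule test_function_gsq[OF \<phi>])
  have ig: "integrable lebesgue (\<lambda>z. gsq \<phi> (pull t z) * jac t z)"
    by (rule test_function_integrable[OF test_function_mult(2)[OF test_function_comp_pull[OF tg xstar_UNIV tt] smooth_jac]])
  have iZ: "integrable lebesgue ?Z" by (rule test_function_integrable[OF Z])
  have iD: "integrable lebesgue (gsq (deform t \<phi>))"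
    by (rule test_function_integrable[OF test_function_gsq[OF test_function_deform[OF \<phi> xstar_UNIV tt]]])
  have "(LINT z|lebesgue. gsq (deform t \<phi>) z) \<le> (LINT z|lebesgue. (real DIM('x) + 2)\<^sup>2 / 4 * t\<^sup>2 * ?Z z
    + t / 2 * (?f z * ?P z) + (1 + 4 * (real DIM('x))\<^sup>2 * t\<^sup>2) * (gsq \<phi> (pull t z) * jac t z))"
    by (rule integral_mono[OF iD])
       (intro Bochner_Integration.integrable_add integrable_mult_right iZ ifP ig, use deform_energy_pointwise[OF t sm] in simp)
  also have "\<dots> = (real DIM('x) + 2)\<^sup>2 / 4 * t\<^sup>2 * (LINT z|lebesgue. ?Z z) + t / 2 * (LINT z|lebesgue. ?f z * ?P z)
     + (1 + 4 * (real DIM('x))\<^sup>2 * t\<^sup>2) * (LINT z|lebesgue. gsq \<phi> (pull t z) * jac t z)"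
    using iZ ifP ig by simp
  also have "\<dots> \<le> (real DIM('x) + 2)\<^sup>2 / 4 * t\<^sup>2 * (2 * (LINT z|lebesgue. (\<phi> z)\<^sup>2))
     + t / 2 * (- (15 / 256 * (LINT z|lebesgue. jap z ^ 7 * (\<phi> z)\<^sup>2)))
     + (1 + 4 * (real DIM('x))\<^sup>2 * t\<^sup>2) * (LINT z|lebesgue. gsq \<phi> z)"
    unfolding flow_invariant[OF tg tt]
    using integral_pull_le[OF t s2] cross t by (intro add_mono mult_left_mono) auto
  also have "\<dots> \<le> (1 + 4 * (real DIM('x))\<^sup>2 * t\<^sup>2) * (LINT z|lebesgue. gsq \<phi> z)
    + (real DIM('x) + 2)\<^sup>2 * t\<^sup>2 * (LINT z|lebesgue. (\<phi> z)\<^sup>2) 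
    - 15 / 512 * t * (LINT z|lebesgue. jap z ^ 7 * (\<phi> z)\<^sup>2)"
  proof -
    have "0 \<le> (real DIM('x) + 2)\<^sup>2 * t\<^sup>2 * (LINT z|lebesgue. (\<phi> z)\<^sup>2)" by (intro mult_nonneg_nonneg integral_nonneg_AE) auto
    moreover have "(real DIM('x) + 2)\<^sup>2 / 4 * t\<^sup>2 * (2 * (LINT z|lebesgue. (\<phi> z)\<^sup>2)) = (real DIM('x) + 2)\<^sup>2 * t\<^sup>2 * (LINT z|lebesgue. (\<phi> z)\<^sup>2) / 2"
      "t / 2 * (- (15 / 256 * (LINT z|lebesgue. jap z ^ 7 * (\<phi> z)\<^sup>2))) = - (15 / 512 * t * (LINT z|lebesgue. jap z ^ 7 * (\<phi> z)\<^sup>2))" by simp_all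
    ultimately show ?thesis by linarith
  qed
  finally show ?thesis .
qed

text \<open>Gronwall's argument for the squared L2 distance g at time s. Young's inequality with
  weight t gives g' \<le> g / t + 2 t E, and over a time interval of length t the exponential factor
  is only e. Since g starts at 0 and e \<le> 3, the constant is 6.\<close>

lemma comp_pull_difference:
  fixes \<phi> :: "'x::euclidean_space \<times> 'y::euclidean_space \<Rightarrow> real"
  assumes t: "0 < t" "t \<le> 1 / (2 * real DIM('x))" and \<phi>: "test_function UNIV \<phi>"
  shows "(LINT z|lebesgue. (\<phi> (pull t z) - \<phi> z)\<^sup>2) \<le> 6 * t\<^sup>2 * (LINT z|lebesgue. gsq \<phi> z)"
proof -
  have t0: "0 \<le> t" using t by simp
  have t1: "t \<le> 1/2" by (rule t_half[OF t0 t(2)])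
  obtain K where K: "smooth \<phi>" "compact K" "\<And>z. z \<notin> K \<Longrightarrow> \<phi> z = 0"
    using test_functionE[OF \<phi>] by metis
  obtain B1 where B1: "B1 > 0" "\<And>h z. \<bar>partial h \<phi> z\<bar> \<le> B1 * norm h"
    by (rule test_function_partial_bound[OF \<phi>]) blast
  obtain B2 where B2: "B2 > 0" "\<And>z. \<bar>\<phi> z\<bar> \<le> B2" using test_function_bounded[OF \<phi>] by auto
  define E where "E = (LINT z|lebesgue. gsq \<phi> z)"
  have E: "0 \<le> E" unfolding E_def by (rule integral_nonneg_AE) simp
  let ?C = "xhull K \<union> K"
  have C: "compact ?C" by (intro compact_Un compact_xhull K)
  have out: "\<phi> (pull s z) = 0" "\<phi> z = 0" if "s \<in> {0..t}" "z \<notin> ?C" for s z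
    using pull_in_xhull[of s z K] that t1 K(3)[of "pull s z"] K(3)[of z] by auto
  let ?D = "\<lambda>s z. jap z * partial (fst z, 0) \<phi> (pull s z)"
  define g where "g = (\<lambda>s. LINT z|lebesgue. (\<phi> (pull s z) - \<phi> z)\<^sup>2)"
  define g' where "g' = (\<lambda>s. LINT z|lebesgue. 2 * (\<phi> (pull s z) - \<phi> z) * - ?D s z)"
  have sD: "continuous_on UNIV (?D s)" for s
  proof -
    have "?D s z = jap z * (grad \<phi> (pull s z) \<bullet> (fst z, 0))" for z
      by (simp only: partial_grad[OF K(1)])
    moreover have "smooth (\<lambda>z. jap z * (grad \<phi> (pull s z) \<bullet> (fst z, 0)))"
      unfolding grad_def by (intro smooth_intros smooth_compose[OF _ smooth_pull, of "\<lambda>z. \<Sum>b\<in>Basis. partial b \<phi> z *\<^sub>R b"] K(1))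
    ultimately show ?thesis using smooth_continuous by (simp only:)
  qed
  have Dbound: "\<bar>?D s z\<bar> \<le> B1" for s z
  proof -
    have "\<bar>?D s z\<bar> \<le> jap z * (B1 * norm (fst z))"
      using B1(2)[of "(fst z, 0)" "pull s z"] B1(2)[of "pull s z" "(fst z, 0)"] jap_pos[of z] by (simp add: abs_mult norm_Pair)
    also have "\<dots> \<le> B1" using norm_jap_le_1[of z] B1(1) by (simp add: mult.commute mult.left_commute)
    finally show ?thesis .
  qed
  have int_out: "integrable lebesgue f" if "continuous_on UNIV f" "\<And>z. z \<notin> ?C \<Longrightarrow> f z = 0" for f :: "'x \<times> 'y \<Rightarrow> real"
    using integrable_mult_test_function[OF _ C, of "\<lambda>z. 1" f] that by (simp add: image_constant_conv)
  have cont: "continuous_on UNIV (\<lambda>z. \<phi> (pull s z) - \<phi> z)" for s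
    by (intro smooth_continuous smooth_intros K(1))
  have d: "(g has_real_derivative g' s) (at s within {0..t})" if s: "s \<in> {0..t}" for s
    unfolding g_def g'_def
  proof (rule has_real_derivative_integral[where w="\<lambda>z. 4 * B2 * B1 * indicator ?C z", OF _ s])
    fix s and z :: "'x \<times> 'y" assume s: "s \<in> {0..t}"
    have "((\<lambda>t. pull t z) has_derivative (\<lambda>u. (u * - jap z) *\<^sub>R (fst z, 0))) (at s)"
      unfolding pull_def by (auto intro!: derivative_eq_intros simp: fun_eq_iff algebra_simps)
    from has_derivative_compose[OF this smooth_has_derivative[OF K(1)]]
    have "((\<lambda>t. \<phi> (pull t z)) has_real_derivative - ?D s z) (at s)"
      unfolding has_field_derivative_def
      by (rule has_derivative_eq_rhs) (simp only: partial_scaleR[OF K(1)], simp add: fun_eq_iff)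
    then have "((\<lambda>s. (\<phi> (pull s z) - \<phi> z)\<^sup>2) has_real_derivative 2 * (\<phi> (pull s z) - \<phi> z) * - ?D s z) (at s)"
      by (auto intro!: derivative_eq_intros)
    then show "((\<lambda>s. (\<phi> (pull s z) - \<phi> z)\<^sup>2) has_real_derivative 2 * (\<phi> (pull s z) - \<phi> z) * - ?D s z) (at s within {0..t})"
      by (rule has_field_derivative_at_within)
    show "\<bar>2 * (\<phi> (pull s z) - \<phi> z) * - ?D s z\<bar> \<le> 4 * B2 * B1 * indicator ?C z"
    proof (cases "z \<in> ?C")
      case True
      have "\<bar>2 * (\<phi> (pull s z) - \<phi> z)\<bar> \<le> 4 * B2" using B2(2)[of "pull s z"] B2(2)[of z] by auto
      then have "\<bar>2 * (\<phi> (pull s z) - \<phi> z)\<bar> * \<bar>- ?D s z\<bar> \<le> 4 * B2 * B1"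
        using Dbound[of z s] B2(1) by (intro mult_mono) auto
      then show ?thesis using True by (simp add: abs_mult)
    qed (use out s in simp)
  next
    fix s assume s: "s \<in> {0..t}"
    show "integrable lebesgue (\<lambda>z. (\<phi> (pull s z) - \<phi> z)\<^sup>2)"
      by (rule int_out) (use out s in \<open>auto intro!: continuous_intros cont\<close>)
  next
    show "(\<lambda>z. 2 * (\<phi> (pull s z) - \<phi> z) * - ?D s z) \<in> borel_measurable lebesgue"
      by (intro continuous_borel_measurable_lebesgue continuous_intros cont sD)
    show "integrable lebesgue (\<lambda>z. 4 * B2 * B1 * indicator ?C z)" by (rule integrable_indicator_compact[OF C])
  qed auto
  have g'_le: "g' s \<le> g s / t + 2 * t * E" if s: "s \<in> {0..t}" for s
  proof -
    have s1: "0 \<le> s" "s \<le> 1 / (2 * real DIM('x))" using s t by auto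
    have tg: "test_function UNIV (gsq \<phi>)" by (rule test_function_gsq[OF \<phi>])
    have tgp: "test_function UNIV (\<lambda>z. gsq \<phi> (pull s z))"
      by (rule test_function_comp_pull[OF tg xstar_UNIV s1(1)]) (use s t1 in auto)
    have i1: "integrable lebesgue (\<lambda>z. (\<phi> (pull s z) - \<phi> z)\<^sup>2 / t)"
      by (rule int_out) (use out s t(1) in \<open>auto intro!: continuous_intros cont\<close>)
    have i2: "integrable lebesgue (\<lambda>z. t * gsq \<phi> (pull s z))"
      by (intro integrable_mult_right test_function_integrable[OF tgp])
    have "g' s \<le> (LINT z|lebesgue. (\<phi> (pull s z) - \<phi> z)\<^sup>2 / t + t * gsq \<phi> (pull s z))"
      unfolding g'_def
    proof (rule integral_mono[OF _ Bochner_Integration.integrable_add[OF i1 i2]])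
      show "integrable lebesgue (\<lambda>z. 2 * (\<phi> (pull s z) - \<phi> z) * - ?D s z)"
        by (rule int_out[OF continuous_on_mult[OF continuous_on_mult[OF continuous_on_const cont] continuous_on_minus[OF sD]]])
           (use out s in simp)
      fix z
      let ?p = "\<phi> (pull s z) - \<phi> z"
      have "(?D s z)\<^sup>2 \<le> gsq \<phi> (pull s z)"
      proof -
        have "\<bar>?D s z\<bar> \<le> jap z * (norm (grad \<phi> (pull s z)) * norm (fst z, 0::'y))"
          unfolding partial_grad[OF K(1)] using Cauchy_Schwarz_ineq2[of "grad \<phi> (pull s z)" "(fst z, 0)"] jap_pos[of z]
          by (simp add: abs_mult)
        also have "\<dots> = (norm (fst z) * jap z) * norm (grad \<phi> (pull s z))" by (simp add: norm_Pair)
        also have "\<dots> \<le> 1 * norm (grad \<phi> (pull s z))" using norm_jap_le_1[of z] by (intro mult_right_mono) auto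
        finally have "\<bar>?D s z\<bar>\<^sup>2 \<le> (norm (grad \<phi> (pull s z)))\<^sup>2" by (intro power_mono) auto
        then show ?thesis by (simp only: gsq_grad power2_abs)
      qed
      then have "t * (?D s z)\<^sup>2 \<le> t * gsq \<phi> (pull s z)" using t0 by (rule mult_left_mono)
      \<comment> \<open>Young's inequality, in the form that a square divided by t is
        nonnegative.\<close>
      moreover have "0 \<le> (?p + t * ?D s z)\<^sup>2 / t" using t by simp
      moreover have "(?p + t * ?D s z)\<^sup>2 / t = ?p\<^sup>2 / t + 2 * ?p * ?D s z + t * (?D s z)\<^sup>2"
        using t by (simp add: field_simps power2_eq_square)
      ultimately show "2 * ?p * - ?D s z \<le> ?p\<^sup>2 / t + t * gsq \<phi> (pull s z)" by linarith
    qed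
    also have "\<dots> = g s / t + t * (LINT z|lebesgue. gsq \<phi> (pull s z))"
      unfolding g_def using i1 i2 by simp
    also have "\<dots> \<le> g s / t + t * (2 * E)"
      unfolding E_def using integral_pull_le[OF s1 tg gsq_nonneg] t0 by (intro add_left_mono mult_left_mono) auto
    finally show ?thesis by simp
  qed
  \<comment> \<open>Integrating factor: multiplying by exp (-s / t) removes the term g / t and
    leaves a source of at most 2 t E, which is subtracted so that \<open>h\<close>
    decreases.\<close>
  define h where "h = (\<lambda>s. exp (- s / t) * g s - 2 * t * E * s)"
  have dh: "(h has_real_derivative (exp (- s / t) * (g' s - g s / t) - 2 * t * E)) (at s within {0..t})" if s: "s \<in> {0..t}" for s
  proof -
    have "((\<lambda>s. exp (- s / t)) has_real_derivative exp (- s / t) * (- 1 / t)) (at s within {0..t})"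
      using t(1) by (auto intro!: derivative_eq_intros)
    from DERIV_diff[OF DERIV_mult[OF this d[OF s]] DERIV_cmult[OF DERIV_ident, of "2 * t * E"]]
    show ?thesis unfolding h_def by (rule DERIV_cong) (simp add: algebra_simps)
  qed
  have "h t \<le> h 0"
  proof (rule DERIV_nonpos_imp_decreasing_open[OF t0])
    fix s assume s: "0 < s" "s < t"
    then have "(h has_real_derivative (exp (- s / t) * (g' s - g s / t) - 2 * t * E)) (at s)"
      using dh[of s] at_within_interior[of s "{0..t}"] by simp
    moreover have "exp (- s / t) * (g' s - g s / t) \<le> exp (- s / t) * (2 * t * E)"
      using g'_le[of s] s by (intro mult_left_mono) auto
    moreover have "exp (- s / t) * (2 * t * E) \<le> 1 * (2 * t * E)"
      using s t E by (intro mult_right_mono) auto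
    ultimately show "\<exists>y. (h has_real_derivative y) (at s) \<and> y \<le> 0"
      by (intro exI[of _ "exp (- s / t) * (g' s - g s / t) - 2 * t * E"] conjI) linarith+
  next
    show "continuous_on {0..t} h"
      using dh DERIV_continuous continuous_on_eq_continuous_within by blast
  qed
  then have "exp (- 1) * g t \<le> 2 * t * E * t" using t by (simp add: h_def g_def)
  then have "exp 1 * (exp (- 1) * g t) \<le> exp 1 * (2 * t * E * t)" by (intro mult_left_mono) auto
  moreover have "exp 1 * (exp (- 1) * g t) = g t" by (simp add: exp_minus)
  ultimately have "g t \<le> exp 1 * (2 * t * E * t)" by linarith
  also have "\<dots> \<le> 3 * (2 * t * E * t)" using exp_le t E by (intro mult_right_mono) auto
  also have "\<dots> = 6 * t\<^sup>2 * E" by (simp add: power2_eq_square)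
  finally show ?thesis by (simp only: g_def E_def)
qed

text \<open>The difference splits into the effect of \<open>damp - 1\<close>, at most t n in size,
  and the displacement of the argument.\<close>

lemma deform_difference:
  fixes \<phi> :: "'x::euclidean_space \<times> 'y::euclidean_space \<Rightarrow> real"
  assumes t: "0 < t" "t \<le> 1 / (2 * real DIM('x))" and \<phi>: "test_function UNIV \<phi>"
  shows "(LINT z|lebesgue. (deform t \<phi> z - \<phi> z)\<^sup>2)
    \<le> t\<^sup>2 * (12 * (LINT z|lebesgue. gsq \<phi> z) + 4 * (real DIM('x))\<^sup>2 * (LINT z|lebesgue. (\<phi> z)\<^sup>2))"
proof -
  have t0: "0 \<le> t" using t by simp
  have t1: "t \<le> 1/2" by (rule t_half[OF t0 t(2)])
  have s2: "test_function UNIV (\<lambda>z. (\<phi> z)\<^sup>2)"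
    unfolding power2_eq_square by (rule test_function_mult[OF \<phi> test_function_smooth[OF \<phi>]])
  have i1: "integrable lebesgue (\<lambda>z. (\<phi> (pull t z))\<^sup>2)"
    by (rule test_function_integrable[OF test_function_comp_pull[OF s2 xstar_UNIV t0 t1]])
  have td: "test_function UNIV (\<lambda>z. \<phi> (pull t z) - \<phi> z)"
    by (intro test_function_diff \<phi> test_function_comp_pull[OF \<phi> xstar_UNIV t0 t1])
  have i2: "integrable lebesgue (\<lambda>z. (\<phi> (pull t z) - \<phi> z)\<^sup>2)"
    unfolding power2_eq_square by (rule test_function_integrable[OF test_function_mult(1)[OF td test_function_smooth[OF td]]])
  have td': "test_function UNIV (\<lambda>z. deform t \<phi> z - \<phi> z)"
    by (intro test_function_diff \<phi> test_function_deform[OF \<phi> xstar_UNIV t0 t1])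
  have "(LINT z|lebesgue. (deform t \<phi> z - \<phi> z)\<^sup>2)
     \<le> (LINT z|lebesgue. 2 * (t * real DIM('x))\<^sup>2 * (\<phi> (pull t z))\<^sup>2 + 2 * (\<phi> (pull t z) - \<phi> z)\<^sup>2)"
  proof (rule integral_mono)
    show "integrable lebesgue (\<lambda>z. (deform t \<phi> z - \<phi> z)\<^sup>2)"
      unfolding power2_eq_square by (rule test_function_integrable[OF test_function_mult(1)[OF td' test_function_smooth[OF td']]])
    show "integrable lebesgue (\<lambda>z. 2 * (t * real DIM('x))\<^sup>2 * (\<phi> (pull t z))\<^sup>2 + 2 * (\<phi> (pull t z) - \<phi> z)\<^sup>2)"
      by (intro Bochner_Integration.integrable_add integrable_mult_right i1 i2)
    fix z
    let ?p = "(damp t z - 1) * \<phi> (pull t z)" and ?q = "\<phi> (pull t z) - \<phi> z"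
    have "\<bar>damp t z - 1\<bar>\<^sup>2 \<le> (t * real DIM('x))\<^sup>2" by (intro power_mono damp_bounds[OF t0 t(2)]) simp
    then have "?p\<^sup>2 \<le> (t * real DIM('x))\<^sup>2 * (\<phi> (pull t z))\<^sup>2"
      unfolding power_mult_distrib[of "damp t z - 1"] by (intro mult_right_mono) auto
    moreover have eq: "deform t \<phi> z - \<phi> z = ?p + ?q" by (simp add: deform_def algebra_simps)
    moreover have "(?p + ?q)\<^sup>2 \<le> 2 * ?p\<^sup>2 + 2 * ?q\<^sup>2"
      using sum_squares_bound[of ?p ?q] by (simp add: power2_sum)
    ultimately show "(deform t \<phi> z - \<phi> z)\<^sup>2 \<le> 2 * (t * real DIM('x))\<^sup>2 * (\<phi> (pull t z))\<^sup>2 + 2 * ?q\<^sup>2"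
      unfolding eq by linarith
  qed
  also have "\<dots> = 2 * (t * real DIM('x))\<^sup>2 * (LINT z|lebesgue. (\<phi> (pull t z))\<^sup>2) + 2 * (LINT z|lebesgue. (\<phi> (pull t z) - \<phi> z)\<^sup>2)"
    using i1 i2 by simp
  also have "\<dots> \<le> 2 * (t * real DIM('x))\<^sup>2 * (2 * (LINT z|lebesgue. (\<phi> z)\<^sup>2)) + 2 * (6 * t\<^sup>2 * (LINT z|lebesgue. gsq \<phi> z))"
    by (intro add_mono mult_left_mono integral_pull_le[OF t0 t(2) s2] comp_pull_difference[OF t \<phi>]) auto
  finally show ?thesis by (simp add: algebra_simps power_mult_distrib)
qed

section \<open>L2 calculus for real functions on the whole space\<close>

section \<open>Real square integrable functions\<close>

text \<open>Complex functions on the domain are later replaced by real ones on the whole space,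
  extended by zero, so that a single measure and a real inner product suffice.\<close>

definition sqint :: "('a::euclidean_space \<Rightarrow> real) \<Rightarrow> bool" where
  "sqint f \<longleftrightarrow> f \<in> borel_measurable lebesgue \<and> integrable lebesgue (\<lambda>z. (f z)\<^sup>2)"

definition n2 :: "('a::euclidean_space \<Rightarrow> real) \<Rightarrow> real" where
  "n2 f = sqrt (LINT z|lebesgue. (f z)\<^sup>2)"

lemma n2_nonneg [simp]: "0 \<le> n2 f" by (simp add: n2_def integral_nonneg_AE)

lemma n2_sq: "(n2 f)\<^sup>2 = (LINT z|lebesgue. (f z)\<^sup>2)" by (simp add: n2_def integral_nonneg_AE)

lemma sqint_mult: "sqint f \<Longrightarrow> sqint g \<Longrightarrow> integrable lebesgue (\<lambda>z. f z * g z)"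
proof -
  assume f: "sqint f" and g: "sqint g"
  show ?thesis
  proof (rule Bochner_Integration.integrable_bound)
    show "integrable lebesgue (\<lambda>z. (f z)\<^sup>2 + (g z)\<^sup>2)" using f g by (auto simp: sqint_def)
    show "(\<lambda>z. f z * g z) \<in> borel_measurable lebesgue" using f g by (auto simp: sqint_def)
    show "AE z in lebesgue. norm (f z * g z) \<le> norm ((f z)\<^sup>2 + (g z)\<^sup>2)"
    proof (rule AE_I2)
      fix z
      have "2 * (\<bar>f z\<bar> * \<bar>g z\<bar>) \<le> (f z)\<^sup>2 + (g z)\<^sup>2"
        using sum_squares_bound[of "\<bar>f z\<bar>" "\<bar>g z\<bar>"] by (simp add: mult.assoc)
      moreover have "0 \<le> \<bar>f z\<bar> * \<bar>g z\<bar>" by simp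
      ultimately have "\<bar>f z\<bar> * \<bar>g z\<bar> \<le> (f z)\<^sup>2 + (g z)\<^sup>2" by linarith
      then show "norm (f z * g z) \<le> norm ((f z)\<^sup>2 + (g z)\<^sup>2)" by (simp add: abs_mult)
    qed
  qed
qed

lemma sqint_add: "sqint f \<Longrightarrow> sqint g \<Longrightarrow> sqint (\<lambda>z. f z + g z)"
  using sqint_mult[of f g] unfolding sqint_def power2_sum by (auto simp: mult.assoc)

lemma sqint_cmult: "sqint f \<Longrightarrow> sqint (\<lambda>z. c * f z)"
  unfolding sqint_def power_mult_distrib by auto

lemma sqint_diff: "sqint f \<Longrightarrow> sqint g \<Longrightarrow> sqint (\<lambda>z. f z - g z)"
  using sqint_add[of f "\<lambda>z. -1 * g z"] sqint_cmult[of g "-1"] by simp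

lemma sqint_bound:
  assumes "f \<in> borel_measurable lebesgue" "sqint g" "\<And>z. \<bar>f z\<bar> \<le> \<bar>g z\<bar>"
  shows "sqint f" "n2 f \<le> n2 g"
proof -
  have le: "(f z)\<^sup>2 \<le> (g z)\<^sup>2" for z using assms(3)[of z] by (simp add: abs_le_square_iff)
  have i: "integrable lebesgue (\<lambda>z. (f z)\<^sup>2)"
    by (rule Bochner_Integration.integrable_bound[of _ "\<lambda>z. (g z)\<^sup>2"]) (use assms le in \<open>auto simp: sqint_def\<close>)
  then show "sqint f" using assms by (simp add: sqint_def)
  show "n2 f \<le> n2 g" unfolding n2_def
    by (intro real_sqrt_le_mono integral_mono i le) (use assms in \<open>auto simp: sqint_def\<close>)
qed

lemma sqint_abs: "sqint f \<Longrightarrow> sqint (\<lambda>z. \<bar>f z\<bar>)" by (auto simp: sqint_def)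

lemma n2_abs: "n2 (\<lambda>z. \<bar>f z\<bar>) = n2 f" by (simp add: n2_def)

lemma n2_cmult: "n2 (\<lambda>z. c * f z) = \<bar>c\<bar> * n2 f"
  by (simp add: n2_def power_mult_distrib real_sqrt_mult)

lemma Cauchy_Schwarz_n2:
  assumes f: "sqint f" and g: "sqint g"
  shows "\<bar>LINT z|lebesgue. f z * g z\<bar> \<le> n2 f * n2 g"
proof -
  let ?B = "LINT z|lebesgue. f z * g z"
  have q: "0 \<le> (n2 f)\<^sup>2 + 2 * s * ?B + s\<^sup>2 * (n2 g)\<^sup>2" for s
  proof -
    have i: "integrable lebesgue (\<lambda>z. (f z)\<^sup>2)" "integrable lebesgue (\<lambda>z. f z * g z)" "integrable lebesgue (\<lambda>z. (g z)\<^sup>2)"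
      using f g sqint_mult by (auto simp: sqint_def)
    have "0 \<le> (LINT z|lebesgue. (f z + s * g z)\<^sup>2)" by (rule integral_nonneg_AE) simp
    also have "\<dots> = (LINT z|lebesgue. (f z)\<^sup>2 + 2 * s * (f z * g z) + s\<^sup>2 * (g z)\<^sup>2)"
      by (rule Bochner_Integration.integral_cong) (auto simp: power2_eq_square algebra_simps)
    also have "\<dots> = (n2 f)\<^sup>2 + 2 * s * ?B + s\<^sup>2 * (n2 g)\<^sup>2" using i by (simp add: n2_sq)
    finally show ?thesis .
  qed
  have "?B\<^sup>2 \<le> (n2 f * n2 g)\<^sup>2"
  proof (cases "n2 g = 0")
    case True
    have "?B = 0"
    proof (rule ccontr)
      assume B: "?B \<noteq> 0"
      \<comment> \<open>With \<open>n2 g = 0\<close> the quadratic polynomial in s is affine; this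
        value of s makes it -1.\<close>
      have "0 \<le> (n2 f)\<^sup>2 + 2 * (- ((n2 f)\<^sup>2 + 1) / (2 * ?B)) * ?B" using q[of "- ((n2 f)\<^sup>2 + 1) / (2 * ?B)"] True by simp
      also have "\<dots> = - 1" using B by (simp add: field_simps)
      finally show False by simp
    qed
    then show ?thesis by simp
  next
    case False
    then have p: "0 < (n2 g)\<^sup>2" by simp
    have "0 \<le> (n2 f)\<^sup>2 + 2 * (- ?B / (n2 g)\<^sup>2) * ?B + (- ?B / (n2 g)\<^sup>2)\<^sup>2 * (n2 g)\<^sup>2" by (rule q)
    also have "\<dots> = (n2 f)\<^sup>2 - ?B\<^sup>2 / (n2 g)\<^sup>2" using False by (simp add: field_simps power2_eq_square)
    finally show ?thesis using p by (simp add: field_simps power_mult_distrib)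
  qed
  then show ?thesis by (simp add: abs_le_square_iff[symmetric])
qed

lemma n2_triangle: 
  assumes "sqint f" "sqint g" shows "n2 (\<lambda>z. f z + g z) \<le> n2 f + n2 g"
proof -
  have i: "integrable lebesgue (\<lambda>z. (f z)\<^sup>2)" "integrable lebesgue (\<lambda>z. f z * g z)" "integrable lebesgue (\<lambda>z. (g z)\<^sup>2)"
    using assms sqint_mult by (auto simp: sqint_def)
  have "(n2 (\<lambda>z. f z + g z))\<^sup>2 = (LINT z|lebesgue. (f z)\<^sup>2 + 2 * (f z * g z) + (g z)\<^sup>2)"
    unfolding n2_sq by (rule Bochner_Integration.integral_cong) (auto simp: power2_eq_square algebra_simps)
  also have "\<dots> = (n2 f)\<^sup>2 + 2 * (LINT z|lebesgue. f z * g z) + (n2 g)\<^sup>2" using i by (simp add: n2_sq)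
  also have "\<dots> \<le> (n2 f + n2 g)\<^sup>2" using Cauchy_Schwarz_n2[OF assms] by (simp add: power2_sum)
  finally show ?thesis by (rule power2_le_imp_le) simp
qed

lemma n2_triangle_diff: 
  assumes "sqint f" "sqint g" shows "n2 (\<lambda>z. f z - g z) \<le> n2 f + n2 g"
  using n2_triangle[OF assms(1) sqint_cmult[OF assms(2), of "-1"]] n2_cmult[of "-1" g] by simp

lemma n2_commute: "n2 (\<lambda>z. f z - g z) = n2 (\<lambda>z. g z - f z)"
  unfolding n2_def by (subst power2_commute) (rule refl)

lemma sqint_test_function: "test_function \<Omega> \<phi> \<Longrightarrow> sqint \<phi>"
  unfolding sqint_def power2_eq_square
  using smooth_measurable test_function_smooth test_function_integrable test_function_mult(1) by metis

lemma integral_mult_tendsto_zero: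
  assumes "\<And>k. sqint (f k)" "\<And>k. sqint (g k)" "(\<lambda>k. n2 (f k)) \<longlonglongrightarrow> 0" "\<And>k. n2 (g k) \<le> M"
  shows "(\<lambda>k. LINT z|lebesgue. f k z * g k z) \<longlonglongrightarrow> 0"
proof (rule tendsto_rabs_zero_cancel, rule tendsto_sandwich[of "\<lambda>k. 0" _ _ "\<lambda>k. n2 (f k) * M"])
  show "\<forall>\<^sub>F k in sequentially. \<bar>LINT z|lebesgue. f k z * g k z\<bar> \<le> n2 (f k) * M"
    by (intro always_eventually allI order_trans[OF Cauchy_Schwarz_n2[OF assms(1,2)] mult_left_mono[OF assms(4) n2_nonneg]])
  show "(\<lambda>k. n2 (f k) * M) \<longlonglongrightarrow> 0" using tendsto_mult_right[OF assms(3), of M] by simp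
qed auto

lemma n2_tendsto:
  assumes "\<And>k. sqint (f k)" "sqint h" "(\<lambda>k. n2 (\<lambda>z. f k z - h z)) \<longlonglongrightarrow> 0"
  shows "(\<lambda>k. n2 (f k)) \<longlonglongrightarrow> n2 h"
proof (rule LIM_zero_cancel, rule tendsto_rabs_zero_cancel, rule tendsto_sandwich[OF _ _ tendsto_const assms(3)])
  have "\<bar>n2 (f k) - n2 h\<bar> \<le> n2 (\<lambda>z. f k z - h z)" for k
    using n2_triangle[OF sqint_diff[OF assms(1,2)] assms(2), of k] n2_triangle[OF sqint_diff[OF assms(2,1)] assms(1), of k k]
      n2_commute[of h "f k"] by (simp add: abs_le_iff)
  then show "\<forall>\<^sub>F k in sequentially. \<bar>n2 (f k) - n2 h\<bar> \<le> n2 (\<lambda>z. f k z - h z)" by simp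
qed auto

lemma n2_bounded:
  assumes "\<And>k. sqint (f k)" "sqint h" "(\<lambda>k. n2 (\<lambda>z. f k z - h z)) \<longlonglongrightarrow> 0"
  obtains M where "\<And>k. n2 (f k) \<le> M"
proof -
  have "Bseq (\<lambda>k. n2 (f k))" using n2_tendsto[OF assms] convergent_imp_Bseq convergentI by blast
  then obtain M where "\<And>k. norm (n2 (f k)) \<le> M" by (metis BseqE)
  then show ?thesis using that by fastforce
qed

lemma sqint_integrable_sq: "sqint f \<Longrightarrow> integrable lebesgue (\<lambda>z. (f z)\<^sup>2)" by (simp add: sqint_def)

section \<open>A sign-preserving smooth truncation\<close>

section \<open>Truncated approximations\<close>

text \<open>A smooth way of cutting \<open>a\<close> off by \<open>b\<close>: the result never has
  the sign opposite to \<open>a\<close>, vanishes where \<open>b\<close> does, is at most 2 |a| in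
  size, and tends to \<open>a\<close> when \<open>b\<close> tends to \<open>a\<close> and
  \<open>e\<close> to 0. Applied to the eigenfunction and a test function it is compactly supported
  without losing the sign, which is what Fatou's lemma requires.\<close>

definition trunc :: "real \<Rightarrow> real \<Rightarrow> real \<Rightarrow> real" where
  "trunc e a b = 2 * a * b\<^sup>2 / (a\<^sup>2 + b\<^sup>2 + e)"

context
  fixes e :: real assumes e: "0 < e"
begin

lemma trunc_denom: "0 < a\<^sup>2 + b\<^sup>2 + e" using e by (simp add: add_nonneg_pos)

lemma trunc_le: "\<bar>trunc e a b\<bar> \<le> 2 * \<bar>a\<bar>"
proof -
  have "\<bar>a\<bar> * b\<^sup>2 \<le> \<bar>a\<bar> * (a\<^sup>2 + b\<^sup>2 + e)" using e by (intro mult_left_mono) auto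
  then show ?thesis using trunc_denom[of a b] by (simp add: trunc_def abs_mult divide_le_eq)
qed

lemma trunc_sign: "0 \<le> a * trunc e a b"
proof -
  have "a * trunc e a b = 2 * a\<^sup>2 * b\<^sup>2 / (a\<^sup>2 + b\<^sup>2 + e)" by (simp add: trunc_def power2_eq_square)
  then show ?thesis using trunc_denom[of a b] by simp
qed

text \<open>The constant is uniform in \<open>b\<close> and \<open>e\<close>. With c = b^2 + e the
  difference is 2 b^2 (a - a') (c - a a') over (a^2 + c)(a'^2 + c), and the bound follows from 2 |a
  a'| \<le> a^2 + a'^2.\<close>

lemma trunc_lipschitz: "\<bar>trunc e a b - trunc e a' b\<bar> \<le> 2 * \<bar>a - a'\<bar>"
proof -
  define c where "c = b\<^sup>2 + e"
  define P where "P = (a\<^sup>2 + c) * (a'\<^sup>2 + c)"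
  have c: "0 < c" "b\<^sup>2 \<le> c" using e by (auto simp: c_def add_nonneg_pos)
  have pos: "0 < a\<^sup>2 + c" "0 < a'\<^sup>2 + c" using c by (auto simp: add_nonneg_pos)
  then have P: "0 < P" by (simp add: P_def)
  have "trunc e a b - trunc e a' b = 2 * a * b\<^sup>2 / (a\<^sup>2 + c) - 2 * a' * b\<^sup>2 / (a'\<^sup>2 + c)"
    by (simp add: trunc_def c_def add.assoc)
  also have "\<dots> = 2 * (b\<^sup>2 * (a - a') * (c - a * a')) / P"
    unfolding P_def using pos by (simp add: divide_simps) (simp add: algebra_simps power2_eq_square)
  finally have "\<bar>trunc e a b - trunc e a' b\<bar> = 2 * (b\<^sup>2 * \<bar>a - a'\<bar> * \<bar>c - a * a'\<bar>) / P"
    using P by (simp add: abs_mult)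
  also have "\<dots> \<le> 2 * (\<bar>a - a'\<bar> * P) / P"
  proof -
    have "2 * \<bar>a * a'\<bar> \<le> a\<^sup>2 + a'\<^sup>2" using sum_squares_bound[of "\<bar>a\<bar>" "\<bar>a'\<bar>"] by (simp add: abs_mult)
    then have "c * (2 * \<bar>a * a'\<bar>) \<le> c * (a\<^sup>2 + a'\<^sup>2)" using c by (intro mult_left_mono) auto
    moreover have "0 \<le> a\<^sup>2 * a'\<^sup>2" "0 \<le> c * \<bar>a * a'\<bar>" using c by auto
    ultimately have "c * (c + \<bar>a * a'\<bar>) \<le> P" unfolding P_def by (simp add: algebra_simps power2_eq_square)
    moreover have "b\<^sup>2 * \<bar>c - a * a'\<bar> \<le> c * (c + \<bar>a * a'\<bar>)" using c by (intro mult_mono) auto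
    ultimately have "\<bar>a - a'\<bar> * (b\<^sup>2 * \<bar>c - a * a'\<bar>) \<le> \<bar>a - a'\<bar> * P" by (intro mult_left_mono) auto
    then show ?thesis using P by (intro divide_right_mono) (auto simp: mult_ac)
  qed
  also have "\<dots> = 2 * \<bar>a - a'\<bar>" using P by simp
  finally show ?thesis .
qed

text \<open>The gradient bound is free of \<open>e\<close>, because the partial derivatives of
  \<open>trunc\<close> are homogeneous of degree zero in a, b and the square root of e. Truncated
  sequences thus stay bounded in H^1, although their gradients need not converge.\<close>

lemma trunc_partial:
  fixes \<phi> \<psi> :: "'a::euclidean_space \<Rightarrow> real"
  assumes "smooth \<phi>" "smooth \<psi>"
  shows "smooth (\<lambda>z. trunc e (\<phi> z) (\<psi> z))"
    and "\<bar>partial h (\<lambda>z. trunc e (\<phi> z) (\<psi> z)) z\<bar> \<le> 2 * \<bar>partial h \<phi> z\<bar> + 2 * \<bar>partial h \<psi> z\<bar>"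
proof -
  have nz: "(\<phi> z)\<^sup>2 + (\<psi> z)\<^sup>2 + e \<noteq> 0" for z using trunc_denom[of "\<phi> z" "\<psi> z"] by simp
  show "smooth (\<lambda>z. trunc e (\<phi> z) (\<psi> z))"
    unfolding trunc_def by (intro smooth_intros assms nz)
  define a b p q where "a = \<phi> z" "b = \<psi> z" "p = partial h \<phi> z" "q = partial h \<psi> z"
  define Q where "Q = a\<^sup>2 + b\<^sup>2 + e"
  have Q: "0 < Q" "b\<^sup>2 \<le> Q" "a\<^sup>2 + e \<le> Q" "a\<^sup>2 + b\<^sup>2 \<le> Q" using trunc_denom[of a b] e by (auto simp: Q_def)
  note ph = smooth_has_derivative[OF assms(1)] and ps = smooth_has_derivative[OF assms(2)]
  have num: "((\<lambda>z. 2 * \<phi> z * (\<psi> z)\<^sup>2) has_derivative (\<lambda>h. (2 * \<phi> z) * (real 2 * partial h \<psi> z * \<psi> z ^ (2 - 1)) + (2 * partial h \<phi> z) * (\<psi> z)\<^sup>2)) (at z)"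
    by (intro has_derivative_mult has_derivative_mult_right has_derivative_power ph ps)
  have den: "((\<lambda>z. (\<phi> z)\<^sup>2 + (\<psi> z)\<^sup>2 + e) has_derivative (\<lambda>h. real 2 * partial h \<phi> z * \<phi> z ^ (2 - 1) + real 2 * partial h \<psi> z * \<psi> z ^ (2 - 1) + 0)) (at z)"
    by (intro has_derivative_add has_derivative_const has_derivative_power ph ps)
  have "partial h (\<lambda>z. trunc e (\<phi> z) (\<psi> z)) z = ((4 * a * b * q + 2 * p * b\<^sup>2) * Q - (2 * a * b\<^sup>2) * (2 * p * a + 2 * q * b)) / (Q * Q)"
    unfolding trunc_def using partial_eqI[OF has_derivative_divide'[OF num den nz], of h]
    by (simp add: a_b_p_q_def Q_def algebra_simps)
  also have "\<dots> = (2 * b\<^sup>2 * (b\<^sup>2 + e - a\<^sup>2) * p + 4 * a * b * (a\<^sup>2 + e) * q) / (Q * Q)"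
    by (rule arg_cong[where f="\<lambda>x. x / (Q * Q)"]) (simp add: Q_def algebra_simps power2_eq_square)
  finally have "\<bar>partial h (\<lambda>z. trunc e (\<phi> z) (\<psi> z)) z\<bar> = \<bar>2 * b\<^sup>2 * (b\<^sup>2 + e - a\<^sup>2) * p + 4 * a * b * (a\<^sup>2 + e) * q\<bar> / (Q * Q)"
    using Q by simp
  also have "\<dots> \<le> ((2 * \<bar>p\<bar> + 2 * \<bar>q\<bar>) * (Q * Q)) / (Q * Q)"
  proof (rule divide_right_mono)
    have "b\<^sup>2 * \<bar>b\<^sup>2 + e - a\<^sup>2\<bar> \<le> Q * Q" using Q e by (intro mult_mono) (auto simp: Q_def abs_le_iff)
    then have "2 * \<bar>p\<bar> * (b\<^sup>2 * \<bar>b\<^sup>2 + e - a\<^sup>2\<bar>) \<le> 2 * \<bar>p\<bar> * (Q * Q)" by (intro mult_left_mono) auto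
    then have 1: "\<bar>2 * b\<^sup>2 * (b\<^sup>2 + e - a\<^sup>2) * p\<bar> \<le> 2 * \<bar>p\<bar> * (Q * Q)" by (simp add: abs_mult mult_ac)
    have "2 * \<bar>a * b\<bar> \<le> Q" using sum_squares_bound[of "\<bar>a\<bar>" "\<bar>b\<bar>"] Q(4) by (simp add: abs_mult)
    then have "(2 * \<bar>a * b\<bar>) * (a\<^sup>2 + e) \<le> Q * Q" using Q e by (intro mult_mono) auto
    then have "2 * \<bar>q\<bar> * ((2 * \<bar>a * b\<bar>) * (a\<^sup>2 + e)) \<le> 2 * \<bar>q\<bar> * (Q * Q)" by (intro mult_left_mono) auto
    then have 2: "\<bar>4 * a * b * (a\<^sup>2 + e) * q\<bar> \<le> 2 * \<bar>q\<bar> * (Q * Q)" using e by (simp add: abs_mult mult_ac)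
    show "\<bar>2 * b\<^sup>2 * (b\<^sup>2 + e - a\<^sup>2) * p + 4 * a * b * (a\<^sup>2 + e) * q\<bar> \<le> (2 * \<bar>p\<bar> + 2 * \<bar>q\<bar>) * (Q * Q)"
      using 1 2 by (simp only: distrib_right)
  qed (use Q in simp)
  also have "\<dots> = 2 * \<bar>p\<bar> + 2 * \<bar>q\<bar>" using Q by simp
  finally show "\<bar>partial h (\<lambda>z. trunc e (\<phi> z) (\<psi> z)) z\<bar> \<le> 2 * \<bar>partial h \<phi> z\<bar> + 2 * \<bar>partial h \<psi> z\<bar>"
    by (simp add: a_b_p_q_def)
qed

end

lemma trunc_zero [simp]: "trunc e a 0 = 0" "trunc e 0 b = 0" by (simp_all add: trunc_def)

lemma trunc_tendsto:
  assumes "b \<longlonglongrightarrow> a" "e \<longlonglongrightarrow> 0"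
  shows "(\<lambda>k. trunc (e k) a (b k)) \<longlonglongrightarrow> a"
proof (cases "a = 0")
  case False
  have "(\<lambda>k. 2 * a * (b k)\<^sup>2 / (a\<^sup>2 + (b k)\<^sup>2 + e k)) \<longlonglongrightarrow> 2 * a * a\<^sup>2 / (a\<^sup>2 + a\<^sup>2 + 0)"
    by (intro tendsto_intros assms) (use False in simp)
  moreover have "2 * a * a\<^sup>2 / (a\<^sup>2 + a\<^sup>2 + 0) = a" using False by simp
  ultimately show ?thesis unfolding trunc_def by metis
qed simp

section \<open>The weak form of the equation for a real eigenfunction\<close>

section \<open>Absence of eigenfunctions on a star-shaped set\<close>

text \<open>One real component of an eigenfunction, with \<open>u\<close>, its gradient
  \<open>D\<close> and \<open>V\<close> as functions on the whole space. The H^1 approximation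
  \<open>\<phi>\<close> is part of the data and converges almost everywhere as well, which a
  subsequence provides. The condition on \<open>V\<close> is already free of the factor |x|.\<close>

locale dirichlet_eigenfunction =
  fixes \<Omega> :: "('x::euclidean_space \<times> 'y::euclidean_space) set"
    and V u :: "'x \<times> 'y \<Rightarrow> real" and D :: "'x \<times> 'y \<Rightarrow> 'x \<times> 'y \<Rightarrow> real"
    and \<phi> :: "nat \<Rightarrow> 'x \<times> 'y \<Rightarrow> real" and lam :: real
  assumes dim: "DIM('x) \<ge> 3" and star: "xstar \<Omega>"
    and V_measurable: "V \<in> borel_measurable lebesgue" and V_nonneg: "\<And>z. 0 \<le> V z"
    and V_bounded: "\<And>K. compact K \<Longrightarrow> K \<subseteq> \<Omega> \<Longrightarrow> bounded (V ` K)"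
    and V_repulsive: "\<And>\<eta>. test_function \<Omega> \<eta> \<Longrightarrow> (\<And>z. 0 \<le> \<eta> z) \<Longrightarrow> 0 \<le> (LINT z|lebesgue. V z * xdiv \<eta> z)"
    and u: "sqint u" and D: "\<And>b. b \<in> Basis \<Longrightarrow> sqint (D b)"
    and \<phi>: "\<And>k. test_function \<Omega> (\<phi> k)"
    and \<phi>_L2: "(\<lambda>k. n2 (\<lambda>z. \<phi> k z - u z)) \<longlonglongrightarrow> 0"
    and \<phi>_D: "\<And>b. b \<in> Basis \<Longrightarrow> (\<lambda>k. n2 (\<lambda>z. partial b (\<phi> k) z - D b z)) \<longlonglongrightarrow> 0"
    and \<phi>_AE: "AE z in lebesgue. (\<lambda>k. \<phi> k z) \<longlonglongrightarrow> u z"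
    and equation: "\<And>w. test_function \<Omega> w \<Longrightarrow>
        - (\<Sum>b\<in>Basis. LINT z|lebesgue. u z * partial b (partial b w) z) + (LINT z|lebesgue. V z * u z * w z)
          = lam * (LINT z|lebesgue. u z * w z)"
begin

definition B :: "('x \<times> 'y \<Rightarrow> real) \<Rightarrow> real" where
  "B w = (\<Sum>b\<in>Basis. LINT z|lebesgue. D b z * partial b w z)"

lemma sq\<phi>: "sqint (\<phi> k)" by (rule sqint_test_function[OF \<phi>])

lemma sqp: "test_function \<Omega> w \<Longrightarrow> sqint (partial b w)"
  by (rule sqint_test_function[OF test_function_partial])

lemma u_meas [measurable]: "u \<in> borel_measurable lebesgue" using u by (simp add: sqint_def)
lemma \<phi>_meas [measurable]: "\<phi> k \<in> borel_measurable lebesgue" using sq\<phi> by (simp add: sqint_def)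
declare V_measurable [measurable]

lemma integral_tendsto:
  assumes "\<And>k. sqint (f k)" "sqint h" "(\<lambda>k. n2 (\<lambda>z. f k z - h z)) \<longlonglongrightarrow> 0" "sqint g"
  shows "(\<lambda>k. LINT z|lebesgue. f k z * g z) \<longlonglongrightarrow> (LINT z|lebesgue. h z * g z)"
proof (rule LIM_zero_cancel)
  have "(\<lambda>k. LINT z|lebesgue. (f k z - h z) * g z) \<longlonglongrightarrow> 0"
    by (rule integral_mult_tendsto_zero[OF sqint_diff[OF assms(1,2)] assms(4) assms(3) order_refl])
  moreover have "(LINT z|lebesgue. (f k z - h z) * g z) = (LINT z|lebesgue. f k z * g z) - (LINT z|lebesgue. h z * g z)" for k
    using sqint_mult[OF assms(1) assms(4)] sqint_mult[OF assms(2,4)] by (simp add: left_diff_distrib)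
  ultimately show "(\<lambda>k. (LINT z|lebesgue. f k z * g z) - (LINT z|lebesgue. h z * g z)) \<longlonglongrightarrow> 0" by simp
qed

text \<open>Passing to the limit in the integration by parts for \<open>\<phi> k\<close> shows that
  the L2 limits \<open>D\<close> are weak derivatives, so this need not be assumed in the
  locale.\<close>

lemma weak_D:
  assumes w: "test_function \<Omega> w" and b: "b \<in> Basis"
  shows "(LINT z|lebesgue. D b z * w z) = - (LINT z|lebesgue. u z * partial b w z)"
proof -
  have "(\<lambda>k. LINT z|lebesgue. partial b (\<phi> k) z * w z) \<longlonglongrightarrow> (LINT z|lebesgue. D b z * w z)"
    by (rule integral_tendsto[OF sqp[OF \<phi>] D[OF b] \<phi>_D[OF b] sqint_test_function[OF w]])
  moreover have "(LINT z|lebesgue. partial b (\<phi> k) z * w z) = - (LINT z|lebesgue. \<phi> k z * partial b w z)" for k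
    using integral_by_parts[OF w test_function_smooth[OF \<phi>], of k b] by simp
  moreover have "(\<lambda>k. - (LINT z|lebesgue. \<phi> k z * partial b w z)) \<longlonglongrightarrow> - (LINT z|lebesgue. u z * partial b w z)"
    by (intro tendsto_minus integral_tendsto[OF sq\<phi> u \<phi>_L2 sqp[OF w]])
  ultimately show ?thesis using LIMSEQ_unique by (simp only:)
qed

lemma weak_equation:
  assumes w: "test_function \<Omega> w"
  shows "B w + (LINT z|lebesgue. V z * u z * w z) = lam * (LINT z|lebesgue. u z * w z)"
proof -
  have "B w = - (\<Sum>b\<in>Basis. LINT z|lebesgue. u z * partial b (partial b w) z)"
    unfolding B_def sum_negf[symmetric] by (rule sum.cong) (simp_all add: weak_D[OF test_function_partial[OF w]])
  then show ?thesis using equation[OF w] by simp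
qed

lemma B_diff:
  assumes "test_function \<Omega> v" "test_function \<Omega> w"
  shows "B (\<lambda>z. v z - w z) = B v - B w"
proof -
  have "(LINT z|lebesgue. D b z * partial b (\<lambda>z. v z - w z) z) = (LINT z|lebesgue. D b z * partial b v z) - (LINT z|lebesgue. D b z * partial b w z)"
    if b: "b \<in> Basis" for b
    unfolding partial_diff[OF test_function_smooth[OF assms(1)] test_function_smooth[OF assms(2)]] right_diff_distrib
    by (rule Bochner_Integration.integral_diff) (intro sqint_mult D[OF b] sqp assms)+
  then show ?thesis unfolding B_def sum_subtractf[symmetric] by (rule sum.cong[OF refl])
qed

lemma partial_bounded:
  obtains M where "\<And>k b. b \<in> Basis \<Longrightarrow> n2 (partial b (\<phi> k)) \<le> M" "0 \<le> M"
proof -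
  have "\<exists>M. \<forall>k. n2 (partial b (\<phi> k)) \<le> M" if b: "b \<in> Basis" for b
    using n2_bounded[OF sqp[OF \<phi>] D[OF b] \<phi>_D[OF b]] by metis
  then obtain M where M: "\<And>b k. b \<in> Basis \<Longrightarrow> n2 (partial b (\<phi> k)) \<le> M b" by metis
  then have M0: "0 \<le> M b" if "b \<in> Basis" for b using n2_nonneg order_trans that by blast
  show ?thesis
  proof (rule that[of "\<Sum>b\<in>Basis. M b"])
    show "n2 (partial b (\<phi> k)) \<le> (\<Sum>b\<in>Basis. M b)" if b: "b \<in> Basis" for k b
      using M[OF b, of k] member_le_sum[OF b, of M] M0 by force
    show "0 \<le> (\<Sum>b\<in>Basis. M b)" using M0 by (simp add: sum_nonneg)
  qed
qed

text \<open>Bounded gradients together with L2 convergence to zero give weak convergence of the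
  gradients: against the smooth function \<open>partial b (\<phi> i)\<close> the derivative can be
  moved off \<open>w k\<close>, and these functions approximate \<open>D b\<close> in L2.\<close>

lemma B_tendsto_zero:
  assumes w: "\<And>k. test_function \<Omega> (w k)" and M: "\<And>k b. b \<in> Basis \<Longrightarrow> n2 (partial b (w k)) \<le> M"
    and z: "(\<lambda>k. n2 (w k)) \<longlonglongrightarrow> 0"
  shows "(\<lambda>k. B (w k)) \<longlonglongrightarrow> 0"
  unfolding B_def
proof (rule tendsto_null_sum)
  fix b :: "'x \<times> 'y" assume b: "b \<in> Basis"
  have M0: "0 \<le> M" using M[OF b, of 0] n2_nonneg order_trans by blast
  show "(\<lambda>k. LINT z|lebesgue. D b z * partial b (w k) z) \<longlonglongrightarrow> 0"
  proof (rule LIMSEQ_I)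
    fix r :: real assume r: "0 < r"
    then have "0 < r / (2 * (M + 1))" using M0 by simp
    \<comment> \<open>\<open>i\<close> is fixed before k, so that the approximation error is at most
      r / 2 uniformly in k; \<open>M + 1\<close> keeps the denominator positive.\<close>
    then obtain i where i: "n2 (\<lambda>z. partial b (\<phi> i) z - D b z) < r / (2 * (M + 1))"
      using LIMSEQ_D[OF \<phi>_D[OF b], of "r / (2 * (M + 1))"] by auto
    have "(\<lambda>k. LINT z|lebesgue. w k z * partial b (partial b (\<phi> i)) z) \<longlonglongrightarrow> 0"
      by (rule integral_mult_tendsto_zero[OF sqint_test_function[OF w] sqp[OF test_function_partial[OF \<phi>]] z order_refl])
    from LIMSEQ_D[OF this, of "r / 2"] r obtain N where N: "\<And>k. k \<ge> N \<Longrightarrow> \<bar>LINT z|lebesgue. w k z * partial b (partial b (\<phi> i)) z\<bar> < r / 2"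
      by auto
    show "\<exists>no. \<forall>k\<ge>no. norm ((LINT z|lebesgue. D b z * partial b (w k) z) - 0) < r"
    proof (intro exI allI impI)
      fix k assume k: "N \<le> k"
      have sq: "sqint (\<lambda>z. partial b (\<phi> i) z - D b z)" by (intro sqint_diff sqp \<phi> D b)
      have "(LINT z|lebesgue. D b z * partial b (w k) z)
        = (LINT z|lebesgue. partial b (\<phi> i) z * partial b (w k) z - (partial b (\<phi> i) z - D b z) * partial b (w k) z)"
        by (rule Bochner_Integration.integral_cong) (auto simp: algebra_simps)
      also have "\<dots> = (LINT z|lebesgue. partial b (\<phi> i) z * partial b (w k) z) - (LINT z|lebesgue. (partial b (\<phi> i) z - D b z) * partial b (w k) z)"
        by (rule Bochner_Integration.integral_diff) (intro sqint_mult sq sqp w \<phi>)+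
      also have "(LINT z|lebesgue. partial b (\<phi> i) z * partial b (w k) z) = - (LINT z|lebesgue. w k z * partial b (partial b (\<phi> i)) z)"
        using integral_by_parts[OF w[of k] smooth_partial[OF test_function_smooth[OF \<phi>[of i]]]] by (simp add: mult.commute)
      finally have e: "(LINT z|lebesgue. D b z * partial b (w k) z) = - (LINT z|lebesgue. w k z * partial b (partial b (\<phi> i)) z)
         - (LINT z|lebesgue. (partial b (\<phi> i) z - D b z) * partial b (w k) z)" .
      have "\<bar>LINT z|lebesgue. (partial b (\<phi> i) z - D b z) * partial b (w k) z\<bar> \<le> n2 (\<lambda>z. partial b (\<phi> i) z - D b z) * n2 (partial b (w k))"
        by (rule Cauchy_Schwarz_n2[OF sq sqp[OF w]])
      also have "\<dots> \<le> r / (2 * (M + 1)) * (M + 1)"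
        using i M[OF b, of k] M0 r by (intro mult_mono) auto
      also have "\<dots> = r / 2" using M0 by (simp add: field_simps)
      finally show "norm ((LINT z|lebesgue. D b z * partial b (w k) z) - 0) < r"
        unfolding e using N[OF k] by simp
    qed
  qed
qed

text \<open>\<open>R\<close> vanishes off the support of \<open>\<phi> k\<close>, a compact part of
  the domain on which \<open>V\<close> is bounded. Replacing \<open>u\<close> in the first slot of
  \<open>trunc\<close> by a close \<open>\<phi> j\<close> therefore changes all three quantities
  little, and it produces a test function.\<close>

lemma truncated_approximation_step:
  fixes e d :: real and k :: nat
  assumes e: "0 < e" and d: "0 < d"
  defines "R \<equiv> \<lambda>z. trunc e (u z) (\<phi> k z)"
  shows "\<exists>j. let w = (\<lambda>z. trunc e (\<phi> j z) (\<phi> k z)) in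
      n2 (\<lambda>z. w z - R z) < d \<and>
      \<bar>(LINT z|lebesgue. V z * u z * w z) - (LINT z|lebesgue. V z * u z * R z)\<bar> < d \<and>
      \<bar>(LINT z|lebesgue. V z * (w z)\<^sup>2) - (LINT z|lebesgue. V z * (R z)\<^sup>2)\<bar> < d"
    and "integrable lebesgue (\<lambda>z. V z * u z * R z)" "integrable lebesgue (\<lambda>z. V z * (R z)\<^sup>2)"
proof -
  obtain K where K: "smooth (\<phi> k)" "compact K" "K \<subseteq> \<Omega>" "\<And>z. z \<notin> K \<Longrightarrow> \<phi> k z = 0"
    using test_functionE[OF \<phi>[of k]] by metis
  obtain C0 where C0: "\<forall>z\<in>K. \<bar>V z\<bar> \<le> C0" using V_bounded[OF K(2,3)] by (auto simp: bounded_iff)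
  define C where "C = max C0 0"
  have C: "\<And>z. z \<in> K \<Longrightarrow> V z \<le> C" "0 \<le> C" using C0 by (force simp: C_def)+
  have R0: "R z = 0" if "z \<notin> K" for z using K(4)[OF that] by (simp add: R_def)
  have Rle: "\<bar>R z\<bar> \<le> 2 * \<bar>u z\<bar>" for z unfolding R_def by (rule trunc_le[OF e])
  have [measurable]: "R \<in> borel_measurable lebesgue" unfolding R_def trunc_def by measurable
  have sR: "sqint R" by (rule sqint_bound(1)[OF _ sqint_cmult[OF u, of 2]]) (use Rle in \<open>auto simp: abs_mult\<close>)
  have VK: "V z * \<bar>f z\<bar> \<le> C * \<bar>f z\<bar>" if "\<And>z. z \<notin> K \<Longrightarrow> f z = 0" for f :: "'x \<times> 'y \<Rightarrow> real" and z
  proof (cases "z \<in> K")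
    case True
    then show ?thesis using C(1)[OF True] by (intro mult_right_mono) auto
  qed (simp add: that)
  have iV: "integrable lebesgue (\<lambda>z. V z * f z)" "\<bar>LINT z|lebesgue. V z * f z\<bar> \<le> C * (LINT z|lebesgue. g z)"
    if "f \<in> borel_measurable lebesgue" "integrable lebesgue g" "\<And>z. \<bar>f z\<bar> \<le> g z" "\<And>z. z \<notin> K \<Longrightarrow> f z = 0" for f g :: "'x \<times> 'y \<Rightarrow> real"
  proof -
    have [measurable]: "f \<in> borel_measurable lebesgue" by fact
    have le: "\<bar>V z * f z\<bar> \<le> C * g z" for z
      using VK[of f z] that(4) mult_left_mono[OF that(3)[of z] C(2)] V_nonneg[of z] by (simp add: abs_mult)
    show i: "integrable lebesgue (\<lambda>z. V z * f z)"
    proof (rule Bochner_Integration.integrable_bound[OF integrable_mult_right[OF that(2), of C]])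
      show "AE z in lebesgue. norm (V z * f z) \<le> norm (C * g z)"
        using order_trans[OF le abs_ge_self] by (intro AE_I2) simp
    qed measurable
    have "\<bar>LINT z|lebesgue. V z * f z\<bar> \<le> (LINT z|lebesgue. \<bar>V z * f z\<bar>)" by (rule integral_abs_bound)
    also have "\<dots> \<le> (LINT z|lebesgue. C * g z)"
      by (rule integral_mono) (use i that le in auto)
    finally show "\<bar>LINT z|lebesgue. V z * f z\<bar> \<le> C * (LINT z|lebesgue. g z)" by simp
  qed
  have i1: "integrable lebesgue (\<lambda>z. V z * (u z * R z))"
    by (rule iV(1)[of _ "\<lambda>z. \<bar>u z\<bar> * \<bar>R z\<bar>"]) (use R0 in \<open>auto simp: abs_mult intro!: sqint_mult sqint_abs u sR\<close>)
  then show iuR: "integrable lebesgue (\<lambda>z. V z * u z * R z)" by (simp add: mult.assoc)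
  show iRR: "integrable lebesgue (\<lambda>z. V z * (R z)\<^sup>2)"
    by (rule iV(1)[of _ "\<lambda>z. (R z)\<^sup>2"]) (use R0 sR in \<open>auto simp: sqint_def\<close>)
  \<comment> \<open>The sum of the constants of the three error estimates; a single
    \<open>del\<close> with \<open>del * Z < d\<close> then serves all of them.\<close>
  define Z where "Z = 2 + 2 * C * n2 u + 2 * C * (2 * (n2 u + 1) + 2 * n2 u)"
  have Z: "Z \<ge> 2" using C by (simp add: Z_def)
  have "0 < min 1 (d / Z)" using d Z by simp
  then obtain j where j0: "n2 (\<lambda>z. \<phi> j z - u z) < min 1 (d / Z)"
    using LIMSEQ_D[OF \<phi>_L2] by fastforce
  define del where "del = n2 (\<lambda>z. \<phi> j z - u z)"
  have del: "0 \<le> del" "del < 1" "del * Z < d" using j0 Z by (auto simp: del_def field_simps)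
  define w where "w = (\<lambda>z. trunc e (\<phi> j z) (\<phi> k z))"
  have [measurable]: "w \<in> borel_measurable lebesgue" unfolding w_def trunc_def by measurable
  have w0: "w z = 0" if "z \<notin> K" for z using K(4)[OF that] by (simp add: w_def)
  have wR: "\<bar>w z - R z\<bar> \<le> 2 * \<bar>\<phi> j z - u z\<bar>" for z unfolding w_def R_def by (rule trunc_lipschitz[OF e])
  have wle: "\<bar>w z\<bar> \<le> 2 * \<bar>\<phi> j z\<bar>" for z unfolding w_def by (rule trunc_le[OF e])
  have sw: "sqint w" by (rule sqint_bound(1)[OF _ sqint_cmult[OF sq\<phi>[of j], of 2]]) (use wle in \<open>auto simp: abs_mult\<close>)
  have sd: "sqint (\<lambda>z. \<phi> j z - u z)" by (rule sqint_diff[OF sq\<phi> u])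
  have n1: "n2 (\<lambda>z. w z - R z) \<le> 2 * del"
  proof -
    have "\<bar>w z - R z\<bar> \<le> \<bar>2 * (\<phi> j z - u z)\<bar>" for z using wR[of z] unfolding abs_mult[of 2] by simp
    then have "n2 (\<lambda>z. w z - R z) \<le> n2 (\<lambda>z. 2 * (\<phi> j z - u z))"
      by (intro sqint_bound(2)[OF _ sqint_cmult[OF sd]]) measurable
    then show ?thesis unfolding n2_cmult del_def by simp
  qed
  have swR: "sqint (\<lambda>z. w z - R z)" by (rule sqint_diff[OF sw sR])
  have nphi: "n2 (\<phi> j) \<le> n2 u + 1"
    using n2_triangle[OF sd u] del by (simp add: del_def)
  have iw: "integrable lebesgue (\<lambda>z. V z * (u z * w z))"
    by (rule iV(1)[of _ "\<lambda>z. \<bar>u z\<bar> * \<bar>w z\<bar>"]) (use w0 in \<open>auto simp: abs_mult intro!: sqint_mult sqint_abs u sw\<close>)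
  have e1: "\<bar>(LINT z|lebesgue. V z * u z * w z) - (LINT z|lebesgue. V z * u z * R z)\<bar> \<le> 2 * C * n2 u * del"
  proof -
    have "(LINT z|lebesgue. V z * u z * w z) - (LINT z|lebesgue. V z * u z * R z) = (LINT z|lebesgue. V z * (u z * (w z - R z)))"
      using Bochner_Integration.integral_diff[OF iw i1] by (simp add: algebra_simps)
    also have "\<bar>\<dots>\<bar> \<le> C * (LINT z|lebesgue. \<bar>u z\<bar> * \<bar>w z - R z\<bar>)"
      by (rule iV(2)) (use w0 R0 in \<open>auto simp: abs_mult intro!: sqint_mult sqint_abs u swR\<close>)
    also have "\<dots> \<le> C * (n2 u * (2 * del))"
    proof (rule mult_left_mono[OF _ C(2)])
      have "(LINT z|lebesgue. \<bar>u z\<bar> * \<bar>w z - R z\<bar>) \<le> n2 u * n2 (\<lambda>z. w z - R z)"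
        using Cauchy_Schwarz_n2[OF sqint_abs[OF u] sqint_abs[OF swR]] by (simp add: n2_abs)
      also have "\<dots> \<le> n2 u * (2 * del)" by (rule mult_left_mono[OF n1]) simp
      finally show "(LINT z|lebesgue. \<bar>u z\<bar> * \<bar>w z - R z\<bar>) \<le> n2 u * (2 * del)" .
    qed
    finally show ?thesis by (simp add: mult_ac)
  qed
  have iww: "integrable lebesgue (\<lambda>z. V z * (w z)\<^sup>2)"
    by (rule iV(1)[of _ "\<lambda>z. (w z)\<^sup>2"]) (use w0 sw in \<open>auto simp: sqint_def\<close>)
  have e2: "\<bar>(LINT z|lebesgue. V z * (w z)\<^sup>2) - (LINT z|lebesgue. V z * (R z)\<^sup>2)\<bar> \<le> 2 * C * (2 * (n2 u + 1) + 2 * n2 u) * del"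
  proof -
    have "(LINT z|lebesgue. V z * (w z)\<^sup>2) - (LINT z|lebesgue. V z * (R z)\<^sup>2) = (LINT z|lebesgue. V z * ((w z - R z) * (w z + R z)))"
      using Bochner_Integration.integral_diff[OF iww iRR] by (simp add: algebra_simps power2_eq_square)
    also have "\<bar>\<dots>\<bar> \<le> C * (LINT z|lebesgue. \<bar>w z - R z\<bar> * \<bar>w z + R z\<bar>)"
      by (rule iV(2)) (use w0 R0 in \<open>auto simp: abs_mult intro!: sqint_mult sqint_abs sqint_add sw sR swR\<close>)
    also have "\<dots> \<le> C * ((2 * del) * (2 * (n2 u + 1) + 2 * n2 u))"
    proof (rule mult_left_mono[OF _ C(2)])
      have "(LINT z|lebesgue. \<bar>w z - R z\<bar> * \<bar>w z + R z\<bar>) \<le> n2 (\<lambda>z. w z - R z) * n2 (\<lambda>z. w z + R z)"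
        using Cauchy_Schwarz_n2[OF sqint_abs[OF swR] sqint_abs[OF sqint_add[OF sw sR]]] by (simp add: n2_abs)
      also have "\<dots> \<le> (2 * del) * (2 * (n2 u + 1) + 2 * n2 u)"
      proof (rule mult_mono[OF n1])
        have "n2 w \<le> 2 * n2 (\<phi> j)" using sqint_bound(2)[OF _ sqint_cmult[OF sq\<phi>[of j], of 2], of w] wle by (simp add: n2_cmult abs_mult)
        moreover have "n2 R \<le> 2 * n2 u" using sqint_bound(2)[OF _ sqint_cmult[OF u, of 2], of R] Rle by (simp add: n2_cmult abs_mult)
        ultimately show "n2 (\<lambda>z. w z + R z) \<le> 2 * (n2 u + 1) + 2 * n2 u"
          using n2_triangle[OF sw sR] nphi by (simp add: algebra_simps)
      qed (use del in auto)
      finally show "(LINT z|lebesgue. \<bar>w z - R z\<bar> * \<bar>w z + R z\<bar>) \<le> (2 * del) * (2 * (n2 u + 1) + 2 * n2 u)" .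
    qed
    finally show ?thesis by (simp add: mult_ac)
  qed
  have "2 * del + 2 * C * n2 u * del + 2 * C * (2 * (n2 u + 1) + 2 * n2 u) * del = del * Z"
    by (simp add: Z_def algebra_simps)
  moreover have "0 \<le> 2 * del" "0 \<le> 2 * C * n2 u * del" "0 \<le> 2 * C * (2 * (n2 u + 1) + 2 * n2 u) * del"
    using del C by auto
  ultimately have "n2 (\<lambda>z. w z - R z) < d \<and>
      \<bar>(LINT z|lebesgue. V z * u z * w z) - (LINT z|lebesgue. V z * u z * R z)\<bar> < d \<and>
      \<bar>(LINT z|lebesgue. V z * (w z)\<^sup>2) - (LINT z|lebesgue. V z * (R z)\<^sup>2)\<bar> < d"
    using n1 e1 e2 del(3) by linarith
  then show "\<exists>j. let w = (\<lambda>z. trunc e (\<phi> j z) (\<phi> k z)) in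
      n2 (\<lambda>z. w z - R z) < d \<and>
      \<bar>(LINT z|lebesgue. V z * u z * w z) - (LINT z|lebesgue. V z * u z * R z)\<bar> < d \<and>
      \<bar>(LINT z|lebesgue. V z * (w z)\<^sup>2) - (LINT z|lebesgue. V z * (R z)\<^sup>2)\<bar> < d"
    unfolding w_def Let_def by blast
qed

end

section \<open>Finiteness of the potential energy\<close>

context dirichlet_eigenfunction begin

text \<open>Membership in the operator domain gives the equation only against test functions, so
  integrability of V u^2 has to be proved. The truncations \<open>R k\<close> satisfy 0 \<le> u R_k
  \<le> 2 u^2 and tend to \<open>u\<close> almost everywhere; test functions \<open>w k\<close>
  close to them transfer the equation. Once V u^2 is integrable, its multiples dominate both limits.
  The price of this construction is that the \<open>w k\<close> are only known to be bounded in
  H^1.\<close>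

lemma finite_form_energy:
  obtains w where "\<And>k. test_function \<Omega> (w k)" "(\<lambda>k. n2 (\<lambda>z. w k z - u z)) \<longlonglongrightarrow> 0"
    "\<exists>M. \<forall>k. \<forall>b\<in>Basis. n2 (partial b (w k)) \<le> M"
    "integrable lebesgue (\<lambda>z. V z * (u z)\<^sup>2)"
    "(\<lambda>k. LINT z|lebesgue. V z * u z * w k z) \<longlonglongrightarrow> (LINT z|lebesgue. V z * (u z)\<^sup>2)"
    "(\<lambda>k. LINT z|lebesgue. V z * (w k z)\<^sup>2) \<longlonglongrightarrow> (LINT z|lebesgue. V z * (u z)\<^sup>2)"
proof -
  \<comment> \<open>The same null sequence regularises \<open>trunc\<close> and measures the
    distance of \<open>w k\<close> from \<open>R k\<close>.\<close>
  define e where "e = (\<lambda>k. inverse (real (Suc k)))"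
  have e: "0 < e k" for k by (simp add: e_def)
  have e0: "e \<longlonglongrightarrow> 0" unfolding e_def by (rule LIMSEQ_inverse_real_of_nat)
  define R where "R = (\<lambda>k z. trunc (e k) (u z) (\<phi> k z))"
  define good where "good = (\<lambda>k j. let w = (\<lambda>z. trunc (e k) (\<phi> j z) (\<phi> k z)) in
      n2 (\<lambda>z. w z - R k z) < e k \<and>
      \<bar>(LINT z|lebesgue. V z * u z * w z) - (LINT z|lebesgue. V z * u z * R k z)\<bar> < e k \<and>
      \<bar>(LINT z|lebesgue. V z * (w z)\<^sup>2) - (LINT z|lebesgue. V z * (R k z)\<^sup>2)\<bar> < e k)"
  have "\<exists>j. good k j" for k
    unfolding good_def R_def by (rule truncated_approximation_step(1)[OF e e])
  then obtain j where j: "\<And>k. good k (j k)" by metis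
  define w where "w = (\<lambda>k z. trunc (e k) (\<phi> (j k) z) (\<phi> k z))"
  have w: "n2 (\<lambda>z. w k z - R k z) < e k"
    "\<bar>(LINT z|lebesgue. V z * u z * w k z) - (LINT z|lebesgue. V z * u z * R k z)\<bar> < e k"
    "\<bar>(LINT z|lebesgue. V z * (w k z)\<^sup>2) - (LINT z|lebesgue. V z * (R k z)\<^sup>2)\<bar> < e k" for k
    using j[of k] unfolding good_def Let_def w_def by auto
  have iR: "integrable lebesgue (\<lambda>z. V z * u z * R k z)" "integrable lebesgue (\<lambda>z. V z * (R k z)\<^sup>2)" for k
    unfolding R_def by (rule truncated_approximation_step(2,3)[OF e zero_less_one])+
  have tw: "test_function \<Omega> (w k)" for k
  proof -
    obtain K where K: "smooth (\<phi> k)" "compact K" "K \<subseteq> \<Omega>" "\<And>z. z \<notin> K \<Longrightarrow> \<phi> k z = 0"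
      using test_functionE[OF \<phi>[of k]] by metis
    show ?thesis
      unfolding w_def
      by (rule test_functionI[OF trunc_partial(1)[OF e test_function_smooth[OF \<phi>] K(1)] K(2,3)]) (simp add: K(4))
  qed
  have Rle: "\<bar>R k z\<bar> \<le> 2 * \<bar>u z\<bar>" for k z unfolding R_def by (rule trunc_le[OF e])
  have [measurable]: "R k \<in> borel_measurable lebesgue" for k unfolding R_def trunc_def by measurable
  have sR: "sqint (R k)" for k by (rule sqint_bound(1)[OF _ sqint_cmult[OF u, of 2]]) (use Rle in \<open>auto simp: abs_mult\<close>)
  have R_AE: "AE z in lebesgue. (\<lambda>k. R k z) \<longlonglongrightarrow> u z"
    using \<phi>_AE by (rule AE_mp) (rule AE_I2, unfold R_def, intro impI trunc_tendsto e0)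
  have usq: "integrable lebesgue (\<lambda>z. (u z)\<^sup>2)" using u by (simp add: sqint_def)
  have "(\<lambda>k. LINT z|lebesgue. (R k z - u z)\<^sup>2) \<longlonglongrightarrow> (LINT z|(lebesgue :: ('x \<times> 'y) measure). 0)"
  proof (rule integral_dominated_convergence[where w="\<lambda>z. 9 * (u z)\<^sup>2"])
    show "AE z in lebesgue. (\<lambda>k. (R k z - u z)\<^sup>2) \<longlonglongrightarrow> 0"
      using R_AE
    proof (rule AE_mp, intro AE_I2 impI)
      fix z assume "(\<lambda>k. R k z) \<longlonglongrightarrow> u z"
      then have "(\<lambda>k. (R k z - u z)\<^sup>2) \<longlonglongrightarrow> (u z - u z)\<^sup>2" by (intro tendsto_intros)
      then show "(\<lambda>k. (R k z - u z)\<^sup>2) \<longlonglongrightarrow> 0" by simp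
    qed
    show "AE z in lebesgue. norm ((R k z - u z)\<^sup>2) \<le> 9 * (u z)\<^sup>2" for k
    proof (rule AE_I2)
      fix z :: "'x \<times> 'y"
      have "\<bar>R k z - u z\<bar> \<le> \<bar>3 * u z\<bar>" using Rle[of k z] by (simp add: abs_mult)
      then have "(R k z - u z)\<^sup>2 \<le> (3 * u z)\<^sup>2" by (simp only: abs_le_square_iff)
      then show "norm ((R k z - u z)\<^sup>2) \<le> 9 * (u z)\<^sup>2" by (simp add: power_mult_distrib)
    qed
  qed (use usq in auto)
  then have "(\<lambda>k. n2 (\<lambda>z. R k z - u z)) \<longlonglongrightarrow> sqrt 0"
    unfolding n2_def by (intro tendsto_real_sqrt) simp
  then have Ru: "(\<lambda>k. n2 (\<lambda>z. R k z - u z)) \<longlonglongrightarrow> 0" by simp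
  have sw: "sqint (w k)" for k by (rule sqint_test_function[OF tw])
  have wu: "(\<lambda>k. n2 (\<lambda>z. w k z - u z)) \<longlonglongrightarrow> 0"
  proof (rule tendsto_sandwich[of "\<lambda>k. 0" _ _ "\<lambda>k. e k + n2 (\<lambda>z. R k z - u z)"])
    have "n2 (\<lambda>z. w k z - u z) \<le> e k + n2 (\<lambda>z. R k z - u z)" for k
      using n2_triangle[OF sqint_diff[OF sw sR] sqint_diff[OF sR u], of k k k] w(1)[of k] by simp
    then show "\<forall>\<^sub>F k in sequentially. n2 (\<lambda>z. w k z - u z) \<le> e k + n2 (\<lambda>z. R k z - u z)" by simp
    show "(\<lambda>k. e k + n2 (\<lambda>z. R k z - u z)) \<longlonglongrightarrow> 0" using tendsto_add[OF e0 Ru] by simp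
  qed auto
  obtain M where M: "\<And>k b. b \<in> Basis \<Longrightarrow> n2 (partial b (\<phi> k)) \<le> M" "0 \<le> M" by (rule partial_bounded) blast
  have wM: "n2 (partial b (w k)) \<le> 4 * M" if b: "b \<in> Basis" for k b
  proof -
    let ?g = "\<lambda>z. 2 * \<bar>partial b (\<phi> (j k)) z\<bar> + 2 * \<bar>partial b (\<phi> k) z\<bar>"
    have s1: "sqint (\<lambda>z. 2 * \<bar>partial b (\<phi> i) z\<bar>)" for i by (intro sqint_cmult sqint_abs sqp \<phi>)
    have "\<bar>partial b (w k) z\<bar> \<le> \<bar>?g z\<bar>" for z
      unfolding w_def using trunc_partial(2)[OF e[of k] test_function_smooth[OF \<phi>[of "j k"]] test_function_smooth[OF \<phi>[of k]], where h=b and z=z]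
      by (rule order_trans[OF _ abs_ge_self])
    then have "n2 (partial b (w k)) \<le> n2 ?g"
      by (intro sqint_bound(2) sqint_add s1) (use sqp[OF tw[of k], of b] in \<open>auto simp: sqint_def\<close>)
    also have "\<dots> \<le> 2 * n2 (partial b (\<phi> (j k))) + 2 * n2 (partial b (\<phi> k))"
      using n2_triangle[OF s1 s1, of "j k" k] by (simp add: n2_cmult n2_abs)
    also have "\<dots> \<le> 4 * M" using M(1)[OF b, of k] M(1)[OF b, of "j k"] by linarith
    finally show ?thesis .
  qed
  text \<open>The equation tested with \<open>w\<close> bounds the potential energy; Fatou's lemma then applies
    because \<open>u * R k\<close> is nonnegative.\<close>
  have Bw: "\<bar>B (w k)\<bar> \<le> (\<Sum>b\<in>Basis. n2 (D b) * (4 * M))" for k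
    unfolding B_def
    by (rule order_trans[OF sum_abs], rule sum_mono, rule order_trans[OF Cauchy_Schwarz_n2[OF D sqp[OF tw]]])
       (auto intro!: mult_left_mono wM)
  obtain N where N: "\<And>k. n2 (w k) \<le> N" by (rule n2_bounded[OF sw u wu]) blast
  define P where "P = \<bar>lam\<bar> * (n2 u * N) + (\<Sum>b\<in>Basis. n2 (D b) * (4 * M)) + 1"
  have P: "(LINT z|lebesgue. V z * u z * R k z) \<le> P" for k
  proof -
    have "\<bar>LINT z|lebesgue. u z * w k z\<bar> \<le> n2 u * N"
      by (rule order_trans[OF Cauchy_Schwarz_n2[OF u sw] mult_left_mono[OF N]]) simp
    then have "\<bar>lam * (LINT z|lebesgue. u z * w k z)\<bar> \<le> \<bar>lam\<bar> * (n2 u * N)"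
      unfolding abs_mult by (rule mult_left_mono) simp
    moreover have "e k \<le> 1" by (simp add: e_def field_simps)
    ultimately show ?thesis
      using weak_equation[OF tw[of k]] w(2)[of k] Bw[of k] unfolding P_def by linarith
  qed
  have nonneg: "0 \<le> V z * u z * R k z" for k z
    using mult_nonneg_nonneg[OF V_nonneg trunc_sign[OF e]] unfolding R_def by (simp add: mult.assoc)
  have iV: "integrable lebesgue (\<lambda>z. V z * (u z)\<^sup>2)"
  proof (rule integrableI_nonneg)
    have "AE z in lebesgue. liminf (\<lambda>k. ennreal (V z * u z * R k z)) = ennreal (V z * (u z)\<^sup>2)"
      using R_AE
    proof (rule AE_mp, intro AE_I2 impI)
      fix z assume "(\<lambda>k. R k z) \<longlonglongrightarrow> u z"
      then have "(\<lambda>k. V z * u z * R k z) \<longlonglongrightarrow> V z * u z * u z" by (intro tendsto_intros)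
      then have "(\<lambda>k. ennreal (V z * u z * R k z)) \<longlonglongrightarrow> ennreal (V z * (u z)\<^sup>2)"
        by (intro tendsto_ennrealI) (simp add: power2_eq_square mult.assoc)
      then show "liminf (\<lambda>k. ennreal (V z * u z * R k z)) = ennreal (V z * (u z)\<^sup>2)"
        by (rule lim_imp_Liminf[OF trivial_limit_sequentially])
    qed
    then have "(\<integral>\<^sup>+ z. ennreal (V z * (u z)\<^sup>2) \<partial>lebesgue) = (\<integral>\<^sup>+ z. liminf (\<lambda>k. ennreal (V z * u z * R k z)) \<partial>lebesgue)"
      by (intro nn_integral_cong_AE) (auto simp: eq_commute)
    also have "\<dots> \<le> liminf (\<lambda>k. \<integral>\<^sup>+ z. ennreal (V z * u z * R k z) \<partial>lebesgue)"
      by (rule nn_integral_liminf) measurable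
    also have "\<dots> \<le> liminf (\<lambda>k. ennreal P)"
    proof (rule Liminf_mono, rule always_eventually, rule allI)
      fix k
      have "(\<integral>\<^sup>+ z. ennreal (V z * u z * R k z) \<partial>lebesgue) = ennreal (LINT z|lebesgue. V z * u z * R k z)"
        by (rule nn_integral_eq_integral[OF iR(1)]) (simp add: nonneg)
      also have "\<dots> \<le> ennreal P" by (rule ennreal_leI[OF P])
      finally show "(\<integral>\<^sup>+ z. ennreal (V z * u z * R k z) \<partial>lebesgue) \<le> ennreal P" .
    qed
    also have "\<dots> < \<infinity>" by (simp add: Liminf_const)
    finally show "(\<integral>\<^sup>+ z. ennreal (V z * (u z)\<^sup>2) \<partial>lebesgue) < \<infinity>" .
  qed (use V_nonneg in auto)
  have l1: "(\<lambda>k. LINT z|lebesgue. V z * u z * R k z) \<longlonglongrightarrow> (LINT z|lebesgue. V z * (u z)\<^sup>2)"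
  proof (rule integral_dominated_convergence[where w="\<lambda>z. 2 * (V z * (u z)\<^sup>2)"])
    show "AE z in lebesgue. (\<lambda>k. V z * u z * R k z) \<longlonglongrightarrow> V z * (u z)\<^sup>2"
      using R_AE
    proof (rule AE_mp, intro AE_I2 impI)
      fix z assume "(\<lambda>k. R k z) \<longlonglongrightarrow> u z"
      then have "(\<lambda>k. V z * u z * R k z) \<longlonglongrightarrow> V z * u z * u z" by (intro tendsto_intros)
      then show "(\<lambda>k. V z * u z * R k z) \<longlonglongrightarrow> V z * (u z)\<^sup>2" by (simp add: power2_eq_square mult.assoc)
    qed
    show "AE z in lebesgue. norm (V z * u z * R k z) \<le> 2 * (V z * (u z)\<^sup>2)" for k
    proof (rule AE_I2)
      fix z :: "'x \<times> 'y"
      have "V z * \<bar>u z\<bar> * \<bar>R k z\<bar> \<le> V z * \<bar>u z\<bar> * (2 * \<bar>u z\<bar>)" using Rle V_nonneg by (intro mult_left_mono) auto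
      also have "\<dots> = 2 * (V z * (u z)\<^sup>2)" by (simp add: power2_eq_square mult_ac flip: abs_mult)
      finally show "norm (V z * u z * R k z) \<le> 2 * (V z * (u z)\<^sup>2)" using V_nonneg[of z] by (simp add: abs_mult)
    qed
  qed (use iV in auto)
  have l2: "(\<lambda>k. LINT z|lebesgue. V z * (R k z)\<^sup>2) \<longlonglongrightarrow> (LINT z|lebesgue. V z * (u z)\<^sup>2)"
  proof (rule integral_dominated_convergence[where w="\<lambda>z. 4 * (V z * (u z)\<^sup>2)"])
    show "AE z in lebesgue. (\<lambda>k. V z * (R k z)\<^sup>2) \<longlonglongrightarrow> V z * (u z)\<^sup>2"
      using R_AE by (rule AE_mp) (intro AE_I2 impI tendsto_intros)
    show "AE z in lebesgue. norm (V z * (R k z)\<^sup>2) \<le> 4 * (V z * (u z)\<^sup>2)" for k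
    proof (rule AE_I2)
      fix z :: "'x \<times> 'y"
      have "\<bar>R k z\<bar> \<le> \<bar>2 * u z\<bar>" using Rle[of k z] by (simp add: abs_mult)
      then have "(R k z)\<^sup>2 \<le> (2 * u z)\<^sup>2" by (simp only: abs_le_square_iff)
      then have "V z * (R k z)\<^sup>2 \<le> V z * (2 * u z)\<^sup>2" using V_nonneg by (rule mult_left_mono)
      then show "norm (V z * (R k z)\<^sup>2) \<le> 4 * (V z * (u z)\<^sup>2)" using V_nonneg[of z] by (simp add: abs_mult power_mult_distrib)
    qed
  qed (use iV in auto)
  have close: "f \<longlonglongrightarrow> l" if "g \<longlonglongrightarrow> l" "\<And>k. \<bar>f k - g k\<bar> < e k" for f g :: "nat \<Rightarrow> real" and l
  proof -
    have "(\<lambda>k. f k - g k) \<longlonglongrightarrow> 0"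
      by (rule tendsto_rabs_zero_cancel, rule tendsto_sandwich[OF _ _ tendsto_const e0])
         (use that(2) less_imp_le in \<open>auto intro!: always_eventually\<close>)
    from tendsto_add[OF this that(1)] show ?thesis by simp
  qed
  show ?thesis
    by (rule that[OF tw wu _ iV close[OF l1 w(2)] close[OF l2 w(3)]]) (use wM in blast)
qed

lemma integral_gsq:
  assumes "test_function \<Omega> f" shows "(LINT z|lebesgue. gsq f z) = (\<Sum>b\<in>Basis. (n2 (partial b f))\<^sup>2)"
  unfolding gsq_def n2_sq
  by (rule Bochner_Integration.integral_sum) (rule sqint_integrable_sq[OF sqp[OF assms]])

lemma n2_partial_le:
  assumes "test_function \<Omega> f" "b \<in> Basis" shows "(n2 (partial b f))\<^sup>2 \<le> (LINT z|lebesgue. gsq f z)"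
  unfolding integral_gsq[OF assms(1)] by (rule member_le_sum) (use assms in auto)

section \<open>Testing the equation with the deformed approximations\<close>

context
  fixes t :: real assumes t: "0 < t" "t \<le> 1 / (2 * real DIM('x))"
begin

lemma t_facts: "0 \<le> t" "t \<le> 1/2" "4 * (real DIM('x))\<^sup>2 * t\<^sup>2 \<le> 1" "t\<^sup>2 \<le> 1"
proof -
  show t0: "0 \<le> t" using t by simp
  show th: "t \<le> 1/2" by (rule t_half(1)[OF t0 t(2)])
  have "t * real DIM('x) \<le> 1/2" by (rule t_half(2)[OF t0 t(2)])
  then have "(t * real DIM('x))\<^sup>2 \<le> (1/2)\<^sup>2" using t0 by (intro power_mono) auto
  then show "4 * (real DIM('x))\<^sup>2 * t\<^sup>2 \<le> 1" by (simp add: power_mult_distrib power2_eq_square mult_ac)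
  show "t\<^sup>2 \<le> 1" using t0 th by (simp add: power_le_one)
qed

lemma test_deform: "test_function \<Omega> f \<Longrightarrow> test_function \<Omega> (deform t f)"
  by (rule test_function_deform[OF _ star t_facts(1,2)])

lemma deform_linear: "deform t (\<lambda>z. f z - g z) = (\<lambda>z. deform t f z - deform t g z)"
  by (simp add: deform_def fun_eq_iff right_diff_distrib)

lemma n2_deform_le:
  assumes f: "test_function \<Omega> f" shows "n2 (deform t f) \<le> 2 * n2 f"
proof -
  have "(n2 (deform t f))\<^sup>2 \<le> (n2 f)\<^sup>2 + 4 * (real DIM('x))\<^sup>2 * t\<^sup>2 * (n2 f)\<^sup>2"
    using deform_L2_norm[OF t_facts(1) t(2) test_function_mono[OF f subset_UNIV]] unfolding n2_sq by linarith
  also have "\<dots> \<le> (n2 f)\<^sup>2 + 1 * (n2 f)\<^sup>2" using t_facts(3) by (intro add_left_mono mult_right_mono) auto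
  also have "\<dots> \<le> (2 * n2 f)\<^sup>2" by (simp add: power_mult_distrib)
  finally show ?thesis by (rule power2_le_imp_le) simp
qed

text \<open>Supplies the gradient bounds that are needed to pass to limits after deforming, as in
  \<open>B_tendsto_zero\<close>.\<close>

lemma deform_gradient_bounded:
  assumes f: "\<And>k. test_function \<Omega> (f k)" and M: "\<And>k b. b \<in> Basis \<Longrightarrow> n2 (partial b (f k)) \<le> M" and N: "\<And>k. n2 (f k) \<le> N"
  obtains M' where "\<And>k b. b \<in> Basis \<Longrightarrow> n2 (partial b (\<lambda>z. deform t (f k) z - f k z)) \<le> M'"
proof -
  define Q where "Q = 2 * (real DIM('x \<times> 'y) * M\<^sup>2) + (real DIM('x) + 2)\<^sup>2 * N\<^sup>2"
  show ?thesis
  proof (rule that[of "sqrt Q + M"])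
    fix k and b :: "'x \<times> 'y" assume b: "b \<in> Basis"
    have td: "test_function \<Omega> (deform t (f k))" by (rule test_deform[OF f])
    have E: "(LINT z|lebesgue. gsq (f k) z) \<le> real DIM('x \<times> 'y) * M\<^sup>2"
    proof -
      have "(LINT z|lebesgue. gsq (f k) z) \<le> (\<Sum>b\<in>(Basis :: ('x \<times> 'y) set). M\<^sup>2)"
        unfolding integral_gsq[OF f] by (intro sum_mono power_mono M) auto
      then show ?thesis by simp
    qed
    have E0: "0 \<le> (LINT z|lebesgue. gsq (f k) z)" by (rule integral_nonneg_AE) simp
    have A0: "0 \<le> (LINT z|lebesgue. jap z ^ 7 * (f k z)\<^sup>2)" by (rule integral_nonneg_AE) (simp add: jap_pos less_imp_le)
    have N2: "(n2 (f k))\<^sup>2 \<le> N\<^sup>2" by (intro power_mono N) simp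
    have "(n2 (partial b (deform t (f k))))\<^sup>2 \<le> (LINT z|lebesgue. gsq (deform t (f k)) z)" by (rule n2_partial_le[OF td b])
    also have "\<dots> \<le> (1 + 4 * (real DIM('x))\<^sup>2 * t\<^sup>2) * (LINT z|lebesgue. gsq (f k) z)
        + (real DIM('x) + 2)\<^sup>2 * t\<^sup>2 * (n2 (f k))\<^sup>2 - 15 / 512 * t * (LINT z|lebesgue. jap z ^ 7 * (f k z)\<^sup>2)"
      using deform_energy[OF dim t_facts(1) t(2) test_function_mono[OF f subset_UNIV]] unfolding n2_sq .
    also have "\<dots> \<le> (1 + 1) * (LINT z|lebesgue. gsq (f k) z) + (real DIM('x) + 2)\<^sup>2 * 1 * N\<^sup>2 - 0"
      using t_facts E0 A0 N2 by (intro diff_mono add_mono mult_mono) auto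
    also have "\<dots> \<le> Q" unfolding Q_def using E by simp
    finally have "n2 (partial b (deform t (f k))) \<le> sqrt Q" by (rule real_le_rsqrt)
    moreover have "n2 (partial b (\<lambda>z. deform t (f k) z - f k z)) \<le> n2 (partial b (deform t (f k))) + n2 (partial b (f k))"
      unfolding partial_diff[OF test_function_smooth[OF td] test_function_smooth[OF f]]
      by (rule n2_triangle_diff[OF sqp[OF td] sqp[OF f]])
    ultimately show "n2 (partial b (\<lambda>z. deform t (f k) z - f k z)) \<le> sqrt Q + M" using M[OF b, of k] by linarith
  qed
qed

lemma V_square_integrable:
  assumes "test_function \<Omega> f" shows "integrable lebesgue (\<lambda>z. V z * (f z)\<^sup>2)"
proof -
  obtain K where K: "smooth f" "compact K" "K \<subseteq> \<Omega>" "\<And>z. z \<notin> K \<Longrightarrow> f z = 0"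
    using test_functionE[OF assms] by metis
  show ?thesis
    by (rule integrable_mult_test_function[OF V_measurable K(2) V_bounded[OF K(2,3)] smooth_continuous[OF smooth_power[OF K(1)]]])
       (simp add: K(4))
qed

text \<open>\<open>damp_sq_le_jac\<close> and the sign of \<open>V\<close> reduce the claim to the
  transported integral with \<open>jac\<close>, which decreases along the flow. For test functions
  all integrals extend over a compact part of the domain, where \<open>V\<close> is bounded.\<close>

lemma V_deform_le:
  assumes f: "test_function \<Omega> f"
  shows "(LINT z|lebesgue. V z * (deform t f z)\<^sup>2) \<le> (1 + 4 * (real DIM('x))\<^sup>2 * t\<^sup>2) * (LINT z|lebesgue. V z * (f z)\<^sup>2)"
proof -
  obtain K where K: "smooth f" "compact K" "K \<subseteq> \<Omega>" "\<And>z. z \<notin> K \<Longrightarrow> f z = 0"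
    using test_functionE[OF f] by metis
  let ?C = "xhull K"
  have C: "compact ?C" "bounded (V ` ?C)" "?C \<subseteq> \<Omega>"
    using compact_xhull[OF K(2)] xhull_subset[OF star K(3)] V_bounded by auto
  have s2: "test_function \<Omega> (\<lambda>z. (f z)\<^sup>2)"
    unfolding power2_eq_square by (rule test_function_mult(1)[OF f K(1)])
  have out: "(f (pull s z))\<^sup>2 = 0" if "0 \<le> s" "s \<le> t" "z \<notin> ?C" for s z
    using pull_in_xhull[of s z K] that t_facts(2) K(4)[of "pull s z"] by auto
  have fl: "(LINT z|lebesgue. V z * ((f (pull t z))\<^sup>2 * jac t z)) \<le> (LINT z|lebesgue. V z * (f z)\<^sup>2)"
    by (rule flow_decreasing[OF V_measurable C test_function_mono[OF s2 subset_UNIV] _ t_facts(1) _ out V_repulsive])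
       (use t_facts in auto)
  have i: "integrable lebesgue (\<lambda>z. V z * ((f (pull t z))\<^sup>2 * jac t z))"
    by (rule integrable_mult_test_function[OF V_measurable C(1,2) 
          smooth_continuous[OF smooth_mult[OF smooth_comp_pull[OF test_function_smooth[OF s2]] smooth_jac]]])
       (use out t_facts in simp)
  have "(LINT z|lebesgue. V z * (deform t f z)\<^sup>2) \<le> (LINT z|lebesgue. (1 + 4 * (real DIM('x))\<^sup>2 * t\<^sup>2) * (V z * ((f (pull t z))\<^sup>2 * jac t z)))"
  proof (rule integral_mono[OF V_square_integrable[OF test_deform[OF f]] integrable_mult_right[OF i]])
    fix z
    have "(damp t z)\<^sup>2 * (f (pull t z))\<^sup>2 \<le> (1 + 4 * (real DIM('x))\<^sup>2 * t\<^sup>2) * jac t z * (f (pull t z))\<^sup>2"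
      by (intro mult_right_mono damp_sq_le_jac[OF t_facts(1) t(2)]) simp
    then have "V z * ((damp t z)\<^sup>2 * (f (pull t z))\<^sup>2) \<le> V z * ((1 + 4 * (real DIM('x))\<^sup>2 * t\<^sup>2) * jac t z * (f (pull t z))\<^sup>2)"
      by (rule mult_left_mono[OF _ V_nonneg])
    then show "V z * (deform t f z)\<^sup>2 \<le> (1 + 4 * (real DIM('x))\<^sup>2 * t\<^sup>2) * (V z * ((f (pull t z))\<^sup>2 * jac t z))"
      by (simp add: deform_def power_mult_distrib mult_ac)
  qed
  also have "\<dots> = (1 + 4 * (real DIM('x))\<^sup>2 * t\<^sup>2) * (LINT z|lebesgue. V z * ((f (pull t z))\<^sup>2 * jac t z))" by simp
  also have "\<dots> \<le> (1 + 4 * (real DIM('x))\<^sup>2 * t\<^sup>2) * (LINT z|lebesgue. V z * (f z)\<^sup>2)"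
    by (rule mult_left_mono[OF fl]) simp
  finally show ?thesis .
qed

text \<open>Young's inequality with equal weights. For \<open>f\<close> the deformed
  \<open>w k\<close> the right side is bounded by a quantity tending to the energy of
  \<open>u\<close> plus O(t^2), so nothing is lost at first order.\<close>

lemma V_mixed:
  assumes f: "test_function \<Omega> f" and iu: "integrable lebesgue (\<lambda>z. V z * (u z)\<^sup>2)"
  shows "integrable lebesgue (\<lambda>z. V z * u z * f z)"
    and "(LINT z|lebesgue. V z * u z * f z) \<le> (LINT z|lebesgue. V z * (u z)\<^sup>2) / 2 + (LINT z|lebesgue. V z * (f z)\<^sup>2) / 2"
proof -
  have le: "\<bar>V z * u z * f z\<bar> \<le> (V z * (u z)\<^sup>2) / 2 + (V z * (f z)\<^sup>2) / 2" for z
  proof -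
    have "\<bar>u z\<bar> * \<bar>f z\<bar> \<le> ((u z)\<^sup>2 + (f z)\<^sup>2) / 2" using sum_squares_bound[of "\<bar>u z\<bar>" "\<bar>f z\<bar>"] by simp
    then have "V z * (\<bar>u z\<bar> * \<bar>f z\<bar>) \<le> V z * (((u z)\<^sup>2 + (f z)\<^sup>2) / 2)" by (rule mult_left_mono[OF _ V_nonneg])
    then show ?thesis using V_nonneg[of z] by (simp add: abs_mult algebra_simps add_divide_distrib)
  qed
  have iR: "integrable lebesgue (\<lambda>z. (V z * (u z)\<^sup>2) / 2 + (V z * (f z)\<^sup>2) / 2)"
    using iu V_square_integrable[OF f] by simp
  have [measurable]: "f \<in> borel_measurable lebesgue" by (rule smooth_measurable[OF test_function_smooth[OF f]])
  show i: "integrable lebesgue (\<lambda>z. V z * u z * f z)"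
  proof (rule Bochner_Integration.integrable_bound[OF iR])
    show "AE z in lebesgue. norm (V z * u z * f z) \<le> norm ((V z * (u z)\<^sup>2) / 2 + (V z * (f z)\<^sup>2) / 2)"
      using order_trans[OF le abs_ge_self] by (intro AE_I2) simp
  qed measurable
  have "(LINT z|lebesgue. V z * u z * f z) \<le> (LINT z|lebesgue. (V z * (u z)\<^sup>2) / 2 + (V z * (f z)\<^sup>2) / 2)"
    by (rule integral_mono[OF i iR]) (rule order_trans[OF abs_ge_self le])
  also have "\<dots> = (LINT z|lebesgue. V z * (u z)\<^sup>2) / 2 + (LINT z|lebesgue. V z * (f z)\<^sup>2) / 2"
    using iu V_square_integrable[OF f] by simp
  finally show "(LINT z|lebesgue. V z * u z * f z) \<le> (LINT z|lebesgue. V z * (u z)\<^sup>2) / 2 + (LINT z|lebesgue. V z * (f z)\<^sup>2) / 2" .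
qed

text \<open>Convexity: x (y - x) \<le> (y^2 - x^2) / 2 turns the linear expression from testing the
  equation into the difference of energies that \<open>deform_energy\<close> estimates.\<close>

lemma deform_gradient_term:
  assumes f: "test_function \<Omega> f"
  shows "(\<Sum>b\<in>Basis. LINT z|lebesgue. partial b f z * partial b (\<lambda>z. deform t f z - f z) z)
    \<le> ((LINT z|lebesgue. gsq (deform t f) z) - (LINT z|lebesgue. gsq f z)) / 2"
proof -
  have td: "test_function \<Omega> (deform t f)" by (rule test_deform[OF f])
  have "(LINT z|lebesgue. partial b f z * partial b (\<lambda>z. deform t f z - f z) z) \<le> ((n2 (partial b (deform t f)))\<^sup>2 - (n2 (partial b f))\<^sup>2) / 2" for b
  proof -
    note i = sqint_integrable_sq[OF sqp[OF td, of b]] sqint_integrable_sq[OF sqp[OF f, of b]]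
    have "(LINT z|lebesgue. partial b f z * partial b (\<lambda>z. deform t f z - f z) z)
        \<le> (LINT z|lebesgue. ((partial b (deform t f) z)\<^sup>2 - (partial b f z)\<^sup>2) / 2)"
    proof (rule integral_mono)
      show "integrable lebesgue (\<lambda>z. partial b f z * partial b (\<lambda>z. deform t f z - f z) z)"
        by (intro sqint_mult sqp f test_function_diff td)
      show "integrable lebesgue (\<lambda>z. ((partial b (deform t f) z)\<^sup>2 - (partial b f z)\<^sup>2) / 2)" using i by simp
      fix z
      have "x * (y - x) \<le> (y\<^sup>2 - x\<^sup>2) / 2" for x y :: real
        using zero_le_power2[of "y - x"] by (simp add: power2_eq_square algebra_simps)
      then show "partial b f z * partial b (\<lambda>z. deform t f z - f z) z \<le> ((partial b (deform t f) z)\<^sup>2 - (partial b f z)\<^sup>2) / 2"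
        unfolding partial_diff[OF test_function_smooth[OF td] test_function_smooth[OF f]] .
    qed
    also have "\<dots> = ((n2 (partial b (deform t f)))\<^sup>2 - (n2 (partial b f))\<^sup>2) / 2" unfolding n2_sq using i by simp
    finally show ?thesis .
  qed
  then have "(\<Sum>b\<in>Basis. LINT z|lebesgue. partial b f z * partial b (\<lambda>z. deform t f z - f z) z)
    \<le> (\<Sum>b\<in>Basis. ((n2 (partial b (deform t f)))\<^sup>2 - (n2 (partial b f))\<^sup>2) / 2)" by (rule sum_mono)
  then show ?thesis
    unfolding integral_gsq[OF td] integral_gsq[OF f] sum_subtractf[symmetric] sum_divide_distrib[symmetric] .
qed

text \<open>With T f for the deformed f, polarisation writes the integrand as half of (T f)^2 - f^2
  - (T f - f)^2. The first difference integrates to O(t^2) by conservation of mass, the last square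
  by the displacement estimate.\<close>

lemma deform_mass_term:
  assumes f: "test_function \<Omega> f"
  shows "\<bar>LINT z|lebesgue. f z * (deform t f z - f z)\<bar> 
    \<le> t\<^sup>2 / 2 * (12 * (LINT z|lebesgue. gsq f z) + 8 * (real DIM('x))\<^sup>2 * (n2 f)\<^sup>2)"
proof -
  have td: "test_function \<Omega> (deform t f)" by (rule test_deform[OF f])
  have tx: "test_function \<Omega> (\<lambda>z. deform t f z - f z)" by (intro test_function_diff td f)
  note i = sqint_integrable_sq[OF sqint_test_function[OF td]] sqint_integrable_sq[OF sqint_test_function[OF f]] sqint_integrable_sq[OF sqint_test_function[OF tx]]
  have "(LINT z|lebesgue. f z * (deform t f z - f z)) = (LINT z|lebesgue. ((deform t f z)\<^sup>2 - (f z)\<^sup>2 - (deform t f z - f z)\<^sup>2) / 2)"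
    by (rule Bochner_Integration.integral_cong) (auto simp: power2_eq_square algebra_simps)
  also have "\<dots> = ((n2 (deform t f))\<^sup>2 - (n2 f)\<^sup>2 - (n2 (\<lambda>z. deform t f z - f z))\<^sup>2) / 2" unfolding n2_sq using i by simp
  finally have eq: "(LINT z|lebesgue. f z * (deform t f z - f z)) = ((n2 (deform t f))\<^sup>2 - (n2 f)\<^sup>2 - (n2 (\<lambda>z. deform t f z - f z))\<^sup>2) / 2" .
  note fU = test_function_mono[OF f subset_UNIV]
  have 1: "\<bar>(n2 (deform t f))\<^sup>2 - (n2 f)\<^sup>2\<bar> \<le> 4 * (real DIM('x))\<^sup>2 * t\<^sup>2 * (n2 f)\<^sup>2"
    using deform_L2_norm[OF t_facts(1) t(2) fU] unfolding n2_sq .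
  have 2: "(n2 (\<lambda>z. deform t f z - f z))\<^sup>2 \<le> t\<^sup>2 * (12 * (LINT z|lebesgue. gsq f z) + 4 * (real DIM('x))\<^sup>2 * (n2 f)\<^sup>2)"
    using deform_difference[OF t fU] unfolding n2_sq .
  have "\<bar>LINT z|lebesgue. f z * (deform t f z - f z)\<bar> \<le> (4 * (real DIM('x))\<^sup>2 * t\<^sup>2 * (n2 f)\<^sup>2 + t\<^sup>2 * (12 * (LINT z|lebesgue. gsq f z) + 4 * (real DIM('x))\<^sup>2 * (n2 f)\<^sup>2)) / 2"
  proof -
    have "\<bar>(p - q - r) / 2\<bar> \<le> (s1 + s2) / 2" if "\<bar>p - q\<bar> \<le> s1" "r \<le> s2" "0 \<le> r" for p q r s1 s2 :: real
      using that by (auto simp: abs_le_iff field_simps)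
    from this[OF 1 2 zero_le_power2] show ?thesis unfolding eq .
  qed
  also have "\<dots> = t\<^sup>2 / 2 * (12 * (LINT z|lebesgue. gsq f z) + 8 * (real DIM('x))\<^sup>2 * (n2 f)\<^sup>2)" by (simp add: algebra_simps)
  finally show ?thesis .
qed

text \<open>The equation is tested with the increment of \<open>w k\<close> under the deformation.
  The potential term is estimated on \<open>w k\<close>, the other terms on \<open>\<phi> k\<close>;
  the two sequences differ by one that is null in L2 and bounded in H^1, so the exchange costs only
  a null sequence. Then k tends to infinity with \<open>t\<close> fixed.\<close>

lemma main_inequality:
  defines "E \<equiv> (\<Sum>b\<in>Basis. (n2 (D b))\<^sup>2)" and "N \<equiv> (n2 u)\<^sup>2" and "P \<equiv> LINT z|lebesgue. V z * (u z)\<^sup>2"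
  shows "15 / 1024 * t * (LINT z|lebesgue. jap z ^ 7 * (u z)\<^sup>2) \<le> t\<^sup>2 * 
    (2 * (real DIM('x))\<^sup>2 * E + (real DIM('x) + 2)\<^sup>2 / 2 * N + \<bar>lam\<bar> / 2 * (12 * E + 8 * (real DIM('x))\<^sup>2 * N) + 2 * (real DIM('x))\<^sup>2 * P)"
proof -
  let ?n = "real DIM('x)"
  let ?T = "deform t"
  obtain w where w: "\<And>k. test_function \<Omega> (w k)" "(\<lambda>k. n2 (\<lambda>z. w k z - u z)) \<longlonglongrightarrow> 0"
    "\<exists>M. \<forall>k. \<forall>b\<in>Basis. n2 (partial b (w k)) \<le> M"
    "integrable lebesgue (\<lambda>z. V z * (u z)\<^sup>2)"
    "(\<lambda>k. LINT z|lebesgue. V z * u z * w k z) \<longlonglongrightarrow> P"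
    "(\<lambda>k. LINT z|lebesgue. V z * (w k z)\<^sup>2) \<longlonglongrightarrow> P"
    unfolding P_def by (rule finite_form_energy) blast
  obtain Mw where Mw: "\<And>k b. b \<in> Basis \<Longrightarrow> n2 (partial b (w k)) \<le> Mw" using w(3) by blast
  obtain M where M: "\<And>k b. b \<in> Basis \<Longrightarrow> n2 (partial b (\<phi> k)) \<le> M" by (rule partial_bounded) blast
  obtain N\<phi> where N\<phi>: "\<And>k. n2 (\<phi> k) \<le> N\<phi>" by (rule n2_bounded[OF sq\<phi> u \<phi>_L2]) blast
  have sw: "sqint (w k)" for k by (rule sqint_test_function[OF w(1)])
  define d where "d = (\<lambda>k z. w k z - \<phi> k z)"
  have td: "test_function \<Omega> (d k)" for k unfolding d_def by (intro test_function_diff w \<phi>)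
  have d0: "(\<lambda>k. n2 (d k)) \<longlonglongrightarrow> 0"
  proof (rule tendsto_sandwich[of "\<lambda>k. 0" _ _ "\<lambda>k. n2 (\<lambda>z. w k z - u z) + n2 (\<lambda>z. \<phi> k z - u z)"])
    have "n2 (d k) \<le> n2 (\<lambda>z. w k z - u z) + n2 (\<lambda>z. \<phi> k z - u z)" for k
      using n2_triangle_diff[OF sqint_diff[OF sw u] sqint_diff[OF sq\<phi> u], of k k] by (simp add: d_def)
    then show "\<forall>\<^sub>F k in sequentially. n2 (d k) \<le> n2 (\<lambda>z. w k z - u z) + n2 (\<lambda>z. \<phi> k z - u z)" by simp
    show "(\<lambda>k. n2 (\<lambda>z. w k z - u z) + n2 (\<lambda>z. \<phi> k z - u z)) \<longlonglongrightarrow> 0" using tendsto_add[OF w(2) \<phi>_L2] by simp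
  qed auto
  obtain Nd where Nd: "\<And>k. n2 (d k) \<le> Nd"
    using convergent_imp_Bseq[OF convergentI[OF d0]] by (metis BseqE abs_le_D1 real_norm_def)
  have dM: "n2 (partial b (d k)) \<le> Mw + M" if b: "b \<in> Basis" for k b
    unfolding d_def partial_diff[OF test_function_smooth[OF w(1)] test_function_smooth[OF \<phi>]]
    using n2_triangle_diff[OF sqp[OF w(1)[of k], of b] sqp[OF \<phi>[of k], of b]] Mw[OF b, of k] M[OF b, of k] by linarith
  \<comment> \<open>\<open>y\<close>, \<open>x\<close> and \<open>q\<close> are the increments under
    the deformation of \<open>d\<close>, \<open>\<phi>\<close> and \<open>w\<close>; by linearity
    \<open>q\<close> is the sum of \<open>x\<close> and \<open>y\<close>.\<close>
  define y where "y = (\<lambda>k z. ?T (d k) z - d k z)"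
  define x where "x = (\<lambda>k z. ?T (\<phi> k) z - \<phi> k z)"
  define q where "q = (\<lambda>k z. ?T (w k) z - w k z)"
  have ty: "test_function \<Omega> (y k)" and tx: "test_function \<Omega> (x k)" and tq: "test_function \<Omega> (q k)" for k
    unfolding y_def x_def q_def by (intro test_function_diff test_deform td \<phi> w)+
  have yq: "y k = (\<lambda>z. q k z - x k z)" for k
    unfolding y_def q_def x_def d_def deform_linear by (simp add: fun_eq_iff)
  obtain My where My: "\<And>k b. b \<in> Basis \<Longrightarrow> n2 (partial b (y k)) \<le> My"
    unfolding y_def by (rule deform_gradient_bounded[of d "Mw + M" Nd, OF td dM Nd]) blast+
  obtain Mx where Mx: "\<And>k b. b \<in> Basis \<Longrightarrow> n2 (partial b (x k)) \<le> Mx"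
    unfolding x_def by (rule deform_gradient_bounded[of \<phi> M N\<phi>, OF \<phi> M N\<phi>]) blast+
  have y0: "(\<lambda>k. n2 (y k)) \<longlonglongrightarrow> 0"
  proof (rule tendsto_sandwich[of "\<lambda>k. 0" _ _ "\<lambda>k. 3 * n2 (d k)"])
    have "n2 (y k) \<le> 3 * n2 (d k)" for k
      using n2_triangle_diff[OF sqint_test_function[OF test_deform[OF td]] sqint_test_function[OF td], of k k] n2_deform_le[OF td, of k]
      unfolding y_def by linarith
    then show "\<forall>\<^sub>F k in sequentially. n2 (y k) \<le> 3 * n2 (d k)" by simp
    show "(\<lambda>k. 3 * n2 (d k)) \<longlonglongrightarrow> 0" using tendsto_mult_left[OF d0, of 3] by simp
  qed auto
  have Nx: "n2 (x k) \<le> 3 * N\<phi>" for k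
    using n2_triangle_diff[OF sqint_test_function[OF test_deform[OF \<phi>]] sq\<phi>, of k k] n2_deform_le[OF \<phi>, of k] N\<phi>[of k]
    unfolding x_def by linarith
  define G where "G = (\<lambda>k. \<Sum>b\<in>Basis. LINT z|lebesgue. partial b (\<phi> k) z * partial b (x k) z)"
  have a0: "(\<lambda>k. B (y k)) \<longlonglongrightarrow> 0" by (rule B_tendsto_zero[OF ty My y0])
  have b0: "(\<lambda>k. B (x k) - G k) \<longlonglongrightarrow> 0"
  proof -
    have "B (x k) - G k = (\<Sum>b\<in>Basis. LINT z|lebesgue. (D b z - partial b (\<phi> k) z) * partial b (x k) z)" for k
      unfolding B_def G_def sum_subtractf[symmetric]
    proof (rule sum.cong[OF refl])
      fix b :: "'x \<times> 'y" assume b: "b \<in> Basis"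
      show "(LINT z|lebesgue. D b z * partial b (x k) z) - (LINT z|lebesgue. partial b (\<phi> k) z * partial b (x k) z)
         = (LINT z|lebesgue. (D b z - partial b (\<phi> k) z) * partial b (x k) z)"
        using sqint_mult[OF D[OF b] sqp[OF tx[of k], of b]] sqint_mult[OF sqp[OF \<phi>[of k], of b] sqp[OF tx[of k], of b]]
        by (simp add: left_diff_distrib)
    qed
    moreover have "(\<lambda>k. \<Sum>b\<in>Basis. LINT z|lebesgue. (D b z - partial b (\<phi> k) z) * partial b (x k) z) \<longlonglongrightarrow> 0"
    proof (rule tendsto_null_sum)
      fix b :: "'x \<times> 'y" assume b: "b \<in> Basis"
      have "(\<lambda>k. n2 (\<lambda>z. D b z - partial b (\<phi> k) z)) \<longlonglongrightarrow> 0" using \<phi>_D[OF b] by (subst n2_commute)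
      then show "(\<lambda>k. LINT z|lebesgue. (D b z - partial b (\<phi> k) z) * partial b (x k) z) \<longlonglongrightarrow> 0"
        by (rule integral_mult_tendsto_zero[OF sqint_diff[OF D[OF b] sqp[OF \<phi>]] sqp[OF tx] _ Mx[OF b]])
    qed
    ultimately show ?thesis by simp
  qed
  have c0: "(\<lambda>k. (LINT z|lebesgue. u z * q k z) - (LINT z|lebesgue. \<phi> k z * x k z)) \<longlonglongrightarrow> 0"
  proof -
    have e: "(LINT z|lebesgue. u z * q k z) - (LINT z|lebesgue. \<phi> k z * x k z)
        = (LINT z|lebesgue. y k z * u z) + (LINT z|lebesgue. (u z - \<phi> k z) * x k z)" for k
    proof -
      have s: "sqint (x k)" "sqint (q k)" "sqint (y k)" using tx tq ty sqint_test_function by blast+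
      note i = sqint_mult[OF u s(2)] sqint_mult[OF u s(1)] sqint_mult[OF sq\<phi>[of k] s(1)] 
      show ?thesis using i unfolding yq by (simp add: algebra_simps)
    qed
    have "(\<lambda>k. n2 (\<lambda>z. u z - \<phi> k z)) \<longlonglongrightarrow> 0" using \<phi>_L2 by (subst n2_commute)
    then have "(\<lambda>k. LINT z|lebesgue. (u z - \<phi> k z) * x k z) \<longlonglongrightarrow> 0"
      by (rule integral_mult_tendsto_zero[OF sqint_diff[OF u sq\<phi>] sqint_test_function[OF tx] _ Nx])
    moreover have "(\<lambda>k. LINT z|lebesgue. y k z * u z) \<longlonglongrightarrow> 0"
      by (rule integral_mult_tendsto_zero[OF sqint_test_function[OF ty] u y0 order_refl])
    ultimately show ?thesis unfolding e using tendsto_add by fastforce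
  qed
  define Ek where "Ek = (\<lambda>k. LINT z|lebesgue. gsq (\<phi> k) z)"
  define Nk where "Nk = (\<lambda>k. (n2 (\<phi> k))\<^sup>2)"
  define Ak where "Ak = (\<lambda>k. LINT z|lebesgue. jap z ^ 7 * (\<phi> k z)\<^sup>2)"
  define A where "A = (LINT z|lebesgue. jap z ^ 7 * (u z)\<^sup>2)"
  have Ek: "Ek \<longlonglongrightarrow> E"
    unfolding Ek_def E_def integral_gsq[OF \<phi>]
    by (intro tendsto_sum tendsto_power n2_tendsto[OF sqp[OF \<phi>] D \<phi>_D])
  have Nk: "Nk \<longlonglongrightarrow> N" unfolding Nk_def N_def by (intro tendsto_power n2_tendsto[OF sq\<phi> u \<phi>_L2])
  have Ak: "Ak \<longlonglongrightarrow> A"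
  proof (rule LIM_zero_cancel)
    let ?g = "\<lambda>k z. jap z ^ 7 * (\<phi> k z + u z)"
    have j: "0 \<le> jap z ^ 7" "jap z ^ 7 \<le> 1" for z :: "'x \<times> 'y" using jap_pos[of z] jap_le_1[of z] by (auto simp: power_le_one)
    have jm [measurable]: "(jap :: 'x \<times> 'y \<Rightarrow> real) \<in> borel_measurable lebesgue" by (rule smooth_measurable[OF smooth_jap])
    have jb: "\<bar>jap z ^ 7 * c\<bar> \<le> \<bar>c\<bar>" for z :: "'x \<times> 'y" and c using mult_right_mono[OF j(2)[of z], of "\<bar>c\<bar>"] j(1)[of z] by (simp add: abs_mult)
    have sg: "sqint (?g k)" "n2 (?g k) \<le> n2 (\<lambda>z. \<phi> k z + u z)" for k
      by (rule sqint_bound[OF _ sqint_add[OF sq\<phi> u] jb], measurable)+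
    have "n2 (?g k) \<le> N\<phi> + n2 u" for k
      using sg(2)[of k] n2_triangle[OF sq\<phi> u, of k] N\<phi>[of k] by linarith
    then have "(\<lambda>k. LINT z|lebesgue. (\<phi> k z - u z) * ?g k z) \<longlonglongrightarrow> 0"
      by (rule integral_mult_tendsto_zero[OF sqint_diff[OF sq\<phi> u] sg(1) \<phi>_L2])
    moreover have "(LINT z|lebesgue. (\<phi> k z - u z) * ?g k z) = Ak k - A" for k
    proof -
      have s: "sqint (\<lambda>z. jap z ^ 7 * f z)" if "sqint f" for f :: "'x \<times> 'y \<Rightarrow> real"
      proof (rule sqint_bound(1)[OF _ that jb])
        have [measurable]: "f \<in> borel_measurable lebesgue" using that by (simp add: sqint_def)
        show "(\<lambda>z. jap z ^ 7 * f z) \<in> borel_measurable lebesgue" by measurable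
      qed
      have "(LINT z|lebesgue. (\<phi> k z - u z) * ?g k z) = (LINT z|lebesgue. (jap z ^ 7 * \<phi> k z) * \<phi> k z - (jap z ^ 7 * u z) * u z)"
        by (rule Bochner_Integration.integral_cong) (auto simp: algebra_simps)
      also have "\<dots> = (LINT z|lebesgue. (jap z ^ 7 * \<phi> k z) * \<phi> k z) - (LINT z|lebesgue. (jap z ^ 7 * u z) * u z)"
        by (rule Bochner_Integration.integral_diff) (intro sqint_mult s sq\<phi> u)+
      finally show ?thesis unfolding Ak_def A_def by (simp add: power2_eq_square mult.assoc)
    qed
    ultimately show "(\<lambda>k. Ak k - A) \<longlonglongrightarrow> 0" by simp
  qed
  define Uk where "Uk = (\<lambda>k. LINT z|lebesgue. V z * u z * w k z)"
  define Wk where "Wk = (\<lambda>k. LINT z|lebesgue. V z * (w k z)\<^sup>2)"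
  define err where "err = (\<lambda>k. B (y k) + (B (x k) - G k) - lam * ((LINT z|lebesgue. u z * q k z) - (LINT z|lebesgue. \<phi> k z * x k z)))"
  \<comment> \<open>Everything that converges is an argument of \<open>X\<close>, which is
    continuous, so a single limit finishes the proof. In the limit the potential terms become P / 2
    + P / 2 - P plus O(t^2).\<close>
  define X where "X = (\<lambda>e E' N' A' W' U'. e + ((4 * ?n\<^sup>2 * t\<^sup>2) * E' + (?n + 2)\<^sup>2 * t\<^sup>2 * N' - 15 / 512 * t * A') / 2
      + (P / 2 + (1 + 4 * ?n\<^sup>2 * t\<^sup>2) * W' / 2 - U') + \<bar>lam\<bar> * (t\<^sup>2 / 2 * (12 * E' + 8 * ?n\<^sup>2 * N')))"
  have ge: "0 \<le> X (err k) (Ek k) (Nk k) (Ak k) (Wk k) (Uk k)" for k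
  proof -
    have eq: "B (q k) + (LINT z|lebesgue. V z * u z * q k z) = lam * (LINT z|lebesgue. u z * q k z)" by (rule weak_equation[OF tq])
    have Bq: "B (q k) = B (y k) + B (x k)" using B_diff[OF tq tx, of k k] by (simp add: yq)
    have g: "G k \<le> ((4 * ?n\<^sup>2 * t\<^sup>2) * Ek k + (?n + 2)\<^sup>2 * t\<^sup>2 * Nk k - 15 / 512 * t * Ak k) / 2"
      using deform_gradient_term[OF \<phi>, of k] deform_energy[OF dim t_facts(1) t(2) test_function_mono[OF \<phi> subset_UNIV], of k]
      unfolding G_def x_def Ek_def Nk_def Ak_def n2_sq by (simp add: algebra_simps)
    have "\<bar>lam * (LINT z|lebesgue. \<phi> k z * x k z)\<bar> \<le> \<bar>lam\<bar> * (t\<^sup>2 / 2 * (12 * Ek k + 8 * ?n\<^sup>2 * Nk k))"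
      unfolding abs_mult[of lam] x_def Ek_def Nk_def by (rule mult_left_mono[OF deform_mass_term[OF \<phi>]]) simp
    then have l: "- (lam * (LINT z|lebesgue. \<phi> k z * x k z)) \<le> \<bar>lam\<bar> * (t\<^sup>2 / 2 * (12 * Ek k + 8 * ?n\<^sup>2 * Nk k))" by linarith
    have "(LINT z|lebesgue. V z * u z * q k z) = (LINT z|lebesgue. V z * u z * ?T (w k) z) - Uk k"
      unfolding Uk_def q_def right_diff_distrib
      by (rule Bochner_Integration.integral_diff[OF V_mixed(1)[OF test_deform[OF w(1)] w(4)] V_mixed(1)[OF w(1) w(4)]])
    moreover have "(LINT z|lebesgue. V z * u z * ?T (w k) z) \<le> P / 2 + (LINT z|lebesgue. V z * (?T (w k) z)\<^sup>2) / 2"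
      unfolding P_def by (rule V_mixed(2)[OF test_deform[OF w(1)] w(4)])
    moreover have "(LINT z|lebesgue. V z * (?T (w k) z)\<^sup>2) \<le> (1 + 4 * ?n\<^sup>2 * t\<^sup>2) * Wk k"
      unfolding Wk_def by (rule V_deform_le[OF w(1)])
    ultimately have v: "(LINT z|lebesgue. V z * u z * q k z) \<le> P / 2 + (1 + 4 * ?n\<^sup>2 * t\<^sup>2) * Wk k / 2 - Uk k" by linarith
    have "0 = err k + G k + (LINT z|lebesgue. V z * u z * q k z) - lam * (LINT z|lebesgue. \<phi> k z * x k z)"
      unfolding err_def using eq Bq by (simp add: right_diff_distrib)
    also have "\<dots> \<le> X (err k) (Ek k) (Nk k) (Ak k) (Wk k) (Uk k)"
      unfolding X_def using g l v by linarith
    finally show ?thesis .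
  qed
  have "err \<longlonglongrightarrow> 0 + 0 - lam * 0"
    unfolding err_def by (intro tendsto_intros a0 b0 c0)
  then have e0: "err \<longlonglongrightarrow> 0" by simp
  have "(\<lambda>k. X (err k) (Ek k) (Nk k) (Ak k) (Wk k) (Uk k)) \<longlonglongrightarrow> X 0 E N A P P"
    unfolding X_def by (intro tendsto_intros e0 Ek Nk Ak w(5,6)[folded Uk_def Wk_def]) auto
  then have "0 \<le> X 0 E N A P P" by (rule LIMSEQ_le_const) (use ge in auto)
  moreover have "X 0 E N A P P = t\<^sup>2 * (2 * ?n\<^sup>2 * E + (?n + 2)\<^sup>2 / 2 * N + \<bar>lam\<bar> / 2 * (12 * E + 8 * ?n\<^sup>2 * N) + 2 * ?n\<^sup>2 * P)
      - 15 / 1024 * t * A"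
    unfolding X_def by (simp add: field_simps)
  ultimately show ?thesis unfolding A_def[symmetric] by simp
qed

end

text \<open>Dividing \<open>main_inequality\<close> by \<open>t\<close> and letting \<open>t\<close>
  tend to 0 annihilates the weighted norm, and the weight \<open>jap z ^ 7\<close> is positive
  everywhere.\<close>

theorem eigenfunction_zero: "AE z in lebesgue. u z = 0"
proof -
  define A where "A = (LINT z|lebesgue. jap z ^ 7 * (u z)\<^sup>2)"
  define Q where "Q = 2 * (real DIM('x))\<^sup>2 * (\<Sum>b\<in>Basis. (n2 (D b))\<^sup>2) + (real DIM('x) + 2)\<^sup>2 / 2 * (n2 u)\<^sup>2 
     + \<bar>lam\<bar> / 2 * (12 * (\<Sum>b\<in>Basis. (n2 (D b))\<^sup>2) + 8 * (real DIM('x))\<^sup>2 * (n2 u)\<^sup>2) + 2 * (real DIM('x))\<^sup>2 * (LINT z|lebesgue. V z * (u z)\<^sup>2)"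
  have le: "15 / 1024 * A \<le> t * Q" if t: "0 < t" "t \<le> 1 / (2 * real DIM('x))" for t
  proof -
    have "t * (15 / 1024 * A) \<le> t * (t * Q)"
      using main_inequality[OF t] unfolding A_def Q_def by (simp add: power2_eq_square mult_ac)
    then show ?thesis using t by simp
  qed
  have "15 / 1024 * A \<le> 0 * Q"
  proof (rule tendsto_le[OF _ _ tendsto_const])
    show "((\<lambda>t. t * Q) \<longlongrightarrow> 0 * Q) (at_right 0)" by (intro tendsto_intros)
    have "0 < 1 / (2 * real DIM('x))" using DIM_positive[where 'a='x] by simp
    then show "\<forall>\<^sub>F t in at_right 0. 15 / 1024 * A \<le> t * Q"
      unfolding eventually_at_right_field using le less_imp_le by blast
  qed simp
  then have "A \<le> 0" by simp
  moreover have i: "integrable lebesgue (\<lambda>z. jap z ^ 7 * (u z)\<^sup>2)"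
  proof (rule Bochner_Integration.integrable_bound[OF sqint_integrable_sq[OF u]])
    have [measurable]: "(jap :: 'x \<times> 'y \<Rightarrow> real) \<in> borel_measurable lebesgue" by (rule smooth_measurable[OF smooth_jap])
    show "(\<lambda>z. jap z ^ 7 * (u z)\<^sup>2) \<in> borel_measurable lebesgue" by measurable
    show "AE z in lebesgue. norm (jap z ^ 7 * (u z)\<^sup>2) \<le> norm ((u z)\<^sup>2)"
    proof (rule AE_I2)
      fix z :: "'x \<times> 'y"
      have "jap z ^ 7 \<le> 1" using jap_pos[of z] jap_le_1[of z] by (simp add: power_le_one)
      then have "jap z ^ 7 * (u z)\<^sup>2 \<le> 1 * (u z)\<^sup>2" by (rule mult_right_mono) simp
      then show "norm (jap z ^ 7 * (u z)\<^sup>2) \<le> norm ((u z)\<^sup>2)" using jap_pos[of z] by (simp add: abs_mult)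
    qed
  qed
  moreover have nn: "0 \<le> jap z ^ 7 * (u z)\<^sup>2" for z :: "'x \<times> 'y" using jap_pos[of z] by simp
  then have "0 \<le> A" unfolding A_def by (intro integral_nonneg_AE) simp
  ultimately have "A = 0" by simp
  then have "AE z in lebesgue. jap z ^ 7 * (u z)\<^sup>2 = 0"
    using integral_nonneg_eq_0_iff_AE[OF i] nn unfolding A_def by simp
  then show ?thesis
  proof (rule AE_mp, intro AE_I2 impI)
    fix z assume "jap z ^ 7 * (u z)\<^sup>2 = 0"
    then show "u z = 0" using jap_pos[of z] by simp
  qed
qed

end

section \<open>Smooth bumps on boxes and the fundamental lemma of the calculus of variations\<close>

section \<open>Bump functions\<close>

text \<open>The functions t^-m exp (-1/t) form a family whose derivatives are linear combinations of
  its members, so smoothness follows by induction for all m at once. The bumps are built from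
  \<open>flat 0\<close>.\<close>

definition flat :: "nat \<Rightarrow> real \<Rightarrow> real" where
  "flat m t = (if 0 < t then inverse t ^ m * exp (- inverse t) else 0)"

lemma flat_right_tendsto: "(flat m \<longlongrightarrow> 0) (at_right 0)"
proof -
  have "((\<lambda>x. inverse x ^ m / exp (inverse x)) \<longlongrightarrow> (0::real)) (at_right 0)"
    by (rule filterlim_compose[OF tendsto_power_div_exp_0 filterlim_inverse_at_top_right])
  then show ?thesis
  proof (rule Lim_transform_eventually)
    show "\<forall>\<^sub>F x in at_right 0. inverse x ^ m / exp (inverse x) = flat m x"
      using eventually_at_right_less[of 0] by eventually_elim (simp add: flat_def exp_minus divide_inverse)
  qed
qed

lemma flat_DERIV: "(flat m has_real_derivative (flat (Suc (Suc m)) t - real m * flat (Suc m) t)) (at t)"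
proof -
  consider "t < 0" | "t = 0" | "0 < t" by linarith
  then show ?thesis
  proof cases
    case 1
    have "((\<lambda>t. 0) has_real_derivative 0) (at t)" by simp
    then have "(flat m has_real_derivative 0) (at t)"
      by (rule has_field_derivative_transform_within_open[of _ _ _ "{..<0}"]) (use 1 in \<open>auto simp: flat_def\<close>)
    then show ?thesis using 1 by (simp add: flat_def)
  next
    case 2
    \<comment> \<open>At the origin the right-hand difference quotient of \<open>flat m\<close> is
      \<open>flat (Suc m)\<close>.\<close>
    have "((\<lambda>h. flat m h / h) \<longlongrightarrow> 0) (at 0)"
    proof (rule filterlim_split_at)
      show "((\<lambda>h. flat m h / h) \<longlongrightarrow> 0) (at_left 0)"
        by (rule Lim_transform_eventually[OF tendsto_const[of 0]]) (simp add: eventually_at_filter flat_def)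
      show "((\<lambda>h. flat m h / h) \<longlongrightarrow> 0) (at_right 0)"
        by (rule Lim_transform_eventually[OF flat_right_tendsto[of "Suc m"]])
           (use eventually_at_right_less[of 0] in \<open>eventually_elim, simp add: flat_def divide_inverse\<close>)
    qed
    then show ?thesis using 2 by (simp add: has_field_derivative_iff flat_def)
  next
    case 3
    have "((\<lambda>t. inverse t ^ m * exp (- inverse t)) has_real_derivative
        inverse t ^ m * (exp (- inverse t) * - (- (inverse t * 1 * inverse t))) + (real m * (- (inverse t * 1 * inverse t) * inverse t ^ (m - Suc 0))) * exp (- inverse t)) (at t)"
      using 3 by (auto intro!: derivative_eq_intros simp: power2_eq_square)
    then have "((\<lambda>t. inverse t ^ m * exp (- inverse t)) has_real_derivative (flat (Suc (Suc m)) t - real m * flat (Suc m) t)) (at t)"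
      by (rule DERIV_cong) (use 3 in \<open>cases m; simp add: flat_def algebra_simps\<close>)
    then show ?thesis
      by (rule has_field_derivative_transform_within_open[of _ _ _ "{0<..}"]) (use 3 in \<open>auto simp: flat_def\<close>)
  qed
qed

lemma smooth_flat: "smooth (flat m)"
proof -
  have "Ck k (flat m)" for k
  proof (induction k arbitrary: m)
    case 0
    show ?case using DERIV_isCont[OF flat_DERIV] by (simp add: continuous_at_imp_continuous_on)
  next
    case (Suc k)
    have "(flat m has_derivative (\<lambda>h. h * (flat (Suc (Suc m)) t - real m * flat (Suc m) t))) (at t)" for t
      using flat_DERIV[of m t] by (simp add: has_field_derivative_def mult_commute_abs)
    then show ?case
      by (rule Ck_SucI) (intro Ck_mult Ck_diff Ck_const Suc.IH)
  qed
  then show ?thesis by (simp add: smooth_def)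
qed

lemma flat0_bounds: "0 \<le> flat 0 t" "flat 0 t \<le> 1" "0 < t \<Longrightarrow> 0 < flat 0 t" "t \<le> 0 \<Longrightarrow> flat 0 t = 0"
  by (auto simp: flat_def)

text \<open>A product over coordinates, so that it is positive exactly on an open box; boxes are
  what determines Lebesgue measure in \<open>AE_zero_of_test_functions\<close>.\<close>

definition bump :: "'a::euclidean_space \<Rightarrow> 'a \<Rightarrow> 'a \<Rightarrow> real" where
  "bump a b z = (\<Prod>i\<in>Basis. flat 0 (z \<bullet> i - a \<bullet> i) * flat 0 (b \<bullet> i - z \<bullet> i))"

lemma smooth_bump: "smooth (bump a b)"
  unfolding bump_def[abs_def]
  by (intro smooth_prod smooth_mult smooth_compose[OF smooth_flat] smooth_intros)

lemma bump_bounds: "0 \<le> bump a b z" "bump a b z \<le> 1"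
  unfolding bump_def by (auto intro!: prod_nonneg prod_le_1 mult_nonneg_nonneg mult_le_one simp: flat0_bounds)

lemma bump_pos: "z \<in> box a b \<Longrightarrow> 0 < bump a b z"
  unfolding bump_def by (auto intro!: prod_pos mult_pos_pos simp: flat0_bounds mem_box)

lemma bump_zero: assumes "z \<notin> box a b" shows "bump a b z = 0"
proof -
  obtain i where i: "i \<in> Basis" "\<not> (a \<bullet> i < z \<bullet> i \<and> z \<bullet> i < b \<bullet> i)" using assms by (auto simp: mem_box)
  then have "flat 0 (z \<bullet> i - a \<bullet> i) * flat 0 (b \<bullet> i - z \<bullet> i) = 0" by (auto simp: flat0_bounds(4) not_less)
  then show ?thesis unfolding bump_def using i(1) by (intro prod_zero) auto
qed

lemma test_function_bump:
  assumes "cbox a b \<subseteq> \<Omega>" shows "test_function \<Omega> (bump a b)"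
  by (rule test_functionI[OF smooth_bump compact_cbox assms]) (use bump_zero box_subset_cbox in blast)

text \<open>The powers of \<open>1 - bump\<close> tend to 0 on the box and equal 1 off it, so the
  indicator of a box is a bounded limit of test functions.\<close>

lemma box_indicator_limit:
  assumes "cbox a b \<subseteq> \<Omega>"
  shows "test_function \<Omega> (\<lambda>z. 1 - (1 - bump a b z) ^ k)"
    and "(\<lambda>k. 1 - (1 - bump a b z) ^ k) \<longlonglongrightarrow> indicator (box a b) z"
    and "\<bar>1 - (1 - bump a b z) ^ k\<bar> \<le> indicator (box a b) z"
proof -
  show "test_function \<Omega> (\<lambda>z. 1 - (1 - bump a b z) ^ k)"
  proof (rule test_functionI[OF _ compact_cbox assms])
    show "smooth (\<lambda>z. 1 - (1 - bump a b z) ^ k)" by (intro smooth_intros smooth_bump)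
    show "1 - (1 - bump a b z) ^ k = 0" if "z \<notin> cbox a b" for z
    proof -
      have "z \<notin> box a b" using that box_subset_cbox by blast
      then show ?thesis by (simp add: bump_zero)
    qed
  qed
  show "(\<lambda>k. 1 - (1 - bump a b z) ^ k) \<longlonglongrightarrow> indicator (box a b) z"
  proof (cases "z \<in> box a b")
    case True
    have "(\<lambda>k. (1 - bump a b z) ^ k) \<longlonglongrightarrow> 0"
      by (rule LIMSEQ_power_zero) (use bump_pos[OF True] bump_bounds[of a b z] in auto)
    from tendsto_diff[OF tendsto_const this, of 1] show ?thesis using True by simp
  qed (simp add: bump_zero)
  show "\<bar>1 - (1 - bump a b z) ^ k\<bar> \<le> indicator (box a b) z"
  proof (cases "z \<in> box a b")
    case True
    have "0 \<le> (1 - bump a b z) ^ k" "(1 - bump a b z) ^ k \<le> 1"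
      using bump_bounds[of a b z] by (auto intro: power_le_one)
    then show ?thesis using True by auto
  qed (simp add: bump_zero)
qed

text \<open>Uniqueness of Lebesgue measure: the measure with density 1 + h / D has the Lebesgue
  value on every box, hence it is Lebesgue measure and its density is 1 almost everywhere.
  \<open>D = C + 1\<close> keeps the density nonnegative and the denominator positive.\<close>

lemma AE_zero_of_test_functions:
  fixes h :: "'a::euclidean_space \<Rightarrow> real"
  assumes h [measurable]: "h \<in> borel_measurable borel" and C: "\<And>z. \<bar>h z\<bar> \<le> C"
    and 0: "\<And>\<eta>. test_function UNIV \<eta> \<Longrightarrow> (LINT z|lborel. h z * \<eta> z) = 0"
  shows "AE z in lborel. h z = 0"
proof -
  define D where "D = C + 1"
  have "0 \<le> C" using C[of undefined] by linarith
  then have D: "0 < D" "\<bar>h z\<bar> \<le> D" for z using C[of z] by (simp_all add: D_def)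
  have box: "(LINT z|lborel. h z * indicator (box a b) z) = 0" for a b
  proof -
    have "(\<lambda>k. LINT z|lborel. h z * (1 - (1 - bump a b z) ^ k)) \<longlonglongrightarrow> (LINT z|lborel. h z * indicator (box a b) z)"
    proof (rule integral_dominated_convergence[where w="\<lambda>z. D * indicator (cbox a b) z"])
      show "(\<lambda>z. h z * (1 - (1 - bump a b z) ^ k)) \<in> borel_measurable lborel" for k
        using borel_measurable_continuous_onI[OF smooth_continuous[OF smooth_bump[of a b]]] by measurable
      show "integrable lborel (\<lambda>z. D * indicator (cbox a b) z)"
        by (intro integrable_mult_right integrable_real_indicator emeasure_lborel_cbox_finite) simp
      show "AE z in lborel. (\<lambda>k. h z * (1 - (1 - bump a b z) ^ k)) \<longlonglongrightarrow> h z * indicator (box a b) z"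
        by (intro AE_I2 tendsto_mult_left box_indicator_limit(2)[of a b UNIV]) simp
      show "AE z in lborel. norm (h z * (1 - (1 - bump a b z) ^ k)) \<le> D * indicator (cbox a b) z" for k
      proof (rule AE_I2)
        fix z
        have "\<bar>h z\<bar> * \<bar>1 - (1 - bump a b z) ^ k\<bar> \<le> D * indicator (box a b) z"
          using D box_indicator_limit(3)[of a b UNIV z k] by (intro mult_mono) auto
        also have "\<dots> \<le> D * indicator (cbox a b) z"
          using D box_subset_cbox[of a b] by (intro mult_left_mono) (auto simp: indicator_def)
        finally show "norm (h z * (1 - (1 - bump a b z) ^ k)) \<le> D * indicator (cbox a b) z" by (simp add: abs_mult)
      qed
    qed simp
    moreover have "(LINT z|lborel. h z * (1 - (1 - bump a b z) ^ k)) = 0" for k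
      by (rule 0[OF box_indicator_limit(1)]) simp
    ultimately show ?thesis by (simp add: LIMSEQ_const_iff)
  qed
  let ?M = "density lborel (\<lambda>z. ennreal (1 + h z / D))"
  have nn: "0 \<le> 1 + h z / D" for z using D(2)[of z] D(1) by (simp add: field_simps abs_le_iff)
  have "lborel = ?M"
  proof (rule lborel_eqI)
    fix l u :: 'a assume lu: "\<And>b. b \<in> Basis \<Longrightarrow> l \<bullet> b \<le> u \<bullet> b"
    have ib: "integrable lborel (indicator (box l u) :: 'a \<Rightarrow> real)"
      by (intro integrable_real_indicator emeasure_lborel_box_finite) simp
    have ih: "integrable lborel (\<lambda>z. h z * indicator (box l u) z)"
    proof (rule Bochner_Integration.integrable_bound[OF integrable_mult_right[OF ib, of D]])
      show "AE z in lborel. norm (h z * indicator (box l u) z) \<le> norm (D * indicator (box l u) z)"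
        using D by (intro AE_I2) (simp add: abs_mult mult_right_mono)
    qed measurable
    have "emeasure ?M (box l u) = (\<integral>\<^sup>+z. ennreal (1 + h z / D) * indicator (box l u) z \<partial>lborel)"
      by (rule emeasure_density) simp_all
    also have "\<dots> = (\<integral>\<^sup>+z. ennreal (indicator (box l u) z + (1 / D) * (h z * indicator (box l u) z)) \<partial>lborel)"
      by (rule nn_integral_cong) (auto simp: indicator_def)
    also have "\<dots> = ennreal (LINT z|lborel. indicator (box l u) z + (1 / D) * (h z * indicator (box l u) z))"
    proof (rule nn_integral_eq_integral)
      show "integrable lborel (\<lambda>z. indicator (box l u) z + (1 / D) * (h z * indicator (box l u) z))"
        by (intro Bochner_Integration.integrable_add integrable_mult_right ib ih)
      show "AE z in lborel. 0 \<le> indicator (box l u) z + (1 / D) * (h z * indicator (box l u) z)"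
        using nn by (intro AE_I2) (simp add: indicator_def)
    qed
    also have "(LINT z|lborel. indicator (box l u) z + (1 / D) * (h z * indicator (box l u) z)) = (LINT z|lborel. indicator (box l u) z)"
      using ib ih box[of l u] by simp
    also have "\<dots> = (\<Prod>b\<in>Basis. (u - l) \<bullet> b)" using lu by (simp add: measure_def emeasure_lborel_box_eq inner_diff_left prod_nonneg)
    finally show "emeasure ?M (box l u) = (\<Prod>b\<in>Basis. (u - l) \<bullet> b)" .
  qed simp
  then have "density lborel (\<lambda>z. ennreal (1 + h z / D)) = density lborel (\<lambda>z. 1)" by (simp add: density_1)
  then have "AE z in lborel. ennreal (1 + h z / D) = 1"
    by (subst (asm) sigma_finite_measure.density_unique_iff[OF lborel.sigma_finite_measure_axioms]) auto
  then show ?thesis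
  proof (rule AE_mp, intro AE_I2 impI)
    fix z assume "ennreal (1 + h z / D) = 1"
    then have "1 + h z / D = 1" using nn[of z] by simp
    then show "h z = 0" using D by simp
  qed
qed

section \<open>Vitali coverings and slopes of monotone functions\<close>

section \<open>Monotone functions on the line\<close>

text \<open>Points interior to arbitrarily short intervals with property \<open>S\<close>. Placing
  both endpoints away from the point, instead of using difference quotients at it, makes slope
  conditions open in the point and the intervals a Vitali cover.\<close>

definition straddle :: "(real \<Rightarrow> real \<Rightarrow> bool) \<Rightarrow> real set" where
  "straddle S = {s. \<forall>n::nat. \<exists>u v. u < s \<and> s < v \<and> v - u < 1 / Suc n \<and> S u v}"

text \<open>Intervals are balls about their midpoints, so the Vitali covering theorem for balls
  selects disjoint ones that cover almost all of \<open>E\<close> within the given open set.\<close>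

lemma straddle_cover:
  assumes "E \<subseteq> straddle S" "open U" "E \<subseteq> U"
  obtains C where "countable C" "\<And>u v. (u, v) \<in> C \<Longrightarrow> u < v \<and> S u v \<and> {u<..<v} \<subseteq> U"
    "disjoint_family_on (\<lambda>(u, v). {u<..<v}) C" "negligible (E - (\<Union>(u, v)\<in>C. {u<..<v}))"
proof -
  define K where "K = {(u, v). u < v \<and> S u v \<and> {u<..<v} \<subseteq> U}"
  have ball: "ball ((fst i + snd i) / 2) ((snd i - fst i) / 2) = {fst i<..<snd i}" for i :: "real \<times> real"
    by (simp add: ball_eq_greaterThanLessThan field_simps add_divide_distrib[symmetric] diff_divide_distrib[symmetric])
  have "\<exists>i. i \<in> K \<and> x \<in> ball ((fst i + snd i) / 2) ((snd i - fst i) / 2) \<and> (snd i - fst i) / 2 < d"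
    if x: "x \<in> E" and d: "0 < d" for x d
  proof -
    obtain r where r: "0 < r" "ball x r \<subseteq> U" using assms(2,3) x openE by blast
    obtain n :: nat where n: "1 / Suc n < min d r" using d r by (metis nat_approx_posE min_less_iff_conj)
    obtain u v where uv: "u < x" "x < v" "v - u < 1 / Suc n" "S u v" using assms(1) x unfolding straddle_def by blast
    have "{u<..<v} \<subseteq> ball x r"
      using uv n by (auto simp: dist_real_def)
    then have "(u, v) \<in> K" using uv r by (auto simp: K_def)
    moreover have "(v - u) / 2 < d" using uv n by auto
    ultimately show ?thesis using uv by (intro exI[of _ "(u, v)"]) (simp only: ball, simp)
  qed
  from Vitali_covering_theorem_balls[of E K "\<lambda>i. (fst i + snd i) / 2" "\<lambda>i. (snd i - fst i) / 2", OF this]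
  obtain C where C: "countable C" "C \<subseteq> K"
    "pairwise (\<lambda>i j. disjnt (ball ((fst i + snd i) / 2) ((snd i - fst i) / 2)) (ball ((fst j + snd j) / 2) ((snd j - fst j) / 2))) C"
    "negligible (E - (\<Union>i\<in>C. ball ((fst i + snd i) / 2) ((snd i - fst i) / 2)))"
    by blast
  show ?thesis
  proof (rule that[OF C(1)])
    show "\<And>u v. (u, v) \<in> C \<Longrightarrow> u < v \<and> S u v \<and> {u<..<v} \<subseteq> U" using C(2) by (auto simp: K_def)
    show "disjoint_family_on (\<lambda>(u, v). {u<..<v}) C"
      using C(3) unfolding ball pairwise_def disjnt_def disjoint_family_on_def by (simp add: case_prod_beta)
    show "negligible (E - (\<Union>(u, v)\<in>C. {u<..<v}))" using C(4) unfolding ball by (simp add: case_prod_beta)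
  qed
qed

text \<open>By continuity the endpoints carry no mass, so open and closed intervals have equal
  measure.\<close>

lemma emeasure_interval_measure_Ioo:
  assumes "u < v" "mono F" "continuous_on UNIV F"
  shows "emeasure (interval_measure F) {u<..<v} = ennreal (F v - F u)"
proof (rule antisym)
  have m: "\<And>x y. x \<le> y \<Longrightarrow> F x \<le> F y" using assms(2) by (auto dest: monoD)
  have Icc: "emeasure (interval_measure F) {a..b} = ennreal (F b - F a)" if "a \<le> b" for a b
    by (rule emeasure_interval_measure_Icc[OF that m assms(3)])
  have "emeasure (interval_measure F) {u<..<v} \<le> emeasure (interval_measure F) {u..v}"
    by (intro emeasure_mono) auto
  then show "emeasure (interval_measure F) {u<..<v} \<le> ennreal (F v - F u)" using Icc[of u v] assms(1) by simp
  have "{u..v} = {u<..<v} \<union> ({u..u} \<union> {v..v})" using assms(1) by auto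
  then have "emeasure (interval_measure F) {u..v} \<le> emeasure (interval_measure F) {u<..<v} + emeasure (interval_measure F) ({u..u} \<union> {v..v})"
    using emeasure_subadditive[of "{u<..<v}" "interval_measure F" "{u..u} \<union> {v..v}"] by simp
  also have "\<dots> \<le> emeasure (interval_measure F) {u<..<v} + (emeasure (interval_measure F) {u..u} + emeasure (interval_measure F) {v..v})"
    by (intro add_left_mono emeasure_subadditive) auto
  finally have "emeasure (interval_measure F) {u..v} \<le> emeasure (interval_measure F) {u<..<v} + (emeasure (interval_measure F) {u..u} + emeasure (interval_measure F) {v..v})" .
  moreover have "emeasure (interval_measure F) {a..a} = 0" for a using Icc[of a a] by simp
  ultimately show "ennreal (F v - F u) \<le> emeasure (interval_measure F) {u<..<v}" using Icc[of u v] assms(1) by simp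
qed

lemma emeasure_union_intervals:
  assumes "countable C" "disjoint_family_on (\<lambda>(u, v). {u<..<v}) C" "sets M = sets borel"
  shows "emeasure M (\<Union>(u, v)\<in>C. {u<..<v::real}) = (\<integral>\<^sup>+ (u, v). emeasure M {u<..<v} \<partial>count_space C)"
proof -
  have "emeasure M (\<Union>i\<in>C. (\<lambda>(u, v). {u<..<v}) i) = (\<integral>\<^sup>+ i. emeasure M ((\<lambda>(u, v). {u<..<v}) i) \<partial>count_space C)"
    by (rule emeasure_UN_countable[OF _ assms(1,2)]) (auto simp: assms(3) split: prod.splits)
  then show ?thesis by (simp add: case_prod_unfold)
qed

lemma negligible_emeasure_lborel: "negligible S \<Longrightarrow> S \<in> sets borel \<Longrightarrow> emeasure lborel S = 0"
  by (simp add: negligible_iff_emeasure0 negligible_imp_sets)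

text \<open>Lebesgue's argument. Almost all of \<open>E\<close> is covered by disjoint intervals of
  slope below \<open>p\<close> in an open set barely larger than \<open>E\<close>, and then, inside
  these, by disjoint intervals of slope above \<open>q\<close>. Comparing Lebesgue measure with the
  measure of the increments of \<open>G\<close> yields q |E| \<le> p (|E| + e).\<close>

lemma monotone_straddle_null:
  fixes G :: "real \<Rightarrow> real"
  assumes G: "mono G" "continuous_on UNIV G" and pq: "0 \<le> p" "p < q"
    and E: "E \<in> sets borel" "bounded E"
    and up: "E \<subseteq> straddle (\<lambda>u v. q * (v - u) < G v - G u)" and down: "E \<subseteq> straddle (\<lambda>u v. G v - G u < p * (v - u))"
  shows "emeasure lborel E = 0"
proof -
  let ?\<nu> = "interval_measure G"
  have fin: "emeasure lborel E < \<infinity>" using E emeasure_bounded_finite by blast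
  then obtain x where x: "emeasure lborel E = ennreal x" "0 \<le> x" by (metis ennreal_cases infinity_ennreal_def less_irrefl)
  have "q * x \<le> p * (x + e)" if e: "0 < e" for e :: real
  proof -
    obtain O' where O': "open O'" "E \<subseteq> O'" "emeasure lborel (O' - E) < ennreal e"
      using outer_regular_lborel[OF E(1) e] by blast
    obtain C1 where C1: "countable C1" "\<And>u v. (u, v) \<in> C1 \<Longrightarrow> u < v \<and> G v - G u < p * (v - u) \<and> {u<..<v} \<subseteq> O'"
      "disjoint_family_on (\<lambda>(u, v). {u<..<v}) C1" "negligible (E - (\<Union>(u, v)\<in>C1. {u<..<v}))"
      by (rule straddle_cover[OF down O'(1,2)]) blast
    let ?U1 = "\<Union>(u, v)\<in>C1. {u<..<v}"
    have oU1: "open ?U1" by auto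
    \<comment> \<open>The second cover is taken inside \<open>?U1\<close>, so that its increments
      are part of those of the first cover.\<close>
    obtain C2 where C2: "countable C2" "\<And>u v. (u, v) \<in> C2 \<Longrightarrow> u < v \<and> q * (v - u) < G v - G u \<and> {u<..<v} \<subseteq> ?U1"
      "disjoint_family_on (\<lambda>(u, v). {u<..<v}) C2" "negligible (E \<inter> ?U1 - (\<Union>(u, v)\<in>C2. {u<..<v}))"
      by (rule straddle_cover[of "E \<inter> ?U1" _ ?U1, OF _ oU1]) (use up in blast)+
    let ?U2 = "\<Union>(u, v)\<in>C2. {u<..<v}"
    have bU: "?U1 \<in> sets borel" "?U2 \<in> sets borel" by (auto intro!: borel_open)
    have "E - ?U2 \<subseteq> (E - ?U1) \<union> (E \<inter> ?U1 - ?U2)" by blast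
    then have "negligible (E - ?U2)" using C1(4) C2(4) negligible_Un negligible_subset by blast
    moreover have "E - ?U2 \<in> sets borel" using E(1) bU(2) by (rule sets.Diff)
    ultimately have n0: "emeasure lborel (E - ?U2) = 0" by (rule negligible_emeasure_lborel)
    have "emeasure lborel E \<le> emeasure lborel (?U2 \<union> (E - ?U2))" using E bU by (intro emeasure_mono) auto
    also have "\<dots> \<le> emeasure lborel ?U2 + emeasure lborel (E - ?U2)" using E bU by (intro emeasure_subadditive) auto
    finally have mE: "emeasure lborel E \<le> emeasure lborel ?U2" using n0 by simp
    have q0: "0 \<le> q" using pq by simp
    have "ennreal q * emeasure lborel ?U2 = (\<integral>\<^sup>+ (u, v). ennreal q * emeasure lborel {u<..<v} \<partial>count_space C2)"
      by (subst emeasure_union_intervals[OF C2(1,3)]) (auto simp: nn_integral_cmult[symmetric] case_prod_unfold)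
    also have "\<dots> \<le> (\<integral>\<^sup>+ (u, v). emeasure ?\<nu> {u<..<v} \<partial>count_space C2)"
    proof (rule nn_integral_mono, clarsimp)
      fix u v assume uv: "(u, v) \<in> C2"
      have "ennreal q * ennreal (v - u) \<le> ennreal (G v - G u)"
        using C2(2)[OF uv] q0 by (auto simp: ennreal_mult[symmetric] intro!: ennreal_leI)
      then show "ennreal q * emeasure lborel {u<..<v} \<le> emeasure ?\<nu> {u<..<v}"
        using C2(2)[OF uv] emeasure_interval_measure_Ioo[OF _ G, of u v] by simp
    qed
    also have "\<dots> = emeasure ?\<nu> ?U2" by (rule emeasure_union_intervals[OF C2(1,3), symmetric]) simp
    also have "\<dots> \<le> emeasure ?\<nu> ?U1"
      using bU C2(2) by (intro emeasure_mono) (fastforce, simp)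
    also have "\<dots> = (\<integral>\<^sup>+ (u, v). emeasure ?\<nu> {u<..<v} \<partial>count_space C1)" by (rule emeasure_union_intervals[OF C1(1,3)]) simp
    also have "\<dots> \<le> (\<integral>\<^sup>+ (u, v). ennreal p * emeasure lborel {u<..<v} \<partial>count_space C1)"
    proof (rule nn_integral_mono, clarsimp)
      fix u v assume uv: "(u, v) \<in> C1"
      have "ennreal (G v - G u) \<le> ennreal p * ennreal (v - u)"
        using C1(2)[OF uv] pq by (auto simp: ennreal_mult[symmetric] intro!: ennreal_leI)
      then show "emeasure ?\<nu> {u<..<v} \<le> ennreal p * emeasure lborel {u<..<v}"
        using C1(2)[OF uv] emeasure_interval_measure_Ioo[OF _ G, of u v] by simp
    qed
    also have "\<dots> = ennreal p * emeasure lborel ?U1"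
      by (subst emeasure_union_intervals[OF C1(1,3)]) (auto simp: nn_integral_cmult[symmetric] case_prod_unfold)
    also have "\<dots> \<le> ennreal p * emeasure lborel O'"
      using O'(1) C1(2) by (intro mult_left_mono emeasure_mono) (fastforce, simp_all)
    also have "emeasure lborel O' \<le> emeasure lborel (E \<union> (O' - E))" using O' E by (intro emeasure_mono) auto
    also have "\<dots> \<le> emeasure lborel E + emeasure lborel (O' - E)" using O' E by (intro emeasure_subadditive) auto
    also have "\<dots> \<le> ennreal x + ennreal e" using x O'(3) by (intro add_mono) auto
    finally have "ennreal q * emeasure lborel ?U2 \<le> ennreal p * (ennreal x + ennreal e)" by (simp add: mult_left_mono)
    then have "ennreal q * ennreal x \<le> ennreal p * (ennreal x + ennreal e)"
      using mE x by (metis (no_types, lifting) mult_left_mono order_trans zero_le)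
    then have "ennreal (q * x) \<le> ennreal (p * (x + e))" using x e pq q0 by (simp add: ennreal_mult ennreal_plus)
    then show ?thesis using x e pq by (subst (asm) ennreal_le_iff) auto
  qed
  then have "q * x \<le> p * x + e" if e: "0 < e" for e
  proof -
    have "q * x \<le> p * (x + e / (p + 1))" using \<open>\<And>e. 0 < e \<Longrightarrow> q * x \<le> p * (x + e)\<close>[of "e / (p + 1)"] e pq by simp
    also have "\<dots> \<le> p * x + e" using e pq by (simp add: field_simps)
    finally show ?thesis .
  qed
  then have "q * x \<le> p * x" by (rule field_le_epsilon)
  then have "x = 0" using x pq by (metis mult_le_cancel_right not_less antisym_conv2 le_less)
  then show ?thesis using x by simp
qed

section \<open>Directional derivatives and differentiability almost everywhere\<close>

section \<open>Rademacher's theorem\<close>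

text \<open>The condition of \<open>straddle\<close> along the line through z in direction v,
  phrased as a condition on the point z of the whole space so that Fubini's theorem can be
  applied.\<close>

definition steep :: "('a::euclidean_space \<Rightarrow> real) \<Rightarrow> 'a \<Rightarrow> real \<Rightarrow> 'a set" where
  "steep f v q = {z. \<forall>n::nat. \<exists>s r. s < 0 \<and> 0 < r \<and> r - s < 1 / Suc n \<and> q * (r - s) < f (z + r *\<^sub>R v) - f (z + s *\<^sub>R v)}"

text \<open>The union over the real parameters s and r is uncountable, but its members are open;
  only the intersection over n has to be countable.\<close>

lemma steep_borel:
  assumes f: "continuous_on UNIV f" shows "steep f v q \<in> sets borel"
proof -
  have "open (\<Union>s\<in>{s. s < 0}. \<Union>r\<in>{r. 0 < r \<and> r - s < 1 / Suc n}. {z. q * (r - s) < f (z + r *\<^sub>R v) - f (z + s *\<^sub>R v)})" for n :: nat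
    by (intro open_UN ballI open_Collect_less continuous_intros continuous_on_compose2[OF f]) auto
  then have "(\<Inter>n::nat. (\<Union>s\<in>{s. s < 0}. \<Union>r\<in>{r. 0 < r \<and> r - s < 1 / Suc n}. {z. q * (r - s) < f (z + r *\<^sub>R v) - f (z + s *\<^sub>R v)})) \<in> sets borel"
    by (intro sets.countable_INT'') auto
  also have "(\<Inter>n::nat. (\<Union>s\<in>{s. s < 0}. \<Union>r\<in>{r. 0 < r \<and> r - s < 1 / Suc n}. {z. q * (r - s) < f (z + r *\<^sub>R v) - f (z + s *\<^sub>R v)})) = steep f v q"
    unfolding steep_def by blast
  finally show ?thesis .
qed

lemma steep_line:
  "z + t *\<^sub>R v \<in> steep f v q \<longleftrightarrow> t \<in> straddle (\<lambda>u w. q * (w - u) < f (z + w *\<^sub>R v) - f (z + u *\<^sub>R v))"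
proof
  assume L: "z + t *\<^sub>R v \<in> steep f v q"
  show "t \<in> straddle (\<lambda>u w. q * (w - u) < f (z + w *\<^sub>R v) - f (z + u *\<^sub>R v))"
    unfolding straddle_def
  proof (intro CollectI allI)
    fix n :: nat
    obtain s r where "s < 0" "0 < r" "r - s < 1 / Suc n" "q * (r - s) < f (z + t *\<^sub>R v + r *\<^sub>R v) - f (z + t *\<^sub>R v + s *\<^sub>R v)"
      using L unfolding steep_def by blast
    then show "\<exists>u w. u < t \<and> t < w \<and> w - u < 1 / Suc n \<and> q * (w - u) < f (z + w *\<^sub>R v) - f (z + u *\<^sub>R v)"
      by (intro exI[of _ "t + s"] exI[of _ "t + r"]) (simp add: scaleR_left_distrib add.assoc)
  qed
next
  assume R: "t \<in> straddle (\<lambda>u w. q * (w - u) < f (z + w *\<^sub>R v) - f (z + u *\<^sub>R v))"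
  show "z + t *\<^sub>R v \<in> steep f v q"
    unfolding steep_def
  proof (intro CollectI allI)
    fix n :: nat
    obtain u w where "u < t" "t < w" "w - u < 1 / Suc n" "q * (w - u) < f (z + w *\<^sub>R v) - f (z + u *\<^sub>R v)"
      using R unfolding straddle_def by blast
    then show "\<exists>s r. s < 0 \<and> 0 < r \<and> r - s < 1 / Suc n \<and> q * (r - s) < f (z + t *\<^sub>R v + r *\<^sub>R v) - f (z + t *\<^sub>R v + s *\<^sub>R v)"
      by (intro exI[of _ "u - t"] exI[of _ "w - t"]) (simp add: scaleR_left_diff_distrib)
  qed
qed

text \<open>Fubini without adapted coordinates: by translation invariance the measure of
  \<open>E\<close> is its average over the translates by t v with t in the unit interval, and
  exchanging the integrals leaves the measures of line sections.\<close>

lemma null_set_of_lines: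
  fixes E :: "'a::euclidean_space set"
  assumes E: "E \<in> sets borel" and null: "\<And>z. emeasure lborel {t \<in> {0..1}. z + t *\<^sub>R v \<in> E} = 0"
  shows "emeasure lborel E = 0"
proof -
  have [measurable]: "E \<in> sets borel" by fact
  have tr: "(\<integral>\<^sup>+z. indicator E (z + t *\<^sub>R v) \<partial>lborel) = emeasure lborel E" for t
  proof -
    have "emeasure lborel E = (\<integral>\<^sup>+z. indicator E z \<partial>distr lborel borel ((+) (t *\<^sub>R v)))"
      by (subst lborel_distr_plus) simp
    also have "\<dots> = (\<integral>\<^sup>+z. indicator E (t *\<^sub>R v + z) \<partial>lborel)" by (subst nn_integral_distr) auto
    finally show ?thesis by (simp add: add.commute)
  qed
  have "emeasure lborel E = (\<integral>\<^sup>+t. (\<integral>\<^sup>+z. indicator {0..1} t * indicator E (z + t *\<^sub>R v) \<partial>lborel) \<partial>lborel)"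
  proof -
    have "(\<integral>\<^sup>+z. indicator {0..1} t * indicator E (z + t *\<^sub>R v) \<partial>lborel) = indicator {0..1} t * emeasure lborel E" for t :: real
      by (subst nn_integral_cmult) (simp_all add: tr)
    then show ?thesis by (simp add: nn_integral_multc)
  qed
  also have "\<dots> = (\<integral>\<^sup>+z. (\<integral>\<^sup>+t. indicator {0..1} t * indicator E (z + t *\<^sub>R v) \<partial>lborel) \<partial>lborel)"
    by (rule lborel_pair.Fubini'[symmetric]) (simp add: case_prod_beta)
  also have "(\<lambda>z. \<integral>\<^sup>+t. indicator {0..1} t * indicator E (z + t *\<^sub>R v) \<partial>lborel) = (\<lambda>z. 0)"
  proof
    fix z
    have [measurable]: "{t \<in> {0..1}. z + t *\<^sub>R v \<in> E} \<in> sets borel" by measurable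
    have "(\<integral>\<^sup>+t. indicator {0..1} t * indicator E (z + t *\<^sub>R v) \<partial>lborel) = (\<integral>\<^sup>+t. indicator {t \<in> {0..1}. z + t *\<^sub>R v \<in> E} t \<partial>lborel)"
      by (rule nn_integral_cong) (auto simp: indicator_def)
    then show "(\<integral>\<^sup>+t. indicator {0..1} t * indicator E (z + t *\<^sub>R v) \<partial>lborel) = 0" using null[of z] by simp
  qed
  finally show ?thesis by simp
qed

text \<open>Adding M t with M = L |v| makes the restriction of \<open>f\<close> to a line
  nondecreasing and raises every slope by M, which reduces the claim to the one-dimensional
  case.\<close>

lemma Lipschitz_steep_null:
  fixes f :: "'a::euclidean_space \<Rightarrow> real"
  assumes f: "L-lipschitz_on UNIV f" and pq: "p < q"
  shows "emeasure lborel (steep f v q \<inter> steep (\<lambda>z. - f z) v (- p)) = 0"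
proof (rule null_set_of_lines[where v=v])
  have cf: "continuous_on UNIV f" using f lipschitz_on_continuous_on by blast
  then show sb: "steep f v q \<inter> steep (\<lambda>z. - f z) v (- p) \<in> sets borel"
    by (intro sets.Int steep_borel continuous_intros)
  fix z
  define M where "M = L * norm v"
  define g where "g = (\<lambda>t. f (z + t *\<^sub>R v))"
  define G where "G = (\<lambda>t. g t + M * t)"
  have L0: "0 \<le> L" using f lipschitz_on_nonneg by blast
  have gl: "\<bar>g a - g b\<bar> \<le> M * \<bar>a - b\<bar>" for a b
    using lipschitz_onD[OF f, of "z + a *\<^sub>R v" "z + b *\<^sub>R v"]
    unfolding g_def M_def by (simp add: dist_norm mult_ac flip: scaleR_left_diff_distrib)
  have mono: "mono G"
  proof (rule monoI)
    fix a b :: real assume "a \<le> b" then show "G a \<le> G b" using gl[of a b] by (simp add: G_def algebra_simps abs_le_iff)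
  qed
  have cont: "continuous_on UNIV G"
    unfolding G_def g_def by (intro continuous_intros continuous_on_compose2[OF cf]) auto
  let ?E = "{t \<in> {0..1}. z + t *\<^sub>R v \<in> steep f v q \<inter> steep (\<lambda>z. - f z) v (- p)}"
  have E: "?E \<in> sets borel" using sb by measurable
  have up: "?E \<subseteq> straddle (\<lambda>u w. (q + M) * (w - u) < G w - G u)"
    unfolding steep_line Int_iff straddle_def G_def g_def by (simp add: algebra_simps) blast
  have down: "?E \<subseteq> straddle (\<lambda>u w. G w - G u < (p + M) * (w - u))"
    unfolding steep_line Int_iff straddle_def G_def g_def by (simp add: algebra_simps) blast
  have bE: "bounded ?E" by (rule bounded_subset[of "{0..1}"]) auto
  show "emeasure lborel ?E = 0"
  proof (cases "0 \<le> p + M")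
    case True
    show ?thesis
      by (rule monotone_straddle_null[OF mono cont True _ E bE up down]) (use pq in simp)
  next
    \<comment> \<open>A nondecreasing function has no interval of negative slope, so the second
      straddle set is empty.\<close>
    case False
    have "straddle (\<lambda>u w. G w - G u < (p + M) * (w - u)) = {}"
    proof -
      have "\<not> G w - G u < (p + M) * (w - u)" if "u < w" for u w
      proof -
        have "(p + M) * (w - u) \<le> 0" using False that by (simp add: mult_le_0_iff)
        then show ?thesis using monoD[OF mono, of u w] that by linarith
      qed
      then show ?thesis unfolding straddle_def using less_trans by blast
    qed
    then have "?E = {}" using down by blast
    then show ?thesis by (simp only: emeasure_empty)
  qed
qed

text \<open>A steep interval with one endpoint at \<open>z\<close> becomes a straddling one when
  that endpoint is pushed slightly beyond \<open>z\<close>; continuity keeps the strict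
  inequality.\<close>

lemma steep_of_frequently:
  fixes f :: "'a::euclidean_space \<Rightarrow> real"
  assumes cf: "continuous_on UNIV f" and fr: "\<exists>\<^sub>F h in at 0. q < (f (z + h *\<^sub>R v) - f z) / h"
  shows "z \<in> steep f v q"
  unfolding steep_def
proof (intro CollectI allI)
  fix n :: nat
  have "\<forall>\<^sub>F h in at (0::real). dist h 0 < 1 / (2 * Suc n)" unfolding eventually_at by (rule exI[of _ "1 / (2 * Suc n)"]) simp
  from frequently_eventually_frequently[OF fr this] 
  have "\<exists>\<^sub>F h in at 0. q < (f (z + h *\<^sub>R v) - f z) / h \<and> dist h 0 < 1 / (2 * Suc n) \<and> h \<noteq> 0"
    using eventually_neq_at_within[of 0 0 UNIV] by (auto dest: frequently_eventually_frequently simp: conj_ac elim: frequently_rev_mp)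
  then obtain h where h: "q < (f (z + h *\<^sub>R v) - f z) / h" "\<bar>h\<bar> < 1 / (2 * Suc n)" "h \<noteq> 0"
    using frequently_ex by fastforce
  have cl: "((\<lambda>s. f (z + s *\<^sub>R v)) \<longlongrightarrow> f (z + 0 *\<^sub>R v)) (at 0)"
  proof -
    have "continuous_on UNIV (\<lambda>s. f (z + s *\<^sub>R v))"
      by (rule continuous_on_compose2[OF cf]) (auto intro!: continuous_intros)
    then have "isCont (\<lambda>s. f (z + s *\<^sub>R v)) 0" by (simp add: continuous_on_eq_continuous_at)
    then show ?thesis by (simp add: isCont_def)
  qed
  define e where "e = (1::real) / (2 * Suc n)"
  have e: "0 < e" "2 * e = 1 / Suc n" by (simp_all add: e_def field_simps)
  have he: "\<bar>h\<bar> < e" using h(2) by (simp only: e_def)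
  show "\<exists>s r. s < 0 \<and> 0 < r \<and> r - s < 1 / Suc n \<and> q * (r - s) < f (z + r *\<^sub>R v) - f (z + s *\<^sub>R v)"
  proof (cases "0 < h")
    case True
    have "((\<lambda>s. f (z + h *\<^sub>R v) - f (z + s *\<^sub>R v) - q * (h - s)) \<longlongrightarrow> f (z + h *\<^sub>R v) - f (z + 0 *\<^sub>R v) - q * (h - 0)) (at_left 0)"
      by (intro tendsto_intros filterlim_mono[OF cl]) (auto simp: at_within_le_at)
    moreover have "0 < f (z + h *\<^sub>R v) - f (z + 0 *\<^sub>R v) - q * (h - 0)" using h True by (simp add: field_simps)
    ultimately have "\<forall>\<^sub>F s in at_left 0. 0 < f (z + h *\<^sub>R v) - f (z + s *\<^sub>R v) - q * (h - s)" by (rule order_tendstoD(1))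
    moreover have "\<forall>\<^sub>F s in at_left (0::real). s \<in> {-e<..<0}" by (rule eventually_at_leftI[of "-e"]) (use e in auto)
    ultimately have "\<forall>\<^sub>F s in at_left (0::real). 0 < f (z + h *\<^sub>R v) - f (z + s *\<^sub>R v) - q * (h - s) \<and> s \<in> {-e<..<0}" by (rule eventually_conj)
    then obtain s where "0 < f (z + h *\<^sub>R v) - f (z + s *\<^sub>R v) - q * (h - s)" "s \<in> {-e<..<0}"
      using eventually_happens'[OF trivial_limit_at_left_real] by blast
    then show ?thesis using True he e(2) by (intro exI[of _ s] exI[of _ h]) auto
  next
    case False
    have "((\<lambda>s. f (z + s *\<^sub>R v) - f (z + h *\<^sub>R v) - q * (s - h)) \<longlongrightarrow> f (z + 0 *\<^sub>R v) - f (z + h *\<^sub>R v) - q * (0 - h)) (at_right 0)"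
      by (intro tendsto_intros filterlim_mono[OF cl]) (auto simp: at_within_le_at)
    moreover have "0 < f (z + 0 *\<^sub>R v) - f (z + h *\<^sub>R v) - q * (0 - h)" using h False by (simp add: field_simps)
    ultimately have "\<forall>\<^sub>F s in at_right 0. 0 < f (z + s *\<^sub>R v) - f (z + h *\<^sub>R v) - q * (s - h)" by (rule order_tendstoD(1))
    moreover have "\<forall>\<^sub>F s in at_right (0::real). s \<in> {0<..<e}" by (rule eventually_at_rightI[of _ e]) (use e in auto)
    ultimately have "\<forall>\<^sub>F s in at_right (0::real). 0 < f (z + s *\<^sub>R v) - f (z + h *\<^sub>R v) - q * (s - h) \<and> s \<in> {0<..<e}" by (rule eventually_conj)
    then obtain s where "0 < f (z + s *\<^sub>R v) - f (z + h *\<^sub>R v) - q * (s - h)" "s \<in> {0<..<e}"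
      using eventually_happens'[OF trivial_limit_at_right_real] by blast
    then show ?thesis using False he h(3) e(2) by (intro exI[of _ h] exI[of _ s]) auto
  qed
qed

text \<open>Were the lower limit of the difference quotients smaller than the upper one, two
  rationals p < q strictly between them would place \<open>z\<close> in one of countably many
  exceptional sets. The Lipschitz bound makes the common value finite.\<close>

lemma directional_derivative_exists:
  fixes f :: "'a::euclidean_space \<Rightarrow> real"
  assumes f: "L-lipschitz_on UNIV f"
    and nz: "\<And>p q. p < q \<Longrightarrow> z \<notin> steep f v (real_of_rat q) \<inter> steep (\<lambda>z. - f z) v (- real_of_rat p)"
  shows "\<exists>l. ((\<lambda>h. (f (z + h *\<^sub>R v) - f z) / h) \<longlongrightarrow> l) (at 0)"
proof -
  define Q where "Q = (\<lambda>h. (f (z + h *\<^sub>R v) - f z) / h)"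
  have cf: "continuous_on UNIV f" using f lipschitz_on_continuous_on by blast
  have Qb: "\<bar>Q h\<bar> \<le> L * norm v" for h
  proof (cases "h = 0")
    case False
    have "\<bar>f (z + h *\<^sub>R v) - f z\<bar> \<le> L * (\<bar>h\<bar> * norm v)"
      using lipschitz_onD[OF f, of "z + h *\<^sub>R v" z] by (simp add: dist_norm)
    then show ?thesis using False by (simp add: Q_def field_simps)
  qed (use lipschitz_on_nonneg[OF f] in \<open>simp add: Q_def\<close>)
  have le: "Limsup (at 0) (\<lambda>h. ereal (Q h)) \<le> Liminf (at 0) (\<lambda>h. ereal (Q h))"
  proof (rule ccontr)
    assume "\<not> ?thesis"
    then have "Liminf (at 0) (\<lambda>h. ereal (Q h)) < Limsup (at 0) (\<lambda>h. ereal (Q h))" by simp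
    from ereal_dense3[OF this] obtain p where p: "Liminf (at 0) (\<lambda>h. ereal (Q h)) < ereal (real_of_rat p)"
      "ereal (real_of_rat p) < Limsup (at 0) (\<lambda>h. ereal (Q h))" by blast
    from ereal_dense3[OF p(2)] obtain q where q: "ereal (real_of_rat p) < ereal (real_of_rat q)"
      "ereal (real_of_rat q) < Limsup (at 0) (\<lambda>h. ereal (Q h))" by blast
    have "\<exists>\<^sub>F h in at 0. real_of_rat q < Q h"
    proof (rule ccontr)
      assume "\<not> ?thesis"
      then have "\<forall>\<^sub>F h in at 0. ereal (Q h) \<le> ereal (real_of_rat q)" by (simp add: not_frequently not_less)
      from Limsup_bounded[OF this] show False using q(2) by simp
    qed
    then have "z \<in> steep f v (real_of_rat q)" unfolding Q_def by (rule steep_of_frequently[OF cf])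
    moreover have "\<exists>\<^sub>F h in at 0. Q h < real_of_rat p"
    proof (rule ccontr)
      assume "\<not> ?thesis"
      then have "\<forall>\<^sub>F h in at 0. ereal (real_of_rat p) \<le> ereal (Q h)" by (simp add: not_frequently not_less)
      from Liminf_bounded[OF this] show False using p(1) by simp
    qed
    then have "\<exists>\<^sub>F h in at 0. - real_of_rat p < (- f (z + h *\<^sub>R v) - - f z) / h"
      by (rule frequently_elim1) (simp add: Q_def divide_simps split: if_splits)
    then have "z \<in> steep (\<lambda>z. - f z) v (- real_of_rat p)"
      by (intro steep_of_frequently continuous_intros cf)
    ultimately show False using nz[of p q] q(1) by (simp add: of_rat_less)
  qed
  define l where "l = Liminf (at 0) (\<lambda>h. ereal (Q h))"
  have lim: "((\<lambda>h. ereal (Q h)) \<longlongrightarrow> l) (at 0)"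
    using le Liminf_le_Limsup[of "at (0::real)" "\<lambda>h. ereal (Q h)"] unfolding l_def
    by (subst tendsto_iff_Liminf_eq_Limsup) auto
  have "l \<le> ereal (L * norm v)" "ereal (- (L * norm v)) \<le> l"
    using Qb by (auto intro!: tendsto_upperbound[OF lim] tendsto_lowerbound[OF lim] always_eventually simp: abs_le_iff minus_le_iff)
  then obtain r where "l = ereal r" by (cases l) auto
  then show ?thesis using lim unfolding Q_def by auto
qed


lemma integral_lborel_translate:
  fixes f :: "'a::euclidean_space \<Rightarrow> real"
  assumes "f \<in> borel_measurable borel"
  shows "(LINT z|lborel. f (z + c)) = (LINT z|lborel. f z)"
proof -
  have "(LINT z|lborel. f z) = (LINT z|distr lborel borel ((+) c). f z)"
    by (metis lborel_distr_plus)
  also have "\<dots> = (LINT z|lborel. f (c + z))"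
    by (subst integral_distr) (use assms in auto)
  finally show ?thesis by (simp add: add.commute)
qed

lemma integrable_lborel_compact:
  fixes g :: "'a::euclidean_space \<Rightarrow> real"
  assumes "continuous_on UNIV g" "compact K" "\<And>z. z \<notin> K \<Longrightarrow> g z = 0"
  shows "integrable lborel g"
proof -
  have "integrable lborel (\<lambda>x. indicator K x *\<^sub>R g x)"
    by (rule borel_integrable_compact[OF assms(2) continuous_on_subset[OF assms(1)]]) simp
  moreover have "(\<lambda>x. indicator K x *\<^sub>R g x) = g" using assms(3) by (auto simp: fun_eq_iff indicator_def)
  ultimately show ?thesis by metis
qed

lemma test_function_lipschitz:
  fixes \<eta> :: "'a::euclidean_space \<Rightarrow> real"
  assumes "test_function \<Omega> \<eta>"
  obtains B where "0 < B" "\<And>x y. \<bar>\<eta> x - \<eta> y\<bar> \<le> B * norm (x - y)"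
proof -
  obtain B where B: "B > 0" "\<And>z h. \<bar>partial h \<eta> z\<bar> \<le> B * norm h" by (rule test_function_partial_bound[OF assms]) blast
  have s: "smooth \<eta>" by (rule test_function_smooth[OF assms])
  show ?thesis
  proof (rule that[OF B(1)])
    fix x y
    have "norm (\<eta> x - \<eta> y) \<le> B * norm (x - y)"
    proof (rule differentiable_bound[of UNIV _ "\<lambda>z h. partial h \<eta> z"])
      show "(\<eta> has_derivative (\<lambda>h. partial h \<eta> z)) (at z within UNIV)" for z using smooth_has_derivative[OF s] by simp
      show "onorm (\<lambda>h. partial h \<eta> z) \<le> B" for z by (rule onorm_le) (use B(2) in simp)
    qed auto
    then show "\<bar>\<eta> x - \<eta> y\<bar> \<le> B * norm (x - y)" by simp
  qed
qed

context
  fixes f :: "'a::euclidean_space \<Rightarrow> real" and L :: real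
  assumes f: "L-lipschitz_on UNIV f"
begin

lemma f_cont: "continuous_on UNIV f" using f lipschitz_on_continuous_on by blast

lemma f_lip: "\<bar>f x - f y\<bar> \<le> L * norm (x - y)"
  using lipschitz_onD[OF f, of x y] by (simp add: dist_norm)

lemma L_nonneg: "0 \<le> L" using f lipschitz_on_nonneg by blast

lemma f_borel [measurable]: "f \<in> borel_measurable borel"
  by (rule borel_measurable_continuous_onI[OF f_cont])

definition dquot :: "'a \<Rightarrow> nat \<Rightarrow> 'a \<Rightarrow> real" where
  "dquot v k z = (f (z + (1 / Suc k) *\<^sub>R v) - f z) / (1 / Suc k)"

text \<open>The truncation only matters where the limit does not exist.\<close>

definition ddir :: "'a \<Rightarrow> 'a \<Rightarrow> real" where
  "ddir v z = max (- (L * norm v)) (min (L * norm v) (lim (\<lambda>k. dquot v k z)))"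

lemma dquot_bound: "\<bar>dquot v k z\<bar> \<le> L * norm v"
proof -
  have "\<bar>f (z + (1 / Suc k) *\<^sub>R v) - f z\<bar> \<le> L * ((1 / Suc k) * norm v)"
    using f_lip[of "z + (1 / Suc k) *\<^sub>R v" z] by simp
  then have "\<bar>f (z + (1 / Suc k) *\<^sub>R v) - f z\<bar> * Suc k \<le> (L * ((1 / Suc k) * norm v)) * Suc k" by (rule mult_right_mono) simp
  then show ?thesis by (simp add: dquot_def abs_mult)
qed

lemma dquot_borel [measurable]: "dquot v k \<in> borel_measurable borel"
  unfolding dquot_def[abs_def] by measurable

lemma ddir_borel [measurable]: "ddir v \<in> borel_measurable borel"
  unfolding ddir_def[abs_def] by measurable

lemma ddir_bound: "\<bar>ddir v z\<bar> \<le> L * norm v"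
  unfolding ddir_def using L_nonneg by (auto simp: abs_le_iff)

lemma ddir_AE: "AE z in lborel. ((\<lambda>h. (f (z + h *\<^sub>R v) - f z) / h) \<longlongrightarrow> ddir v z) (at 0)"
proof -
  have "AE z in lborel. z \<notin> steep f v (real_of_rat q) \<inter> steep (\<lambda>z. - f z) v (- real_of_rat p)" if "p < q" for p q
  proof (rule AE_not_in, rule null_setsI)
    show "emeasure lborel (steep f v (real_of_rat q) \<inter> steep (\<lambda>z. - f z) v (- real_of_rat p)) = 0"
      by (rule Lipschitz_steep_null[OF f]) (simp add: of_rat_less that)
    show "steep f v (real_of_rat q) \<inter> steep (\<lambda>z. - f z) v (- real_of_rat p) \<in> sets lborel"
      using steep_borel f_cont continuous_on_minus[OF f_cont] by (metis sets.Int sets_lborel)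
  qed
  then have "AE z in lborel. \<forall>p q. p < q \<longrightarrow> z \<notin> steep f v (real_of_rat q) \<inter> steep (\<lambda>z. - f z) v (- real_of_rat p)"
    by (subst AE_all_countable, intro allI, subst AE_all_countable, intro allI) (use AE_mp AE_I2 in auto)
  then show ?thesis
  proof (rule AE_mp, intro AE_I2 impI)
    fix z assume z: "\<forall>p q. p < q \<longrightarrow> z \<notin> steep f v (real_of_rat q) \<inter> steep (\<lambda>z. - f z) v (- real_of_rat p)"
    obtain l where l: "((\<lambda>h. (f (z + h *\<^sub>R v) - f z) / h) \<longlongrightarrow> l) (at 0)"
      using directional_derivative_exists[OF f, of z v] z by blast
    have "filterlim (\<lambda>k. 1 / real (Suc k)) (at 0) sequentially"
      using LIMSEQ_Suc[OF lim_1_over_n] by (auto simp: filterlim_at)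
    from filterlim_compose[OF l this] have k: "(\<lambda>k. dquot v k z) \<longlonglongrightarrow> l" unfolding dquot_def .
    have "dquot v k z \<le> L * norm v \<and> - (L * norm v) \<le> dquot v k z" for k
      using dquot_bound[of v k z] by (simp add: abs_le_iff minus_le_iff)
    then have "l \<le> L * norm v" "- (L * norm v) \<le> l"
      using LIMSEQ_le_const2[OF k, of "L * norm v"] LIMSEQ_le_const[OF k, of "- (L * norm v)"] by blast+
    then have "ddir v z = l" unfolding ddir_def limI[OF k] by simp
    then show "((\<lambda>h. (f (z + h *\<^sub>R v) - f z) / h) \<longlongrightarrow> ddir v z) (at 0)" using l by simp
  qed
qed

lemma ddir_AE_seq: "AE z in lborel. (\<lambda>k. dquot v k z) \<longlonglongrightarrow> ddir v z"
  using ddir_AE[of v]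
proof (rule AE_mp, intro AE_I2 impI)
  fix z assume l: "((\<lambda>h. (f (z + h *\<^sub>R v) - f z) / h) \<longlongrightarrow> ddir v z) (at 0)"
  have "filterlim (\<lambda>k. 1 / real (Suc k)) (at 0) sequentially"
    using LIMSEQ_Suc[OF lim_1_over_n] by (auto simp: filterlim_at)
  from filterlim_compose[OF l this] show "(\<lambda>k. dquot v k z) \<longlonglongrightarrow> ddir v z" unfolding dquot_def .
qed

text \<open>Translation invariance shifts the difference quotient from \<open>f\<close> to the test
  function, and both sides converge dominatedly: the quotients of \<open>f\<close> are bounded by
  its Lipschitz constant, those of \<open>\<eta>\<close> by its own.\<close>

lemma ddir_weak:
  assumes \<eta>: "test_function UNIV \<eta>"
  shows "(LINT z|lborel. ddir v z * \<eta> z) = - (LINT z|lborel. f z * partial v \<eta> z)"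
proof -
  obtain K where K: "smooth \<eta>" "compact K" "\<And>z. z \<notin> K \<Longrightarrow> \<eta> z = 0" using test_functionE[OF \<eta>] by metis
  have [measurable]: "\<eta> \<in> borel_measurable borel" by (rule borel_measurable_continuous_onI[OF smooth_continuous[OF K(1)]])
  have [measurable]: "partial v \<eta> \<in> borel_measurable borel" by (rule borel_measurable_continuous_onI[OF smooth_continuous[OF smooth_partial[OF K(1)]]])
  have i\<eta>: "integrable lborel \<eta>" by (rule integrable_lborel_compact[OF smooth_continuous[OF K(1)] K(2,3)])
  obtain B where B: "0 < B" "\<And>x y. \<bar>\<eta> x - \<eta> y\<bar> \<le> B * norm (x - y)" by (rule test_function_lipschitz[OF \<eta>]) blast
  define C where "C = (\<lambda>(s, z). z + s *\<^sub>R v) ` ({0..1::real} \<times> K)"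
  have C: "compact C" unfolding C_def case_prod_unfold
    by (intro compact_continuous_image continuous_intros compact_Times K) auto
  have outC: "z - s *\<^sub>R v \<notin> K" if "z \<notin> C" "s \<in> {0..1}" for s z
  proof
    assume "z - s *\<^sub>R v \<in> K"
    then have "z \<in> C" unfolding C_def using that(2) by (auto intro!: image_eqI[where x="(s, z - s *\<^sub>R v)"])
    with that show False by simp
  qed
  have "bounded (f ` C)" using C compact_continuous_image compact_imp_bounded continuous_on_subset[OF f_cont] by blast
  then obtain F where F: "\<And>z. z \<in> C \<Longrightarrow> \<bar>f z\<bar> \<le> F" by (auto simp: bounded_iff)
  have 1: "(\<lambda>k. LINT z|lborel. dquot v k z * \<eta> z) \<longlonglongrightarrow> (LINT z|lborel. ddir v z * \<eta> z)"
  proof (rule integral_dominated_convergence[where w="\<lambda>z. L * norm v * \<bar>\<eta> z\<bar>"])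
    show "AE z in lborel. (\<lambda>k. dquot v k z * \<eta> z) \<longlonglongrightarrow> ddir v z * \<eta> z"
      using ddir_AE_seq by (rule AE_mp) (intro AE_I2 impI tendsto_intros)
    show "AE z in lborel. norm (dquot v k z * \<eta> z) \<le> L * norm v * \<bar>\<eta> z\<bar>" for k
      using dquot_bound by (intro AE_I2) (simp add: abs_mult mult_right_mono)
    show "integrable lborel (\<lambda>z. L * norm v * \<bar>\<eta> z\<bar>)" using i\<eta> by simp
  qed measurable
  let ?e = "\<lambda>k z. (\<eta> (z - (1 / Suc k) *\<^sub>R v) - \<eta> z) / (1 / Suc k)"
  have 2: "(LINT z|lborel. dquot v k z * \<eta> z) = (LINT z|lborel. f z * ?e k z)" for k
  proof -
    let ?h = "1 / real (Suc k)"
    have ci: "continuous_on UNIV (\<lambda>z. f (z + ?h *\<^sub>R v) * \<eta> z)" "continuous_on UNIV (\<lambda>z. f z * \<eta> (z - ?h *\<^sub>R v))" "continuous_on UNIV (\<lambda>z. f z * \<eta> z)"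
      by (intro continuous_intros continuous_on_compose2[OF f_cont] continuous_on_compose2[OF smooth_continuous[OF K(1), of UNIV]]; simp)+
    have h: "?h \<in> {0..1}" by simp
    have i1: "integrable lborel (\<lambda>z. f (z + ?h *\<^sub>R v) * \<eta> z)" by (rule integrable_lborel_compact[OF ci(1) K(2)]) (simp add: K(3))
    have i2: "integrable lborel (\<lambda>z. f z * \<eta> (z - ?h *\<^sub>R v))" by (rule integrable_lborel_compact[OF ci(2) C]) (simp add: K(3)[OF outC[OF _ h]] del: of_nat_Suc)
    have i3: "integrable lborel (\<lambda>z. f z * \<eta> z)" by (rule integrable_lborel_compact[OF ci(3) K(2)]) (simp add: K(3))
    have tr: "(LINT z|lborel. f (z + ?h *\<^sub>R v) * \<eta> z) = (LINT z|lborel. f z * \<eta> (z - ?h *\<^sub>R v))"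
      using integral_lborel_translate[of "\<lambda>z. f z * \<eta> (z - ?h *\<^sub>R v)" "?h *\<^sub>R v"] by simp
    have "(LINT z|lborel. dquot v k z * \<eta> z) = (LINT z|lborel. (f (z + ?h *\<^sub>R v) * \<eta> z - f z * \<eta> z) / ?h)"
      by (rule Bochner_Integration.integral_cong) (auto simp: dquot_def algebra_simps)
    also have "\<dots> = ((LINT z|lborel. f z * \<eta> (z - ?h *\<^sub>R v)) - (LINT z|lborel. f z * \<eta> z)) / ?h"
      unfolding tr[symmetric] using i1 i3 by simp
    also have "\<dots> = (LINT z|lborel. (f z * \<eta> (z - ?h *\<^sub>R v) - f z * \<eta> z) / ?h)" using i2 i3 by simp
    also have "\<dots> = (LINT z|lborel. f z * ?e k z)"
      by (rule Bochner_Integration.integral_cong) (auto simp: algebra_simps)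
    finally show ?thesis .
  qed
  have 3: "(\<lambda>k. LINT z|lborel. f z * ?e k z) \<longlonglongrightarrow> (LINT z|lborel. f z * - partial v \<eta> z)"
  proof (rule integral_dominated_convergence[where w="\<lambda>z. (F * (B * norm v)) * indicator C z"])
    show "AE z in lborel. (\<lambda>k. f z * ?e k z) \<longlonglongrightarrow> f z * - partial v \<eta> z"
    proof (intro AE_I2 tendsto_mult_left)
      fix z
      have d: "((\<lambda>h. \<eta> (z - h *\<^sub>R v)) has_derivative (\<lambda>h. partial (- (h *\<^sub>R v)) \<eta> (z - 0 *\<^sub>R v))) (at 0)"
        by (rule has_derivative_compose[OF _ smooth_has_derivative[OF K(1)]]) (auto intro!: derivative_eq_intros)
      have "((\<lambda>h. \<eta> (z - h *\<^sub>R v)) has_real_derivative - partial v \<eta> z) (at 0)"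
        unfolding has_field_derivative_def
        by (rule has_derivative_eq_rhs[OF d]) (simp add: partial_uminus[OF K(1)] partial_scaleR[OF K(1)] fun_eq_iff)
      then have l: "((\<lambda>h. (\<eta> (z - h *\<^sub>R v) - \<eta> z) / h) \<longlongrightarrow> - partial v \<eta> z) (at 0)"
        by (simp add: has_field_derivative_iff)
      have "filterlim (\<lambda>k. 1 / real (Suc k)) (at 0) sequentially"
        using LIMSEQ_Suc[OF lim_1_over_n] by (auto simp: filterlim_at)
      from filterlim_compose[OF l this] show "(\<lambda>k. ?e k z) \<longlonglongrightarrow> - partial v \<eta> z" .
    qed
    show "integrable lborel (\<lambda>z. (F * (B * norm v)) * indicator C z)"
      by (intro integrable_mult_right integrable_real_indicator emeasure_bounded_finite compact_imp_bounded C)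
         (simp add: borel_compact C)
    show "AE z in lborel. norm (f z * ?e k z) \<le> (F * (B * norm v)) * indicator C z" for k
    proof (rule AE_I2)
      fix z
      show "norm (f z * ?e k z) \<le> (F * (B * norm v)) * indicator C z"
      proof (cases "z \<in> C")
        case True
        have "\<bar>\<eta> (z - (1 / Suc k) *\<^sub>R v) - \<eta> z\<bar> \<le> B * ((1 / Suc k) * norm v)"
          using B(2)[of "z - (1 / Suc k) *\<^sub>R v" z] by simp
        then have "\<bar>\<eta> (z - (1 / Suc k) *\<^sub>R v) - \<eta> z\<bar> * Suc k \<le> (B * ((1 / Suc k) * norm v)) * Suc k" by (rule mult_right_mono) simp
        then have "\<bar>?e k z\<bar> \<le> B * norm v" by (simp add: abs_mult)
        then have "\<bar>f z\<bar> * \<bar>?e k z\<bar> \<le> F * (B * norm v)" using F[OF True] B(1) by (intro mult_mono) auto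
        then show ?thesis using True by (simp add: abs_mult)
      next
        case False
        have "\<eta> (z - (1 / Suc k) *\<^sub>R v) = 0" "\<eta> z = 0"
          using K(3)[OF outC[OF False, of "1 / Suc k"]] K(3)[OF outC[OF False, of 0]] by simp_all
        then show ?thesis using False by simp
      qed
    qed
  qed measurable
  have "(LINT z|lborel. ddir v z * \<eta> z) = (LINT z|lborel. f z * - partial v \<eta> z)"
    by (rule LIMSEQ_unique[OF 1]) (use 3 in \<open>simp only: 2\<close>)
  then show ?thesis by simp
qed

text \<open>Existence of the directional derivatives at a point does not make them linear in the
  direction. Linearity comes from the weak form, minus the integral of f times
  \<open>partial v \<eta>\<close>, which is linear in \<open>v\<close>.\<close>

lemma ddir_linear_AE: "AE z in lborel. ddir v z = (\<Sum>b\<in>Basis. (v \<bullet> b) * ddir b z)"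
proof -
  define g where "g = (\<lambda>z. ddir v z - (\<Sum>b\<in>Basis. (v \<bullet> b) * ddir b z))"
  have "AE z in lborel. g z = 0"
  proof (rule AE_zero_of_test_functions)
    show "g \<in> borel_measurable borel" unfolding g_def by measurable
    show "\<bar>g z\<bar> \<le> L * norm v + (\<Sum>b\<in>(Basis :: 'a set). norm v * L)" for z
    proof -
      have "\<bar>\<Sum>b\<in>Basis. (v \<bullet> b) * ddir b z\<bar> \<le> (\<Sum>b\<in>(Basis :: 'a set). norm v * L)"
      proof -
        have "\<bar>\<Sum>b\<in>Basis. (v \<bullet> b) * ddir b z\<bar> \<le> (\<Sum>b\<in>Basis. \<bar>(v \<bullet> b) * ddir b z\<bar>)" by (rule sum_abs)
        also have "\<dots> \<le> (\<Sum>b\<in>(Basis :: 'a set). norm v * L)"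
        proof (rule sum_mono)
          fix b :: 'a assume "b \<in> Basis"
          then show "\<bar>(v \<bullet> b) * ddir b z\<bar> \<le> norm v * L"
            unfolding abs_mult using ddir_bound[of b z] Basis_le_norm[of b v] by (intro mult_mono) auto
        qed
        finally show ?thesis .
      qed
      then show ?thesis unfolding g_def using ddir_bound[of v z] by linarith
    qed
    fix \<eta> :: "'a \<Rightarrow> real" assume \<eta>: "test_function UNIV \<eta>"
    obtain K where K: "smooth \<eta>" "compact K" "\<And>z. z \<notin> K \<Longrightarrow> \<eta> z = 0" using test_functionE[OF \<eta>] by metis
    have [measurable]: "\<eta> \<in> borel_measurable borel" by (rule borel_measurable_continuous_onI[OF smooth_continuous[OF K(1)]])
    have i\<eta>: "integrable lborel \<eta>" by (rule integrable_lborel_compact[OF smooth_continuous[OF K(1)] K(2,3)])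
    have i: "integrable lborel (\<lambda>z. ddir b z * \<eta> z)" for b
    proof (rule Bochner_Integration.integrable_bound[OF integrable_mult_right[OF i\<eta>, of "L * norm b"]])
      show "AE z in lborel. norm (ddir b z * \<eta> z) \<le> norm (L * norm b * \<eta> z)"
        using ddir_bound L_nonneg by (intro AE_I2) (simp add: abs_mult mult_right_mono)
    qed measurable
    have ip: "integrable lborel (\<lambda>z. f z * partial b \<eta> z)" for b
      by (rule integrable_lborel_compact[OF continuous_on_mult[OF f_cont smooth_continuous[OF smooth_partial[OF K(1)]]] K(2)])
         (simp add: partial_zero_outside[OF K(2,3)])
    have "(LINT z|lborel. g z * \<eta> z) = (LINT z|lborel. ddir v z * \<eta> z - (\<Sum>b\<in>Basis. (v \<bullet> b) * (ddir b z * \<eta> z)))"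
      by (rule Bochner_Integration.integral_cong) (auto simp: g_def left_diff_distrib sum_distrib_right mult.assoc)
    also have "\<dots> = (LINT z|lborel. ddir v z * \<eta> z) - (\<Sum>b\<in>Basis. (v \<bullet> b) * (LINT z|lborel. ddir b z * \<eta> z))"
      using i by simp
    also have "\<dots> = - ((LINT z|lborel. f z * partial v \<eta> z) - (\<Sum>b\<in>Basis. (v \<bullet> b) * (LINT z|lborel. f z * partial b \<eta> z)))"
      unfolding ddir_weak[OF \<eta>] by (simp add: sum_negf)
    also have "(\<Sum>b\<in>Basis. (v \<bullet> b) * (LINT z|lborel. f z * partial b \<eta> z)) = (LINT z|lborel. f z * (\<Sum>b\<in>Basis. (v \<bullet> b) * partial b \<eta> z))"
    proof -
      have "(LINT z|lborel. (\<Sum>b\<in>Basis. (v \<bullet> b) * (f z * partial b \<eta> z))) = (\<Sum>b\<in>Basis. (LINT z|lborel. (v \<bullet> b) * (f z * partial b \<eta> z)))"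
        by (rule Bochner_Integration.integral_sum) (intro integrable_mult_right ip)
      moreover have "f z * (\<Sum>b\<in>Basis. (v \<bullet> b) * partial b \<eta> z) = (\<Sum>b\<in>Basis. (v \<bullet> b) * (f z * partial b \<eta> z))" for z
        unfolding sum_distrib_left by (rule sum.cong[OF refl]) simp
      ultimately show ?thesis by simp
    qed
    also have "\<dots> = (LINT z|lborel. f z * partial v \<eta> z)"
      using partial_sum_Basis[OF smooth_differentiable[OF K(1)], where h=v] by (simp only: real_scaleR_def)
    finally show "(LINT z|lborel. g z * \<eta> z) = 0" by simp
  qed
  then show ?thesis unfolding g_def by simp
qed

text \<open>Off one null set the directional derivatives exist and agree with a linear map for a
  countable dense set of directions. Compactness of the unit sphere and the Lipschitz bound extend
  this uniformly to all directions.\<close>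

theorem rademacher: "AE z in lborel. f differentiable (at z)"
proof -
  obtain D :: "'a set" where D: "countable D" "\<And>X. open X \<Longrightarrow> X \<noteq> {} \<Longrightarrow> \<exists>d\<in>D. d \<in> X"
    using countable_dense_exists by metis
  have "AE z in lborel. \<forall>v\<in>D. ((\<lambda>h. (f (z + h *\<^sub>R v) - f z) / h) \<longlongrightarrow> ddir v z) (at 0)"
    by (subst AE_ball_countable[OF D(1)]) (use ddir_AE in blast)
  moreover have "AE z in lborel. \<forall>v\<in>D. ddir v z = (\<Sum>b\<in>Basis. (v \<bullet> b) * ddir b z)"
    by (subst AE_ball_countable[OF D(1)]) (use ddir_linear_AE in blast)
  ultimately show ?thesis
  proof eventually_elim
    case (elim z)
    define T where "T = (\<lambda>v. \<Sum>b\<in>Basis. (v \<bullet> b) * ddir b z)"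
    have linT: "linear T"
      unfolding T_def by (rule linearI) (simp_all add: inner_add_left distrib_right sum.distrib sum_distrib_left mult.assoc)
    then have bT: "bounded_linear T" by (rule linear_conv_bounded_linear[THEN iffD1])
    obtain K where K: "0 < K" "\<And>v. \<bar>T v\<bar> \<le> norm v * K" using bounded_linear.pos_bounded[OF bT] by auto
    have dT: "((\<lambda>h. (f (z + h *\<^sub>R v) - f z) / h) \<longlongrightarrow> T v) (at 0)" if "v \<in> D" for v
      using bspec[OF elim(1) that] bspec[OF elim(2) that] unfolding T_def by simp
    have "(f has_derivative T) (at z)"
      unfolding has_derivative_at_alt
    proof (intro conjI bT allI impI)
      fix e :: real assume e: "0 < e"
      \<comment> \<open>Replacing a unit direction by a dense one costs L \<delta> in
        \<open>f\<close> and K \<delta> in \<open>T\<close>, and the difference quotient along the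
        latter costs \<delta>; hence the three summands.\<close>
      define \<delta> where "\<delta> = e / (L + K + 1)"
      have \<delta>: "0 < \<delta>" "\<delta> * (L + K + 1) = e" using e K(1) L_nonneg by (auto simp: \<delta>_def)
      have "sphere 0 1 \<subseteq> (\<Union>d\<in>D. ball d \<delta>)"
      proof
        fix x :: 'a
        obtain d where "d \<in> D" "d \<in> ball x \<delta>" using D(2)[of "ball x \<delta>"] \<delta>(1) by auto
        then show "x \<in> (\<Union>d\<in>D. ball d \<delta>)" by (auto simp: dist_commute)
      qed
      then obtain D' where D': "D' \<subseteq> D" "finite D'" "sphere 0 1 \<subseteq> (\<Union>d\<in>D'. ball d \<delta>)"
        using compactE_image[OF compact_sphere, of D "\<lambda>d. ball d \<delta>" 0 1] by auto
      have "\<forall>\<^sub>F h in at (0::real). \<forall>d\<in>D'. dist ((f (z + h *\<^sub>R d) - f z) / h) (T d) < \<delta>"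
        using D'(1) by (intro eventually_ball_finite[OF D'(2)] ballI tendstoD[OF dT \<delta>(1)]) auto
      then obtain r where r: "0 < r" "\<And>h. h \<noteq> 0 \<Longrightarrow> \<bar>h\<bar> < r \<Longrightarrow> \<forall>d\<in>D'. dist ((f (z + h *\<^sub>R d) - f z) / h) (T d) < \<delta>"
        unfolding eventually_at by auto
      show "\<exists>d>0. \<forall>y. norm (y - z) < d \<longrightarrow> norm (f y - f z - T (y - z)) \<le> e * norm (y - z)"
      proof (intro exI conjI allI impI)
        show "0 < r" by (rule r(1))
        fix y assume y: "norm (y - z) < r"
        show "norm (f y - f z - T (y - z)) \<le> e * norm (y - z)"
        proof (cases "y = z")
          case True
          then show ?thesis by (simp add: linear_0[OF linT])
        next
          case False
          define h where "h = norm (y - z)"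
          define x where "x = (y - z) /\<^sub>R h"
          have h: "0 < h" "h < r" using False y by (auto simp: h_def)
          have yx: "y = z + h *\<^sub>R x" "norm x = 1" using h by (auto simp: x_def h_def)
          then obtain d where d: "d \<in> D'" "norm (x - d) < \<delta>" using D'(3) by (auto simp: dist_norm norm_minus_commute)
          have "\<bar>(f (z + h *\<^sub>R d) - f z) / h - T d\<bar> < \<delta>" using r(2)[of h] h d(1) by (auto simp: dist_real_def)
          then have "\<bar>(f (z + h *\<^sub>R d) - f z) / h - T d\<bar> * h \<le> \<delta> * h" using h by (intro mult_right_mono) auto
          moreover have "\<bar>(f (z + h *\<^sub>R d) - f z) / h - T d\<bar> * h = \<bar>((f (z + h *\<^sub>R d) - f z) / h - T d) * h\<bar>" using h by (simp add: abs_mult)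
          moreover have "((f (z + h *\<^sub>R d) - f z) / h - T d) * h = f (z + h *\<^sub>R d) - f z - h * T d" using h by (simp add: field_simps)
          ultimately have 1: "\<bar>f (z + h *\<^sub>R d) - f z - h * T d\<bar> \<le> \<delta> * h" by simp
          have "norm (h *\<^sub>R x - h *\<^sub>R d) \<le> h * \<delta>"
            using d(2) h by (simp flip: scaleR_diff_right)
          then have "L * norm (h *\<^sub>R x - h *\<^sub>R d) \<le> L * (h * \<delta>)" using L_nonneg by (rule mult_left_mono)
          then have 2: "\<bar>f (z + h *\<^sub>R x) - f (z + h *\<^sub>R d)\<bar> \<le> L * (h * \<delta>)"
            using f_lip[of "z + h *\<^sub>R x" "z + h *\<^sub>R d"] by simp
          have "\<bar>T (d - x)\<bar> \<le> \<delta> * K"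
            using K(2)[of "d - x"] d(2) K(1) by (smt (verit) mult_right_mono norm_minus_commute)
          then have 3: "h * \<bar>T (d - x)\<bar> \<le> h * (\<delta> * K)" using h by (intro mult_left_mono) auto
          have Tx: "T (y - z) = h * T d - h * T (d - x)"
            using yx(1) by (simp add: linear_scale[OF linT] linear_diff[OF linT] algebra_simps)
          have "h * \<bar>T (d - x)\<bar> = \<bar>h * T (d - x)\<bar>" using h by (simp add: abs_mult)
          then have "\<bar>f y - f z - T (y - z)\<bar> \<le> L * (h * \<delta>) + \<delta> * h + h * (\<delta> * K)"
            unfolding Tx using 1 2 3 arg_cong[OF yx(1), of f] by linarith
          also have "\<dots> = (\<delta> * (L + K + 1)) * h" by (simp add: algebra_simps)
          finally show ?thesis using \<delta>(2) by (simp add: h_def)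
        qed
      qed
    qed
    then show ?case unfolding differentiable_def by blast
  qed
qed

end

section \<open>From the sign of the normal to star-shapedness in x\<close>

section \<open>Repulsive Lipschitz sets are star-shaped in \<open>x\<close>\<close>

text \<open>The image of the compact set \<open>K - O'\<close> misses \<open>p\<close> and is
  closed, so it keeps a positive distance from \<open>p\<close>.\<close>

lemma compact_preimage_nbhd:
  fixes g :: "'a::metric_space \<Rightarrow> 'b::metric_space"
  assumes "compact K" "continuous_on K g" "open O'" "\<And>k. k \<in> K \<Longrightarrow> g k = p \<Longrightarrow> k \<in> O'"
  obtains \<delta> where "0 < \<delta>" "\<And>k. k \<in> K \<Longrightarrow> dist (g k) p < \<delta> \<Longrightarrow> k \<in> O'"
proof -
  have "compact (g ` (K - O'))"
    using assms by (intro compact_continuous_image continuous_on_subset[OF assms(2)] compact_diff) auto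
  then have "open (- g ` (K - O'))" by (simp add: compact_imp_closed open_Compl)
  moreover have "p \<in> - g ` (K - O')" using assms(4) by auto
  ultimately obtain \<delta> where "0 < \<delta>" "ball p \<delta> \<subseteq> - g ` (K - O')" using openE by blast
  then show ?thesis by (intro that[of \<delta>]) (auto simp: dist_commute)
qed

lemma continuous_jap: "continuous_on A jap"
  by (rule smooth_continuous[OF smooth_jap])

lemma continuous_pull2: "continuous_on A (\<lambda>(t, z). pull t z)"
  unfolding pull_def case_prod_beta
  by (intro continuous_intros continuous_on_compose2[OF continuous_jap[of UNIV]]) auto

text \<open>Turns inequalities against test functions into a pointwise one. If W q > W p, a bump
  near p sits where W < c1, while its transport, of equal mass, sits where W > c > c1, contradicting
  \<open>flow_decreasing\<close>. The assumption \<open>seg\<close> keeps all intermediate supports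
  in \<open>U\<close>, and \<open>inj\<close> confines the final one to the vicinity of q.\<close>

lemma flow_pointwise:
  fixes W :: "'x::euclidean_space \<times> 'y::euclidean_space \<Rightarrow> real"
  assumes W: "continuous_on UNIV W" and U: "open U"
    and hyp: "\<And>\<eta>. test_function U \<eta> \<Longrightarrow> (\<And>z. 0 \<le> \<eta> z) \<Longrightarrow> 0 \<le> (LINT z|lebesgue. W z * xdiv \<eta> z)"
    and T: "0 \<le> T" "T \<le> 1/2"
    and seg: "\<And>t z. 0 \<le> t \<Longrightarrow> t \<le> T \<Longrightarrow> pull t z = p \<Longrightarrow> z \<in> U"
    and inj: "\<And>z. pull T z = p \<Longrightarrow> z = q"
  shows "W q \<le> W p"
proof (rule ccontr)
  assume "\<not> ?thesis"
  then obtain c where c: "W p < c" "c < W q" using dense not_le by blast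
  define c1 where "c1 = (W p + c) / 2"
  have c1: "W p < c1" "c1 < c" using c by (auto simp: c1_def)
  let ?H = "xhull (cball p 1)"
  have H: "compact ?H" by (rule compact_xhull) simp
  have cK: "compact ({0..T} \<times> ?H)" by (intro compact_Times H) simp
  have oU: "open (UNIV \<times> U :: (real \<times> ('x \<times> 'y)) set)" by (intro open_Times U) simp
  define g :: "real \<times> ('x \<times> 'y) \<Rightarrow> 'x \<times> 'y" where "g = (\<lambda>(t, z). pull t z)"
  have cg: "continuous_on A g" for A unfolding g_def by (rule continuous_pull2)
  have key: "k \<in> UNIV \<times> U" if "k \<in> {0..T} \<times> ?H" "g k = p" for k
    using that seg[of "fst k" "snd k"] by (cases k) (simp add: g_def)
  obtain \<delta>1 where \<delta>1': "0 < \<delta>1" "\<And>k. k \<in> {0..T} \<times> ?H \<Longrightarrow> dist (g k) p < \<delta>1 \<Longrightarrow> k \<in> UNIV \<times> U"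
    by (rule compact_preimage_nbhd[OF cK cg oU key]) (assumption | blast)+
  have \<delta>1: "0 < \<delta>1" "\<And>t z. (t, z) \<in> {0..T} \<times> ?H \<Longrightarrow> dist (pull t z) p < \<delta>1 \<Longrightarrow> z \<in> U"
    using \<delta>1'(1) \<delta>1'(2) [of "(_, _)"] by (simp_all add: g_def)
  have "open {z. c < W z}" by (intro open_Collect_less continuous_intros W)
  then obtain \<delta>2 where \<delta>2: "0 < \<delta>2" "\<And>k. k \<in> ?H \<Longrightarrow> dist (pull T k) p < \<delta>2 \<Longrightarrow> c < W k"
  proof (rule compact_preimage_nbhd[OF H smooth_continuous[OF smooth_pull[of T]], of "{z. c < W z}" p])
    show "k \<in> {z. c < W z}" if "pull T k = p" for k using inj[OF that] c(2) by simp
  qed simp_all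
  define \<delta> where "\<delta> = min 1 (min \<delta>1 \<delta>2)"
  have "open (ball p \<delta> \<inter> {z. W z < c1})" by (intro open_Int open_Collect_less continuous_intros W) simp
  moreover have "p \<in> ball p \<delta> \<inter> {z. W z < c1}" using \<delta>1 \<delta>2 c1 by (simp add: \<delta>_def)
  ultimately obtain a b where ab: "p \<in> box a b" "cbox a b \<subseteq> ball p \<delta> \<inter> {z. W z < c1}"
    using open_contains_cbox by metis
  define \<eta> where "\<eta> = bump a b"
  have t\<eta>: "test_function UNIV \<eta>" unfolding \<eta>_def by (rule test_function_bump) simp
  have \<eta>0: "0 \<le> \<eta> z" for z unfolding \<eta>_def by (rule bump_bounds)
  have \<eta>out: "\<eta> z = 0" if "z \<notin> cbox a b" for z unfolding \<eta>_def using bump_zero box_subset_cbox that by blast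
  have hull: "z \<in> ?H" if "0 \<le> t" "t \<le> T" "pull t z \<in> cbox a b" for t z
    using pull_in_xhull[of t z "cball p 1"] that T ab(2) by (auto simp: \<delta>_def)
  \<comment> \<open>A compact set containing the supports of the transported bump at all times,
    obtained as a projection from the product with the time interval.\<close>
  define C where "C = snd ` (({0..T} \<times> ?H) \<inter> (\<lambda>(t, z). pull t z) -` cbox a b)"
  have "closed (({0..T} \<times> ?H) \<inter> (\<lambda>(t, z). pull t z) -` cbox a b)"
    by (rule continuous_closed_preimage[OF continuous_pull2 closed_Times[OF closed_atLeastAtMost compact_imp_closed[OF H]] closed_cbox])
  moreover have "bounded (({0..T} \<times> ?H) \<inter> (\<lambda>(t, z). pull t z) -` cbox a b)"
    using H by (intro bounded_Int bounded_Times disjI1 compact_imp_bounded) auto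
  ultimately have "compact (({0..T} \<times> ?H) \<inter> (\<lambda>(t, z). pull t z) -` cbox a b)"
    unfolding compact_eq_bounded_closed by blast
  then have C: "compact C" unfolding C_def by (intro compact_continuous_image continuous_intros)
  have CU: "C \<subseteq> U"
  proof
    fix z assume "z \<in> C"
    then obtain t where "(t, z) \<in> {0..T} \<times> ?H" "pull t z \<in> cbox a b" unfolding C_def by auto
    then show "z \<in> U" using \<delta>1(2)[of t z] ab(2) by (auto simp: \<delta>_def dist_commute)
  qed
  have out: "\<eta> (pull t z) = 0" if "0 \<le> t" "t \<le> T" "z \<notin> C" for t z
  proof (rule \<eta>out, rule notI)
    assume "pull t z \<in> cbox a b"
    then have "z \<in> C" unfolding C_def using hull[OF that(1,2)] that(1,2) by (intro image_eqI[where x="(t, z)"]) auto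
    then show False using that(3) by simp
  qed
  have Wm: "W \<in> borel_measurable lebesgue" by (rule continuous_borel_measurable_lebesgue[OF W])
  have bW: "bounded (W ` K)" if "compact K" for K
    using that compact_continuous_image compact_imp_bounded continuous_on_subset[OF W] by blast
  have fl: "(LINT z|lebesgue. W z * (\<eta> (pull T z) * jac T z)) \<le> (LINT z|lebesgue. W z * \<eta> z)"
    by (rule flow_decreasing[OF Wm C bW[OF C] CU t\<eta> \<eta>0 T(1) _ out hyp]) (use T in auto)
  have tp: "test_function UNIV (\<lambda>z. \<eta> (pull T z) * jac T z)"
    by (rule test_function_mult(2)[OF test_function_comp_pull[OF t\<eta> xstar_UNIV T] smooth_jac])
  have iW: "integrable lebesgue (\<lambda>z. W z * f z)" if f: "test_function UNIV f" for f
  proof -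
    obtain K where K: "smooth f" "compact K" "\<And>z. z \<notin> K \<Longrightarrow> f z = 0" using test_functionE[OF f] by metis
    show ?thesis by (rule integrable_mult_test_function[OF Wm K(2) bW[OF K(2)] smooth_continuous[OF K(1)] K(3)])
  qed
  have "c * (LINT z|lebesgue. \<eta> z) = (LINT z|lebesgue. c * (\<eta> (pull T z) * jac T z))"
    using flow_invariant[OF t\<eta> T] by simp
  also have "\<dots> \<le> (LINT z|lebesgue. W z * (\<eta> (pull T z) * jac T z))"
  proof (rule integral_mono[OF integrable_mult_right[OF test_function_integrable[OF tp]] iW[OF tp]])
    fix z
    show "c * (\<eta> (pull T z) * jac T z) \<le> W z * (\<eta> (pull T z) * jac T z)"
    proof (cases "pull T z \<in> cbox a b")
      case True
      then have "c < W z" using \<delta>2(2)[OF hull[OF T(1) order_refl True]] ab(2) by (auto simp: \<delta>_def dist_commute)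
      then show ?thesis using \<eta>0 jac_bounds[of T z] T by (intro mult_right_mono) auto
    qed (simp add: \<eta>out)
  qed
  also note fl
  also have "(LINT z|lebesgue. W z * \<eta> z) \<le> (LINT z|lebesgue. c1 * \<eta> z)"
  proof (rule integral_mono[OF iW[OF t\<eta>] integrable_mult_right[OF test_function_integrable[OF t\<eta>]]])
    fix z
    show "W z * \<eta> z \<le> c1 * \<eta> z"
    proof (cases "z \<in> cbox a b")
      case True
      then show ?thesis using ab(2) \<eta>0[of z] by (intro mult_right_mono) auto
    qed (simp add: \<eta>out)
  qed
  finally have "(c - c1) * (LINT z|lebesgue. \<eta> z) \<le> 0" by (simp add: left_diff_distrib)
  moreover have "0 \<le> (LINT z|lebesgue. \<eta> z)" by (rule integral_nonneg_AE) (simp add: \<eta>0)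
  ultimately have "(LINT z|lebesgue. \<eta> z) = 0" using c1 by (simp add: mult_le_0_iff)
  then have "AE z in lebesgue. \<eta> z = 0"
    using integral_nonneg_eq_0_iff_AE[OF test_function_integrable[OF t\<eta>]] \<eta>0 by simp
  then have "AE z in lebesgue. z \<notin> box a b"
    by (rule AE_mp) (intro AE_I2 impI, use bump_pos in \<open>force simp: \<eta>_def\<close>)
  then have "negligible (box a b)"
    by (simp add: eventually_ae_filter_negligible) (metis (mono_tags, lifting) mem_Collect_eq negligible_subset subsetI)
  then show False using open_not_negligible[of "box a b"] ab(1) by auto
qed

text \<open>Both points lie on one ray, with x components in the ratio c. If c exceeded 1, then
  \<open>jap z \<le> jap q\<close>, so z would be shrunk no more than q, which forces c \<le> 1. At
  equal times the reverse comparison gives c = 1.\<close>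

lemma pull_injective:
  fixes z q :: "'x::euclidean_space \<times> 'y::euclidean_space"
  assumes t: "0 \<le> t" "t \<le> T" "T \<le> 1/2" and eq: "pull t z = pull T q" and q: "fst q \<noteq> 0"
  obtains c where "1 - T * jap q \<le> c" "c \<le> 1" "z = (c *\<^sub>R fst q, snd q)" "t = T \<Longrightarrow> c = 1"
proof -
  define A where "A = 1 - t * jap z"
  define Q where "Q = 1 - T * jap q"
  have T0: "0 \<le> T" using t by simp
  have tj: "t * jap z \<le> 1/2 * 1" "T * jap q \<le> 1/2 * 1"
    using t T0 jap_pos[of z] jap_le_1[of z] jap_pos[of q] jap_le_1[of q] by (intro mult_mono; simp)+
  have A: "0 < A" "A \<le> 1" and Q: "0 < Q" "Q \<le> 1"
    using tj t T0 jap_pos[of z] jap_pos[of q] by (auto simp: A_def Q_def)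
  define c where "c = Q / A"
  have e: "A *\<^sub>R fst z = Q *\<^sub>R fst q" "snd z = snd q" using eq by (auto simp: pull_def A_def Q_def)
  have "fst z = c *\<^sub>R fst q"
  proof -
    have "fst z = inverse A *\<^sub>R (A *\<^sub>R fst z)" using A by simp
    then show ?thesis unfolding e(1) c_def by (simp add: divide_inverse mult.commute)
  qed
  then have z: "z = (c *\<^sub>R fst q, snd q)" using e(2) by (simp add: prod_eq_iff)
  have c0: "0 < c" using A Q by (simp add: c_def)
  have jz: "jap z = 1 / sqrt (1 + c\<^sup>2 * (fst q \<bullet> fst q))" by (simp add: jap_def z power2_eq_square)
  have qq: "0 < fst q \<bullet> fst q" using q by simp
  have pos: "0 < 1 + c\<^sup>2 * (fst q \<bullet> fst q)" "0 < 1 + fst q \<bullet> fst q" using qq by (auto intro: add_pos_nonneg)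
  have c1: "c \<le> 1"
  proof (rule ccontr)
    assume "\<not> c \<le> 1"
    then have "1\<^sup>2 \<le> c\<^sup>2" by (intro power_mono) auto
    then have "1 * (fst q \<bullet> fst q) \<le> c\<^sup>2 * (fst q \<bullet> fst q)" using qq by (intro mult_right_mono) auto
    then have "jap z \<le> jap q" unfolding jz jap_def[of q] using pos by (intro divide_left_mono) auto
    then have "t * jap z \<le> T * jap q" using t jap_pos[of z] T0 by (intro mult_mono) auto
    then have "c \<le> 1" using A by (simp add: c_def A_def Q_def)
    with \<open>\<not> c \<le> 1\<close> show False by simp
  qed
  show ?thesis
  proof (rule that[OF _ c1 z])
    show "1 - T * jap q \<le> c" using A Q unfolding Q_def[symmetric] c_def by (simp add: pos_le_divide_eq mult_left_le)
    assume tT: "t = T"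
    have "c\<^sup>2 \<le> 1\<^sup>2" using c0 c1 by (intro power_mono) auto
    then have "c\<^sup>2 * (fst q \<bullet> fst q) \<le> 1 * (fst q \<bullet> fst q)" using qq by (intro mult_right_mono) auto
    then have "jap q \<le> jap z" unfolding jz jap_def[of q] using pos by (intro divide_left_mono) auto
    then have "T * jap q \<le> t * jap z" unfolding tT using T0 by (intro mult_left_mono) auto
    then have "A \<le> Q" by (simp add: A_def Q_def)
    then have "1 \<le> c" using A by (simp add: c_def)
    then show "c = 1" using c1 by simp
  qed
qed


lemma has_derivative_lipschitz_bound:
  fixes F :: "'a::euclidean_space \<Rightarrow> real"
  assumes F: "M-lipschitz_on UNIV F" and d: "(F has_derivative T) (at z)"
  shows "((\<lambda>t. (F (z + t *\<^sub>R h) - F z) / t) \<longlongrightarrow> T h) (at 0)" "\<bar>T h\<bar> \<le> M * norm h"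
proof -
  have lin: "linear T" using d has_derivative_linear by blast
  have d': "(F has_derivative T) (at (z + 0 *\<^sub>R h))" using d by simp
  have "((\<lambda>t. F (z + t *\<^sub>R h)) has_derivative (\<lambda>t. T (t *\<^sub>R h))) (at 0)"
    by (rule has_derivative_compose[where f="\<lambda>t. z + t *\<^sub>R h", OF _ d']) (auto intro!: derivative_eq_intros)
  then have "((\<lambda>t. F (z + t *\<^sub>R h)) has_real_derivative T h) (at 0)"
    unfolding has_field_derivative_def
    by (rule has_derivative_eq_rhs) (simp add: linear_scale[OF lin] fun_eq_iff)
  then show lim: "((\<lambda>t. (F (z + t *\<^sub>R h) - F z) / t) \<longlongrightarrow> T h) (at 0)"
    by (simp add: has_field_derivative_iff)
  have b: "\<bar>(F (z + t *\<^sub>R h) - F z) / t\<bar> \<le> M * norm h" for t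
  proof (cases "t = 0")
    case False
    have "\<bar>F (z + t *\<^sub>R h) - F z\<bar> \<le> M * (\<bar>t\<bar> * norm h)"
      using lipschitz_onD[OF F, of "z + t *\<^sub>R h" z] by (simp add: dist_norm)
    then show ?thesis using False by (simp add: field_simps)
  qed (use lipschitz_on_nonneg[OF F] in simp)
  show "\<bar>T h\<bar> \<le> M * norm h"
    by (rule tendsto_upperbound[OF tendsto_rabs[OF lim]]) (use b in \<open>auto intro: always_eventually\<close>)
qed

text \<open>\<open>F\<close> has slope 1 along the chart direction \<open>e\<close>, so an interior
  point z can be shifted along \<open>e\<close> to a boundary point q with the same derivative. This
  joins differentiability almost everywhere inside, which Rademacher's theorem gives, to the
  condition on normals, which concerns the boundary only. Returning from the x component of q to
  that of z changes the derivative by at most M |F z|, whence the right side.\<close>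

lemma repulsive_chart:
  fixes \<Omega> :: "('x::euclidean_space \<times> 'y::euclidean_space) set"
  assumes op: "open \<Omega>" and rep: "repulsive \<Omega>" and chart: "lipschitz_chart \<Omega> p e f" and p: "p \<in> frontier \<Omega>"
  obtains F M r where "0 < r" "M-lipschitz_on UNIV F" "\<Omega> \<inter> ball p r = {z \<in> ball p r. F z < 0}" "F p = 0"
    "\<And>z T. z \<in> \<Omega> \<inter> ball p r \<Longrightarrow> (F has_derivative T) (at z) \<Longrightarrow> T (fst z, 0) \<le> - M * F z"
proof -
  obtain L r0 where e: "norm e = 1" and L: "L-lipschitz_on {w. w \<bullet> e = 0} f" and r0: "0 < r0"
    and \<Omega>: "\<Omega> \<inter> ball p r0 = {z \<in> ball p r0. z \<bullet> e < f (z - (z \<bullet> e) *\<^sub>R e)}"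
    using chart unfolding lipschitz_chart_def by blast
  have ee: "e \<bullet> e = 1" using e by (simp add: norm_eq_1)
  define P where "P = (\<lambda>z. z - (z \<bullet> e) *\<^sub>R e)"
  have Pe: "P z \<bullet> e = 0" for z by (simp add: P_def inner_diff_left ee)
  have Padd: "P (z + t *\<^sub>R e) = P z" for z t by (simp add: P_def inner_add_left ee algebra_simps)
  have Plip: "norm (P z - P w) \<le> norm (z - w)" for z w
  proof -
    have "P z - P w = P (z - w)" by (simp add: P_def inner_diff_left algebra_simps)
    moreover have "(norm (P (z - w)))\<^sup>2 = (norm (z - w))\<^sup>2 - ((z - w) \<bullet> e)\<^sup>2"
      unfolding power2_norm_eq_inner P_def by (simp add: inner_diff_left inner_diff_right ee inner_commute power2_eq_square algebra_simps)
    ultimately have "(norm (P z - P w))\<^sup>2 \<le> (norm (z - w))\<^sup>2" by simp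
    then show ?thesis by (rule power2_le_imp_le) simp
  qed
  define F where "F = (\<lambda>z. z \<bullet> e - f (P z))"
  define M where "M = 1 + L"
  have L0: "0 \<le> L" using L lipschitz_on_nonneg by blast
  have FM: "M-lipschitz_on UNIV F"
  proof (rule lipschitz_onI)
    fix z w
    have "\<bar>f (P z) - f (P w)\<bar> \<le> L * norm (P z - P w)"
      using lipschitz_onD[OF L, of "P z" "P w"] Pe by (simp add: dist_norm)
    also have "\<dots> \<le> L * norm (z - w)" by (rule mult_left_mono[OF Plip L0])
    finally have 1: "\<bar>f (P z) - f (P w)\<bar> \<le> L * norm (z - w)" .
    have 2: "\<bar>z \<bullet> e - w \<bullet> e\<bar> \<le> norm (z - w)"
      using Cauchy_Schwarz_ineq2[of "z - w" e] e by (simp add: inner_diff_left)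
    show "dist (F z) (F w) \<le> M * dist z w"
      unfolding F_def M_def dist_norm real_norm_def using 1 2 by (simp add: distrib_right)
  qed (use L0 in \<open>simp add: M_def\<close>)
  have M1: "1 \<le> M" using L0 by (simp add: M_def)
  have F\<Omega>: "z \<in> \<Omega> \<longleftrightarrow> F z < 0" if "z \<in> ball p r0" for z
  proof -
    have "z \<in> \<Omega> \<inter> ball p r0 \<longleftrightarrow> z \<in> {z \<in> ball p r0. z \<bullet> e < f (z - (z \<bullet> e) *\<^sub>R e)}" by (simp only: \<Omega>)
    then show ?thesis using that by (simp add: F_def P_def)
  qed
  have cF: "continuous_on UNIV F" using FM lipschitz_on_continuous_on by blast
  have p\<Omega>: "p \<notin> \<Omega>" "p \<in> closure \<Omega>" using p op by (auto simp: frontier_def interior_open)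
  have Fp: "F p = 0"
  proof (rule antisym)
    show "0 \<le> F p" using F\<Omega>[of p] p\<Omega> r0 by simp
    show "F p \<le> 0"
    proof (rule ccontr)
      assume "\<not> F p \<le> 0"
      then have "p \<in> ball p r0 \<inter> {z. 0 < F z}" using r0 by simp
      moreover have "open (ball p r0 \<inter> {z. 0 < F z})" by (intro open_Int open_Collect_less continuous_intros cF) simp
      ultimately obtain z where "z \<in> \<Omega>" "z \<in> ball p r0 \<inter> {z. 0 < F z}" using p\<Omega>(2) open_Int_closure_eq_empty[of "ball p r0 \<inter> {z. 0 < F z}" \<Omega>] by blast
      then show False using F\<Omega>[of z] by simp
    qed
  qed
  \<comment> \<open>The shifted point is at distance at most (M + 1) |z - p| from p; this radius
    keeps it where the chart is valid.\<close>
  define r where "r = r0 / (M + 2)"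
  have r: "0 < r" "(M + 1) * r < r0" "r < r0"
  proof -
    show "0 < r" using r0 M1 by (simp add: r_def)
    have "(M + 2) * r = r0" using M1 by (simp add: r_def)
    then show "(M + 1) * r < r0" using \<open>0 < r\<close> by (simp add: algebra_simps)
    moreover have "1 * r \<le> (M + 1) * r" using M1 \<open>0 < r\<close> by (intro mult_right_mono) auto
    ultimately show "r < r0" by simp
  qed
  show ?thesis
  proof (rule that[OF r(1) FM _ Fp])
    show "\<Omega> \<inter> ball p r = {z \<in> ball p r. F z < 0}" using F\<Omega> r(3) by auto
    fix z T assume z: "z \<in> \<Omega> \<inter> ball p r" and T: "(F has_derivative T) (at z)"
    have lin: "linear T" using T has_derivative_linear by blast
    have zr: "norm (z - p) < r" using z by (simp add: dist_norm norm_minus_commute)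
    have Fz: "F z < 0" using F\<Omega>[of z] z r(3) by auto
    have Fz2: "\<bar>F z\<bar> \<le> M * norm (z - p)" using lipschitz_onD[OF FM, of z p] Fp by (simp add: dist_norm)
    \<comment> \<open>The point at which the line through z in direction \<open>e\<close> meets the
      graph.\<close>
    define q where "q = z - F z *\<^sub>R e"
    have Pq: "P q = P z" using Padd[of z "- F z"] by (simp add: q_def)
    have Fadd: "F (w + t *\<^sub>R e) = F w + t" for w t by (simp add: F_def Padd inner_add_left ee)
    have Fq: "F q = 0" using Fadd[of z "- F z"] by (simp add: q_def)
    have "norm (q - p) \<le> norm (z - p) + \<bar>F z\<bar>"
      using norm_triangle_ineq4[of "z - p" "F z *\<^sub>R e"] e by (simp add: q_def algebra_simps)
    also have "\<dots> \<le> (M + 1) * norm (z - p)" using Fz2 by (simp add: algebra_simps)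
    also have "\<dots> \<le> (M + 1) * r" using zr M1 by (intro mult_left_mono) auto
    finally have qp: "norm (q - p) < r0" using r(2) by simp
    then have qb: "q \<in> ball p r0" by (simp add: dist_norm norm_minus_commute)
    have q\<Omega>: "q \<notin> \<Omega>" using F\<Omega>[OF qb] Fq by simp
    have "q \<in> closure \<Omega>"
      unfolding closure_approachable
    proof (intro allI impI)
      fix \<epsilon> :: real assume \<epsilon>: "0 < \<epsilon>"
      define t where "t = min (\<epsilon> / 2) ((r0 - norm (q - p)) / 2)"
      have t: "0 < t" "t < \<epsilon>" "norm (q - p) + t < r0" using \<epsilon> qp by (auto simp: t_def min_def field_simps)
      have "norm (q - t *\<^sub>R e - p) \<le> norm (q - p) + t"
        using norm_triangle_ineq4[of "q - p" "t *\<^sub>R e"] e t(1) by (simp add: algebra_simps)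
      then have "q - t *\<^sub>R e \<in> ball p r0" using t(3) by (simp add: dist_norm norm_minus_commute)
      moreover have "F (q - t *\<^sub>R e) < 0" using Fadd[of q "- t"] Fq t(1) by simp
      ultimately have "q - t *\<^sub>R e \<in> \<Omega>" using F\<Omega> by blast
      moreover have "dist (q - t *\<^sub>R e) q < \<epsilon>" using t e by (simp add: dist_norm)
      ultimately show "\<exists>y\<in>\<Omega>. dist y q < \<epsilon>" by blast
    qed
    then have fq: "q \<in> frontier \<Omega>" using q\<Omega> op by (simp add: frontier_def interior_open)
    have exL: "\<exists>L. L-lipschitz_on {w. w \<bullet> e = 0} f" using L by blast
    have chq: "lipschitz_chart \<Omega> q e f"
      unfolding lipschitz_chart_def
    proof (rule conjI[OF e conjI[OF exL]], rule exI[of _ "r0 - norm (q - p)"], rule conjI)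
      show "0 < r0 - norm (q - p)" using qp by simp
      have "ball q (r0 - norm (q - p)) \<subseteq> ball p r0"
      proof
        fix y assume "y \<in> ball q (r0 - norm (q - p))"
        then show "y \<in> ball p r0" using dist_triangle[of p y q] by (simp add: dist_norm norm_minus_commute)
      qed
      then show "\<Omega> \<inter> ball q (r0 - norm (q - p)) = {z \<in> ball q (r0 - norm (q - p)). z \<bullet> e < f (z - (z \<bullet> e) *\<^sub>R e)}"
        using \<Omega> by blast
    qed
    have Te: "T e = 1"
    proof -
      have "((\<lambda>t. (F (z + t *\<^sub>R e) - F z) / t) \<longlongrightarrow> T e) (at 0)" by (rule has_derivative_lipschitz_bound(1)[OF FM T])
      moreover have "((\<lambda>t. (F (z + t *\<^sub>R e) - F z) / t) \<longlongrightarrow> 1) (at 0)"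
        unfolding Fadd by (rule Lim_transform_eventually[OF tendsto_const[of 1]]) (simp add: eventually_at_filter)
      ultimately show ?thesis using tendsto_unique[of "at (0::real)"] by fastforce
    qed
    define n where "n = (\<Sum>b\<in>Basis. T b *\<^sub>R b)"
    have Tn: "T h = n \<bullet> h" for h
      unfolding n_def linear_sum_Basis[OF lin, of h] inner_sum_left by (simp add: inner_commute mult.commute)
    \<comment> \<open>The gradient of the chart function: that of \<open>F\<close> is
      \<open>n = e - g\<close>, and \<open>T e = 1\<close> makes \<open>g\<close> orthogonal to
      \<open>e\<close>.\<close>
    define g where "g = e - n"
    have ge: "g \<bullet> e = 0" using Te Tn[of e] by (simp add: g_def inner_diff_left ee)
    have df: "(f has_derivative (\<lambda>h. g \<bullet> h)) (at (q - (q \<bullet> e) *\<^sub>R e) within {w. w \<bullet> e = 0})"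
    proof -
      have PP: "P w = w" if "w \<bullet> e = 0" for w using that by (simp add: P_def)
      have z': "P z + (z \<bullet> e) *\<^sub>R e = z" by (simp add: P_def)
      have "((\<lambda>y. y \<bullet> e - F y) has_derivative (\<lambda>h. h \<bullet> e - T h)) (at (P z + (z \<bullet> e) *\<^sub>R e))"
        unfolding z' by (intro has_derivative_diff T bounded_linear_imp_has_derivative bounded_linear_inner_left)
      then have "((\<lambda>w. (w + (z \<bullet> e) *\<^sub>R e) \<bullet> e - F (w + (z \<bullet> e) *\<^sub>R e)) has_derivative (\<lambda>h. h \<bullet> e - T h)) (at (P z))"
        by (rule has_derivative_compose[rotated, where f="\<lambda>w. w + (z \<bullet> e) *\<^sub>R e"]) (auto intro!: derivative_eq_intros)
      moreover have "(w + (z \<bullet> e) *\<^sub>R e) \<bullet> e - F (w + (z \<bullet> e) *\<^sub>R e) = f (P w)" for w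
      proof -
        have "(w + (z \<bullet> e) *\<^sub>R e) \<bullet> e = w \<bullet> e + z \<bullet> e" by (simp add: inner_add_left ee)
        moreover have "F w = w \<bullet> e - f (P w)" by (simp only: F_def)
        ultimately show ?thesis unfolding Fadd by linarith
      qed
      ultimately have "((\<lambda>w. f (P w)) has_derivative (\<lambda>h. h \<bullet> e - T h)) (at (P z))" by (simp only:)
      then have "((\<lambda>w. f (P w)) has_derivative (\<lambda>h. h \<bullet> e - T h)) (at (P z) within {w. w \<bullet> e = 0})"
        by (rule has_derivative_at_withinI)
      then have "(f has_derivative (\<lambda>h. h \<bullet> e - T h)) (at (P z) within {w. w \<bullet> e = 0})"
        by (rule has_derivative_transform_within[OF _ zero_less_one]) (simp_all add: Pe PP)
      moreover have "(\<lambda>h. h \<bullet> e - T h) = (\<lambda>h. g \<bullet> h)" by (simp add: Tn g_def inner_diff_left inner_commute fun_eq_iff)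
      moreover have "q - (q \<bullet> e) *\<^sub>R e = P z" using Pq by (simp add: P_def)
      ultimately show ?thesis by simp
    qed
    have "exterior_unit_normal \<Omega> (fst q, snd q) ((e - g) /\<^sub>R norm (e - g))"
      unfolding exterior_unit_normal_def prod.collapse
      by (intro conjI fq exI[of _ e] exI[of _ f] exI[of _ g] chq ge df refl)
    then have "((e - g) /\<^sub>R norm (e - g)) \<bullet> (fst q, 0) \<le> 0" using rep unfolding repulsive_def by blast
    moreover have "e - g = n" by (simp add: g_def)
    moreover have "n \<noteq> 0" using Te Tn[of e] by auto
    ultimately have "n \<bullet> (fst q, 0) \<le> 0" by (simp add: mult_le_0_iff field_simps del: inner_Pair)
    then have Tq: "T (fst q, 0) \<le> 0" by (simp only: Tn)
    have "(fst z, 0) = (fst q, 0) + F z *\<^sub>R (fst e, 0)" by (simp add: q_def)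
    from arg_cong[OF this, of T] have Tz: "T (fst z, 0) = T (fst q, 0) + F z * T (fst e, 0)"
      unfolding linear_add[OF lin] linear_scale[OF lin] real_scaleR_def .
    have "norm (fst e, 0::'y) \<le> 1" using norm_fst_le[of "fst e" "snd e"] e by (simp add: norm_Pair[of "fst e" 0])
    then have "M * norm (fst e, 0::'y) \<le> M * 1" using M1 by (intro mult_left_mono) auto
    then have "- T (fst e, 0) \<le> M" using has_derivative_lipschitz_bound(2)[OF FM T, of "(fst e, 0)"] by simp
    then have "(- F z) * - T (fst e, 0) \<le> (- F z) * M" using Fz by (intro mult_left_mono) auto
    then show "T (fst z, 0) \<le> - M * F z" unfolding Tz using Tq by (simp add: mult.commute)
  qed
qed

text \<open>The weight |x|^(2k) is an integrating factor: x . grad_x (|x|^(2k) F) is at most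
  |x|^(2k) (2k - M) F, which is nonpositive because F < 0 and 2k \<ge> M. This absorbs the error M
  |F| left by the chart. \<open>ddir_weak\<close> moves the derivative onto \<open>F\<close>, and
  Rademacher's theorem identifies it almost everywhere with the one the hypothesis speaks
  of.\<close>

lemma lipschitz_xdiv_nonneg:
  fixes F :: "'x::euclidean_space \<times> 'y::euclidean_space \<Rightarrow> real"
  assumes FM: "M-lipschitz_on UNIV F" and k: "M \<le> 2 * real k" and neg: "\<And>z. z \<in> U \<Longrightarrow> F z < 0"
    and T: "\<And>z T. z \<in> U \<Longrightarrow> (F has_derivative T) (at z) \<Longrightarrow> T (fst z, 0) \<le> - M * F z"
    and \<eta>: "test_function U \<eta>" "\<And>z. 0 \<le> \<eta> z"
  shows "0 \<le> (LINT z|lebesgue. (fst z \<bullet> fst z) ^ k * F z * xdiv \<eta> z)"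
proof -
  define m where "m = (\<lambda>z::'x \<times> 'y. (fst z \<bullet> fst z) ^ k)"
  have sm: "smooth m" unfolding m_def by (intro smooth_intros)
  have m0: "0 \<le> m z" for z by (simp add: m_def)
  have s\<eta>: "smooth \<eta>" by (rule test_function_smooth[OF \<eta>(1)])
  define \<zeta> where "\<zeta> = (\<lambda>z. m z * \<eta> z)"
  have t\<zeta>: "test_function U \<zeta>" unfolding \<zeta>_def by (rule test_function_mult(1)[OF \<eta>(1) sm])
  have s\<zeta>: "smooth \<zeta>" by (rule test_function_smooth[OF t\<zeta>])
  have pm: "partial (fst z, 0) m z = 2 * real k * m z" for z
  proof -
    have "((\<lambda>z::'x \<times> 'y. fst z \<bullet> fst z) has_derivative (\<lambda>h. fst z \<bullet> fst h + fst h \<bullet> fst z)) (at z)"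
      by (intro has_derivative_inner bounded_linear.has_derivative[OF bounded_linear_fst] has_derivative_ident)
    from partial_eqI[OF has_derivative_power[OF this, of k], of "(fst z, 0)"] show ?thesis
      unfolding m_def by (cases k) simp_all
  qed
  \<comment> \<open>The weight is absorbed into the test function; being homogeneous of degree 2k in
    x, it contributes the constant 2k.\<close>
  have xd: "m z * xdiv \<eta> z = xdiv \<zeta> z - 2 * real k * \<zeta> z" for z
    unfolding xdiv_eq[OF s\<zeta>] xdiv_eq[OF s\<eta>] unfolding \<zeta>_def partial_mult[OF sm s\<eta>] pm by (simp add: algebra_simps)
  obtain K where K: "compact K" "K \<subseteq> U" "\<And>z. z \<notin> K \<Longrightarrow> \<zeta> z = 0" using test_functionE[OF t\<zeta>] by metis
  have cF: "continuous_on UNIV F" using FM lipschitz_on_continuous_on by blast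
  have [measurable]: "F \<in> borel_measurable borel" by (rule borel_measurable_continuous_onI[OF cF])
  have bm: "f \<in> borel_measurable borel" if "smooth f" for f :: "'x \<times> 'y \<Rightarrow> real"
    by (rule borel_measurable_continuous_onI[OF smooth_continuous[OF that]])
  have [measurable]: "\<zeta> \<in> borel_measurable borel" by (rule bm[OF s\<zeta>])
  let ?tb = "\<lambda>b z. (fst z \<bullet> b) * \<zeta> z"
  have tb: "test_function U (?tb b)" for b by (rule test_function_mult(1)[OF t\<zeta>]) (intro smooth_intros)
  have tbU: "test_function UNIV (?tb b)" for b by (rule test_function_mono[OF tb]) simp
  have icont: "integrable lborel (\<lambda>z. F z * g z)" if "smooth g" "\<And>z. z \<notin> K \<Longrightarrow> g z = 0" for g
    by (rule integrable_lborel_compact[OF continuous_on_mult[OF cF smooth_continuous[OF that(1)]] K(1)]) (simp add: that(2))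
  have i\<zeta>: "integrable lborel \<zeta>" by (rule integrable_lborel_compact[OF smooth_continuous[OF s\<zeta>] K(1,3)])
  let ?d = "\<lambda>b z. ddir F M (b, 0) z"
  have [measurable]: "ddir F M v \<in> borel_measurable borel" for v by (rule ddir_borel[OF FM])
  have id: "integrable lborel (\<lambda>z. ?d b z * ?tb b z)" for b
  proof (rule Bochner_Integration.integrable_bound)
    show "integrable lborel (\<lambda>z. (M * norm (b, 0::'y)) * ?tb b z)"
      by (intro integrable_mult_right integrable_lborel_compact[OF smooth_continuous[OF test_function_smooth[OF tb]] K(1)]) (simp add: K(3))
    show "(\<lambda>z. ?d b z * ?tb b z) \<in> borel_measurable lborel"
      using bm[OF test_function_smooth[OF tb[of b]]] by measurable
    show "AE z in lborel. norm (?d b z * ?tb b z) \<le> norm ((M * norm (b, 0::'y)) * ?tb b z)"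
    proof (rule AE_I2)
      fix z
      have "\<bar>?d b z\<bar> * \<bar>?tb b z\<bar> \<le> (M * norm (b, 0::'y)) * \<bar>?tb b z\<bar>" by (rule mult_right_mono[OF ddir_bound[OF FM]]) simp
      also have "\<dots> = \<bar>(M * norm (b, 0::'y)) * ?tb b z\<bar>" using lipschitz_on_nonneg[OF FM] by (simp add: abs_mult)
      finally show "norm (?d b z * ?tb b z) \<le> norm ((M * norm (b, 0::'y)) * ?tb b z)" by (simp only: abs_mult real_norm_def)
    qed
  qed
  have iF\<zeta>: "integrable lborel (\<lambda>z. F z * \<zeta> z)" by (rule icont[OF s\<zeta> K(3)])
  have iFx: "integrable lborel (\<lambda>z. F z * xdiv \<zeta> z)" by (rule icont[OF smooth_xdiv[OF s\<zeta>] xdiv_outside[OF K(1,3)]])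
  have "(LINT z|lborel. F z * xdiv \<zeta> z) = (\<Sum>b\<in>Basis. LINT z|lborel. F z * partial (b, 0) (?tb b) z)"
    unfolding xdiv_def sum_distrib_left
  proof (rule Bochner_Integration.integral_sum)
    show "integrable lborel (\<lambda>z. F z * partial (b, 0) (?tb b) z)" for b
      by (rule icont[OF smooth_partial[OF test_function_smooth[OF tb]] partial_zero_outside[OF K(1)]]) (simp_all add: K(3))
  qed
  also have "\<dots> = - (\<Sum>b\<in>Basis. LINT z|lborel. ?d b z * ?tb b z)"
    unfolding ddir_weak[OF FM tbU] by (simp add: sum_negf)
  also have "(\<Sum>b\<in>Basis. LINT z|lborel. ?d b z * ?tb b z) = (LINT z|lborel. (\<Sum>b\<in>Basis. ?d b z * ?tb b z))"
    by (rule Bochner_Integration.integral_sum[symmetric]) (rule id)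
  finally have ibp: "(LINT z|lborel. F z * xdiv \<zeta> z) = - (LINT z|lborel. (\<Sum>b\<in>Basis. ?d b z * ?tb b z))" .
  have isum: "integrable lborel (\<lambda>z. \<Sum>b\<in>Basis. ?d b z * ?tb b z)" using id by simp
  have "AE z in lborel. \<forall>b\<in>(Basis :: 'x set). ((\<lambda>h. (F (z + h *\<^sub>R (b, 0)) - F z) / h) \<longlongrightarrow> ?d b z) (at 0)"
    by (subst AE_ball_countable, simp add: countable_finite, intro ballI ddir_AE[OF FM])
  then have ae: "AE z in lborel. (\<Sum>b\<in>Basis. ?d b z * ?tb b z) + 2 * real k * (F z * \<zeta> z) \<le> 0"
    using rademacher[OF FM]
  proof eventually_elim
    case (elim z)
    show ?case
    proof (cases "z \<in> K")
      case False
      then show ?thesis by (simp add: K(3))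
    next
      case True
      then have zU: "z \<in> U" using K(2) by blast
      obtain T' where T': "(F has_derivative T') (at z)" using elim(2) by (auto simp: differentiable_def)
      have "?d b z = T' (b, 0)" if "b \<in> Basis" for b
        by (rule tendsto_unique[OF _ bspec[OF elim(1) that] has_derivative_lipschitz_bound(1)[OF FM T']]) simp
      then have "(\<Sum>b\<in>Basis. ?d b z * ?tb b z) = (\<Sum>b\<in>Basis. (fst z \<bullet> b) * T' (b, 0)) * \<zeta> z"
        unfolding sum_distrib_right by (intro sum.cong) auto
      also have "\<dots> = T' (fst z, 0) * \<zeta> z" by (simp add: linear_sum_fst_Basis[OF has_derivative_linear[OF T']])
      finally have eq: "(\<Sum>b\<in>Basis. ?d b z * ?tb b z) + 2 * real k * (F z * \<zeta> z) = (T' (fst z, 0) + 2 * real k * F z) * \<zeta> z"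
        by (simp add: algebra_simps)
      have "(2 * real k - M) * F z \<le> 0" using k neg[OF zU] by (simp add: mult_le_0_iff)
      then have "T' (fst z, 0) + 2 * real k * F z \<le> 0" using T[OF zU T'] by (simp add: algebra_simps)
      then show ?thesis unfolding eq using m0[of z] \<eta>(2)[of z] by (simp add: \<zeta>_def mult_le_0_iff)
    qed
  qed
  have "0 \<le> (LINT z|lborel. - ((\<Sum>b\<in>Basis. ?d b z * ?tb b z) + 2 * real k * (F z * \<zeta> z)))"
    by (rule integral_nonneg_AE) (use ae in auto)
  also have "\<dots> = (LINT z|lborel. F z * xdiv \<zeta> z) - 2 * real k * (LINT z|lborel. F z * \<zeta> z)"
    unfolding ibp using isum iF\<zeta> by simp
  also have "\<dots> = (LINT z|lborel. F z * xdiv \<zeta> z - 2 * real k * (F z * \<zeta> z))" using iFx iF\<zeta> by simp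
  also have "\<dots> = (LINT z|lborel. (fst z \<bullet> fst z) ^ k * F z * xdiv \<eta> z)"
  proof (rule Bochner_Integration.integral_cong[OF refl])
    fix z
    have "F z * (m z * xdiv \<eta> z) = F z * (xdiv \<zeta> z - 2 * real k * \<zeta> z)" by (simp only: xd)
    then show "F z * xdiv \<zeta> z - 2 * real k * (F z * \<zeta> z) = (fst z \<bullet> fst z) ^ k * F z * xdiv \<eta> z"
      by (simp add: m_def algebra_simps)
  qed
  also have "\<dots> = (LINT z|lebesgue. (fst z \<bullet> fst z) ^ k * F z * xdiv \<eta> z)"
    by (rule integral_completion[symmetric]) (use bm[OF smooth_xdiv[OF s\<eta>]] bm[OF sm[unfolded m_def]] in measurable)
  finally show ?thesis .
qed

text \<open>A ray going outward from a point of the domain is followed to its first exit p. The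
  weighted defining function is negative just before p and does not increase along the ray towards
  p, yet it vanishes at p.\<close>

theorem repulsive_imp_xstar:
  fixes \<Omega> :: "('x::euclidean_space \<times> 'y::euclidean_space) set"
  assumes op: "open \<Omega>" and lip: "lipschitz_boundary \<Omega>" and rep: "repulsive \<Omega>"
  shows "xstar \<Omega>"
proof (rule ccontr)
  assume "\<not> xstar \<Omega>"
  then obtain z0 s1 where z0: "z0 \<in> \<Omega>" and s1: "1 \<le> s1" "(s1 *\<^sub>R fst z0, snd z0) \<notin> \<Omega>" unfolding xstar_def by blast
  define \<gamma> where "\<gamma> = (\<lambda>s. (s *\<^sub>R fst z0, snd z0))"
  have c\<gamma>: "continuous_on A \<gamma>" for A unfolding \<gamma>_def by (intro continuous_intros)
  have \<gamma>1: "\<gamma> 1 = z0" by (simp add: \<gamma>_def)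
  have x0: "fst z0 \<noteq> 0"
  proof
    assume "fst z0 = 0"
    then have "(s1 *\<^sub>R fst z0, snd z0) = z0" by (simp add: prod_eq_iff)
    then show False using z0 s1 by simp
  qed
  define S where "S = {1..s1} \<inter> \<gamma> -` (- \<Omega>)"
  have "closed S" unfolding S_def by (rule continuous_closed_preimage[OF c\<gamma>]) (use op in auto)
  moreover have S1: "s1 \<in> S" using s1 by (simp add: S_def \<gamma>_def)
  moreover have bS: "bdd_below S" by (rule bdd_belowI[of _ 1]) (simp add: S_def)
  ultimately have \<sigma>S: "Inf S \<in> S" using closed_contains_Inf by blast
  define \<sigma> where "\<sigma> = Inf S"
  have \<sigma>: "\<gamma> \<sigma> \<notin> \<Omega>" "1 \<le> \<sigma>" "\<sigma> \<le> s1" using \<sigma>S by (auto simp: S_def \<sigma>_def)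
  have below: "\<gamma> s \<in> \<Omega>" if "1 \<le> s" "s < \<sigma>" for s
  proof (rule ccontr)
    assume "\<gamma> s \<notin> \<Omega>"
    then have "s \<in> S" using that \<sigma>(3) by (simp add: S_def)
    then have "\<sigma> \<le> s" unfolding \<sigma>_def by (rule cInf_lower[OF _ bS])
    then show False using that by simp
  qed
  have \<sigma>1: "1 < \<sigma>" using \<sigma> z0 \<gamma>1 by (cases "\<sigma> = 1") auto
  define p where "p = \<gamma> \<sigma>"
  have lim: "(\<gamma> \<longlongrightarrow> p) (at_left \<sigma>)"
  proof -
    have "isCont \<gamma> \<sigma>" using c\<gamma>[of UNIV] by (simp add: continuous_on_eq_continuous_at)
    then have "(\<gamma> \<longlongrightarrow> p) (at \<sigma>)" by (simp add: isCont_def p_def)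
    then show ?thesis by (rule tendsto_mono[OF at_le[OF subset_UNIV]])
  qed
  have ev: "\<forall>\<^sub>F s in at_left \<sigma>. s \<in> {1<..<\<sigma>}" by (rule eventually_at_leftI[OF _ \<sigma>1]) 
  have "p \<in> closure \<Omega>"
  proof (rule Lim_in_closed_set[OF closed_closure _ _ lim])
    show "\<forall>\<^sub>F s in at_left \<sigma>. \<gamma> s \<in> closure \<Omega>"
      using ev by eventually_elim (use below closure_subset in force)
  qed simp
  then have p: "p \<in> frontier \<Omega>" using \<sigma>(1) op by (simp add: p_def frontier_def interior_open)
  obtain e f where ch: "lipschitz_chart \<Omega> p e f" using lip p unfolding lipschitz_boundary_def by blast
  obtain F M r where r: "0 < r" and FM: "M-lipschitz_on UNIV F"
    and F\<Omega>: "\<Omega> \<inter> ball p r = {z \<in> ball p r. F z < 0}" and Fp: "F p = 0"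
    and FT: "\<And>z T. z \<in> \<Omega> \<inter> ball p r \<Longrightarrow> (F has_derivative T) (at z) \<Longrightarrow> T (fst z, 0) \<le> - M * F z"
    by (rule repulsive_chart[OF op rep ch p]) blast
  define U where "U = \<Omega> \<inter> ball p r"
  have oU: "open U" unfolding U_def using op by auto
  obtain k :: nat where k: "M \<le> real k" using real_arch_simple by blast
  have k2: "M \<le> 2 * real k" using k by simp
  define W where "W = (\<lambda>z::'x \<times> 'y. (fst z \<bullet> fst z) ^ k * F z)"
  have cF: "continuous_on UNIV F" using FM lipschitz_on_continuous_on by blast
  have cW: "continuous_on UNIV W" unfolding W_def by (intro continuous_intros cF)
  have negU: "F z < 0" if "z \<in> U" for z using that F\<Omega> unfolding U_def by blast
  have hyp: "0 \<le> (LINT z|lebesgue. W z * xdiv \<eta> z)" if "test_function U \<eta>" "\<And>z. 0 \<le> \<eta> z" for \<eta>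
    unfolding W_def
  proof (rule lipschitz_xdiv_nonneg[OF FM k2, of U \<eta>])
    show "T (fst z, 0) \<le> - M * F z" if "z \<in> U" "(F has_derivative T) (at z)" for z T
      using FT that unfolding U_def by blast
  qed (use negU that in auto)
  obtain \<epsilon> where \<epsilon>: "0 < \<epsilon>" "\<And>s. \<bar>s - \<sigma>\<bar> < \<epsilon> \<Longrightarrow> \<gamma> s \<in> ball p r"
  proof -
    have "isCont \<gamma> \<sigma>" using c\<gamma>[of UNIV] by (simp add: continuous_on_eq_continuous_at)
    then obtain \<epsilon> where "0 < \<epsilon>" "\<forall>s. dist s \<sigma> < \<epsilon> \<longrightarrow> dist (\<gamma> s) (\<gamma> \<sigma>) < r"
      using r unfolding continuous_at_eps_delta by blast
    then show ?thesis by (intro that[of \<epsilon>]) (auto simp: p_def dist_real_def dist_commute)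
  qed
  \<comment> \<open>Restricting the ray to a piece of length parameter at most 1 / \<kappa> makes
    the time \<open>T\<close> below at most 1/2.\<close>
  define \<kappa> where "\<kappa> = 2 * (1 + norm (fst z0))"
  have \<kappa>: "2 \<le> \<kappa>" by (simp add: \<kappa>_def)
  define m where "m = min (min (\<epsilon> / 2) ((\<sigma> - 1) / 2)) (1 / \<kappa>)"
  have m: "0 < m" "m \<le> \<epsilon> / 2" "m \<le> (\<sigma> - 1) / 2" "m \<le> 1 / \<kappa>"
  proof -
    show "0 < m" using \<epsilon>(1) \<sigma>1 \<kappa> by (simp add: m_def)
    show "m \<le> \<epsilon> / 2" unfolding m_def by (rule order_trans[OF min.cobounded1 min.cobounded1])
    show "m \<le> (\<sigma> - 1) / 2" unfolding m_def by (rule order_trans[OF min.cobounded1 min.cobounded2])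
    show "m \<le> 1 / \<kappa>" unfolding m_def by (rule min.cobounded2)
  qed
  define s0 where "s0 = \<sigma> - m"
  have s0: "s0 < \<sigma>" "1 < s0" "\<sigma> - s0 < \<epsilon>" "\<sigma> - s0 \<le> 1 / \<kappa>" using m \<epsilon>(1) \<sigma>1 by (auto simp: s0_def)
  have inU: "\<gamma> s \<in> U" if "s0 \<le> s" "s < \<sigma>" for s
    unfolding U_def using below[of s] \<epsilon>(2)[of s] that s0 by auto
  have W: "W (\<gamma> s) \<le> W (\<gamma> s0)" if s: "s0 < s" "s < \<sigma>" for s
  proof -
    define q where "q = \<gamma> s"
    have jq: "0 < jap q" by (rule jap_pos)
    \<comment> \<open>Chosen so that \<open>pull T\<close> carries \<open>\<gamma> s\<close> back to
      \<open>\<gamma> s0\<close>: it multiplies the x component by s0 / s.\<close>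
    define T where "T = (1 - s0 / s) / jap q"
    have sp: "1 < s" using s s0 by simp
    have Tj: "1 - T * jap q = s0 / s" using jq by (simp add: T_def)
    have "s0 / s \<le> 1" using s sp by simp
    then have T0: "0 \<le> T" using jq by (simp add: T_def)
    have "1 / jap q = sqrt (1 + fst q \<bullet> fst q)" by (simp add: jap_def)
    also have "\<dots> \<le> 1 + norm (fst q)"
      by (rule real_le_lsqrt) (simp_all add: power2_sum power2_norm_eq_inner)
    also have "norm (fst q) = s * norm (fst z0)" using sp by (simp add: q_def \<gamma>_def)
    finally have j1: "1 / jap q \<le> 1 + s * norm (fst z0)" .
    have T12: "T \<le> 1/2"
    proof -
      have "T = (s - s0) / s * (1 / jap q)" using sp by (simp add: T_def diff_divide_distrib)
      also have "\<dots> \<le> (s - s0) / s * (1 + s * norm (fst z0))" using j1 s sp by (intro mult_left_mono) auto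
      also have "\<dots> = (s - s0) * (1 / s + norm (fst z0))" using sp by (simp add: field_simps)
      also have "\<dots> \<le> (1 / \<kappa>) * (1 + norm (fst z0))" using s s0 sp \<kappa> by (intro mult_mono add_right_mono) auto
      also have "\<dots> = 1 / 2"
      proof -
        have "1 + norm (fst z0) \<noteq> 0" using norm_ge_zero[of "fst z0"] by linarith
        then show ?thesis by (simp add: \<kappa>_def field_simps)
      qed
      finally show ?thesis .
    qed
    have fq: "fst q \<noteq> 0" using x0 sp by (simp add: q_def \<gamma>_def)
    have pq: "pull T q = \<gamma> s0" unfolding pull_def Tj using sp by (simp add: q_def \<gamma>_def)
    have "W q \<le> W (\<gamma> s0)"
    proof (rule flow_pointwise[OF cW oU hyp T0 T12])
      fix t z assume t: "0 \<le> t" "t \<le> T" and z: "pull t z = \<gamma> s0"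
      obtain c where c: "1 - T * jap q \<le> c" "c \<le> 1" "z = (c *\<^sub>R fst q, snd q)"
        by (rule pull_injective[OF t T12 z[folded pq] fq]) blast
      have zc: "z = \<gamma> (c * s)" unfolding c(3) by (simp add: q_def \<gamma>_def)
      have "s0 / s * s \<le> c * s" using c(1) sp unfolding Tj by (intro mult_right_mono) auto
      then have c1: "s0 \<le> c * s" using sp by simp
      have "c * s \<le> 1 * s" using c(2) sp by (intro mult_right_mono) auto
      then have c2: "c * s < \<sigma>" using s by linarith
      show "z \<in> U" unfolding zc using c1 c2 sp s by (intro inU) linarith+
    next
      fix z assume z: "pull T z = \<gamma> s0"
      obtain c where "z = (c *\<^sub>R fst q, snd q)" "c = 1"
        by (rule pull_injective[OF T0 order_refl T12 z[folded pq] fq]) simp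
      then show "z = q" by (simp add: prod_eq_iff)
    qed
    then show ?thesis by (simp add: q_def)
  qed
  have "((\<lambda>s. W (\<gamma> s)) \<longlongrightarrow> W p) (at_left \<sigma>)"
  proof (rule isCont_tendsto_compose[OF _ lim])
    show "isCont W p" using cW continuous_on_eq_continuous_at[OF open_UNIV, of W] by blast
  qed
  then have "W p \<le> W (\<gamma> s0)"
  proof (rule tendsto_upperbound)
    have "\<forall>\<^sub>F s in at_left \<sigma>. s \<in> {s0<..<\<sigma>}" by (rule eventually_at_leftI[OF _ s0(1)])
    then show "\<forall>\<^sub>F s in at_left \<sigma>. W (\<gamma> s) \<le> W (\<gamma> s0)" by eventually_elim (use W in auto)
  qed simp
  moreover have "W p = 0" by (simp add: W_def Fp)
  moreover have "W (\<gamma> s0) < 0"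
  proof -
    have "0 < fst (\<gamma> s0) \<bullet> fst (\<gamma> s0)" using x0 s0 by (simp add: \<gamma>_def)
    then show ?thesis unfolding W_def using negU[OF inU[OF order_refl s0(1)]] by (simp add: mult_less_0_iff)
  qed
  ultimately show False by simp
qed

section \<open>Removing the factor |x| from the condition on the potential\<close>

section \<open>The potential decreases along the flow\<close>

lemma test_function_xdiv:
  fixes \<eta> :: "'x::euclidean_space \<times> 'y::euclidean_space \<Rightarrow> real"
  assumes "test_function \<Omega> \<eta>" shows "test_function \<Omega> (xdiv \<eta>)"
  unfolding xdiv_def[abs_def]
  by (intro test_function_sum test_function_partial test_function_mult assms smooth_intros)

text \<open>The factor \<open>norm (fst z)\<close> in the hypothesis is removed by testing with \<open>\<eta>\<close> times a
  smooth approximation of \<open>1 / norm (fst z)\<close>, whose radial derivative has the good sign.\<close>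

lemma repulsive_potential:
  fixes V :: "'x::euclidean_space \<times> 'y::euclidean_space \<Rightarrow> real"
  assumes V [measurable]: "V \<in> borel_measurable lebesgue" and nn: "\<And>z. 0 \<le> V z"
    and bd: "\<And>K. compact K \<Longrightarrow> K \<subseteq> \<Omega> \<Longrightarrow> bounded (V ` K)"
    and rep: "\<And>\<eta>. test_function \<Omega> \<eta> \<Longrightarrow> (\<And>z. 0 \<le> \<eta> z) \<Longrightarrow> 0 \<le> (LINT z|lebesgue. V z * (norm (fst z) * xdiv \<eta> z))"
    and \<eta>: "test_function \<Omega> \<eta>" "\<And>z. 0 \<le> \<eta> z"
  shows "0 \<le> (LINT z|lebesgue. V z * xdiv \<eta> z)"
proof -
  obtain K where K: "smooth \<eta>" "compact K" "K \<subseteq> \<Omega>" "\<And>z. z \<notin> K \<Longrightarrow> \<eta> z = 0"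
    using test_functionE[OF \<eta>(1)] by metis
  \<comment> \<open>With c = k + 1, \<open>J k\<close> is 1 / sqrt (1 + c^2 |x|^2). Then c
    \<open>J k\<close> smoothly approximates 1 / |x|, and \<open>m k\<close>, its product with |x|,
    tends to 1 off x = 0.\<close>
  define J where "J k z = jap (real (Suc k) *\<^sub>R z)" for k and z :: "'x \<times> 'y"
  define m where "m k z = real (Suc k) * norm (fst z) * J k z" for k and z :: "'x \<times> 'y"
  have J0: "0 < J k z" for k z unfolding J_def by (rule jap_pos)
  have J1: "J k z \<le> 1" for k z unfolding J_def by (rule jap_le_1)
  have m1: "0 \<le> m k z" "m k z \<le> 1" for k z
    using norm_jap_le_1[of "real (Suc k) *\<^sub>R z"] J0[of k z] by (simp_all add: m_def J_def)
  have msq: "(m k z)\<^sup>2 = 1 - (J k z)\<^sup>2" for k z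
    using jap_sq[of "real (Suc k) *\<^sub>R z"]
    unfolding m_def J_def power_mult_distrib power2_norm_eq_inner by (simp add: power2_eq_square mult_ac)
  have sJ: "smooth (J k)" for k
    unfolding J_def by (rule smooth_compose[OF smooth_jap]) (intro smooth_intros)
  have cm: "continuous_on UNIV (m k)" for k
    unfolding m_def by (intro continuous_intros smooth_continuous[OF sJ])
  have zero: "xdiv \<eta> z = 0" if "z \<notin> K" for z
  proof -
    have "\<eta> z = 0" "partial (fst z, 0) \<eta> z = 0"
      using K(4)[OF that] partial_zero_outside[OF K(2,4) that] by auto
    then show ?thesis by (simp add: xdiv_eq[OF K(1)])
  qed
  have cx: "continuous_on UNIV (xdiv \<eta>)"
    by (rule smooth_continuous[OF test_function_smooth[OF test_function_xdiv[OF \<eta>(1)]]])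
  have int: "integrable lebesgue (\<lambda>z. V z * f z)" if "continuous_on UNIV f" "\<And>z. z \<notin> K \<Longrightarrow> f z = 0" for f
    by (rule integrable_mult_test_function[OF V K(2) bd[OF K(2,3)] that])
  have pos: "0 \<le> (LINT z|lebesgue. V z * (m k z * xdiv \<eta> z))" for k
  proof -
    let ?c = "real (Suc k)"
    define \<rho> where "\<rho> z = ?c * J k z" for z
    have s\<rho>: "smooth \<rho>" unfolding \<rho>_def by (intro smooth_intros sJ)
    have t: "test_function \<Omega> (\<lambda>z. \<rho> z * \<eta> z)" by (rule test_function_mult[OF \<eta>(1) s\<rho>])
    have st: "smooth (\<lambda>z. \<rho> z * \<eta> z)" by (rule test_function_smooth[OF t])
    have cxt: "continuous_on UNIV (xdiv (\<lambda>z. \<rho> z * \<eta> z))"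
      by (rule smooth_continuous[OF test_function_smooth[OF test_function_xdiv[OF t]]])
    have p\<rho>: "partial (fst z, 0) \<rho> z = - (\<rho> z * (m k z)\<^sup>2)" for z
    proof -
      have "(J k has_derivative (\<lambda>h. - ((fst (?c *\<^sub>R z) \<bullet> fst (?c *\<^sub>R h)) * J k z ^ 3))) (at z)"
        unfolding J_def
        by (rule has_derivative_compose[OF has_derivative_scaleR_right[OF has_derivative_ident] jap_has_derivative])
      from has_derivative_mult_right[OF this, of ?c]
      have "partial (fst z, 0) \<rho> z = ?c * - ((fst (?c *\<^sub>R z) \<bullet> fst (?c *\<^sub>R (fst z, 0::'y))) * J k z ^ 3)"
        unfolding \<rho>_def by (rule partial_eqI)
      also have "\<dots> = - (\<rho> z * (m k z)\<^sup>2)"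
        by (simp add: \<rho>_def m_def power_mult_distrib dot_square_norm power2_eq_square power3_eq_cube)
      finally show ?thesis .
    qed
    have x: "xdiv (\<lambda>z. \<rho> z * \<eta> z) z = \<rho> z * xdiv \<eta> z - \<rho> z * (m k z)\<^sup>2 * \<eta> z" for z
      unfolding xdiv_eq[OF st] xdiv_eq[OF K(1)] partial_mult[OF s\<rho> K(1)] p\<rho> by (simp add: algebra_simps)
    have "0 \<le> (LINT z|lebesgue. V z * (norm (fst z) * xdiv (\<lambda>z. \<rho> z * \<eta> z) z))"
      by (rule rep[OF t]) (use \<eta>(2) J0 in \<open>simp add: \<rho>_def less_imp_le\<close>)
    also have "\<dots> \<le> (LINT z|lebesgue. V z * (m k z * xdiv \<eta> z))"
    proof (rule integral_mono)
      show "integrable lebesgue (\<lambda>z. V z * (norm (fst z) * xdiv (\<lambda>z. \<rho> z * \<eta> z) z))"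
        by (rule int) (intro continuous_intros cxt, simp add: x zero K(4))
      show "integrable lebesgue (\<lambda>z. V z * (m k z * xdiv \<eta> z))"
        by (rule int) (intro continuous_intros cx cm, simp add: zero)
      fix z :: "'x \<times> 'y"
      have "m k z = norm (fst z) * \<rho> z" by (simp add: m_def \<rho>_def)
      then have "norm (fst z) * xdiv (\<lambda>z. \<rho> z * \<eta> z) z = m k z * xdiv \<eta> z - m k z * (m k z)\<^sup>2 * \<eta> z"
        unfolding x by (simp add: algebra_simps)
      also have "\<dots> \<le> m k z * xdiv \<eta> z" using m1[of k z] \<eta>(2)[of z] by simp
      finally show "V z * (norm (fst z) * xdiv (\<lambda>z. \<rho> z * \<eta> z) z) \<le> V z * (m k z * xdiv \<eta> z)"
        by (rule mult_left_mono[OF _ nn])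
    qed
    finally show ?thesis .
  qed
  have lim: "(\<lambda>k. m k z) \<longlonglongrightarrow> 1" if z: "fst z \<noteq> 0" for z
  proof -
    have "(\<lambda>k. J k z) \<longlonglongrightarrow> 0"
    proof (rule tendsto_sandwich)
      show "\<forall>\<^sub>F k in sequentially. 0 \<le> J k z" using J0 by (simp add: less_imp_le)
      show "\<forall>\<^sub>F k in sequentially. J k z \<le> inverse (real (Suc k)) * (1 / norm (fst z))"
      proof (intro always_eventually allI)
        fix k
        have "real (Suc k) * norm (fst z) * J k z \<le> 1" using m1(2)[of k z] by (simp only: m_def)
        then show "J k z \<le> inverse (real (Suc k)) * (1 / norm (fst z))" using z by (simp add: field_simps del: of_nat_Suc)
      qed
      show "(\<lambda>k. inverse (real (Suc k)) * (1 / norm (fst z))) \<longlonglongrightarrow> 0"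
        by (rule tendsto_mult_left_zero[OF LIMSEQ_inverse_real_of_nat])
    qed simp
    then have "(\<lambda>k. sqrt (1 - (J k z)\<^sup>2)) \<longlonglongrightarrow> sqrt (1 - 0\<^sup>2)" by (intro tendsto_intros)
    moreover have "sqrt (1 - (J k z)\<^sup>2) = m k z" for k using m1(1)[of k z] by (simp add: msq[symmetric])
    ultimately show ?thesis by simp
  qed
  obtain b :: 'x where b: "b \<in> Basis" using nonempty_Basis by blast
  \<comment> \<open>The set x = 0, where \<open>m k\<close> does not tend to 1, lies in a null
    hyperplane.\<close>
  have "negligible {z :: 'x \<times> 'y. (b, 0) \<bullet> z = 0}" by (rule negligible_hyperplane) (use b in \<open>auto simp: zero_prod_def\<close>)
  then have "AE z in lebesgue. z \<notin> {z :: 'x \<times> 'y. (b, 0) \<bullet> z = 0}"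
    by (intro AE_not_in) (simp add: negligible_iff_null_sets)
  then have ae: "AE z in lebesgue. fst (z :: 'x \<times> 'y) \<noteq> 0" by (rule AE_mp) (auto intro!: AE_I2 simp: inner_prod_def)
  have "(\<lambda>k. LINT z|lebesgue. V z * (m k z * xdiv \<eta> z)) \<longlonglongrightarrow> (LINT z|lebesgue. V z * xdiv \<eta> z)"
  proof (rule integral_dominated_convergence[where w="\<lambda>z. \<bar>V z * xdiv \<eta> z\<bar>"])
    show "(\<lambda>z. V z * xdiv \<eta> z) \<in> borel_measurable lebesgue"
      using int[OF cx zero] by (rule borel_measurable_integrable)
    show "integrable lebesgue (\<lambda>z. \<bar>V z * xdiv \<eta> z\<bar>)"
      using int[OF cx zero] by (rule integrable_abs)
    show "(\<lambda>z. V z * (m k z * xdiv \<eta> z)) \<in> borel_measurable lebesgue" for k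
      by (rule borel_measurable_integrable[OF int]) (intro continuous_intros cx cm, simp add: zero)
    show "AE z in lebesgue. (\<lambda>k. V z * (m k z * xdiv \<eta> z)) \<longlonglongrightarrow> V z * xdiv \<eta> z"
      using ae
    proof (rule AE_mp, intro AE_I2 impI)
      fix z :: "'x \<times> 'y" assume "fst z \<noteq> 0"
      from tendsto_mult_left[OF tendsto_mult_right[OF lim[OF this]]]
      show "(\<lambda>k. V z * (m k z * xdiv \<eta> z)) \<longlonglongrightarrow> V z * xdiv \<eta> z" by simp
    qed
    show "AE z in lebesgue. norm (V z * (m k z * xdiv \<eta> z)) \<le> \<bar>V z * xdiv \<eta> z\<bar>" for k
    proof (rule AE_I2)
      fix z
      have "m k z * \<bar>V z * xdiv \<eta> z\<bar> \<le> 1 * \<bar>V z * xdiv \<eta> z\<bar>" by (intro mult_right_mono m1) simp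
      then show "norm (V z * (m k z * xdiv \<eta> z)) \<le> \<bar>V z * xdiv \<eta> z\<bar>"
        using m1(1)[of k z] by (simp add: abs_mult mult_ac)
    qed
  qed
  then show ?thesis by (rule LIMSEQ_le_const) (use pos in blast)
qed


section \<open>Reduction of complex eigenfunctions to their real and imaginary parts\<close>

section \<open>Real and imaginary parts of complex eigenfunctions\<close>

lemma L2_diff:
  assumes "f \<in> L2 M" "g \<in> L2 M" shows "(\<lambda>z. f z - g z) \<in> L2 M"
proof -
  have "integrable M (\<lambda>z. (cmod (f z - g z))\<^sup>2)"
  proof (rule Bochner_Integration.integrable_bound[of _ "\<lambda>z. 2 * (cmod (f z))\<^sup>2 + 2 * (cmod (g z))\<^sup>2"])
    show "AE z in M. norm ((cmod (f z - g z))\<^sup>2) \<le> norm (2 * (cmod (f z))\<^sup>2 + 2 * (cmod (g z))\<^sup>2)"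
    proof (rule AE_I2)
      fix z
      have "(cmod (f z - g z))\<^sup>2 \<le> (cmod (f z) + cmod (g z))\<^sup>2" by (intro power_mono norm_triangle_ineq4) simp
      also have "\<dots> \<le> 2 * (cmod (f z))\<^sup>2 + 2 * (cmod (g z))\<^sup>2"
        using sum_squares_bound[of "cmod (f z)" "cmod (g z)"] by (simp add: power2_sum)
      finally show "norm ((cmod (f z - g z))\<^sup>2) \<le> norm (2 * (cmod (f z))\<^sup>2 + 2 * (cmod (g z))\<^sup>2)" by simp
    qed
  qed (use assms in \<open>auto simp: L2_def\<close>)
  then show ?thesis using assms by (auto simp: L2_def)
qed

lemma L2_of_sqint:
  assumes \<Omega>: "\<Omega> \<in> sets lebesgue" and f: "sqint (\<lambda>z. Re (f z))" "sqint (\<lambda>z. Im (f z))"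
  shows "f \<in> L2 (lebesgue_on \<Omega>)"
proof -
  have "integrable lebesgue (\<lambda>z. indicator \<Omega> z *\<^sub>R ((Re (f z))\<^sup>2 + (Im (f z))\<^sup>2))"
    by (intro integrable_mult_indicator \<Omega> Bochner_Integration.integrable_add sqint_integrable_sq f)
  then have "integrable (lebesgue_on \<Omega>) (\<lambda>z. (cmod (f z))\<^sup>2)"
    using \<Omega> by (simp add: integrable_restrict_space cmod_power2)
  moreover have "f \<in> borel_measurable lebesgue"
    using f by (simp add: sqint_def borel_measurable_complex_iff)
  ultimately show ?thesis by (simp add: L2_def measurable_restrict_space1)
qed

text \<open>\<open>P\<close> stands for the real or the imaginary part. Multiplication by the
  indicator is extension by zero; it discards the unspecified values of \<open>v\<close> off
  \<open>\<Omega>\<close>.\<close>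

lemma sqint_component:
  assumes \<Omega>: "\<Omega> \<in> sets lebesgue" and P: "bounded_linear P" "\<And>c. \<bar>P c\<bar> \<le> cmod c"
    and v: "v \<in> L2 (lebesgue_on \<Omega>)"
  shows "sqint (\<lambda>z. indicator \<Omega> z * P (v z))"
    and "n2 (\<lambda>z. indicator \<Omega> z * P (v z)) \<le> L2_norm (lebesgue_on \<Omega>) v"
proof -
  have vm [measurable]: "v \<in> borel_measurable (lebesgue_on \<Omega>)"
    and vi: "integrable (lebesgue_on \<Omega>) (\<lambda>z. (cmod (v z))\<^sup>2)" using v by (simp_all add: L2_def)
  have le: "(P c)\<^sup>2 \<le> (cmod c)\<^sup>2" for c using P(2)[of c] by (simp add: abs_le_square_iff[symmetric])
  have Pm: "P \<in> borel_measurable borel"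
    by (intro borel_measurable_continuous_onI linear_continuous_on P)
  have Pv: "(\<lambda>z. P (v z)) \<in> borel_measurable (lebesgue_on \<Omega>)" by (rule measurable_compose[OF vm Pm])
  have i: "integrable (lebesgue_on \<Omega>) (\<lambda>z. (P (v z))\<^sup>2)"
    by (rule Bochner_Integration.integrable_bound[OF vi]) (use Pv le in auto)
  have sq: "indicator \<Omega> z * (P (v z))\<^sup>2 = (indicator \<Omega> z * P (v z))\<^sup>2" for z
    by (simp add: indicator_def)
  show "sqint (\<lambda>z. indicator \<Omega> z * P (v z))"
    using Pv i \<Omega> by (simp add: sqint_def borel_measurable_restrict_space_iff integrable_restrict_space sq)
  have "(LINT z|lebesgue. (indicator \<Omega> z * P (v z))\<^sup>2) = (LINT z|lebesgue_on \<Omega>. (P (v z))\<^sup>2)"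
    using \<Omega> by (simp add: integral_restrict_space sq)
  also have "\<dots> \<le> (LINT z|lebesgue_on \<Omega>. (cmod (v z))\<^sup>2)" by (intro integral_mono i vi le)
  finally show "n2 (\<lambda>z. indicator \<Omega> z * P (v z)) \<le> L2_norm (lebesgue_on \<Omega>) v"
    by (simp add: n2_def L2_norm_def)
qed

text \<open>A bounded real-linear \<open>P\<close> commutes with the integral and with real factors,
  which transfers the complex equation to each component.\<close>

lemma component_integral:
  assumes \<Omega>: "\<Omega> \<in> sets lebesgue" and P: "bounded_linear P"
    and v: "v \<in> L2 (lebesgue_on \<Omega>)" and g: "sqint g"
  shows "P (LINT z|lebesgue_on \<Omega>. v z * of_real (g z)) = (LINT z|lebesgue. (indicator \<Omega> z * P (v z)) * g z)"
proof -
  have g2: "(\<lambda>z. of_real (g z)) \<in> L2 (lebesgue_on \<Omega>)"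
    by (rule L2_of_sqint[OF \<Omega>]) (use g in \<open>simp_all add: sqint_def\<close>)
  have "integrable (lebesgue_on \<Omega>) (\<lambda>z. v z * of_real (g z))"
  proof (rule Bochner_Integration.integrable_bound)
    show "integrable (lebesgue_on \<Omega>) (\<lambda>z. (cmod (v z))\<^sup>2 + (cmod (of_real (g z)))\<^sup>2)"
      using v g2 by (simp add: L2_def)
    show "(\<lambda>z. v z * of_real (g z)) \<in> borel_measurable (lebesgue_on \<Omega>)"
      by (rule borel_measurable_times) (use v g2 in \<open>simp_all add: L2_def\<close>)
    show "AE z in lebesgue_on \<Omega>. norm (v z * of_real (g z)) \<le> norm ((cmod (v z))\<^sup>2 + (cmod (of_real (g z)))\<^sup>2)"
    proof (rule AE_I2)
      fix z
      have "2 * (cmod (v z) * cmod (of_real (g z))) \<le> (cmod (v z))\<^sup>2 + (cmod (of_real (g z)))\<^sup>2"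
        using sum_squares_bound[of "cmod (v z)" "cmod (of_real (g z))"] by (simp add: mult.assoc)
      moreover have "0 \<le> cmod (v z) * cmod (of_real (g z))" by simp
      ultimately show "norm (v z * of_real (g z)) \<le> norm ((cmod (v z))\<^sup>2 + (cmod (of_real (g z)))\<^sup>2)"
        unfolding norm_mult real_norm_def by linarith
    qed
  qed
  from integral_bounded_linear[OF P this]
  have "P (LINT z|lebesgue_on \<Omega>. v z * of_real (g z)) = (LINT z|lebesgue_on \<Omega>. P (v z * of_real (g z)))" by simp
  also have "\<dots> = (LINT z|lebesgue_on \<Omega>. P (v z) * g z)"
  proof -
    have "P (v z * of_real (g z)) = P (v z) * g z" for z
      using linear_scale[OF bounded_linear.linear[OF P], of "g z" "v z"]
      by (simp add: scaleR_conv_of_real mult.commute)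
    then show ?thesis by (simp only:)
  qed
  finally show ?thesis using \<Omega> by (simp add: integral_restrict_space mult.assoc)
qed

lemma partial_linear:
  assumes "bounded_linear L" "smooth f"
  shows "partial b (\<lambda>z. L (f z)) = (\<lambda>z. L (partial b f z))"
  using partial_eqI[OF bounded_linear.has_derivative[OF assms(1) smooth_has_derivative[OF assms(2)]]] by blast

text \<open>The equation has real coefficients, so each component solves it against real test
  functions. Extending \<open>u\<close> and its gradient by zero yields an instance of
  \<open>dirichlet_eigenfunction\<close>.\<close>

lemma component_zero:
  fixes \<Omega> :: "('x::euclidean_space \<times> 'y::euclidean_space) set" and V :: "'x \<times> 'y \<Rightarrow> real"
  assumes P: "bounded_linear P" "\<And>c. \<bar>P c\<bar> \<le> cmod c" and dim: "3 \<le> DIM('x)"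
    and \<Omega>: "open \<Omega>" "xstar \<Omega>"
    and V: "V \<in> borel_measurable lebesgue" and V0: "\<And>z. 0 \<le> V z"
    and bd: "\<And>K. compact K \<Longrightarrow> K \<subseteq> \<Omega> \<Longrightarrow> bounded (V ` K)"
    and rep: "\<And>\<eta>. test_function \<Omega> \<eta> \<Longrightarrow> (\<And>z. 0 \<le> \<eta> z) \<Longrightarrow> 0 \<le> (LINT z|lebesgue. V z * xdiv \<eta> z)"
    and u: "u \<in> H10 \<Omega>"
    and eq: "\<And>w. test_function \<Omega> w \<Longrightarrow>
      - distr_laplacian (distr_of \<Omega> u) w + distr_of \<Omega> (\<lambda>z. of_real (V z) * u z) w
        = distr_of \<Omega> (\<lambda>z. of_real lam * u z) w"
  shows "AE z in lebesgue_on \<Omega>. P (u z) = 0"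
proof -
  have \<Omega>m: "\<Omega> \<in> sets lebesgue" using \<Omega>(1) by simp
  obtain D \<phi> where uL: "u \<in> L2 (lebesgue_on \<Omega>)"
    and DL: "\<And>b. b \<in> Basis \<Longrightarrow> D b \<in> L2 (lebesgue_on \<Omega>)"
    and \<phi>: "\<And>k. test_function \<Omega> (\<phi> k)"
    and lim: "(\<lambda>k. L2_norm (lebesgue_on \<Omega>) (\<lambda>z. \<phi> k z - u z)) \<longlonglongrightarrow> 0"
    and limD: "\<And>b. b \<in> Basis \<Longrightarrow> (\<lambda>k. L2_norm (lebesgue_on \<Omega>) (\<lambda>z. partial b (\<phi> k) z - D b z)) \<longlonglongrightarrow> 0"
    using u unfolding H10_def by blast
  let ?u = "\<lambda>z. indicator \<Omega> z * P (u z)"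
  define f where "f k z = P (\<phi> k z)" for k z
  have f: "test_function \<Omega> (f k)" for k unfolding f_def by (rule test_function_linear[OF P(1) \<phi>])
  have tL2: "w \<in> L2 (lebesgue_on \<Omega>)" if "test_function \<Omega> w" for w
    by (intro L2_of_sqint \<Omega>m sqint_test_function[OF test_function_linear[OF _ that]] bounded_linear_Re bounded_linear_Im)
  have out: "P (w z) = indicator \<Omega> z * P (w z)" if w: "test_function \<Omega> w" for w z
  proof (cases "z \<in> \<Omega>")
    case False
    obtain K where "K \<subseteq> \<Omega>" "\<And>z. z \<notin> K \<Longrightarrow> w z = 0" using test_functionE[OF w] by metis
    then have "w z = 0" using False by blast
    then show ?thesis using linear_0[OF bounded_linear.linear[OF P(1)]] by simp
  qed simp
  have conv: "(\<lambda>k. n2 (\<lambda>z. P (w k z) - indicator \<Omega> z * P (v z))) \<longlonglongrightarrow> 0"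
    if w: "\<And>k. test_function \<Omega> (w k)" and v: "v \<in> L2 (lebesgue_on \<Omega>)"
      and l: "(\<lambda>k. L2_norm (lebesgue_on \<Omega>) (\<lambda>z. w k z - v z)) \<longlonglongrightarrow> 0" for w v
  proof (rule tendsto_sandwich[OF _ _ tendsto_const l])
    have "n2 (\<lambda>z. P (w k z) - indicator \<Omega> z * P (v z)) \<le> L2_norm (lebesgue_on \<Omega>) (\<lambda>z. w k z - v z)" for k
    proof -
      have "P (w k z) - indicator \<Omega> z * P (v z) = indicator \<Omega> z * P (w k z - v z)" for z
        by (subst out[OF w]) (simp add: linear_diff[OF bounded_linear.linear[OF P(1)]] right_diff_distrib)
      then show ?thesis using sqint_component(2)[OF \<Omega>m P L2_diff[OF tL2[OF w] v]] by simp
    qed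
    then show "\<forall>\<^sub>F k in sequentially. n2 (\<lambda>z. P (w k z) - indicator \<Omega> z * P (v z)) \<le> L2_norm (lebesgue_on \<Omega>) (\<lambda>z. w k z - v z)"
      by simp
  qed simp
  have su: "sqint ?u" by (rule sqint_component(1)[OF \<Omega>m P uL])
  have sf: "sqint (\<lambda>z. f k z - ?u z)" for k by (intro sqint_diff sqint_test_function[OF f] su)
  have fL2: "(\<lambda>k. n2 (\<lambda>z. f k z - ?u z)) \<longlonglongrightarrow> 0" unfolding f_def by (rule conv[OF \<phi> uL lim])
  have fD: "(\<lambda>k. n2 (\<lambda>z. partial b (f k) z - indicator \<Omega> z * P (D b z))) \<longlonglongrightarrow> 0" if b: "b \<in> Basis" for b
  proof -
    have "partial b (f k) z = P (partial b (\<phi> k) z)" for k z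
      unfolding f_def by (rule fun_cong[OF partial_linear[OF P(1) test_function_smooth[OF \<phi>]]])
    then show ?thesis using conv[OF test_function_partial[OF \<phi>] DL[OF b] limD[OF b]] by (simp only:)
  qed
  \<comment> \<open>L2 convergence is L1 convergence of the squares, so a subsequence converges
    almost everywhere.\<close>
  have "(\<lambda>k. LINT z|lebesgue. norm ((f k z - ?u z)\<^sup>2)) \<longlonglongrightarrow> 0"
    using tendsto_power[OF fL2, of 2] unfolding n2_sq by simp
  then have "\<exists>r::nat \<Rightarrow> nat. strict_mono r \<and> (AE z in lebesgue. (\<lambda>k. (f (r k) z - ?u z)\<^sup>2) \<longlonglongrightarrow> 0)"
    by (rule tendsto_L1_AE_subseq[OF sqint_integrable_sq[OF sf]])
  then obtain r :: "nat \<Rightarrow> nat" where r: "strict_mono r"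
    and ae: "AE z in lebesgue. (\<lambda>k. (f (r k) z - ?u z)\<^sup>2) \<longlonglongrightarrow> 0" by (elim exE conjE)
  have aer: "AE z in lebesgue. (\<lambda>k. f (r k) z) \<longlonglongrightarrow> ?u z"
    using ae
  proof (rule AE_mp, intro AE_I2 impI)
    fix z assume "(\<lambda>k. (f (r k) z - ?u z)\<^sup>2) \<longlonglongrightarrow> 0"
    then have "(\<lambda>k. sqrt ((f (r k) z - ?u z)\<^sup>2)) \<longlonglongrightarrow> sqrt 0" by (rule tendsto_real_sqrt)
    then have "(\<lambda>k. \<bar>f (r k) z - ?u z\<bar>) \<longlonglongrightarrow> 0" by simp
    then have "(\<lambda>k. f (r k) z - ?u z) \<longlonglongrightarrow> 0" by (rule tendsto_rabs_zero_cancel)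
    then show "(\<lambda>k. f (r k) z) \<longlonglongrightarrow> ?u z" by (rule LIM_zero_cancel)
  qed
  have equ: "- (\<Sum>b\<in>Basis. LINT z|lebesgue. ?u z * partial b (partial b w) z) + (LINT z|lebesgue. V z * ?u z * w z)
      = lam * (LINT z|lebesgue. ?u z * w z)" if w: "test_function \<Omega> w" for w
  proof -
    have sw: "smooth w" by (rule test_function_smooth[OF w])
    let ?w = "\<lambda>z. of_real (w z) :: complex"
    have tw: "test_function \<Omega> ?w" by (rule test_function_linear[OF bounded_linear_of_real w])
    have pp: "partial b (partial b ?w) = (\<lambda>z. of_real (partial b (partial b w) z))" for b
      unfolding partial_linear[OF bounded_linear_of_real sw]
      by (rule partial_linear[OF bounded_linear_of_real smooth_partial[OF sw]])
    have lin: "linear P" by (rule bounded_linear.linear[OF P(1)])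
    obtain K where K: "compact K" "K \<subseteq> \<Omega>" "\<And>z. z \<notin> K \<Longrightarrow> w z = 0"
      using test_functionE[OF w] by metis
    obtain C where C: "\<And>z. z \<in> K \<Longrightarrow> \<bar>V z\<bar> \<le> C" using bd[OF K(1,2)] by (auto simp: bounded_iff)
    obtain C' where C': "\<And>z. norm (w z) \<le> C'" using test_function_bounded[OF w] by metis
    \<comment> \<open>\<open>V\<close> is only locally bounded, so it is attached to the test
      function rather than to \<open>u\<close>; the product is square integrable.\<close>
    have Vw: "sqint (\<lambda>z. V z * w z)" unfolding sqint_def
    proof (intro conjI)
      show m: "(\<lambda>z. V z * w z) \<in> borel_measurable lebesgue"
        by (rule borel_measurable_times[OF V smooth_measurable[OF sw]])
      show "integrable lebesgue (\<lambda>z. (V z * w z)\<^sup>2)"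
      proof (rule integrable_bounded_compact[OF borel_measurable_power[OF m] K(1)])
        show "\<bar>(V z * w z)\<^sup>2\<bar> \<le> (C * C')\<^sup>2" if "z \<in> K" for z
        proof -
          have "\<bar>V z * w z\<bar> \<le> C * C'" unfolding abs_mult
            by (rule mult_mono) (use C[OF that] C'[of z] in auto)
          from power_mono[OF this, of 2] show ?thesis by simp
        qed
      qed (simp add: K(3))
    qed
    have 1: "P (distr_laplacian (distr_of \<Omega> u) ?w) = (\<Sum>b\<in>Basis. LINT z|lebesgue. ?u z * partial b (partial b w) z)"
      unfolding distr_laplacian_def distr_deriv_def distr_of_def minus_minus linear_sum[OF lin] pp
      by (intro sum.cong refl component_integral \<Omega>m P uL sqint_test_function[OF test_function_partial[OF test_function_partial[OF w]]])
    have "distr_of \<Omega> (\<lambda>z. of_real (V z) * u z) ?w = (LINT z|lebesgue_on \<Omega>. u z * of_real (V z * w z))"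
      unfolding distr_of_def by (simp add: mult_ac)
    then have 2: "P (distr_of \<Omega> (\<lambda>z. of_real (V z) * u z) ?w) = (LINT z|lebesgue. V z * ?u z * w z)"
      using component_integral[OF \<Omega>m P(1) uL Vw] by (simp add: mult_ac)
    have "distr_of \<Omega> (\<lambda>z. of_real lam * u z) ?w = (LINT z|lebesgue_on \<Omega>. u z * of_real (lam * w z))"
      unfolding distr_of_def by (simp add: mult_ac)
    then have "P (distr_of \<Omega> (\<lambda>z. of_real lam * u z) ?w) = (LINT z|lebesgue. ?u z * (lam * w z))"
      using component_integral[OF \<Omega>m P(1) uL sqint_cmult[OF sqint_test_function[OF w], of lam]] by simp
    also have "\<dots> = lam * (LINT z|lebesgue. ?u z * w z)" by (simp add: mult.left_commute)
    finally show ?thesis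
      using arg_cong[OF eq[OF tw], of P] unfolding linear_add[OF lin] linear_neg[OF lin] 1 2 by simp
  qed
  interpret dirichlet_eigenfunction \<Omega> V ?u "\<lambda>b z. indicator \<Omega> z * P (D b z)" "\<lambda>k. f (r k)" lam
  proof
    show "sqint (\<lambda>z. indicator \<Omega> z * P (D b z))" if "b \<in> Basis" for b
      by (rule sqint_component(1)[OF \<Omega>m P DL[OF that]])
    show "(\<lambda>k. n2 (\<lambda>z. f (r k) z - ?u z)) \<longlonglongrightarrow> 0"
      using LIMSEQ_subseq_LIMSEQ[OF fL2 r] by (simp add: o_def)
    show "(\<lambda>k. n2 (\<lambda>z. partial b (f (r k)) z - indicator \<Omega> z * P (D b z))) \<longlonglongrightarrow> 0" if "b \<in> Basis" for b
      using LIMSEQ_subseq_LIMSEQ[OF fD[OF that] r] by (simp add: o_def)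
  qed (fact dim \<Omega>(2) V V0 bd rep su f aer equ)+
  have "AE z in lebesgue. z \<in> \<Omega> \<longrightarrow> P (u z) = 0"
    using eigenfunction_zero by (rule eventually_mono) (simp add: indicator_def split: if_splits)
  then show ?thesis using \<Omega>m by (subst AE_restrict_space_iff) simp_all
qed

lemma selfadjoint_eigenvalue_real:
  assumes H: "selfadjoint M H" and u: "(u, \<lambda>z. \<mu> * u z) \<in> H" "\<not> (AE z in M. u z = 0)"
  shows "\<mu> \<in> \<real>"
proof -
  let ?I = "LINT z|M. (cmod (u z))\<^sup>2"
  have "(u, \<lambda>z. \<mu> * u z) \<in> adjoint_graph M H" "H \<subseteq> L2 M \<times> L2 M" using H u(1) by (auto simp: selfadjoint_def)
  then have eq: "L2_inner M (\<lambda>z. \<mu> * u z) u = L2_inner M u (\<lambda>z. \<mu> * u z)" and uL: "u \<in> L2 M"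
    using u(1) by (auto simp: adjoint_graph_def)
  have "L2_inner M (\<lambda>z. \<mu> * u z) u = (LINT z|M. \<mu> * of_real ((cmod (u z))\<^sup>2))"
    unfolding L2_inner_def mult.assoc complex_norm_square ..
  then have 1: "L2_inner M (\<lambda>z. \<mu> * u z) u = \<mu> * of_real ?I" by (simp del: of_real_power)
  have "L2_inner M u (\<lambda>z. \<mu> * u z) = (LINT z|M. cnj \<mu> * of_real ((cmod (u z))\<^sup>2))"
    unfolding L2_inner_def complex_norm_square by (simp add: mult_ac)
  then have 2: "L2_inner M u (\<lambda>z. \<mu> * u z) = cnj \<mu> * of_real ?I" by (simp del: of_real_power)
  have "\<mu> * of_real ?I = cnj \<mu> * of_real ?I" using eq unfolding 1 2 .
  moreover have "?I \<noteq> 0"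
    using u(2) integral_nonneg_eq_0_iff_AE[of M "\<lambda>z. (cmod (u z))\<^sup>2"] uL by (simp add: L2_def)
  ultimately have "cnj \<mu> = \<mu>" by simp
  then show ?thesis by (simp add: Reals_cnj_iff)
qed

theorem mainTheorem7:
  fixes \<Omega> :: "((real ^ 'n) \<times> (real ^ 'm)) set"
    and V :: "(real ^ 'n) \<times> (real ^ 'm) \<Rightarrow> real"
    and H :: "((real ^ 'n) \<times> (real ^ 'm)) L2_graph"
  assumes "CARD('n) \<ge> 3" and "CARD('m) \<ge> 1"
    and "open \<Omega>" and "lipschitz_boundary \<Omega>" and "repulsive \<Omega>"
    and "V \<in> borel_measurable (lebesgue_on \<Omega>)" and "locally_bounded_on \<Omega> V"
    and "\<forall>z\<in>\<Omega>. V z \<ge> 0"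
    and "distr_nonneg \<Omega> (\<lambda>\<phi>. - distr_x_grad \<Omega> (\<lambda>z. norm (fst z) * V z) \<phi>)"
    and "dirichlet_schroedinger \<Omega> V H" and "selfadjoint (lebesgue_on \<Omega>) H"
  shows "\<not> (\<exists>\<mu>. eigenvalue (lebesgue_on \<Omega>) H \<mu>)"
proof
  assume "\<exists>\<mu>. eigenvalue (lebesgue_on \<Omega>) H \<mu>"
  then obtain \<mu> u where u: "(u, \<lambda>z. \<mu> * u z) \<in> H" "\<not> (AE z in lebesgue_on \<Omega>. u z = 0)"
    unfolding eigenvalue_def by blast
  obtain lam where lam: "\<mu> = of_real lam"
    using selfadjoint_eigenvalue_real[OF assms(11) u] by (auto elim: Reals_cases)
  have \<Omega>m: "\<Omega> \<in> sets lebesgue" using assms(3) by simp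
  then have \<Omega>m': "\<Omega> \<inter> space lebesgue \<in> sets lebesgue" by simp
  have star: "xstar \<Omega>" by (rule repulsive_imp_xstar[OF assms(3-5)])
  \<comment> \<open>Nothing is assumed about \<open>V\<close> outside \<open>\<Omega>\<close>;
    extension by zero makes it measurable and nonnegative on the whole space.\<close>
  define W where "W z = indicator \<Omega> z * V z" for z
  have WV: "W z = V z" if "z \<in> \<Omega>" for z using that by (simp add: W_def)
  have Wm: "W \<in> borel_measurable lebesgue"
    using assms(6) \<Omega>m unfolding W_def[abs_def] by (simp add: borel_measurable_restrict_space_iff)
  have W0: "0 \<le> W z" for z using assms(8) by (simp add: W_def indicator_def)
  have Wb: "bounded (W ` K)" if "compact K" "K \<subseteq> \<Omega>" for K
  proof -
    have "W ` K = V ` K" using that WV by (intro image_cong) auto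
    then show ?thesis using assms(7) that by (simp add: locally_bounded_on_def)
  qed
  have W_rep: "0 \<le> (LINT z|lebesgue. W z * xdiv \<eta> z)" if \<eta>: "test_function \<Omega> \<eta>" "\<And>z. 0 \<le> \<eta> z" for \<eta>
  proof (rule repulsive_potential[OF Wm W0 Wb _ \<eta>])
    fix \<eta> :: "(real ^ 'n) \<times> (real ^ 'm) \<Rightarrow> real" assume \<eta>: "test_function \<Omega> \<eta>" "\<And>z. 0 \<le> \<eta> z"
    let ?p = "\<lambda>b. partial (b, 0) (\<lambda>z. (fst z \<bullet> b) * \<eta> z)"
    have tp: "test_function \<Omega> (?p b)" for b
      by (intro test_function_partial test_function_mult \<eta> smooth_intros)
    have int: "integrable lebesgue (\<lambda>z. W z * (norm (fst z) * h z))" if h: "test_function \<Omega> h" for h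
    proof -
      obtain K where K: "smooth h" "compact K" "K \<subseteq> \<Omega>" "\<And>z. z \<notin> K \<Longrightarrow> h z = 0"
        using test_functionE[OF h] by metis
      show ?thesis
        by (rule integrable_mult_test_function[OF Wm K(2) Wb[OF K(2,3)]])
           (intro continuous_intros smooth_continuous[OF K(1)], simp add: K(4))
    qed
    have "0 \<le> - distr_x_grad \<Omega> (\<lambda>z. norm (fst z) * V z) \<eta>"
      using assms(9) \<eta> unfolding distr_nonneg_def by blast
    \<comment> \<open>The sign in \<open>distr_deriv\<close> cancels the one in the hypothesis, and
      the summands add up to |x| V against \<open>xdiv \<eta>\<close>.\<close>
    also have "\<dots> = (\<Sum>b\<in>Basis. LINT z|lebesgue. W z * (norm (fst z) * ?p b z))"
      unfolding distr_x_grad_def distr_deriv_def distr_of_def sum_negf minus_minus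
      unfolding integral_restrict_space[OF \<Omega>m'] W_def real_scaleR_def by (simp only: mult_ac)
    also have "\<dots> = (LINT z|lebesgue. (\<Sum>b\<in>Basis. W z * (norm (fst z) * ?p b z)))"
      by (rule Bochner_Integration.integral_sum[symmetric, OF int[OF tp]])
    also have "\<dots> = (LINT z|lebesgue. W z * (norm (fst z) * xdiv \<eta> z))"
      unfolding xdiv_def by (simp only: sum_distrib_left)
    finally show "0 \<le> (LINT z|lebesgue. W z * (norm (fst z) * xdiv \<eta> z))" .
  qed
  have uH: "u \<in> H10 \<Omega>" using assms(10) u(1) by (auto simp: dirichlet_schroedinger_def)
  have eq: "- distr_laplacian (distr_of \<Omega> u) w + distr_of \<Omega> (\<lambda>z. of_real (W z) * u z) w
      = distr_of \<Omega> (\<lambda>z. of_real lam * u z) w" if w: "test_function \<Omega> w" for w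
  proof -
    have "distr_of \<Omega> (\<lambda>z. of_real (W z) * u z) w = distr_of \<Omega> (\<lambda>z. of_real (V z) * u z) w"
      unfolding distr_of_def using WV by (intro Bochner_Integration.integral_cong) auto
    moreover have "- distr_laplacian (distr_of \<Omega> u) w + distr_of \<Omega> (\<lambda>z. of_real (V z) * u z) w = distr_of \<Omega> (\<lambda>z. \<mu> * u z) w"
      using assms(10) u(1) w unfolding dirichlet_schroedinger_def by blast
    ultimately show ?thesis unfolding lam by simp
  qed
  have dim: "3 \<le> DIM(real ^ 'n)" using assms(1) by simp
  have "AE z in lebesgue_on \<Omega>. Re (u z) = 0"
    by (rule component_zero[OF bounded_linear_Re abs_Re_le_cmod dim assms(3) star Wm W0 Wb W_rep uH eq])
  moreover have "AE z in lebesgue_on \<Omega>. Im (u z) = 0"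
    by (rule component_zero[OF bounded_linear_Im abs_Im_le_cmod dim assms(3) star Wm W0 Wb W_rep uH eq])
  ultimately have "AE z in lebesgue_on \<Omega>. u z = 0" by eventually_elim (simp add: complex_eq_iff)
  then show False using u(2) by contradiction
qed

end
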